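(* Let $\sigma:\mathbb{R}\to\mathbb{R}$ be a nonrandom Lipschitz continuous function with $\sigma(0)=0$ and $$0<\inf_{z\ne0}|\sigma(z)/z|\le\sup_{z\neq0}|\sigma(z)/z|<\infty.$$ Let $u$ solve $\dot u_t(x)=\tfrac12u_t''(x)+\sigma(u_t(x))\xi_t(x)$ for $x\in\mathbb{R}$, $t>0$, with $u_0(x)=1$ for all $x$, where $\xi$ is space-time white noise, and let $h_t(x):=\log u_t(x)$. Then the tall peaks of the solution are almost surely multifractal; that is, for every $t>0$ there exist infinitely many numbers $\gamma_1>\gamma_2>\cdots>0$ such that, with probability one, $$\operatorname{Dim}_{\rm H}\mathcal{P}_{h_t}(\gamma_i)<\operatorname{Dim}_{\rm H}\mathcal{P}_{h_t}(\gamma_{i+1})\qquad\text{for all }i\ge1,$$ where $\mathcal{P}_{h_t}(\gamma):=\{x\ge e^e:\ h_t(x)\ge\gamma t^{1/3}(\log x)^{2/3}\}$.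
   Context: Solution: $u$ is the unique continuous predictable mild solution in the sense of Walsh (with $\sup_{s\le T,x}\mathrm{E}|u_s(x)|^k<\infty$ for all $T>0,k\ge2$), $u_t(x)=1+\int_{(0,t)\times\mathbb{R}}p_{t-s}(y-x)\sigma(u_s(y))\,\xi(ds\,dy)$, with $p_t(x)=(2\pi t)^{-1/2}e^{-x^2/(2t)}$. It is known that $u_t(x)>0$ a.s., so $h_t$ is well defined. Macroscopic (Barlow–Taylor) Hausdorff dimension: in $\mathbb{R}^d$ let $\mathcal{V}_n:=[-e^n,e^n)^d$ for $n\ge0$, $\mathcal{S}_0:=\mathcal{V}_0$, $\mathcal{S}_{n+1}:=\mathcal{V}_{n+1}\setminus\mathcal{V}_n$. An upright box is a set $Q(x,r)=[x_1,x_1+r)\times\cdots\times[x_d,x_d+r)$, $x\in\mathbb{R}^d$, $r>0$; its side is $r$. For $E\subseteq\mathbb{R}^d$, $\rho>0$, let $\nu^n_\rho(E):=\inf\sum_{i=1}^m(\mathrm{side}(Q_i)/e^n)^\rho$, the infimum over all finite covers of $E\cap\mathcal{S}_n$ by upright boxes $Q_1,\dots,Q_m$ of side $\ge1$. Then $\operatorname{Dim}_{\rm H}E:=\inf\{\rho>0:\sum_{n=1}^\infty\nu^n_\rho(E)<\infty\}$. Here $d=1$. *)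

theory Defs
  imports "HOL-Probability.Probability"
begin

section \<open>Space-time white noise\<close>

definition centered_gaussian :: "'a measure \<Rightarrow> ('a \<Rightarrow> real) \<Rightarrow> real \<Rightarrow> bool" where
  "centered_gaussian M X v \<longleftrightarrow>
     X \<in> borel_measurable M \<and>
     distr M borel X =
       (if v = 0 then return borel 0 else density lborel (normal_density 0 (sqrt v)))"

text \<open>A point of space-time is a pair \<open>(s, y)\<close> of a time \<open>s > 0\<close> and a position \<open>y\<close>.\<close>

definition noise_sets :: "(real \<times> real) set set" where
  "noise_sets = {A \<in> sets borel. A \<subseteq> {0<..} \<times> UNIV \<and> emeasure lborel A < \<infinity>}"

text \<open>White noise is the centered Gaussian process indexed by \<open>noise_sets\<close> whose covariance is
  \<open>Cov (\<xi> A) (\<xi> B) = |A \<inter> B|\<close>. Joint Gaussianity is expressed through finite linear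
  combinations.\<close>

definition white_noise :: "'a measure \<Rightarrow> ((real \<times> real) set \<Rightarrow> 'a \<Rightarrow> real) \<Rightarrow> bool" where
  "white_noise M \<xi> \<longleftrightarrow>
     prob_space M \<and>
     (\<forall>I c. finite I \<and> I \<subseteq> noise_sets \<longrightarrow>
        centered_gaussian M (\<lambda>\<omega>. \<Sum>A\<in>I. c A * \<xi> A \<omega>)
          (\<Sum>A\<in>I. \<Sum>B\<in>I. c A * c B * measure lborel (A \<inter> B)))"

text \<open>The filtration of the noise, augmented by the null sets of \<open>M\<close>.\<close>

definition noise_filtration ::
  "'a measure \<Rightarrow> ((real \<times> real) set \<Rightarrow> 'a \<Rightarrow> real) \<Rightarrow> real \<Rightarrow> 'a measure" where
  "noise_filtration M \<xi> t =
     sigma (space M)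
       ({\<xi> A -` B \<inter> space M | A B.
           A \<in> noise_sets \<and> A \<subseteq> {0<..t} \<times> UNIV \<and> B \<in> sets borel}
        \<union> null_sets M)"

section \<open>Walsh integral\<close>

definition predictable_algebra ::
  "'a measure \<Rightarrow> ((real \<times> real) set \<Rightarrow> 'a \<Rightarrow> real) \<Rightarrow> (real \<times> real \<times> 'a) measure" where
  "predictable_algebra M \<xi> =
     sigma ({0<..} \<times> UNIV \<times> space M)
       {{a<..b} \<times> A \<times> G | a b A G.
          0 \<le> a \<and> a \<le> b \<and> A \<in> sets borel \<and> G \<in> sets (noise_filtration M \<xi> a)}"

definition predictable ::
  "'a measure \<Rightarrow> ((real \<times> real) set \<Rightarrow> 'a \<Rightarrow> real) \<Rightarrow> (real \<Rightarrow> real \<Rightarrow> 'a \<Rightarrow> real) \<Rightarrow> bool" where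
  "predictable M \<xi> \<Phi> \<longleftrightarrow>
     (\<lambda>(s, y, \<omega>). \<Phi> s y \<omega>) \<in> borel_measurable (predictable_algebra M \<xi>)"

text \<open>A simple process is a finite sum of terms \<open>X(\<omega>) 1_{(a,b]}(s) 1_A(y)\<close>, with \<open>X\<close> bounded and
  measurable at time \<open>a\<close>; it is represented by the list of the tuples \<open>(X, a, b, A)\<close>.\<close>

type_synonym 'a simple_process = "(('a \<Rightarrow> real) \<times> real \<times> real \<times> real set) list"

definition is_simple_process ::
  "'a measure \<Rightarrow> ((real \<times> real) set \<Rightarrow> 'a \<Rightarrow> real) \<Rightarrow> 'a simple_process \<Rightarrow> bool" where
  "is_simple_process M \<xi> S \<longleftrightarrow>
     (\<forall>(X, a, b, A) \<in> set S.
        0 \<le> a \<and> a \<le> b \<and> A \<in> sets borel \<and> emeasure lborel A < \<infinity> \<and>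
        X \<in> borel_measurable (noise_filtration M \<xi> a) \<and> bounded (X ` space M))"

definition simple_process_val :: "'a simple_process \<Rightarrow> real \<Rightarrow> real \<Rightarrow> 'a \<Rightarrow> real" where
  "simple_process_val S s y \<omega> = (\<Sum>(X, a, b, A)\<leftarrow>S. X \<omega> * indicator {a<..b} s * indicator A y)"

definition simple_walsh_integral ::
  "((real \<times> real) set \<Rightarrow> 'a \<Rightarrow> real) \<Rightarrow> 'a simple_process \<Rightarrow> 'a \<Rightarrow> real" where
  "simple_walsh_integral \<xi> S \<omega> = (\<Sum>(X, a, b, A)\<leftarrow>S. X \<omega> * \<xi> ({a<..b} \<times> A) \<omega>)"

text \<open>\<open>J\<close> is (a version of) the integral of \<open>\<Phi>\<close> over \<open>(0,\<infinity>) \<times> \<real>\<close>: the \<open>L\<^sup>2\<close> limit of the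
  integrals of simple processes that converge to \<open>\<Phi>\<close> in \<open>L\<^sup>2(ds dy dP)\<close>. By the Walsh isometry,
  \<open>J\<close> is determined almost surely.\<close>

definition has_walsh_integral ::
  "'a measure \<Rightarrow> ((real \<times> real) set \<Rightarrow> 'a \<Rightarrow> real) \<Rightarrow> (real \<Rightarrow> real \<Rightarrow> 'a \<Rightarrow> real) \<Rightarrow>
   ('a \<Rightarrow> real) \<Rightarrow> bool" where
  "has_walsh_integral M \<xi> \<Phi> J \<longleftrightarrow>
     predictable M \<xi> \<Phi> \<and> J \<in> borel_measurable M \<and>
     (\<exists>S :: nat \<Rightarrow> 'a simple_process.
        (\<forall>n. is_simple_process M \<xi> (S n)) \<and>
        (\<lambda>n. \<integral>\<^sup>+ \<omega>. (\<integral>\<^sup>+ z \<in> {0<..} \<times> UNIV.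
               ennreal ((simple_process_val (S n) (fst z) (snd z) \<omega> - \<Phi> (fst z) (snd z) \<omega>)\<^sup>2)
             \<partial>lborel) \<partial>M) \<longlonglongrightarrow> 0 \<and>
        (\<lambda>n. \<integral>\<^sup>+ \<omega>. ennreal ((simple_walsh_integral \<xi> (S n) \<omega> - J \<omega>)\<^sup>2) \<partial>M) \<longlonglongrightarrow> 0)"

section \<open>The stochastic heat equation\<close>

definition heat_kernel :: "real \<Rightarrow> real \<Rightarrow> real" where
  "heat_kernel t x = exp (- (x\<^sup>2 / (2 * t))) / sqrt (2 * pi * t)"

text \<open>Mild solution started from the constant 1, so that the deterministic term
  \<open>\<integral> p\<^sub>t(y - x) u\<^sub>0(y) dy\<close> equals 1.\<close>

definition mild_solution ::
  "'a measure \<Rightarrow> ((real \<times> real) set \<Rightarrow> 'a \<Rightarrow> real) \<Rightarrow> (real \<Rightarrow> real) \<Rightarrow>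
   (real \<Rightarrow> real \<Rightarrow> 'a \<Rightarrow> real) \<Rightarrow> bool" where
  "mild_solution M \<xi> \<sigma> u \<longleftrightarrow>
     (\<forall>x. \<forall>\<omega>\<in>space M. u 0 x \<omega> = 1) \<and>
     predictable M \<xi> u \<and>
     (AE \<omega> in M. continuous_on ({0..} \<times> UNIV) (\<lambda>(s, x). u s x \<omega>)) \<and>
     (\<forall>T>0. \<forall>k::nat. k \<ge> 2 \<longrightarrow>
        (SUP s\<in>{0..T}. SUP x. \<integral>\<^sup>+ \<omega>. ennreal (\<bar>u s x \<omega>\<bar> ^ k) \<partial>M) < \<infinity>) \<and>
     (\<forall>t>0. \<forall>x. \<exists>J.
        has_walsh_integral M \<xi>
          (\<lambda>s y \<omega>. indicator {0<..<t} s * heat_kernel (t - s) (y - x) * \<sigma> (u s y \<omega>)) J \<and>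
        (AE \<omega> in M. u t x \<omega> = 1 + J \<omega>))"

section \<open>Macroscopic Hausdorff dimension\<close>

definition shell_cube :: "nat \<Rightarrow> 'a::euclidean_space set" where
  "shell_cube n = {x. \<forall>b\<in>Basis. - exp (real n) \<le> x \<bullet> b \<and> x \<bullet> b < exp (real n)}"

fun shell :: "nat \<Rightarrow> 'a::euclidean_space set" where
  "shell 0 = shell_cube 0"
| "shell (Suc n) = shell_cube (Suc n) - shell_cube n"

definition upright_box :: "'a::euclidean_space \<Rightarrow> real \<Rightarrow> 'a set" where
  "upright_box x r = {y. \<forall>b\<in>Basis. x \<bullet> b \<le> y \<bullet> b \<and> y \<bullet> b < x \<bullet> b + r}"

text \<open>A finite family of upright boxes is represented by the list of its pairs (corner, side).\<close>

definition macro_content :: "nat \<Rightarrow> real \<Rightarrow> 'a::euclidean_space set \<Rightarrow> ennreal" where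
  "macro_content n \<rho> E =
     Inf {\<Sum>(x, r)\<leftarrow>Q. ennreal ((r / exp (real n)) powr \<rho>) | Q.
            (\<forall>(x, r) \<in> set Q. r \<ge> 1) \<and>
            E \<inter> shell n \<subseteq> (\<Union>(x, r) \<in> set Q. upright_box x r)}"

definition macro_dim :: "'a::euclidean_space set \<Rightarrow> ereal" where
  "macro_dim E = Inf {ereal \<rho> | \<rho>. \<rho> > 0 \<and> (\<Sum>n. macro_content (Suc n) \<rho> E) < \<infinity>}"

section \<open>Tall peaks\<close>

text \<open>Here \<open>h\<close> is the spatial profile at the fixed time \<open>t\<close>.\<close>

definition tall_peaks :: "real \<Rightarrow> (real \<Rightarrow> real) \<Rightarrow> real \<Rightarrow> real set" where
  "tall_peaks t h \<gamma> =
     {x. x \<ge> exp (exp 1) \<and> h x \<ge> \<gamma> * t powr (1/3) * ln x powr (2/3)}"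

end

theory Submission
  imports Defs "HOL-Real_Asymp.Real_Asymp"
begin

text \<open>The tail of \<open>log u\<close> at a fixed time is of the order \<open>exp (- c r\<^bsup>3/2\<^esup>)\<close>, and the peaks of height
  \<open>\<gamma> (log x)\<^bsup>2/3\<^esup>\<close> therefore have a dimension strictly below 1 that tends to 1 as \<open>\<gamma>\<close> tends to 0; the sequence
  is then chosen recursively. Upper bound: the moments \<open>E u\<^bsup>2q\<^esup> \<le> exp (C q\<^sup>3 t)\<close> and chaining bound the
  probability that a unit interval contains a peak by a negative power of its position. Lower bound: under a
  change of measure of cost \<open>exp (C A\<^bsup>3/2\<^esup>)\<close>, which adds a drift \<open>A\<close> to the noise near \<open>x\<close> at distance at
  most \<open>A\<^bsup>-1/2\<^esup>\<close>, the solution grows like \<open>exp (c A t)\<close>, and a second moment argument turns this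
  into a lower bound of the tail. Up to an error \<open>exp (- R)\<close>, the value of \<open>u\<close> at \<open>x\<close> depends on the noise
  within distance \<open>R\<close> only, so peaks at well separated points are almost independent and, for small \<open>\<gamma>\<close>,
  every interval of length \<open>x\<^bsup>\<theta>\<^esup>\<close> far from the origin contains one.\<close>

text \<open>The Walsh integral is given only as an L2 limit. Estimates are therefore made on a grid,
  where sums are revealed cell by cell and each new cell is a Gaussian independent of the past. One
  Gaussian computation per cell replaces Ito's formula for the moments and Girsanov's theorem for
  the change of measure; Fatou's lemma or L2 convergence carries the bounds to the limit. As
  \<open>\<sigma> (u s y w)\<close> may have either sign, the drift is random and follows this sign,
  in a smoothed form because grid values converge only for continuous functions. The exponent 3/2 is
  a matter of scaling. A drift A on width l doubles the tilted mean in time l^2 once A l^2 is a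
  fixed large constant, so time t allows about A t doublings. The logarithm of the fourth moment of
  the density is of order A^2 l t, hence of order A^(3/2). A value exp r of u thus costs r^(3/2),
  and for r of order (log x)^(2/3) the resulting probability is a power of x. The cubic exponent of
  the moments yields the same order after optimizing q. Only a strict gap between an upper and a
  lower bound is wanted, so all constants are crude.\<close>

abbreviation nnE :: "'b measure \<Rightarrow> ('b \<Rightarrow> real) \<Rightarrow> ennreal" where
  "nnE N f \<equiv> \<integral>\<^sup>+x. ennreal (f x) \<partial>N"

section \<open>Independence of the noise on disjoint regions\<close>

lemma abs_mult_le_left: "\<bar>a * b\<bar> \<le> C" if "\<bar>a\<bar> \<le> C" "\<bar>b\<bar> \<le> 1" for a b C :: real
  using mult_mono[OF that] that by (auto simp: abs_mult)

section \<open>Weighted laws are determined by their trigonometric integrals\<close>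

context prob_space
begin

text \<open>Levy's uniqueness theorem concerns probability measures, so the weights are turned into
  densities by dividing by their common mass (the case \<open>\<theta> = 0\<close>). The lower bound
  1 keeps this mass away from 0.\<close>

lemma weighted_law_unique_pos:
  fixes X :: "'a \<Rightarrow> real"
  assumes [measurable]: "W1 \<in> borel_measurable M" "W2 \<in> borel_measurable M" "X \<in> borel_measurable M"
    and W1: "\<And>w. 1 \<le> W1 w" "\<And>w. W1 w \<le> C" and W2: "\<And>w. 1 \<le> W2 w" "\<And>w. W2 w \<le> C"
    and cos_eq: "\<And>\<theta>. (\<integral>w. W1 w * cos (\<theta> * X w) \<partial>M) = (\<integral>w. W2 w * cos (\<theta> * X w) \<partial>M)"
    and sin_eq: "\<And>\<theta>. (\<integral>w. W1 w * sin (\<theta> * X w) \<partial>M) = (\<integral>w. W2 w * sin (\<theta> * X w) \<partial>M)"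
    and [measurable]: "B \<in> sets borel"
  shows "(\<integral>w. W1 w * indicator B (X w) \<partial>M) = (\<integral>w. W2 w * indicator B (X w) \<partial>M)"
proof -
  define wd where "wd = (\<integral>w. W1 w \<partial>M)"
  have w2: "wd = (\<integral>w. W2 w \<partial>M)" using cos_eq[of 0] by (simp add: wd_def)
  have int: "integrable M W" if [measurable]: "W \<in> borel_measurable M" and "\<And>w. 1 \<le> W w" "\<And>w. W w \<le> C" for W :: "'a \<Rightarrow> real"
    by (rule integrable_const_bound[of _ C]) (use that in \<open>auto simp: abs_le_iff intro!: AE_I2 order_trans[OF _ that(3)] dest: order_trans[OF that(2), of _ 0]\<close>, smt (verit) that(2))
  have i1: "integrable M W1" and i2: "integrable M W2" by (auto intro: int W1 W2)
  have "1 \<le> wd"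
    using integral_mono[of M "\<lambda>_. 1" W1] i1 W1 by (simp add: wd_def prob_space)
  define N where "N W = density M (\<lambda>w. ennreal (W w / wd))" for W :: "'a \<Rightarrow> real"
  define D where "D W = distr (N W) borel X" for W
  have rd: "real_distribution (D W)" if [measurable]: "W \<in> borel_measurable M" and W: "\<And>w. 1 \<le> W w" "\<And>w. W w \<le> C"
    and ww: "wd = (\<integral>w. W w \<partial>M)" for W
  proof -
    have "emeasure (N W) (space (N W)) = nnE M (\<lambda>w. W w / wd)"
      by (simp add: N_def emeasure_density cong: nn_integral_cong)
    also have "... = ennreal (\<integral>w. W w / wd \<partial>M)"
      by (rule nn_integral_eq_integral) (use int[OF that(1-3)] \<open>1 \<le> wd\<close> in \<open>auto intro!: AE_I2 divide_nonneg_nonneg order_trans[OF _ W(1)]\<close>)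
    also have "... = 1" using \<open>1 \<le> wd\<close> ww by simp
    finally have "prob_space (N W)" by (rule prob_spaceI)
    then have "prob_space (D W)" unfolding D_def by (rule prob_space.prob_space_distr) (simp add: N_def)
    then show ?thesis unfolding real_distribution_def real_distribution_axioms_def by (simp add: D_def)
  qed
  have wint: "(\<integral>w. f (X w) \<partial>N W) = (\<integral>w. W w * f (X w) \<partial>M) / wd"
    if [measurable]: "W \<in> borel_measurable M" and W: "\<And>w. 1 \<le> W w" "\<And>w. W w \<le> C"
      and [measurable]: "f \<in> borel_measurable borel" for W and f :: "real \<Rightarrow> real"
  proof -
    have "(\<integral>w. f (X w) \<partial>N W) = (\<integral>w. (W w / wd) *\<^sub>R f (X w) \<partial>M)"
      unfolding N_def by (rule integral_density) (use W \<open>1 \<le> wd\<close> in \<open>auto intro!: AE_I2 divide_nonneg_nonneg order_trans[OF _ W(1)]\<close>)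
    also have "... = (\<integral>w. (W w * f (X w)) / wd \<partial>M)" by simp
    finally show ?thesis by (simp only: integral_divide_zero)
  qed
  have ch: "char (D W) \<theta> = Complex ((\<integral>w. W w * cos (\<theta> * X w) \<partial>M) / wd) ((\<integral>w. W w * sin (\<theta> * X w) \<partial>M) / wd)"
    if [measurable]: "W \<in> borel_measurable M" and W: "\<And>w. 1 \<le> W w" "\<And>w. W w \<le> C"
    and ww: "wd = (\<integral>w. W w \<partial>M)" for W \<theta>
  proof -
    interpret D: real_distribution "D W" by (rule rd) fact+
    have ii: "integrable (D W) (\<lambda>x. iexp (\<theta> * x))"
      by (rule D.integrable_const_bound[of _ 1]) (auto simp: D_def)
    have "Re (char (D W) \<theta>) = (\<integral>x. cos (\<theta> * x) \<partial>D W)"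
      unfolding char_def using integral_Re[OF ii] by (simp add: cis_conv_exp[symmetric] flip: of_real_mult)
    also have "... = (\<integral>w. cos (\<theta> * X w) \<partial>N W)"
      unfolding D_def by (subst integral_distr) (auto simp: N_def)
    also have "... = (\<integral>w. W w * cos (\<theta> * X w) \<partial>M) / wd" by (rule wint) (use that in auto)
    finally have re: "Re (char (D W) \<theta>) = ..." .
    have "Im (char (D W) \<theta>) = (\<integral>x. sin (\<theta> * x) \<partial>D W)"
      unfolding char_def using integral_Im[OF ii] by (simp add: cis_conv_exp[symmetric] flip: of_real_mult)
    also have "... = (\<integral>w. sin (\<theta> * X w) \<partial>N W)"
      unfolding D_def by (subst integral_distr) (auto simp: N_def)
    also have "... = (\<integral>w. W w * sin (\<theta> * X w) \<partial>M) / wd" by (rule wint) (use that in auto)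
    finally have im: "Im (char (D W) \<theta>) = ..." .
    show ?thesis using re im by (simp add: complex_eq_iff)
  qed
  have "char (D W1) = char (D W2)"
    by (rule ext) (simp add: ch W1 W2 wd_def w2[unfolded wd_def] cos_eq sin_eq)
  then have DD: "D W1 = D W2" by (intro Levy_uniqueness rd) (use W1 W2 w2 wd_def in auto)
  have "(\<integral>w. W w * indicator B (X w) \<partial>M) / wd = (\<integral>x. indicator B x \<partial>D W)"
    if [measurable]: "W \<in> borel_measurable M" and W: "\<And>w. 1 \<le> W w" "\<And>w. W w \<le> C" for W
    unfolding D_def by (subst integral_distr) (auto simp: N_def wint[OF that, unfolded N_def])
  from this[of W1] this[of W2] show ?thesis using W1 W2 DD \<open>1 \<le> wd\<close>
    by (metis (no_types, lifting) assms(1,2) div_by_0 divide_cancel_right not_one_le_zero)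
qed

text \<open>Adding the constant \<open>C + 1\<close> turns a bounded signed weight into one that is
  at least 1. Signed weights matter because the weight will be a cosine or sine of other noise
  variables.\<close>

lemma weighted_law_unique:
  fixes X :: "'a \<Rightarrow> real"
  assumes [measurable]: "W1 \<in> borel_measurable M" "W2 \<in> borel_measurable M" "X \<in> borel_measurable M"
    and W1: "\<And>w. \<bar>W1 w\<bar> \<le> C" and W2: "\<And>w. \<bar>W2 w\<bar> \<le> C"
    and cos_eq: "\<And>\<theta>. (\<integral>w. W1 w * cos (\<theta> * X w) \<partial>M) = (\<integral>w. W2 w * cos (\<theta> * X w) \<partial>M)"
    and sin_eq: "\<And>\<theta>. (\<integral>w. W1 w * sin (\<theta> * X w) \<partial>M) = (\<integral>w. W2 w * sin (\<theta> * X w) \<partial>M)"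
    and B[measurable]: "B \<in> sets borel"
  shows "(\<integral>w. W1 w * indicator B (X w) \<partial>M) = (\<integral>w. W2 w * indicator B (X w) \<partial>M)"
proof -
  have shift: "(\<integral>w. (W w + (C + 1)) * f (X w) \<partial>M) = (\<integral>w. W w * f (X w) \<partial>M) + (\<integral>w. (C + 1) * f (X w) \<partial>M)"
    if [measurable]: "W \<in> borel_measurable M" and W: "\<And>w. \<bar>W w\<bar> \<le> C" and [measurable]: "f \<in> borel_measurable borel" and f: "\<And>x. \<bar>f x\<bar> \<le> 1"
    for W and f :: "real \<Rightarrow> real"
  proof -
    have "integrable M (\<lambda>w. W w * f (X w))"
      by (rule integrable_const_bound[of _ C]) (auto intro!: AE_I2 abs_mult_le_left f W)
    moreover have "integrable M (\<lambda>w. (C + 1) * f (X w))"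
      by (rule integrable_mult_right, rule integrable_const_bound[of _ 1]) (auto simp: f)
    ultimately have "(\<integral>w. W w * f (X w) + (C + 1) * f (X w) \<partial>M) = (\<integral>w. W w * f (X w) \<partial>M) + (\<integral>w. (C + 1) * f (X w) \<partial>M)"
      by (rule Bochner_Integration.integral_add)
    then show ?thesis by (simp add: distrib_right add_ac)
  qed
  have "(\<integral>w. (W1 w + (C + 1)) * indicator B (X w) \<partial>M) = (\<integral>w. (W2 w + (C + 1)) * indicator B (X w) \<partial>M)"
  proof (rule weighted_law_unique_pos[where C = "2 * C + 1"])
    fix w show "1 \<le> W1 w + (C + 1)" "1 \<le> W2 w + (C + 1)" "W1 w + (C + 1) \<le> 2 * C + 1" "W2 w + (C + 1) \<le> 2 * C + 1"
      using W1[of w] W2[of w] by linarith+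
  next
    fix \<theta>
    show "(\<integral>w. (W1 w + (C + 1)) * cos (\<theta> * X w) \<partial>M) = (\<integral>w. (W2 w + (C + 1)) * cos (\<theta> * X w) \<partial>M)"
      using shift[of W1 "\<lambda>x. cos (\<theta> * x)"] shift[of W2 "\<lambda>x. cos (\<theta> * x)"] W1 W2 cos_eq[of \<theta>] by simp
    show "(\<integral>w. (W1 w + (C + 1)) * sin (\<theta> * X w) \<partial>M) = (\<integral>w. (W2 w + (C + 1)) * sin (\<theta> * X w) \<partial>M)"
      using shift[of W1 "\<lambda>x. sin (\<theta> * x)"] shift[of W2 "\<lambda>x. sin (\<theta> * x)"] W1 W2 sin_eq[of \<theta>] by simp
  qed auto
  then show ?thesis
    using shift[of W1 "indicator B"] shift[of W2 "indicator B"] W1 W2 by (simp add: indicator_def)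
qed

text \<open>A joint law is determined by the laws of the linear combinations (Cramer-Wold). One
  coordinate is resolved at a time: the indicator for coordinate \<open>j\<close> is absorbed into
  the weight, and what the induction then asks for is the one-dimensional statement with cos or sin
  of the remaining combination as further weight. Hence the induction runs over all bounded
  weights.\<close>

lemma weighted_joint_law_unique:
  fixes X :: "'i \<Rightarrow> 'a \<Rightarrow> real"
  assumes "finite I" "\<And>i. i \<in> I \<Longrightarrow> X i \<in> borel_measurable M"
    and "W1 \<in> borel_measurable M" "W2 \<in> borel_measurable M"
    and "\<And>w. \<bar>W1 w\<bar> \<le> C" and "\<And>w. \<bar>W2 w\<bar> \<le> C"
    and "\<And>c. (\<integral>w. W1 w * cos (\<Sum>i\<in>I. c i * X i w) \<partial>M) = (\<integral>w. W2 w * cos (\<Sum>i\<in>I. c i * X i w) \<partial>M)"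
    and "\<And>c. (\<integral>w. W1 w * sin (\<Sum>i\<in>I. c i * X i w) \<partial>M) = (\<integral>w. W2 w * sin (\<Sum>i\<in>I. c i * X i w) \<partial>M)"
    and "\<And>i. i \<in> I \<Longrightarrow> B i \<in> sets borel"
  shows "(\<integral>w. W1 w * (\<Prod>i\<in>I. indicator (B i) (X i w)) \<partial>M) = (\<integral>w. W2 w * (\<Prod>i\<in>I. indicator (B i) (X i w)) \<partial>M)"
  using assms
proof (induction I arbitrary: W1 W2 rule: finite_induct)
  case empty
  then show ?case using empty.prems(6) by simp
next
  case (insert j I)
  note [measurable] = insert.prems(2,3)
  have [measurable]: "X j \<in> borel_measurable M" "\<And>i. i \<in> I \<Longrightarrow> X i \<in> borel_measurable M" "B j \<in> sets borel"
    using insert.prems by auto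
  note b1 = insert.prems(4) and b2 = insert.prems(5)
  define Y where "Y c w = (\<Sum>i\<in>I. c i * X i w)" for c w
  have Ym[measurable]: "Y c \<in> borel_measurable M" for c unfolding Y_def by measurable
  have eq: "(\<integral>w. W1 w * cos (Y c w + \<theta> * X j w) \<partial>M) = (\<integral>w. W2 w * cos (Y c w + \<theta> * X j w) \<partial>M)"
     "(\<integral>w. W1 w * sin (Y c w + \<theta> * X j w) \<partial>M) = (\<integral>w. W2 w * sin (Y c w + \<theta> * X j w) \<partial>M)" for c \<theta>
  proof -
    have "(\<Sum>i\<in>insert j I. (c(j := \<theta>)) i * X i w) = Y c w + \<theta> * X j w" for w
      unfolding Y_def using insert.hyps by (auto simp: add.commute intro!: sum.cong)
    then show "(\<integral>w. W1 w * cos (Y c w + \<theta> * X j w) \<partial>M) = (\<integral>w. W2 w * cos (Y c w + \<theta> * X j w) \<partial>M)"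
     "(\<integral>w. W1 w * sin (Y c w + \<theta> * X j w) \<partial>M) = (\<integral>w. W2 w * sin (Y c w + \<theta> * X j w) \<partial>M)"
      using insert.prems(6)[of "c(j := \<theta>)"] insert.prems(7)[of "c(j := \<theta>)"] by simp_all
  qed
  note eqm = eq(1)[of _ "- \<theta>" for \<theta>, simplified] eq(2)[of _ "- \<theta>" for \<theta>, simplified]
  have int: "integrable M (\<lambda>w. W w * f w)" if [measurable]: "W \<in> borel_measurable M" "f \<in> borel_measurable M"
    and W: "\<And>w. \<bar>W w\<bar> \<le> C" and f: "\<And>w. \<bar>f w\<bar> \<le> 1" for W f :: "'a \<Rightarrow> real"
    by (rule integrable_const_bound[of _ C]) (auto intro!: AE_I2 abs_mult_le_left f W)
  note bm = abs_mult_le_left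
  have half_sum: "(\<integral>w. f w \<partial>M) = ((\<integral>w. g w \<partial>M) + (\<integral>w. h w \<partial>M)) / 2"
    if "integrable M g" "integrable M h" "\<And>w. 2 * f w = g w + h w" for f g h :: "'a \<Rightarrow> real"
  proof -
    have "2 * (\<integral>w. f w \<partial>M) = (\<integral>w. g w + h w \<partial>M)" by (simp flip: that(3))
    then show ?thesis using that by simp
  qed
  have half_diff: "(\<integral>w. f w \<partial>M) = ((\<integral>w. g w \<partial>M) - (\<integral>w. h w \<partial>M)) / 2"
    if "integrable M g" "integrable M h" "\<And>w. 2 * f w = g w - h w" for f g h :: "'a \<Rightarrow> real"
  proof -
    have "2 * (\<integral>w. f w \<partial>M) = (\<integral>w. g w - h w \<partial>M)" by (simp flip: that(3))
    then show ?thesis using that by simp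
  qed
  have intc: "integrable M (\<lambda>w. W w * cos (f w))" "integrable M (\<lambda>w. W w * sin (f w))"
    if "W \<in> borel_measurable M" "\<And>w. \<bar>W w\<bar> \<le> C" "f \<in> borel_measurable M" for W f :: "'a \<Rightarrow> real"
    using that by (auto intro!: int)
  \<comment> \<open>Product-to-sum formulas: agreement is known only for cos and sin of the full
    combination, with either sign of \<theta>.\<close>
  have split: "(\<integral>w. W w * cos (Y c w) * cos (\<theta> * X j w) \<partial>M) = ((\<integral>w. W w * cos (Y c w + (-\<theta>) * X j w) \<partial>M) + (\<integral>w. W w * cos (Y c w + \<theta> * X j w) \<partial>M)) / 2"
       "(\<integral>w. W w * cos (Y c w) * sin (\<theta> * X j w) \<partial>M) = ((\<integral>w. W w * sin (Y c w + \<theta> * X j w) \<partial>M) - (\<integral>w. W w * sin (Y c w + (-\<theta>) * X j w) \<partial>M)) / 2"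
       "(\<integral>w. W w * sin (Y c w) * cos (\<theta> * X j w) \<partial>M) = ((\<integral>w. W w * sin (Y c w + \<theta> * X j w) \<partial>M) + (\<integral>w. W w * sin (Y c w + (-\<theta>) * X j w) \<partial>M)) / 2"
       "(\<integral>w. W w * sin (Y c w) * sin (\<theta> * X j w) \<partial>M) = ((\<integral>w. W w * cos (Y c w + (-\<theta>) * X j w) \<partial>M) - (\<integral>w. W w * cos (Y c w + \<theta> * X j w) \<partial>M)) / 2"
    if [measurable]: "W \<in> borel_measurable M" and W: "\<And>w. \<bar>W w\<bar> \<le> C" for W c \<theta>
    by ((rule half_sum half_diff, (rule intc, measurable, rule W, measurable)+, simp add: cos_add sin_add cos_diff sin_diff algebra_simps)+)
  show ?case
  proof -
    have "(\<integral>w. (W1 w * indicator (B j) (X j w)) * (\<Prod>i\<in>I. indicator (B i) (X i w)) \<partial>M) = (\<integral>w. (W2 w * indicator (B j) (X j w)) * (\<Prod>i\<in>I. indicator (B i) (X i w)) \<partial>M)"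
    proof (rule insert.IH)
      fix c
      show "(\<integral>w. (W1 w * indicator (B j) (X j w)) * cos (\<Sum>i\<in>I. c i * X i w) \<partial>M) = (\<integral>w. (W2 w * indicator (B j) (X j w)) * cos (\<Sum>i\<in>I. c i * X i w) \<partial>M)"
      proof -
        have "(\<integral>w. (W1 w * cos (Y c w)) * indicator (B j) (X j w) \<partial>M) = (\<integral>w. (W2 w * cos (Y c w)) * indicator (B j) (X j w) \<partial>M)"
          by (rule weighted_law_unique[where C = C])
             (simp_all add: b1 b2 bm split[OF insert.prems(2) b1] split[OF insert.prems(3) b2] eq eqm)
        then show ?thesis by (simp add: Y_def mult_ac)
      qed
      show "(\<integral>w. (W1 w * indicator (B j) (X j w)) * sin (\<Sum>i\<in>I. c i * X i w) \<partial>M) = (\<integral>w. (W2 w * indicator (B j) (X j w)) * sin (\<Sum>i\<in>I. c i * X i w) \<partial>M)"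
      proof -
        have "(\<integral>w. (W1 w * sin (Y c w)) * indicator (B j) (X j w) \<partial>M) = (\<integral>w. (W2 w * sin (Y c w)) * indicator (B j) (X j w) \<partial>M)"
          by (rule weighted_law_unique[where C = C])
             (simp_all add: b1 b2 bm split[OF insert.prems(2) b1] split[OF insert.prems(3) b2] eq eqm)
        then show ?thesis by (simp add: Y_def mult_ac)
      qed
    qed (use insert.prems b1 b2 bm in \<open>auto simp: indicator_def\<close>)
    then show ?thesis using insert.hyps by (simp add: mult_ac)
  qed
qed

end

text \<open>As an image of the standard normal law under scaling by \<open>sqrt v\<close>, the
  degenerate case \<open>v = 0\<close> and the case with a density need no distinction from here
  on.\<close>

lemma centered_gaussian_distr:
  assumes "centered_gaussian M X v" "0 \<le> v" "prob_space M"
  shows "X \<in> borel_measurable M" "distr M borel X = distr std_normal_distribution borel (\<lambda>z. sqrt v * z)"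
proof -
  interpret prob_space M by fact
  show [measurable]: "X \<in> borel_measurable M" using assms by (simp add: centered_gaussian_def)
  show "distr M borel X = distr std_normal_distribution borel (\<lambda>z. sqrt v * z)"
  proof (cases "v = 0")
    case True
    interpret N: real_distribution std_normal_distribution by (rule real_dist_normal_dist)
    show ?thesis using assms True N.distr_const[of 0 borel]
      by (simp add: centered_gaussian_def)
  next
    case False
    with assms have v: "0 < sqrt v" by simp
    have "distributed M lborel X (normal_density 0 (sqrt v))"
      using assms False by (simp add: distributed_def centered_gaussian_def distr_cong[OF refl sets_lborel])
    then have "distributed M lborel (\<lambda>w. (X w - 0) / sqrt v) std_normal_density"
      using normal_standard_normal_convert[OF v] by simp
    then have "distr M lborel (\<lambda>w. X w / sqrt v) = std_normal_distribution" by (simp add: distributed_def)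
    then have "distr std_normal_distribution borel (\<lambda>z. sqrt v * z) = distr (distr M lborel (\<lambda>w. X w / sqrt v)) borel (\<lambda>z. sqrt v * z)" by simp
    also have "... = distr M borel ((\<lambda>z. sqrt v * z) \<circ> (\<lambda>w. X w / sqrt v))" by (rule distr_distr) auto
    also have "... = distr M borel X" using v by (simp add: o_def)
    finally show ?thesis by simp
  qed
qed

lemma centered_gaussian_cos_sin:
  assumes "centered_gaussian M X v" "0 \<le> v" "prob_space M"
  shows "(\<integral>w. cos (X w) \<partial>M) = exp (- v / 2)" "(\<integral>w. sin (X w) \<partial>M) = 0"
proof -
  note d = centered_gaussian_distr[OF assms]
  note [measurable] = d(1)
  interpret N: real_distribution std_normal_distribution by (rule real_dist_normal_dist)
  have ii: "complex_integrable std_normal_distribution (\<lambda>x. iexp (sqrt v * x))"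
    by (rule N.integrable_const_bound[of _ 1]) auto
  have ch: "(CLINT x|std_normal_distribution. iexp (sqrt v * x)) = complex_of_real (exp (- v / 2))"
    using fun_cong[OF char_std_normal_distribution, of "sqrt v"] assms(2) by (simp add: char_def)
  have "(\<integral>w. f (X w) \<partial>M) = (\<integral>z. f (sqrt v * z) \<partial>std_normal_distribution)" if [measurable]: "f \<in> borel_measurable borel" for f :: "real \<Rightarrow> real"
    using integral_distr[of X M borel f] integral_distr[of "\<lambda>z. sqrt v * z" std_normal_distribution borel f] d(2) by simp
  from this[of cos] this[of sin] show "(\<integral>w. cos (X w) \<partial>M) = exp (- v / 2)" "(\<integral>w. sin (X w) \<partial>M) = 0"
    using ch integral_Re[OF ii] integral_Im[OF ii] by (simp_all add: cis_conv_exp[symmetric] flip: of_real_mult)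
qed

section \<open>Sigma-algebras and linear functionals of the noise\<close>

definition noise_sigma :: "'a measure \<Rightarrow> ((real \<times> real) set \<Rightarrow> 'a \<Rightarrow> real) \<Rightarrow> (real \<times> real) set \<Rightarrow> 'a measure" where
  "noise_sigma M \<xi> U = sigma (space M)
     ({\<xi> A -` B \<inter> space M | A B. A \<in> noise_sets \<and> A \<subseteq> U \<and> B \<in> sets borel} \<union> null_sets M)"

lemma noise_filtration_eq: "noise_filtration M \<xi> t = noise_sigma M \<xi> ({0<..t} \<times> UNIV)"
  by (simp add: noise_filtration_def noise_sigma_def)

locale noise =
  fixes M :: "'a measure" and \<xi> :: "(real \<times> real) set \<Rightarrow> 'a \<Rightarrow> real"
  assumes wn: "white_noise M \<xi>"
begin

sublocale prob_space M using wn by (simp add: white_noise_def)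

abbreviation "NS \<equiv> noise_sigma M \<xi>"

definition lin :: "(real \<times> real) set set \<Rightarrow> ((real \<times> real) set \<Rightarrow> real) \<Rightarrow> 'a \<Rightarrow> real" where
  "lin I c w = (\<Sum>A\<in>I. c A * \<xi> A w)"

definition linvar :: "(real \<times> real) set set \<Rightarrow> ((real \<times> real) set \<Rightarrow> real) \<Rightarrow> real" where
  "linvar I c = (\<Sum>A\<in>I. \<Sum>B\<in>I. c A * c B * measure lborel (A \<inter> B))"

lemma gaussian_lin:
  assumes "finite I" "I \<subseteq> noise_sets"
  shows "centered_gaussian M (lin I c) (linvar I c)"
  using wn assms unfolding white_noise_def lin_def linvar_def by blast

lemma gaussian_noise: "A \<in> noise_sets \<Longrightarrow> centered_gaussian M (\<xi> A) (measure lborel A)"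
  using gaussian_lin[of "{A}" "\<lambda>_. 1"] by (simp add: lin_def[abs_def] linvar_def)

lemma noise_measurable[measurable]: "A \<in> noise_sets \<Longrightarrow> \<xi> A \<in> borel_measurable M"
  using gaussian_noise by (simp add: centered_gaussian_def)

text \<open>The covariance form is the squared L2 norm of the step function that sums the values
  \<open>c A\<close> over the sets \<open>A\<close> containing a point.\<close>

lemma linvar_nonneg:
  assumes "finite I" "I \<subseteq> noise_sets"
  shows "0 \<le> linvar I c"
proof -
  have "linvar I c = (\<Sum>A\<in>I. \<Sum>B\<in>I. (\<integral>z. (c A * indicator A z) * (c B * indicator B z) \<partial>lborel))"
    unfolding linvar_def
  proof (intro sum.cong refl)
    fix A B assume "A \<in> I" "B \<in> I"
    then have "A \<inter> B \<in> sets borel" using assms by (auto simp: noise_sets_def)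
    have "(\<lambda>z. (c A * indicator A z) * (c B * indicator B z)) = (\<lambda>z. (c A * c B) * indicat_real (A \<inter> B) z)"
      by (auto simp: indicator_def fun_eq_iff)
    then show "c A * c B * measure lborel (A \<inter> B) = (\<integral>z. (c A * indicator A z) * (c B * indicator B z) \<partial>lborel)"
      using \<open>A \<inter> B \<in> sets borel\<close> by simp
  qed
  also have "... = (\<integral>z. (\<Sum>A\<in>I. c A * indicator A z)\<^sup>2 \<partial>lborel)"
  proof -
    have ii: "integrable lborel (\<lambda>z. (c A * indicator A z) * (c B * indicator B z))" if "A \<in> I" "B \<in> I" for A B
    proof -
      have "integrable lborel (\<lambda>z. (c A * c B) * indicat_real (A \<inter> B) z)"
        using that assms le_less_trans[OF emeasure_mono[of "A \<inter> B" A lborel]]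
        by (intro integrable_mult_right integrable_real_indicator) (auto simp: noise_sets_def)
      then show ?thesis by (rule Bochner_Integration.integrable_cong[THEN iffD1, rotated -1]) (auto simp: indicator_def)
    qed
    show ?thesis unfolding power2_eq_square sum_product
      by (subst Bochner_Integration.integral_sum; (intro Bochner_Integration.integrable_sum ii)?; simp?)
         (intro sum.cong refl Bochner_Integration.integral_sum[symmetric] ii)
  qed
  also have "... \<ge> 0" by simp
  finally show ?thesis .
qed

lemma lin_measurable[measurable]: "I \<subseteq> noise_sets \<Longrightarrow> lin I c \<in> borel_measurable M"
  unfolding lin_def[abs_def] by (intro borel_measurable_sum borel_measurable_times borel_measurable_const noise_measurable) auto

lemma lin_cos_sin:
  assumes "finite I" "I \<subseteq> noise_sets"
  shows "expectation (\<lambda>w. cos (lin I c w)) = exp (- linvar I c / 2)" "expectation (\<lambda>w. sin (lin I c w)) = 0"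
  using centered_gaussian_cos_sin[OF gaussian_lin[OF assms] linvar_nonneg[OF assms] prob_space_axioms] by auto

lemma lin_add_disjoint:
  assumes I: "finite I" "I \<subseteq> noise_sets" "\<And>A. A \<in> I \<Longrightarrow> A \<subseteq> U"
    and J: "finite J" "J \<subseteq> noise_sets" "\<And>A. A \<in> J \<Longrightarrow> A \<subseteq> V" and UV: "U \<inter> V = {}"
  obtains e where "\<And>w. lin (I \<union> J) e w = lin I c w + lin J d w" "linvar (I \<union> J) e = linvar I c + linvar J d"
proof
  \<comment> \<open>A set lying in both families is contained in \<open>U \<inter> V\<close>, hence
    empty, but it may be there; so the coefficients are added and not chosen by cases.\<close>
  define c' d' where "c' A = (if A \<in> I then c A else 0)" and "d' A = (if A \<in> J then d A else 0)" for A
  define e where "e A = c' A + d' A" for A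
  have sI: "(\<Sum>A\<in>I \<union> J. c' A * f A) = (\<Sum>A\<in>I. c A * f A)" for f
    using I J by (intro sum.mono_neutral_cong_right) (auto simp: c'_def)
  have sJ: "(\<Sum>A\<in>I \<union> J. d' A * f A) = (\<Sum>A\<in>J. d A * f A)" for f
    using I J by (intro sum.mono_neutral_cong_right) (auto simp: d'_def)
  show "lin (I \<union> J) e w = lin I c w + lin J d w" for w
    unfolding lin_def e_def distrib_right sum.distrib sI sJ ..
  have z: "measure lborel (A \<inter> B) = 0" if "A \<in> I" "B \<in> J" for A B
  proof -
    have "A \<inter> B = {}" using I(3)[OF that(1)] J(3)[OF that(2)] UV by auto
    then show ?thesis by simp
  qed
  have z2: "measure lborel (B \<inter> A) = 0" if "A \<in> I" "B \<in> J" for A B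
    using z[OF that] by (simp add: Int_commute)
  have "linvar (I \<union> J) e = (\<Sum>A\<in>I \<union> J. e A * (\<Sum>B\<in>I \<union> J. e B * measure lborel (A \<inter> B)))"
    by (simp add: linvar_def sum_distrib_left mult_ac)
  also have "... = (\<Sum>A\<in>I. c A * (\<Sum>B\<in>I. c B * measure lborel (A \<inter> B))) + (\<Sum>A\<in>J. d A * (\<Sum>B\<in>J. d B * measure lborel (A \<inter> B)))"
    unfolding e_def distrib_right sum.distrib sI sJ by (simp add: z z2)
  finally show "linvar (I \<union> J) e = linvar I c + linvar J d" by (simp add: linvar_def sum_distrib_left mult_ac)
qed

lemma linvar_minus: "linvar J (\<lambda>A. - d A) = linvar J d" by (simp add: linvar_def)
lemma lin_minus: "lin J (\<lambda>A. - d A) w = - lin J d w" by (simp add: lin_def sum_negf)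

text \<open>The sum and the difference of the two combinations have the same variance, since
  covariances across disjoint regions vanish. Comparing the addition formulas for both isolates each
  product.\<close>

lemma lin_trig_product:
  assumes I: "finite I" "I \<subseteq> noise_sets" "\<And>A. A \<in> I \<Longrightarrow> A \<subseteq> U"
    and J: "finite J" "J \<subseteq> noise_sets" "\<And>A. A \<in> J \<Longrightarrow> A \<subseteq> V" and UV: "U \<inter> V = {}"
  shows "expectation (\<lambda>w. cos (lin J d w) * cos (lin I c w)) = expectation (\<lambda>w. cos (lin J d w)) * expectation (\<lambda>w. cos (lin I c w))"
    "expectation (\<lambda>w. cos (lin J d w) * sin (lin I c w)) = 0"
    "expectation (\<lambda>w. sin (lin J d w) * cos (lin I c w)) = 0"
    "expectation (\<lambda>w. sin (lin J d w) * sin (lin I c w)) = 0"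
proof -
  obtain e where e: "\<And>w. lin (I \<union> J) e w = lin I c w + lin J d w" "linvar (I \<union> J) e = linvar I c + linvar J d"
    by (rule lin_add_disjoint[OF I J UV]) auto
  obtain e' where e': "\<And>w. lin (I \<union> J) e' w = lin I c w - lin J d w" "linvar (I \<union> J) e' = linvar I c + linvar J d"
    by (rule lin_add_disjoint[OF I J UV, of c "\<lambda>A. - d A"]) (auto simp: lin_minus linvar_minus)
  note [measurable] = lin_measurable[OF I(2)] lin_measurable[OF J(2)]
  have ij: "finite (I \<union> J)" "I \<union> J \<subseteq> noise_sets" using I J by auto
  note p = lin_cos_sin[OF ij, of e, unfolded e] lin_cos_sin[OF ij, of e', unfolded e']
  have int: "integrable M (\<lambda>w. f w)" if "f \<in> borel_measurable M" "\<And>w. \<bar>f w\<bar> \<le> 1" for f :: "'a \<Rightarrow> real"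
    by (rule integrable_const_bound[of _ 1]) (use that in auto)
  have ints: "integrable M (\<lambda>w. cos (lin J d w) * cos (lin I c w))" "integrable M (\<lambda>w. cos (lin J d w) * sin (lin I c w))"
     "integrable M (\<lambda>w. sin (lin J d w) * cos (lin I c w))" "integrable M (\<lambda>w. sin (lin J d w) * sin (lin I c w))"
    by (auto intro!: int abs_mult_le_left)
  have q: "expectation (\<lambda>w. cos (lin J d w) * cos (lin I c w)) - expectation (\<lambda>w. sin (lin J d w) * sin (lin I c w)) = exp (- (linvar I c + linvar J d) / 2)"
     "expectation (\<lambda>w. cos (lin J d w) * cos (lin I c w)) + expectation (\<lambda>w. sin (lin J d w) * sin (lin I c w)) = exp (- (linvar I c + linvar J d) / 2)"
     "expectation (\<lambda>w. cos (lin J d w) * sin (lin I c w)) + expectation (\<lambda>w. sin (lin J d w) * cos (lin I c w)) = 0"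
     "expectation (\<lambda>w. cos (lin J d w) * sin (lin I c w)) - expectation (\<lambda>w. sin (lin J d w) * cos (lin I c w)) = 0"
    using p ints by (simp_all add: cos_add sin_add cos_diff sin_diff mult.commute add.commute)
  from q(1,2) have cc: "expectation (\<lambda>w. cos (lin J d w) * cos (lin I c w)) = exp (- (linvar I c + linvar J d) / 2)"
    and "expectation (\<lambda>w. sin (lin J d w) * sin (lin I c w)) = 0" by linarith+
  from this(2) q(3,4) show "expectation (\<lambda>w. cos (lin J d w) * sin (lin I c w)) = 0"
    "expectation (\<lambda>w. sin (lin J d w) * cos (lin I c w)) = 0"
    "expectation (\<lambda>w. sin (lin J d w) * sin (lin I c w)) = 0" by linarith+
  show "expectation (\<lambda>w. cos (lin J d w) * cos (lin I c w)) = expectation (\<lambda>w. cos (lin J d w)) * expectation (\<lambda>w. cos (lin I c w))"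
    using cc by (simp add: lin_cos_sin I J field_simps flip: exp_add)
qed

text \<open>Two passes of \<open>weighted_joint_law_unique\<close>: with trigonometric functions of
  the \<open>J\<close> variables as weight the \<open>I\<close> variables are resolved into
  indicators (\<open>s1\<close>, \<open>s2\<close>); then \<open>PI\<close> itself is the weight and
  the \<open>J\<close> variables are resolved.\<close>

lemma noise_rect_indep:
  assumes I: "finite I" "I \<subseteq> noise_sets" "\<And>A. A \<in> I \<Longrightarrow> A \<subseteq> U"
    and J: "finite J" "J \<subseteq> noise_sets" "\<And>A. A \<in> J \<Longrightarrow> A \<subseteq> V" and UV: "U \<inter> V = {}"
    and B: "\<And>A. A \<in> I \<Longrightarrow> B A \<in> sets borel" and D: "\<And>A. A \<in> J \<Longrightarrow> D A \<in> sets borel"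
  shows "expectation (\<lambda>w. (\<Prod>A\<in>I. indicat_real (B A) (\<xi> A w)) * (\<Prod>A\<in>J. indicat_real (D A) (\<xi> A w))) =
    expectation (\<lambda>w. (\<Prod>A\<in>I. indicat_real (B A) (\<xi> A w))) * expectation (\<lambda>w. (\<Prod>A\<in>J. indicat_real (D A) (\<xi> A w)))"
proof -
  define PI where "PI w = (\<Prod>A\<in>I. indicat_real (B A) (\<xi> A w))" for w
  have mI: "\<xi> A \<in> borel_measurable M" "B A \<in> sets borel" if "A \<in> I" for A using that I B by auto
  have mJ: "\<xi> A \<in> borel_measurable M" if "A \<in> J" for A using that J by auto
  note [measurable] = lin_measurable[OF I(2)] lin_measurable[OF J(2)]
  have [measurable]: "PI \<in> borel_measurable M" unfolding PI_def[abs_def]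
    by (intro borel_measurable_prod measurable_compose[OF mI(1)]) (use mI in auto)
  have PI1: "\<bar>PI w\<bar> \<le> 1" for w unfolding PI_def abs_prod by (intro prod_le_1) auto
  have s1: "expectation (\<lambda>w. cos (lin J d w) * PI w) = expectation (\<lambda>w. expectation (\<lambda>w. cos (lin J d w)) * PI w)" for d
    unfolding PI_def
    by (rule weighted_joint_law_unique[where C = 1])
       (use I B mI lin_trig_product[OF I J UV, of d] in \<open>auto simp: lin_cos_sin[OF J(1,2)] lin_cos_sin lin_def[symmetric] linvar_nonneg[OF J(1,2)]\<close>)
  have s2: "expectation (\<lambda>w. sin (lin J d w) * PI w) = expectation (\<lambda>w. 0 * PI w)" for d
    unfolding PI_def
    by (rule weighted_joint_law_unique[where C = 1])
       (use I B mI lin_trig_product[OF I J UV, of d] in \<open>auto simp: lin_cos_sin lin_def[symmetric]\<close>)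
  have "integrable M PI" by (rule integrable_const_bound[of _ 1]) (use PI1 in auto)
  moreover have "-1 \<le> PI w" "PI w \<le> 1" for w using PI1[of w] by linarith+
  ultimately have "expectation PI \<le> 1" "-1 \<le> expectation PI"
    by (intro integral_le_const integral_ge_const AE_I2; simp)+
  then have "\<bar>expectation PI\<bar> \<le> 1" by linarith
  then have "expectation (\<lambda>w. PI w * (\<Prod>A\<in>J. indicator (D A) (\<xi> A w))) = expectation (\<lambda>w. expectation PI * (\<Prod>A\<in>J. indicator (D A) (\<xi> A w)))"
    by (intro weighted_joint_law_unique[where C = 1])
       (use J D mJ PI1 s1 s2 lin_cos_sin[OF J(1,2)] in \<open>auto simp: lin_def[symmetric] mult.commute\<close>)
  then show ?thesis unfolding PI_def by simp
qed

text \<open>Cylinder events up to null sets. The almost sure clause admits the null sets that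
  augment the sigma-algebra as generators while the family stays closed under intersection.\<close>

definition rect_events :: "(real \<times> real) set \<Rightarrow> 'a set set" where
  "rect_events U = {E \<in> sets M. \<exists>I B. finite I \<and> I \<subseteq> noise_sets \<and> (\<forall>A\<in>I. A \<subseteq> U \<and> B A \<in> sets borel) \<and>
     (AE w in M. w \<in> E \<longleftrightarrow> (\<forall>A\<in>I. \<xi> A w \<in> B A))}"

lemma rect_eventsE:
  assumes "E \<in> rect_events U"
  obtains I B where "E \<in> sets M" "finite I" "I \<subseteq> noise_sets" "\<forall>A\<in>I. A \<subseteq> U \<and> B A \<in> sets borel"
    "AE w in M. w \<in> E \<longleftrightarrow> (\<forall>A\<in>I. \<xi> A w \<in> B A)"
proof -
  have "\<exists>I B. E \<in> sets M \<and> finite I \<and> I \<subseteq> noise_sets \<and> (\<forall>A\<in>I. A \<subseteq> U \<and> B A \<in> sets borel) \<and>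
    (AE w in M. w \<in> E \<longleftrightarrow> (\<forall>A\<in>I. \<xi> A w \<in> B A))" using assms by (simp add: rect_events_def)
  then show thesis using that by auto
qed

lemma rect_eventsI:
  assumes "E \<in> sets M" "finite I" "I \<subseteq> noise_sets" "\<forall>A\<in>I. A \<subseteq> U \<and> B A \<in> sets borel"
    "AE w in M. w \<in> E \<longleftrightarrow> (\<forall>A\<in>I. \<xi> A w \<in> B A)"
  shows "E \<in> rect_events U"
  unfolding rect_events_def by (rule CollectI, rule conjI, fact, rule exI[of _ I], rule exI[of _ B], intro conjI; fact)

lemma prod_indicator_eq: "finite I \<Longrightarrow> (\<Prod>A\<in>I. indicat_real (B A) (f A)) = of_bool (\<forall>A\<in>I. f A \<in> B A)"
  by (induction I rule: finite_induct) auto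

lemma Int_stable_rect_events: "Int_stable (rect_events U)"
proof (rule Int_stableI)
  fix E F assume E: "E \<in> rect_events U" and F: "F \<in> rect_events U"
  obtain I B where I: "E \<in> sets M" "finite I" "I \<subseteq> noise_sets" "\<forall>A\<in>I. A \<subseteq> U \<and> B A \<in> sets borel" "AE w in M. w \<in> E \<longleftrightarrow> (\<forall>A\<in>I. \<xi> A w \<in> B A)"
    by (rule rect_eventsE[OF E])
  obtain J D where J: "F \<in> sets M" "finite J" "J \<subseteq> noise_sets" "\<forall>A\<in>J. A \<subseteq> U \<and> D A \<in> sets borel" "AE w in M. w \<in> F \<longleftrightarrow> (\<forall>A\<in>J. \<xi> A w \<in> D A)"
    by (rule rect_eventsE[OF F])
  define G where "G A = (if A \<in> I then B A else UNIV) \<inter> (if A \<in> J then D A else UNIV)" for A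
  have "AE w in M. w \<in> E \<inter> F \<longleftrightarrow> (\<forall>A\<in>I\<union>J. \<xi> A w \<in> G A)"
    using I(5) J(5) by eventually_elim (auto simp: G_def)
  moreover have "\<forall>A\<in>I\<union>J. A \<subseteq> U \<and> G A \<in> sets borel" using I J by (auto simp: G_def)
  moreover have "E \<inter> F \<in> sets M" "finite (I \<union> J)" "I \<union> J \<subseteq> noise_sets" using I J by auto
  ultimately show "E \<inter> F \<in> rect_events U" by (intro rect_eventsI)
qed

lemma noise_sigma_gen_rect:
  "{\<xi> A -` B \<inter> space M | A B. A \<in> noise_sets \<and> A \<subseteq> U \<and> B \<in> sets borel} \<union> null_sets M \<subseteq> rect_events U"
proof safe
  fix A B assume A: "A \<in> noise_sets" "A \<subseteq> U" and B: "B \<in> sets (borel :: real measure)"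
  show "\<xi> A -` B \<inter> space M \<in> rect_events U" using A B
    by (intro rect_eventsI[where I = "{A}" and B = "\<lambda>_. B"]) auto
next
  fix N assume N: "N \<in> null_sets M"
  \<comment> \<open>A null set is encoded by the impossible condition that \<open>\<xi> {}\<close>
    lies in the empty set.\<close>
  have "{} \<in> noise_sets" by (simp add: noise_sets_def)
  then show "N \<in> rect_events U" using N AE_not_in[OF N]
    by (intro rect_eventsI[where I = "{{}}" and B = "\<lambda>_. {}"]) auto
qed

lemma sets_noise_sigma:
  "sets (NS U) = sigma_sets (space M) ({\<xi> A -` B \<inter> space M | A B. A \<in> noise_sets \<and> A \<subseteq> U \<and> B \<in> sets borel} \<union> null_sets M)"
  unfolding noise_sigma_def by (rule sets_measure_of) (auto dest: null_setsD2 sets.sets_into_space)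

lemma space_noise_sigma[simp]: "space (NS U) = space M"
  unfolding noise_sigma_def by (rule space_measure_of_conv)

lemma sets_noise_sigma_subset: "sets (NS U) \<subseteq> sets M"
  unfolding sets_noise_sigma by (intro sets.sigma_sets_subset order_trans[OF noise_sigma_gen_rect]) (auto simp: rect_events_def)

lemma sets_noise_sigma_mono: "U \<subseteq> V \<Longrightarrow> sets (NS U) \<subseteq> sets (NS V)"
  unfolding sets_noise_sigma by (rule sigma_sets_mono') auto

lemma noise_measurable_sigma:
  assumes "A \<in> noise_sets" "A \<subseteq> U"
  shows "\<xi> A \<in> borel_measurable (NS U)"
  by (rule measurableI) (use assms in \<open>auto simp: sets_noise_sigma intro!: sigma_sets.Basic\<close>)

lemma noise_sigma_measurable_M: "f \<in> borel_measurable (NS U) \<Longrightarrow> f \<in> borel_measurable M"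
  using sets_noise_sigma_subset[of U] by (auto simp: measurable_def)

lemma noise_sigma_measurable_mono: "f \<in> borel_measurable (NS U) \<Longrightarrow> U \<subseteq> V \<Longrightarrow> f \<in> borel_measurable (NS V)"
  using sets_noise_sigma_mono[of U V] by (auto simp: measurable_def)

text \<open>Independence passes from the intersection-stable generators \<open>rect_events\<close>
  to the sigma-algebras they generate; on the generators it is
  \<open>noise_rect_indep\<close>.\<close>

theorem noise_indep:
  assumes "U \<inter> V = {}"
  shows "indep_set (sets (NS U)) (sets (NS V))"
proof -
  have "indep_set (rect_events U) (rect_events V)"
    unfolding indep_sets2_eq
  proof (intro conjI ballI)
    fix E F assume E: "E \<in> rect_events U" and F: "F \<in> rect_events V"
    obtain I B where I: "E \<in> sets M" "finite I" "I \<subseteq> noise_sets" "\<forall>A\<in>I. A \<subseteq> U \<and> B A \<in> sets borel" "AE w in M. w \<in> E \<longleftrightarrow> (\<forall>A\<in>I. \<xi> A w \<in> B A)"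
      by (rule rect_eventsE[OF E])
    obtain J D where J: "F \<in> sets M" "finite J" "J \<subseteq> noise_sets" "\<forall>A\<in>J. A \<subseteq> V \<and> D A \<in> sets borel" "AE w in M. w \<in> F \<longleftrightarrow> (\<forall>A\<in>J. \<xi> A w \<in> D A)"
      by (rule rect_eventsE[OF F])
    have mI: "\<xi> A \<in> borel_measurable M" "B A \<in> sets borel" if "A \<in> I" for A using that I by auto
    have mJ: "\<xi> A \<in> borel_measurable M" "D A \<in> sets borel" if "A \<in> J" for A using that J by auto
    define PI PJ where "PI w = (\<Prod>A\<in>I. indicat_real (B A) (\<xi> A w))" and "PJ w = (\<Prod>A\<in>J. indicat_real (D A) (\<xi> A w))" for w
    have [measurable]: "PI \<in> borel_measurable M" "PJ \<in> borel_measurable M" unfolding PI_def[abs_def] PJ_def[abs_def]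
      by (intro borel_measurable_prod measurable_compose[OF mI(1)] measurable_compose[OF mJ(1)]; use mI mJ in simp)+
    have [measurable]: "E \<in> sets M" "F \<in> sets M" by fact+
    have PE: "AE w in M. PI w = indicator E w" and PF: "AE w in M. PJ w = indicator F w"
    proof -
      have e: "PI w = of_bool (\<forall>A\<in>I. \<xi> A w \<in> B A)" "PJ w = of_bool (\<forall>A\<in>J. \<xi> A w \<in> D A)" for w
        unfolding PI_def PJ_def by (rule prod_indicator_eq[OF I(2)] prod_indicator_eq[OF J(2)])+
      show "AE w in M. PI w = indicator E w" using I(5) by eventually_elim (auto simp: e indicator_def)
      show "AE w in M. PJ w = indicator F w" using J(5) by eventually_elim (auto simp: e indicator_def)
    qed
    have "prob (E \<inter> F) = expectation (indicator (E \<inter> F))" by simp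
    also have "... = expectation (\<lambda>w. PI w * PJ w)"
    proof (rule integral_cong_AE)
      show "AE w in M. indicator (E \<inter> F) w = PI w * PJ w"
        using PE PF by eventually_elim (simp add: indicator_def)
    qed measurable
    also have "... = expectation PI * expectation PJ" unfolding PI_def PJ_def
      by (rule noise_rect_indep[OF I(2,3) _ J(2,3) _ assms]) (use I J in auto)
    also have "expectation PI = expectation (indicator E)"
      using PE by (intro integral_cong_AE) auto
    also have "expectation PJ = expectation (indicator F)"
      using PF by (intro integral_cong_AE) auto
    finally show "prob (E \<inter> F) = prob E * prob F" by simp
  qed (auto simp: rect_events_def)
  then have "indep_set (sigma_sets (space M) (rect_events U)) (sigma_sets (space M) (rect_events V))"
    by (intro indep_set_sigma_sets Int_stable_rect_events)
  then have *: "prob (E \<inter> F) = prob E * prob F" if "E \<in> sigma_sets (space M) (rect_events U)" "F \<in> sigma_sets (space M) (rect_events V)" for E F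
    using that unfolding indep_sets2_eq by blast
  show ?thesis
    unfolding indep_sets2_eq
  proof (intro conjI ballI sets_noise_sigma_subset)
    fix E F assume "E \<in> sets (NS U)" "F \<in> sets (NS V)"
    then show "prob (E \<inter> F) = prob E * prob F"
      unfolding sets_noise_sigma by (intro *; elim subsetD[OF sigma_sets_mono'[OF noise_sigma_gen_rect]])
  qed
qed

text \<open>The defect of additivity is a centered Gaussian of variance 0. Covariances are summed
  over a set of regions, so the three regions have to be distinct, which can fail only if
  \<open>A\<close> or \<open>B\<close> is empty.\<close>

lemma noise_add:
  assumes "A \<in> noise_sets" "B \<in> noise_sets" "A \<inter> B = {}"
  shows "AE w in M. \<xi> (A \<union> B) w = \<xi> A w + \<xi> B w"
proof -
  have zero: "AE w in M. X w = 0" if g: "centered_gaussian M X 0" for X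
  proof -
    have [measurable]: "X \<in> borel_measurable M" using g by (simp add: centered_gaussian_def)
    have d: "distr M borel X = return borel 0" using g by (simp add: centered_gaussian_def)
    have "AE x in distr M borel X. x = 0" unfolding d by (subst AE_return) auto
    then show ?thesis by (simp add: AE_distr_iff)
  qed
  have e0: "AE w in M. \<xi> {} w = 0" using gaussian_noise[of "{}"] by (intro zero) (simp add: noise_sets_def)
  consider "A = {}" | "B = {}" | "A \<noteq> {}" "B \<noteq> {}" by blast
  then show ?thesis
  proof cases
    case 3
    have U: "A \<union> B \<in> noise_sets"
    proof -
      have "emeasure lborel (A \<union> B) = emeasure lborel A + emeasure lborel B"
        using assms by (intro plus_emeasure[symmetric]) (auto simp: noise_sets_def)
      also have "... < \<infinity>" using assms by (simp add: noise_sets_def)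
      finally show ?thesis using assms by (auto simp: noise_sets_def)
    qed
    have d: "A \<noteq> B" "A \<union> B \<noteq> A" "A \<union> B \<noteq> B" using 3 assms(3) by auto
    have meas: "measure lborel (A \<union> B) = measure lborel A + measure lborel B"
      using assms by (intro measure_Union) (auto simp: noise_sets_def)
    define c where "c = (\<lambda>C. if C = A \<union> B then 1 else (-1 :: real))"
    have "linvar {A, B, A \<union> B} c = 0" using d d[symmetric] assms(3)
      by (simp add: linvar_def c_def meas Int_absorb1 Int_absorb2 Int_commute[of B A])
    moreover have "lin {A, B, A \<union> B} c = (\<lambda>w. \<xi> (A \<union> B) w - \<xi> A w - \<xi> B w)" using d d[symmetric]
      by (auto simp: lin_def c_def fun_eq_iff)
    ultimately have "centered_gaussian M (\<lambda>w. \<xi> (A \<union> B) w - \<xi> A w - \<xi> B w) 0"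
      using gaussian_lin[of "{A, B, A \<union> B}" c] assms U by simp
    from zero[OF this] show ?thesis by eventually_elim simp
  qed (use e0 in \<open>auto elim: eventually_mono\<close>)
qed

end

section \<open>Gaussian increments\<close>

abbreviation "\<gamma>0 \<equiv> std_normal_distribution"

interpretation std_normal: real_distribution \<gamma>0 by (rule real_dist_normal_dist)

text \<open>The Cameron-Martin formula in dimension one. It is the single step from which the change
  of measure is built.\<close>

lemma nn_integral_std_normal_shift:
  assumes [measurable]: "g \<in> borel_measurable borel"
  shows "(\<integral>\<^sup>+z. g z * ennreal (exp (a * z - a\<^sup>2 / 2)) \<partial>\<gamma>0) = (\<integral>\<^sup>+z. g (z + a) \<partial>\<gamma>0)"
proof -
  have "(\<integral>\<^sup>+z. g z * ennreal (exp (a * z - a\<^sup>2 / 2)) \<partial>\<gamma>0)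
      = (\<integral>\<^sup>+z. ennreal (std_normal_density z) * (g z * ennreal (exp (a * z - a\<^sup>2 / 2))) \<partial>lborel)"
    by (subst nn_integral_density) auto
  also have "... = (\<integral>\<^sup>+z. ennreal (std_normal_density (z - a)) * g z \<partial>lborel)"
  proof (rule nn_integral_cong)
    fix z
    have "std_normal_density z * exp (a * z - a\<^sup>2 / 2) = std_normal_density (z - a)"
      unfolding std_normal_density_def by (simp add: exp_add[symmetric] field_simps power2_eq_square)
    then show "ennreal (std_normal_density z) * (g z * ennreal (exp (a * z - a\<^sup>2 / 2))) = ennreal (std_normal_density (z - a)) * g z"
      by (metis (no_types, lifting) ennreal_mult' exp_ge_zero mult.commute mult.left_commute)
  qed
  also have "... = (\<integral>\<^sup>+z. ennreal (std_normal_density z) * g (z + a) \<partial>lborel)"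
    by (subst nn_integral_real_affine[where c = 1 and t = a]) (auto simp: add.commute)
  also have "... = (\<integral>\<^sup>+z. g (z + a) \<partial>\<gamma>0)" by (subst nn_integral_density) auto
  finally show ?thesis .
qed

lemma nn_integral_std_normal_exp: "nnE \<gamma>0 (\<lambda>z. exp (a * z - a\<^sup>2 / 2)) = 1"
  using nn_integral_std_normal_shift[of "\<lambda>_. 1" a] std_normal.emeasure_space_1 by simp

lemma integral_std_normal_shift:
  fixes g :: "real \<Rightarrow> real"
  assumes [measurable]: "g \<in> borel_measurable borel"
  shows "(\<integral>z. g z * exp (a * z - a\<^sup>2 / 2) \<partial>\<gamma>0) = (\<integral>z. g (z + a) \<partial>\<gamma>0)"
proof -
  have "(\<integral>z. g z * exp (a * z - a\<^sup>2 / 2) \<partial>\<gamma>0)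
      = (\<integral>z. std_normal_density z * (g z * exp (a * z - a\<^sup>2 / 2)) \<partial>lborel)"
    by (subst integral_density) auto
  also have "... = (\<integral>z. std_normal_density (z - a) * g z \<partial>lborel)"
  proof (rule Bochner_Integration.integral_cong[OF refl])
    fix z
    have "std_normal_density z * exp (a * z - a\<^sup>2 / 2) = std_normal_density (z - a)"
      unfolding std_normal_density_def by (simp add: exp_add[symmetric] field_simps power2_eq_square)
    then show "std_normal_density z * (g z * exp (a * z - a\<^sup>2 / 2)) = std_normal_density (z - a) * g z"
      by (metis mult.commute mult.left_commute)
  qed
  also have "... = (\<integral>z. std_normal_density z * g (z + a) \<partial>lborel)"
    by (subst lborel_integral_real_affine[where c = 1 and t = a]) (auto simp: add.commute)
  also have "... = (\<integral>z. g (z + a) \<partial>\<gamma>0)" by (subst integral_density) auto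
  finally show ?thesis .
qed

lemma std_normal_first: "integrable \<gamma>0 (\<lambda>z. z)" "(\<integral>z. z \<partial>\<gamma>0) = 0"
  using integrable_std_normal_distribution_moment[of 1] integral_std_normal_distribution_moment_odd[of 1] by simp_all

lemma std_normal_second: "integrable \<gamma>0 (\<lambda>z. z\<^sup>2)" "(\<integral>z. z\<^sup>2 \<partial>\<gamma>0) = 1"
  using std_normal_distribution_even_moments[of 1] by simp_all

text \<open>The quotient of factorials is the Gaussian moment of order 2j. Passing from j to j + 1
  multiplies the left side by (q - j)(2q - 2j - 1)/(j + 1) and the right side by (q - j)(2q - 1)/(j
  + 1).\<close>

lemma moment_coeff_le:
  assumes "j \<le> q"
  shows "real (2 * q choose (2 * j)) * (fact (2 * j) / (2 ^ j * fact j)) \<le> real (q choose j) * (2 * real q - 1) ^ j"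
  using assms
proof (induction j)
  case (Suc j)
  then have j: "j < q" by simp
  have absorb: "real (n choose Suc k) * (real k + 1) = real (n choose k) * (real n - real k)" if "k \<le> n" for n k
  proof -
    have "Suc k * (n choose Suc k) = (n - k) * (n choose k)"
      using binomial_absorption[of k n] binomial_absorb_comp[of n k] by simp
    then have "real (Suc k) * real (n choose Suc k) = real (n - k) * real (n choose k)" by (metis of_nat_mult)
    then show ?thesis using that by (simp add: of_nat_diff mult.commute add.commute)
  qed
  have b1: "real (2 * q choose (2 * Suc j)) * ((2 * real j + 1) * (2 * real j + 2)) = real (2 * q choose (2 * j)) * ((2 * real q - 2 * real j) * (2 * real q - 2 * real j - 1))"
  proof -
    have "real (2 * q choose (2 * Suc j)) * ((2 * real j + 1) * (2 * real j + 2))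
        = (2 * real j + 1) * (real (2 * q choose Suc (2 * j + 1)) * (real (2 * j + 1) + 1))" by (simp add: mult_ac)
    also have "... = (real (2 * q choose Suc (2 * j)) * (real (2 * j) + 1)) * (2 * real q - 2 * real j - 1)"
      using j by (subst absorb) (auto simp: mult_ac)
    also have "... = real (2 * q choose (2 * j)) * (2 * real q - 2 * real j) * (2 * real q - 2 * real j - 1)"
      using j by (subst absorb) auto
    finally show ?thesis by (simp add: mult_ac)
  qed
  have b2: "real (q choose Suc j) * (real j + 1) = real (q choose j) * (real q - real j)"
    using j by (intro absorb) simp
  define L where "L = real (2 * q choose (2 * j)) * (fact (2 * j) / (2 ^ j * fact j))"
  have f: "(fact (2 * Suc j) :: real) = (2 * real j + 2) * (2 * real j + 1) * fact (2 * j)"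
    by (simp add: algebra_simps)
  have "real (2 * q choose (2 * Suc j)) * (fact (2 * Suc j) / (2 ^ Suc j * fact (Suc j))) * (real j + 1)
     = (real (2 * q choose (2 * Suc j)) * ((2 * real j + 1) * (2 * real j + 2))) * (fact (2 * j) / (2 ^ Suc j * fact j))"
  proof -
    have g: "B * (P / (t * (c * F))) * c = B * P / (t * F)" if "c \<noteq> 0" for B P t c F :: real using that by simp
    have fS: "(fact (Suc j) :: real) = (real j + 1) * fact j" by simp
    show ?thesis unfolding f fS by (subst g) (simp_all add: mult_ac)
  qed
  also have "... = L * ((real q - real j) * (2 * real q - 2 * real j - 1))"
    unfolding b1 L_def by (simp add: field_simps)
  also have "... \<le> (real (q choose j) * (2 * real q - 1) ^ j) * ((real q - real j) * (2 * real q - 1))"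
  proof (rule mult_mono)
    show "L \<le> real (q choose j) * (2 * real q - 1) ^ j" using Suc.IH j by (simp add: L_def)
  qed (use j in \<open>auto intro!: mult_left_mono mult_nonneg_nonneg\<close>)
  also have "... = (real (q choose Suc j) * (2 * real q - 1) ^ Suc j) * (real j + 1)"
  proof -
    have "(real (q choose j) * (2 * real q - 1) ^ j) * ((real q - real j) * (2 * real q - 1)) = (real (q choose j) * (real q - real j)) * (2 * real q - 1) ^ Suc j"
      by (simp only: power_Suc mult_ac)
    also have "... = (real (q choose Suc j) * (2 * real q - 1) ^ Suc j) * (real j + 1)" unfolding b2[symmetric] by (simp only: mult_ac)
    finally show ?thesis .
  qed
  finally show ?case by (rule mult_right_le_imp_le) simp
qed simp

text \<open>Both sides are binomial expansions, compared term by term; odd Gaussian moments vanish.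
  Read for squared L2q norms: an independent Gaussian increment adds at most 2q - 1 times its
  variance, a form that iterates over cells.\<close>

lemma gaussian_moment_le:
  "nnE \<gamma>0 (\<lambda>z. (a + b * z) ^ (2 * q)) \<le> ennreal ((a\<^sup>2 + (2 * real q - 1) * b\<^sup>2) ^ q)"
proof -
  have int: "integrable \<gamma>0 (\<lambda>z. real (2 * q choose i) * (b * z) ^ i * a ^ (2 * q - i))" for i
    using integrable_std_normal_distribution_moment[of i] by (simp add: power_mult_distrib)
  have eq: "(a + b * z) ^ (2 * q) = (\<Sum>i\<le>2 * q. real (2 * q choose i) * (b * z) ^ i * a ^ (2 * q - i))" for z
    using binomial_ring[of "b * z" a "2 * q"] by (simp add: add.commute)
  have "integrable \<gamma>0 (\<lambda>z. (a + b * z) ^ (2 * q))" unfolding eq by (intro Bochner_Integration.integrable_sum int)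
  then have "nnE \<gamma>0 (\<lambda>z. (a + b * z) ^ (2 * q)) = ennreal (\<integral>z. (a + b * z) ^ (2 * q) \<partial>\<gamma>0)"
    by (rule nn_integral_eq_integral) simp
  moreover have "(\<integral>z. (a + b * z) ^ (2 * q) \<partial>\<gamma>0) \<le> (a\<^sup>2 + (2 * real q - 1) * b\<^sup>2) ^ q"
  proof -
  have "(\<integral>z. (a + b * z) ^ (2 * q) \<partial>\<gamma>0) = (\<Sum>i\<le>2 * q. real (2 * q choose i) * b ^ i * a ^ (2 * q - i) * (\<integral>z. z ^ i \<partial>\<gamma>0))"
    unfolding eq by (subst Bochner_Integration.integral_sum[OF int]) (simp add: power_mult_distrib mult_ac)
  also have "... = (\<Sum>i\<in>(\<lambda>j. 2 * j) ` {..q}. real (2 * q choose i) * b ^ i * a ^ (2 * q - i) * (\<integral>z. z ^ i \<partial>\<gamma>0))"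
  proof (rule sum.mono_neutral_right)
    show "\<forall>i\<in>{..2 * q} - (\<lambda>j. 2 * j) ` {..q}. real (2 * q choose i) * b ^ i * a ^ (2 * q - i) * (\<integral>z. z ^ i \<partial>\<gamma>0) = 0"
    proof
      fix i assume "i \<in> {..2 * q} - (\<lambda>j. 2 * j) ` {..q}"
      then have "odd i" by (auto elim!: evenE)
      then show "real (2 * q choose i) * b ^ i * a ^ (2 * q - i) * (\<integral>z. z ^ i \<partial>\<gamma>0) = 0"
        by (simp add: integral_std_normal_distribution_moment_odd)
    qed
  qed auto
  also have "... = (\<Sum>j\<le>q. real (2 * q choose (2 * j)) * b ^ (2 * j) * a ^ (2 * q - 2 * j) * (fact (2 * j) / (2 ^ j * fact j)))"
    by (subst sum.reindex) (auto simp: inj_on_def std_normal_distribution_even_moments)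
  also have "... \<le> (\<Sum>j\<le>q. real (q choose j) * ((2 * real q - 1) * b\<^sup>2) ^ j * (a\<^sup>2) ^ (q - j))"
  proof (rule sum_mono)
    fix j assume "j \<in> {..q}"
    then have j: "j \<le> q" by simp
    have e: "b ^ (2 * j) * a ^ (2 * q - 2 * j) = (b\<^sup>2) ^ j * (a\<^sup>2) ^ (q - j)"
      by (simp add: power_mult[symmetric] diff_mult_distrib2)
    have "real (2 * q choose (2 * j)) * b ^ (2 * j) * a ^ (2 * q - 2 * j) * (fact (2 * j) / (2 ^ j * fact j))
       = (real (2 * q choose (2 * j)) * (fact (2 * j) / (2 ^ j * fact j))) * ((b\<^sup>2) ^ j * (a\<^sup>2) ^ (q - j))"
      unfolding e[symmetric] by (simp add: mult_ac)
    also have "... \<le> (real (q choose j) * (2 * real q - 1) ^ j) * ((b\<^sup>2) ^ j * (a\<^sup>2) ^ (q - j))"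
      by (intro mult_right_mono moment_coeff_le j) auto
    finally show "real (2 * q choose (2 * j)) * b ^ (2 * j) * a ^ (2 * q - 2 * j) * (fact (2 * j) / (2 ^ j * fact j)) \<le> real (q choose j) * ((2 * real q - 1) * b\<^sup>2) ^ j * (a\<^sup>2) ^ (q - j)"
      unfolding power_mult_distrib[of "2 * real q - 1" "b\<^sup>2" j] by (simp only: mult_ac)
  qed
  also have "... = (a\<^sup>2 + (2 * real q - 1) * b\<^sup>2) ^ q"
  proof -
    have "(\<Sum>j\<le>q. real (q choose j) * ((2 * real q - 1) * b\<^sup>2) ^ j * (a\<^sup>2) ^ (q - j)) = ((2 * real q - 1) * b\<^sup>2 + a\<^sup>2) ^ q"
      by (rule binomial_ring[symmetric])
    then show ?thesis by (simp only: add.commute)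
  qed
  finally show ?thesis .
  qed
  ultimately show ?thesis by (simp add: ennreal_leI)
qed

text \<open>Jensen's inequality for the weights a/(a + b) and b/(a + b), in the shape needed for
  Minkowski's inequality.\<close>

lemma power_sum_convex:
  fixes x y a b :: real
  assumes "0 \<le> x" "0 \<le> y" "0 < a" "0 < b"
  shows "(x + y) ^ q \<le> (a + b) ^ q * (a / (a + b) * (x / a) ^ q + b / (a + b) * (y / b) ^ q)"
proof -
  have c: "convex_on {0::real..} (\<lambda>x. x ^ q)"
  proof (cases "even q")
    case True
    then show ?thesis by (intro convex_on_subset[OF convex_power_even]) auto
  qed (rule convex_power_odd)
  have "(a / (a + b) * (x / a) + b / (a + b) * (y / b)) ^ q \<le> a / (a + b) * (x / a) ^ q + b / (a + b) * (y / b) ^ q"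
    using convex_onD[OF c, of "b / (a + b)" "x / a" "y / b"] assms
    by (simp add: field_simps)
  moreover have "x + y = (a + b) * (a / (a + b) * (x / a) + b / (a + b) * (y / b))"
  proof -
    have "a / (a + b) * (x / a) = x / (a + b)" "b / (a + b) * (y / b) = y / (a + b)" using assms by auto
    then show ?thesis using assms by (simp add: add_divide_distrib[symmetric])
  qed
  ultimately show ?thesis using assms by (simp add: power_mult_distrib mult_left_mono)
qed

text \<open>Minkowski's inequality in L^q without roots. The convexity weights are the norm bounds
  themselves and must be positive; bounds equal to 0 are reached as limits of
  \<open>a + 1 / Suc n\<close>.\<close>

lemma (in prob_space) moment_add_le:
  fixes X Y :: "'a \<Rightarrow> real"
  assumes [measurable]: "X \<in> borel_measurable M" "Y \<in> borel_measurable M"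
    and pos: "\<And>w. 0 \<le> X w" "\<And>w. 0 \<le> Y w" and ab: "0 \<le> a" "0 \<le> b"
    and X: "nnE M (\<lambda>w. X w ^ q) \<le> ennreal (a ^ q)"
    and Y: "nnE M (\<lambda>w. Y w ^ q) \<le> ennreal (b ^ q)"
  shows "nnE M (\<lambda>w. (X w + Y w) ^ q) \<le> ennreal ((a + b) ^ q)"
proof -
  have main: "nnE M (\<lambda>w. (X w + Y w) ^ q) \<le> ennreal ((a + b) ^ q)"
    if ab: "0 < a" "0 < b" and X: "nnE M (\<lambda>w. X w ^ q) \<le> ennreal (a ^ q)"
    and Y: "nnE M (\<lambda>w. Y w ^ q) \<le> ennreal (b ^ q)" for a b
  proof -
    define ca cb where "ca = (a + b) ^ q * (a / (a + b)) / a ^ q" and "cb = (a + b) ^ q * (b / (a + b)) / b ^ q"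
    have c: "0 \<le> ca" "0 \<le> cb" using ab by (auto simp: ca_def cb_def)
    have "nnE M (\<lambda>w. (X w + Y w) ^ q) \<le> (\<integral>\<^sup>+w. ennreal ca * ennreal (X w ^ q) + ennreal cb * ennreal (Y w ^ q) \<partial>M)"
    proof (rule nn_integral_mono)
      fix w
      have "(X w + Y w) ^ q \<le> ca * X w ^ q + cb * Y w ^ q"
        using power_sum_convex[OF pos(1)[of w] pos(2)[of w] ab, of q] by (simp add: ca_def cb_def power_divide algebra_simps)
      then show "ennreal ((X w + Y w) ^ q) \<le> ennreal ca * ennreal (X w ^ q) + ennreal cb * ennreal (Y w ^ q)"
        using c pos by (simp add: ennreal_mult[symmetric] ennreal_plus[symmetric] ennreal_leI del: ennreal_plus)
    qed
    also have "... = ennreal ca * nnE M (\<lambda>w. X w ^ q) + ennreal cb * nnE M (\<lambda>w. Y w ^ q)"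
      by (simp add: nn_integral_add nn_integral_cmult)
    also have "... \<le> ennreal ca * ennreal (a ^ q) + ennreal cb * ennreal (b ^ q)"
      by (intro add_mono mult_left_mono X Y) auto
    also have "... = ennreal (ca * a ^ q + cb * b ^ q)"
      using c ab by (simp add: ennreal_mult[symmetric] ennreal_plus[symmetric] del: ennreal_plus)
    also have "ca * a ^ q + cb * b ^ q = (a + b) ^ q"
      using ab by (simp add: ca_def cb_def distrib_left[symmetric] add_divide_distrib[symmetric])
    finally show ?thesis .
  qed
  have "nnE M (\<lambda>w. (X w + Y w) ^ q) \<le> ennreal ((a + 1 / Suc n + (b + 1 / Suc n)) ^ q)" for n
    using ab by (intro main order_trans[OF X] order_trans[OF Y] ennreal_leI power_mono) (auto intro: add_nonneg_pos)
  moreover have "(\<lambda>n. ennreal ((a + 1 / Suc n + (b + 1 / Suc n)) ^ q)) \<longlonglongrightarrow> ennreal ((a + 0 + (b + 0)) ^ q)"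
    by (intro tendsto_ennrealI tendsto_intros LIMSEQ_Suc[OF lim_1_over_n])
  ultimately show ?thesis by (intro LIMSEQ_le_const[where a = "nnE M (\<lambda>w. (X w + Y w) ^ q)"]) auto
qed

section \<open>Integrating out the noise of one region\<close>

context noise
begin

text \<open>The first component is the sample point itself, seen through the sigma-algebra of
  \<open>U\<close>. This allows any functional of the noise on \<open>U\<close> to be frozen, not
  only functions of finitely many variables.\<close>

lemma noise_indep_distr:
  assumes "C \<in> noise_sets" "C \<inter> U = {}"
  shows "distr M (NS U \<Otimes>\<^sub>M borel) (\<lambda>w. (w, \<xi> C w)) = distr M (NS U) (\<lambda>w. w) \<Otimes>\<^sub>M distr \<gamma>0 borel (\<lambda>z. sqrt (measure lborel C) * z)"
proof -
  have id: "(\<lambda>w. w) \<in> measurable M (NS U)"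
    using sets_noise_sigma_subset[of U] sets.sets_into_space[of _ M] by (auto simp: measurable_def Int_absorb2)
  have "indep_set (sets (NS U)) (sets (NS C))" by (rule noise_indep) (use assms in auto)
  then have ind: "prob (A \<inter> B) = prob A * prob B" if "A \<in> sets (NS U)" "B \<in> sets (NS C)" for A B
    using that unfolding indep_sets2_eq by blast
  have [measurable]: "\<xi> C \<in> borel_measurable M" using assms by simp
  note [measurable] = id
  interpret N: prob_space "distr M (NS U) (\<lambda>w. w)" by (rule prob_space_distr) simp
  interpret g: prob_space "distr \<gamma>0 borel (\<lambda>z. sqrt (measure lborel C) * z)" by (rule std_normal.prob_space_distr) simp
  show ?thesis
  proof (rule pair_measure_eqI[symmetric])
    fix A B assume A: "A \<in> sets (distr M (NS U) (\<lambda>w. w))" and B: "B \<in> sets (distr \<gamma>0 borel (\<lambda>z. sqrt (measure lborel C) * z))"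
    have A': "A \<in> sets (NS U)" "A \<in> sets M" "A \<subseteq> space M" using A sets_noise_sigma_subset[of U] sets.sets_into_space[of A M] by auto
    have B': "B \<in> sets borel" using B by simp
    have "\<xi> C -` B \<inter> space M \<in> sets (NS C)" using measurable_sets[OF noise_measurable_sigma[OF assms(1) order_refl] B'] by simp
    from ind[OF A'(1) this] have i: "prob (A \<inter> (\<xi> C -` B \<inter> space M)) = prob A * prob (\<xi> C -` B \<inter> space M)" .
    have "emeasure (distr M (NS U \<Otimes>\<^sub>M borel) (\<lambda>w. (w, \<xi> C w))) (A \<times> B) = emeasure M (A \<inter> (\<xi> C -` B \<inter> space M))"
      using A' B' by (subst emeasure_distr) (auto intro!: arg_cong[where f = "emeasure M"])
    also have "... = emeasure M A * emeasure M (\<xi> C -` B \<inter> space M)"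
      by (simp add: emeasure_eq_measure i ennreal_mult)
    also have "emeasure M A = emeasure (distr M (NS U) (\<lambda>w. w)) A" using A' by (subst emeasure_distr) (auto simp: Int_absorb2)
    also have "emeasure M (\<xi> C -` B \<inter> space M) = emeasure (distr M borel (\<xi> C)) B" using B' by (subst emeasure_distr) auto
    also have "distr M borel (\<xi> C) = distr \<gamma>0 borel (\<lambda>z. sqrt (measure lborel C) * z)"
      by (rule centered_gaussian_distr(2)[OF gaussian_noise[OF assms(1)] measure_nonneg prob_space_axioms])
    finally show "emeasure (distr M (NS U) (\<lambda>w. w)) A * emeasure (distr \<gamma>0 borel (\<lambda>z. sqrt (measure lborel C) * z)) B
      = emeasure (distr M (NS U \<Otimes>\<^sub>M borel) (\<lambda>w. (w, \<xi> C w))) (A \<times> B)" by simp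
  next
    show "sets (distr M (NS U) (\<lambda>w. w) \<Otimes>\<^sub>M distr \<gamma>0 borel (\<lambda>z. sqrt (measure lborel C) * z)) = sets (distr M (NS U \<Otimes>\<^sub>M borel) (\<lambda>w. (w, \<xi> C w)))"
      unfolding sets_distr by (rule sets_pair_measure_cong) simp_all
  qed (rule N.sigma_finite_measure_axioms g.sigma_finite_measure_axioms)+
qed

lemma indep_nn_integral:
  assumes C: "C \<in> noise_sets" "C \<inter> U = {}" and f[measurable]: "(\<lambda>(w, z). f w z) \<in> borel_measurable (NS U \<Otimes>\<^sub>M borel)"
  shows "(\<integral>\<^sup>+w. f w (\<xi> C w) \<partial>M) = (\<integral>\<^sup>+w. (\<integral>\<^sup>+z. f w (sqrt (measure lborel C) * z) \<partial>\<gamma>0) \<partial>M)"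
proof -
  have id[measurable]: "(\<lambda>w. w) \<in> measurable M (NS U)"
    using sets_noise_sigma_subset[of U] sets.sets_into_space[of _ M] by (auto simp: measurable_def Int_absorb2)
  have [measurable]: "\<xi> C \<in> borel_measurable M" using C by simp
  define g where "g = distr \<gamma>0 borel (\<lambda>z. sqrt (measure lborel C) * z)"
  interpret g: prob_space g unfolding g_def by (rule std_normal.prob_space_distr) simp
  have [simp]: "sets g = sets borel" by (simp add: g_def)
  have "(\<integral>\<^sup>+w. f w (\<xi> C w) \<partial>M) = (\<integral>\<^sup>+p. (\<lambda>(w, z). f w z) p \<partial>distr M (NS U \<Otimes>\<^sub>M borel) (\<lambda>w. (w, \<xi> C w)))"
    by (subst nn_integral_distr) auto
  also have "... = (\<integral>\<^sup>+p. (\<lambda>(w, z). f w z) p \<partial>(distr M (NS U) (\<lambda>w. w) \<Otimes>\<^sub>M g))"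
    unfolding g_def by (subst noise_indep_distr[OF C]) rule
  also have "... = (\<integral>\<^sup>+w. (\<integral>\<^sup>+z. f w z \<partial>g) \<partial>distr M (NS U) (\<lambda>w. w))"
    by (subst g.nn_integral_fst[symmetric]) (auto simp: measurable_cong_sets[OF sets_pair_measure_cong[OF sets_distr \<open>sets g = sets borel\<close>] refl])
  also have "... = (\<integral>\<^sup>+w. (\<integral>\<^sup>+z. f w z \<partial>g) \<partial>M)"
    by (subst nn_integral_distr) (auto intro!: g.borel_measurable_nn_integral simp: measurable_cong_sets[OF sets_pair_measure_cong[OF refl \<open>sets g = sets borel\<close>] refl])
  also have "... = (\<integral>\<^sup>+w. (\<integral>\<^sup>+z. f w (sqrt (measure lborel C) * z) \<partial>\<gamma>0) \<partial>M)"
  proof (rule nn_integral_cong)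
    fix w assume "w \<in> space M"
    then have [measurable]: "f w \<in> borel_measurable borel" using measurable_Pair2[OF f, of w] by simp
    show "(\<integral>\<^sup>+z. f w z \<partial>g) = (\<integral>\<^sup>+z. f w (sqrt (measure lborel C) * z) \<partial>\<gamma>0)"
      unfolding g_def by (subst nn_integral_distr) auto
  qed
  finally show ?thesis .
qed

lemma indep_integral:
  fixes f :: "'a \<Rightarrow> real \<Rightarrow> real"
  assumes C: "C \<in> noise_sets" "C \<inter> U = {}" and f[measurable]: "(\<lambda>(w, z). f w z) \<in> borel_measurable (NS U \<Otimes>\<^sub>M borel)"
    and fin: "(\<integral>\<^sup>+w. (\<integral>\<^sup>+z. ennreal \<bar>f w (sqrt (measure lborel C) * z)\<bar> \<partial>\<gamma>0) \<partial>M) < \<infinity>"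
  shows "integrable M (\<lambda>w. f w (\<xi> C w))" "(\<integral>w. f w (\<xi> C w) \<partial>M) = (\<integral>w. (\<integral>z. f w (sqrt (measure lborel C) * z) \<partial>\<gamma>0) \<partial>M)"
proof -
  have id[measurable]: "(\<lambda>w. w) \<in> measurable M (NS U)"
    using sets_noise_sigma_subset[of U] sets.sets_into_space[of _ M] by (auto simp: measurable_def Int_absorb2)
  have [measurable]: "\<xi> C \<in> borel_measurable M" using C by simp
  define g where "g = distr \<gamma>0 borel (\<lambda>z. sqrt (measure lborel C) * z)"
  define N where "N = distr M (NS U) (\<lambda>w. w)"
  interpret g: prob_space g unfolding g_def by (rule std_normal.prob_space_distr) simp
  interpret N: prob_space N unfolding N_def by (rule prob_space_distr) simp
  interpret P: pair_sigma_finite N g ..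
  have [simp]: "sets g = sets borel" "sets N = sets (NS U)" by (simp_all add: g_def N_def)
  note mc = measurable_cong_sets[OF sets_pair_measure_cong[OF \<open>sets N = sets (NS U)\<close> \<open>sets g = sets borel\<close>] refl]
  have meas: "(\<lambda>w. f w (\<xi> C w)) \<in> borel_measurable M"
    using measurable_compose[of "\<lambda>w. (w, \<xi> C w)" M _ "(\<lambda>(w, z). f w z)", OF _ f] by simp
  have "nnE M (\<lambda>w. norm (f w (\<xi> C w))) = (\<integral>\<^sup>+w. (\<integral>\<^sup>+z. ennreal \<bar>f w (sqrt (measure lborel C) * z)\<bar> \<partial>\<gamma>0) \<partial>M)"
    unfolding real_norm_def by (rule indep_nn_integral[OF C, where f = "\<lambda>w z. ennreal \<bar>f w z\<bar>"]) simp
  then show int: "integrable M (\<lambda>w. f w (\<xi> C w))" using fin meas by (simp add: integrable_iff_bounded)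
  have dd: "distr M (NS U \<Otimes>\<^sub>M borel) (\<lambda>w. (w, \<xi> C w)) = N \<Otimes>\<^sub>M g" unfolding N_def g_def by (rule noise_indep_distr[OF C])
  have "integrable (distr M (NS U \<Otimes>\<^sub>M borel) (\<lambda>w. (w, \<xi> C w))) (\<lambda>(w, z). f w z)"
    by (subst integrable_distr_eq) (use int in auto)
  then have ip: "integrable (N \<Otimes>\<^sub>M g) (\<lambda>(w, z). f w z)" unfolding dd .
  have "(\<integral>w. f w (\<xi> C w) \<partial>M) = (\<integral>p. (\<lambda>(w, z). f w z) p \<partial>distr M (NS U \<Otimes>\<^sub>M borel) (\<lambda>w. (w, \<xi> C w)))"
    by (subst integral_distr) auto
  also have "... = (\<integral>w. (\<integral>z. f w z \<partial>g) \<partial>N)"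
    unfolding dd using P.integral_fst'[OF ip] by simp
  also have "... = (\<integral>w. (\<integral>z. f w z \<partial>g) \<partial>M)"
    unfolding N_def by (subst integral_distr) (auto intro!: g.borel_measurable_lebesgue_integral simp: measurable_cong_sets[OF sets_pair_measure_cong[OF refl \<open>sets g = sets borel\<close>] refl])
  also have "... = (\<integral>w. (\<integral>z. f w (sqrt (measure lborel C) * z) \<partial>\<gamma>0) \<partial>M)"
  proof (rule Bochner_Integration.integral_cong[OF refl])
    fix w assume "w \<in> space M"
    then have [measurable]: "f w \<in> borel_measurable borel" using measurable_Pair2[OF f, of w] by simp
    show "(\<integral>z. f w z \<partial>g) = (\<integral>z. f w (sqrt (measure lborel C) * z) \<partial>\<gamma>0)"
      unfolding g_def by (subst integral_distr) auto
  qed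
  finally show "(\<integral>w. f w (\<xi> C w) \<partial>M) = ..." .
qed

end

section \<open>Discrete stochastic integrals and their change of measure\<close>

locale noise_cells = noise +
  fixes cell region :: "nat \<Rightarrow> (real \<times> real) set"
  assumes cell_noise: "\<And>k. cell k \<in> noise_sets"
    and region_mono: "\<And>k. region k \<subseteq> region (Suc k)"
    and cell_region: "\<And>k. cell k \<subseteq> region (Suc k)"
    and cell_disj: "\<And>k. cell k \<inter> region k = {}"
begin

abbreviation "vol k \<equiv> measure lborel (cell k)"

text \<open>The stochastic integral of a process constant on each cell. \<open>region k\<close>
  contains all earlier cells and misses \<open>cell k\<close>, so coefficients measurable over
  \<open>region k\<close> are independent of the next noise variable.\<close>

definition msum :: "(nat \<Rightarrow> 'a \<Rightarrow> real) \<Rightarrow> nat \<Rightarrow> 'a \<Rightarrow> real" where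
  "msum X n w = (\<Sum>k<n. X k w * \<xi> (cell k) w)"

lemma msum_measurable:
  assumes "\<And>k. k < n \<Longrightarrow> X k \<in> borel_measurable (NS (region k))"
  shows "msum X n \<in> borel_measurable (NS (region n))"
  using assms
proof (induction n)
  case 0
  then show ?case by (simp add: msum_def[abs_def])
next
  case (Suc n)
  have "msum X n \<in> borel_measurable (NS (region (Suc n)))"
    using Suc by (intro noise_sigma_measurable_mono[OF _ region_mono]) auto
  moreover have "X n \<in> borel_measurable (NS (region (Suc n)))"
    using Suc by (intro noise_sigma_measurable_mono[OF _ region_mono]) auto
  moreover have "\<xi> (cell n) \<in> borel_measurable (NS (region (Suc n)))"
    by (rule noise_measurable_sigma[OF cell_noise cell_region])
  ultimately have "(\<lambda>w. msum X n w + X n w * \<xi> (cell n) w) \<in> borel_measurable (NS (region (Suc n)))" by measurable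
  then show ?case by (simp add: msum_def[abs_def])
qed

text \<open>A discrete Burkholder inequality with constant 2q - 1: freeze the past, apply
  \<open>gaussian_moment_le\<close> to the new cell, and add the two squared norms by
  \<open>moment_add_le\<close>.\<close>

lemma msum_moment_le:
  assumes X: "\<And>k. k < n \<Longrightarrow> X k \<in> borel_measurable (NS (region k))"
    and b: "\<And>k. 0 \<le> b k" and q: "1 \<le> q"
    and mom: "\<And>k. k < n \<Longrightarrow> nnE M (\<lambda>w. X k w ^ (2 * q)) \<le> ennreal (b k ^ q)"
  shows "nnE M (\<lambda>w. msum X n w ^ (2 * q)) \<le> ennreal (((2 * real q - 1) * (\<Sum>k<n. vol k * b k)) ^ q)"
  using X mom
proof (induction n)
  case 0
  then show ?case using q by (cases q) (auto simp: msum_def)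
next
  case (Suc n)
  have m[measurable]: "msum X n \<in> borel_measurable (NS (region n))" "X n \<in> borel_measurable (NS (region n))"
    using Suc.prems by (auto intro: msum_measurable)
  note [measurable] = m[THEN noise_sigma_measurable_M]
  have "nnE M (\<lambda>w. msum X (Suc n) w ^ (2 * q)) = nnE M (\<lambda>w. (msum X n w + X n w * \<xi> (cell n) w) ^ (2 * q))"
    by (simp add: msum_def)
  also have "... = (\<integral>\<^sup>+w. (nnE \<gamma>0 (\<lambda>z. (msum X n w + X n w * (sqrt (vol n) * z)) ^ (2 * q))) \<partial>M)"
    by (rule indep_nn_integral[OF cell_noise cell_disj, where f = "\<lambda>w z. ennreal ((msum X n w + X n w * z) ^ (2 * q))"]) measurable
  also have "... \<le> nnE M (\<lambda>w. ((msum X n w)\<^sup>2 + (2 * real q - 1) * vol n * (X n w)\<^sup>2) ^ q)"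
  proof (rule nn_integral_mono)
    fix w
    show "nnE \<gamma>0 (\<lambda>z. (msum X n w + X n w * (sqrt (vol n) * z)) ^ (2 * q)) \<le> ennreal (((msum X n w)\<^sup>2 + (2 * real q - 1) * vol n * (X n w)\<^sup>2) ^ q)"
      using gaussian_moment_le[of "msum X n w" "X n w * sqrt (vol n)" q] by (simp add: mult_ac power_mult_distrib)
  qed
  also have "... \<le> ennreal (((2 * real q - 1) * (\<Sum>k<n. vol k * b k) + (2 * real q - 1) * vol n * b n) ^ q)"
  proof (rule moment_add_le)
    show "nnE M (\<lambda>w. ((msum X n w)\<^sup>2) ^ q) \<le> ennreal (((2 * real q - 1) * (\<Sum>k<n. vol k * b k)) ^ q)"
      using Suc by (simp add: power_mult)
    have c: "0 \<le> (2 * real q - 1) * vol n" using q by simp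
    have "nnE M (\<lambda>w. ((2 * real q - 1) * vol n * (X n w)\<^sup>2) ^ q) = (\<integral>\<^sup>+w. ennreal (((2 * real q - 1) * vol n) ^ q) * ennreal (X n w ^ (2 * q)) \<partial>M)"
      by (intro nn_integral_cong, subst ennreal_mult'[OF zero_le_power[OF c], symmetric]) (simp only: power_mult_distrib power_mult)
    also have "... = ennreal (((2 * real q - 1) * vol n) ^ q) * nnE M (\<lambda>w. X n w ^ (2 * q))" by (rule nn_integral_cmult) simp
    also have "... \<le> ennreal (((2 * real q - 1) * vol n) ^ q) * ennreal (b n ^ q)"
      using Suc.prems(2)[of n] by (intro mult_left_mono) auto
    also have "... = ennreal (((2 * real q - 1) * vol n * b n) ^ q)"
      by (subst ennreal_mult'[OF zero_le_power[OF c], symmetric]) (simp only: power_mult_distrib)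
    finally show "nnE M (\<lambda>w. ((2 * real q - 1) * vol n * (X n w)\<^sup>2) ^ q) \<le> ennreal (((2 * real q - 1) * vol n * b n) ^ q)" .
  qed (use q b in \<open>auto intro!: mult_nonneg_nonneg sum_nonneg\<close>)
  also have "(2 * real q - 1) * (\<Sum>k<n. vol k * b k) + (2 * real q - 1) * vol n * b n = (2 * real q - 1) * (\<Sum>k<Suc n. vol k * b k)"
    by (simp add: algebra_simps)
  finally show ?case .
qed

text \<open>The discrete Girsanov density: under it the noise of \<open>cell k\<close> has
  conditional mean \<open>h k w * vol k\<close> given the past.\<close>

definition tilt :: "(nat \<Rightarrow> 'a \<Rightarrow> real) \<Rightarrow> nat \<Rightarrow> 'a \<Rightarrow> real" where
  "tilt h n w = (\<Prod>k<n. exp (h k w * \<xi> (cell k) w - (h k w)\<^sup>2 * vol k / 2))"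

lemma tilt_pos: "0 < tilt h n w" by (auto simp: tilt_def intro: prod_pos)

lemma tilt_measurable:
  assumes "\<And>k. k < n \<Longrightarrow> h k \<in> borel_measurable (NS (region k))"
  shows "tilt h n \<in> borel_measurable (NS (region n))"
  using assms
proof (induction n)
  case 0
  then show ?case by (simp add: tilt_def[abs_def])
next
  case (Suc n)
  have "tilt h n \<in> borel_measurable (NS (region (Suc n)))"
    using Suc by (intro noise_sigma_measurable_mono[OF _ region_mono]) auto
  moreover have "h n \<in> borel_measurable (NS (region (Suc n)))"
    using Suc by (intro noise_sigma_measurable_mono[OF _ region_mono]) auto
  moreover have "\<xi> (cell n) \<in> borel_measurable (NS (region (Suc n)))"
    by (rule noise_measurable_sigma[OF cell_noise cell_region])
  ultimately have "(\<lambda>w. tilt h n w * exp (h n w * \<xi> (cell n) w - (h n w)\<^sup>2 * vol n / 2)) \<in> borel_measurable (NS (region (Suc n)))" by measurable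
  then show ?case by (simp add: tilt_def[abs_def])
qed

text \<open>With the past frozen this is the Gaussian shift: the factor \<open>e\<close> has mean 1
  and moves the mean of the new noise variable to \<open>vol n * h w\<close>. The bound
  \<open>H\<close> serves integrability.\<close>

lemma tilt_step:
  fixes Y h :: "'a \<Rightarrow> real"
  assumes [measurable]: "Y \<in> borel_measurable (NS (region n))" "h \<in> borel_measurable (NS (region n))"
    and Y: "integrable M Y" and h: "\<And>w. \<bar>h w\<bar> \<le> H"
  defines "e \<equiv> \<lambda>w. exp (h w * \<xi> (cell n) w - (h w)\<^sup>2 * vol n / 2)"
  shows "integrable M (\<lambda>w. Y w * e w)" "expectation (\<lambda>w. Y w * e w) = expectation Y"
    "integrable M (\<lambda>w. Y w * \<xi> (cell n) w * e w)" "expectation (\<lambda>w. Y w * \<xi> (cell n) w * e w) = expectation (\<lambda>w. vol n * Y w * h w)"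
proof -
  define v where "v = sqrt (vol n)"
  have v: "0 \<le> v" "vol n = v\<^sup>2" by (auto simp: v_def)
  have ee: "exp (h w * (v * z) - (h w)\<^sup>2 * vol n / 2) = exp ((h w * v) * z - (h w * v)\<^sup>2 / 2)" for w z
    by (simp add: v power_mult_distrib mult_ac)
  have [measurable]: "Y \<in> borel_measurable M" using Y by auto
  have Yf: "(\<integral>\<^sup>+w. ennreal \<bar>Y w\<bar> \<partial>M) < \<infinity>" using Y by (simp add: integrable_iff_bounded)
  have i1: "(\<integral>\<^sup>+z. ennreal \<bar>Y w * exp (h w * (v * z) - (h w)\<^sup>2 * vol n / 2)\<bar> \<partial>\<gamma>0) = ennreal \<bar>Y w\<bar>" for w
    unfolding ee by (simp add: abs_mult ennreal_mult' nn_integral_cmult nn_integral_std_normal_exp)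
  have c: "(\<integral>\<^sup>+w. (\<integral>\<^sup>+z. ennreal \<bar>Y w * exp (h w * (v * z) - (h w)\<^sup>2 * vol n / 2)\<bar> \<partial>\<gamma>0) \<partial>M) < \<infinity>"
    unfolding i1 by (rule Yf)
  note I1 = indep_integral[OF cell_noise[of n] cell_disj[of n], where f = "\<lambda>w z. Y w * exp (h w * z - (h w)\<^sup>2 * vol n / 2)", folded v_def, OF _ c]
  show "integrable M (\<lambda>w. Y w * e w)" unfolding e_def by (rule I1(1)) measurable
  have "expectation (\<lambda>w. Y w * e w) = (\<integral>w. (\<integral>z. Y w * exp (h w * (v * z) - (h w)\<^sup>2 * vol n / 2) \<partial>\<gamma>0) \<partial>M)"
    unfolding e_def by (rule I1(2)) measurable
  also have "... = expectation Y"
    unfolding ee using integral_std_normal_shift[of "\<lambda>_. 1"] std_normal.prob_space by (simp)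
  finally show "expectation (\<lambda>w. Y w * e w) = expectation Y" .
  have az: "(\<integral>\<^sup>+z. ennreal \<bar>z\<bar> \<partial>\<gamma>0) < \<infinity>" using std_normal_first(1) by (simp add: integrable_iff_bounded)
  define K where "K = (\<integral>\<^sup>+z. ennreal \<bar>z\<bar> \<partial>\<gamma>0) + ennreal (H * v)"
  have H0: "0 \<le> H" using h[of undefined] by linarith
  have i2: "(\<integral>\<^sup>+z. ennreal \<bar>Y w * (v * z) * exp (h w * (v * z) - (h w)\<^sup>2 * vol n / 2)\<bar> \<partial>\<gamma>0) \<le> ennreal \<bar>Y w\<bar> * (ennreal v * K)" for w
  proof -
    have "(\<integral>\<^sup>+z. ennreal \<bar>Y w * (v * z) * exp (h w * (v * z) - (h w)\<^sup>2 * vol n / 2)\<bar> \<partial>\<gamma>0)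
      = (\<integral>\<^sup>+z. ennreal (\<bar>Y w\<bar> * v * \<bar>z\<bar>) * ennreal (exp ((h w * v) * z - (h w * v)\<^sup>2 / 2)) \<partial>\<gamma>0)"
      unfolding ee using v by (intro nn_integral_cong) (simp add: abs_mult ennreal_mult' mult_ac)
    also have "... = nnE \<gamma>0 (\<lambda>z. \<bar>Y w\<bar> * v * \<bar>z + h w * v\<bar>)"
      by (rule nn_integral_std_normal_shift) measurable
    also have "... \<le> (\<integral>\<^sup>+z. ennreal (\<bar>Y w\<bar> * v) * (ennreal \<bar>z\<bar> + ennreal (H * v)) \<partial>\<gamma>0)"
    proof (rule nn_integral_mono)
      fix z
      have "\<bar>z + h w * v\<bar> \<le> \<bar>z\<bar> + H * v" using mult_right_mono[OF h[of w] v(1)] v(1) abs_triangle_ineq[of z "h w * v"] by (simp add: abs_mult)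
      then have "\<bar>Y w\<bar> * v * \<bar>z + h w * v\<bar> \<le> (\<bar>Y w\<bar> * v) * (\<bar>z\<bar> + H * v)" using v by (intro mult_left_mono) auto
      then show "ennreal (\<bar>Y w\<bar> * v * \<bar>z + h w * v\<bar>) \<le> ennreal (\<bar>Y w\<bar> * v) * (ennreal \<bar>z\<bar> + ennreal (H * v))"
        using v H0 by (simp add: ennreal_mult[symmetric] ennreal_plus[symmetric] ennreal_leI del: ennreal_plus)
    qed
    also have "... = ennreal \<bar>Y w\<bar> * (ennreal v * K)"
      using v std_normal.emeasure_space_1 by (simp add: nn_integral_cmult nn_integral_add K_def ennreal_mult mult_ac)
    finally show ?thesis .
  qed
  have "(\<integral>\<^sup>+w. (\<integral>\<^sup>+z. ennreal \<bar>Y w * (v * z) * exp (h w * (v * z) - (h w)\<^sup>2 * vol n / 2)\<bar> \<partial>\<gamma>0) \<partial>M) \<le> (\<integral>\<^sup>+w. ennreal \<bar>Y w\<bar> * (ennreal v * K) \<partial>M)"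
    by (intro nn_integral_mono i2)
  also have "... = (\<integral>\<^sup>+w. ennreal \<bar>Y w\<bar> \<partial>M) * (ennreal v * K)" by (rule nn_integral_multc) simp
  also have "... < \<infinity>" using Yf az by (simp add: K_def ennreal_mult_less_top)
  finally have c: "(\<integral>\<^sup>+w. (\<integral>\<^sup>+z. ennreal \<bar>Y w * (v * z) * exp (h w * (v * z) - (h w)\<^sup>2 * vol n / 2)\<bar> \<partial>\<gamma>0) \<partial>M) < \<infinity>" .
  note I2 = indep_integral[OF cell_noise[of n] cell_disj[of n], where f = "\<lambda>w z. Y w * z * exp (h w * z - (h w)\<^sup>2 * vol n / 2)", folded v_def, OF _ c]
  show "integrable M (\<lambda>w. Y w * \<xi> (cell n) w * e w)" unfolding e_def by (rule I2(1)) measurable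
  have "expectation (\<lambda>w. Y w * \<xi> (cell n) w * e w) = (\<integral>w. (\<integral>z. Y w * (v * z) * exp (h w * (v * z) - (h w)\<^sup>2 * vol n / 2) \<partial>\<gamma>0) \<partial>M)"
    unfolding e_def by (rule I2(2)) measurable
  also have "... = (\<integral>w. (\<integral>z. Y w * (v * (z + h w * v)) \<partial>\<gamma>0) \<partial>M)"
    unfolding ee by (subst integral_std_normal_shift) auto
  also have "... = (\<integral>w. vol n * Y w * h w \<partial>M)"
    using std_normal_first std_normal.prob_space by (simp add: v(2) power2_eq_square mult_ac)
  finally show "expectation (\<lambda>w. Y w * \<xi> (cell n) w * e w) = expectation (\<lambda>w. vol n * Y w * h w)" .
qed

lemma tilt_integrable:
  assumes h: "\<And>k. k < n \<Longrightarrow> h k \<in> borel_measurable (NS (region k))" and H: "\<And>k w. \<bar>h k w\<bar> \<le> H k"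
  shows "integrable M (tilt h n)" "expectation (tilt h n) = 1"
  using h
proof (induction n)
  case 0
  { case 1 then show ?case by (simp add: tilt_def[abs_def]) }
  { case 2 then show ?case by (simp add: tilt_def[abs_def] prob_space) }
next
  case (Suc n)
  have eq: "tilt h (Suc n) = (\<lambda>w. tilt h n w * exp (h n w * \<xi> (cell n) w - (h n w)\<^sup>2 * vol n / 2))" by (simp add: tilt_def[abs_def])
  { case 1 show ?case unfolding eq by (rule tilt_step(1)[OF tilt_measurable]) (use 1 Suc.IH(1) H in auto) }
  { case 2 show ?case unfolding eq by (subst tilt_step(2)[OF tilt_measurable]) (use 2 Suc.IH H in auto) }
qed

text \<open>The fourth power of one factor has conditional mean exp(6 h^2 vol): the Gaussian
  exponential contributes 8 and the normalisation -2. As \<open>h\<close> is random, its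
  deterministic bound \<open>H\<close> is put in before the next cell is treated.\<close>

lemma tilt_fourth_moment:
  assumes h: "\<And>k. k < n \<Longrightarrow> h k \<in> borel_measurable (NS (region k))" and H: "\<And>k w. \<bar>h k w\<bar> \<le> H k"
  shows "nnE M (\<lambda>w. tilt h n w ^ 4) \<le> ennreal (exp (6 * (\<Sum>k<n. (H k)\<^sup>2 * vol k)))"
  using h
proof (induction n)
  case 0
  then show ?case by (simp add: tilt_def[abs_def] emeasure_space_1)
next
  case (Suc n)
  have m[measurable]: "tilt h n \<in> borel_measurable (NS (region n))" "h n \<in> borel_measurable (NS (region n))"
    using Suc.prems by (auto intro: tilt_measurable)
  note [measurable] = m[THEN noise_sigma_measurable_M]
  define v where "v = sqrt (vol n)"
  have v: "0 \<le> v" "vol n = v\<^sup>2" by (auto simp: v_def)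
  have "nnE M (\<lambda>w. tilt h (Suc n) w ^ 4) = nnE M (\<lambda>w. tilt h n w ^ 4 * exp (h n w * \<xi> (cell n) w - (h n w)\<^sup>2 * vol n / 2) ^ 4)"
    by (simp add: tilt_def power_mult_distrib)
  also have "... = (\<integral>\<^sup>+w. (nnE \<gamma>0 (\<lambda>z. tilt h n w ^ 4 * exp (h n w * (v * z) - (h n w)\<^sup>2 * vol n / 2) ^ 4)) \<partial>M)"
    unfolding v_def by (rule indep_nn_integral[OF cell_noise cell_disj, where f = "\<lambda>w z. ennreal (tilt h n w ^ 4 * exp (h n w * z - (h n w)\<^sup>2 * vol n / 2) ^ 4)"]) measurable
  also have "... \<le> (\<integral>\<^sup>+w. ennreal (exp (6 * (H n)\<^sup>2 * vol n)) * ennreal (tilt h n w ^ 4) \<partial>M)"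
  proof (rule nn_integral_mono)
    fix w
    have e4: "exp (h n w * (v * z) - (h n w)\<^sup>2 * vol n / 2) ^ 4 = exp (6 * (h n w)\<^sup>2 * vol n) * exp ((4 * h n w * v) * z - (4 * h n w * v)\<^sup>2 / 2)" for z
      by (simp add: v(2) power_mult_distrib exp_of_nat_mult[symmetric] exp_add[symmetric] algebra_simps)
    have "nnE \<gamma>0 (\<lambda>z. tilt h n w ^ 4 * exp (h n w * (v * z) - (h n w)\<^sup>2 * vol n / 2) ^ 4) = ennreal (tilt h n w ^ 4) * ennreal (exp (6 * (h n w)\<^sup>2 * vol n))"
      unfolding e4 by (simp add: ennreal_mult' nn_integral_cmult nn_integral_std_normal_exp)
    also have "... \<le> ennreal (tilt h n w ^ 4) * ennreal (exp (6 * (H n)\<^sup>2 * vol n))"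
      using power_mono[OF H[of n w], of 2] by (intro mult_left_mono ennreal_leI) (auto intro!: mult_right_mono)
    finally show "nnE \<gamma>0 (\<lambda>z. tilt h n w ^ 4 * exp (h n w * (v * z) - (h n w)\<^sup>2 * vol n / 2) ^ 4) \<le> ennreal (exp (6 * (H n)\<^sup>2 * vol n)) * ennreal (tilt h n w ^ 4)"
      by (simp add: mult.commute)
  qed
  also have "... = ennreal (exp (6 * (H n)\<^sup>2 * vol n)) * nnE M (\<lambda>w. tilt h n w ^ 4)" by (rule nn_integral_cmult) simp
  also have "... \<le> ennreal (exp (6 * (H n)\<^sup>2 * vol n)) * ennreal (exp (6 * (\<Sum>k<n. (H k)\<^sup>2 * vol k)))"
    using Suc by (intro mult_left_mono) auto
  also have "... = ennreal (exp (6 * (\<Sum>k<Suc n. (H k)\<^sup>2 * vol k)))"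
    by (simp add: ennreal_mult'[symmetric] exp_add[symmetric] algebra_simps)
  finally show ?case .
qed

text \<open>Girsanov's theorem for means: under the tilted measure the martingale
  \<open>msum X n\<close> has the mean of its drift. The last factor of the density either
  integrates to 1 or shifts the last noise variable.\<close>

lemma tilt_msum:
  assumes h: "\<And>k. k < n \<Longrightarrow> h k \<in> borel_measurable (NS (region k))" and H: "\<And>k w. \<bar>h k w\<bar> \<le> H k"
    and X: "\<And>k. k < n \<Longrightarrow> X k \<in> borel_measurable (NS (region k))" and C: "\<And>k w. \<bar>X k w\<bar> \<le> C k"
  shows "integrable M (\<lambda>w. msum X n w * tilt h n w) \<and>
     integrable M (\<lambda>w. (\<Sum>k<n. vol k * X k w * h k w) * tilt h n w) \<and>
     expectation (\<lambda>w. msum X n w * tilt h n w) = expectation (\<lambda>w. (\<Sum>k<n. vol k * X k w * h k w) * tilt h n w)"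
  using h X
proof (induction n)
  case 0
  then show ?case by (simp add: msum_def)
next
  case (Suc n)
  define T where "T n w = (\<Sum>k<n. vol k * X k w * h k w)" for n w
  define e where "e w = exp (h n w * \<xi> (cell n) w - (h n w)\<^sup>2 * vol n / 2)" for w
  have mono: "f \<in> borel_measurable (NS (region n))" if "f \<in> borel_measurable (NS (region k))" "k \<le> n" for f k
    using that by (intro noise_sigma_measurable_mono[OF that(1)] lift_Suc_mono_le[of region, OF region_mono])
  have [measurable]: "tilt h n \<in> borel_measurable (NS (region n))" "h n \<in> borel_measurable (NS (region n))" "msum X n \<in> borel_measurable (NS (region n))"
     "X n \<in> borel_measurable (NS (region n))"
    using Suc.prems by (auto intro: tilt_measurable msum_measurable)
  have [measurable]: "X k \<in> borel_measurable (NS (region n))" "h k \<in> borel_measurable (NS (region n))" if "k < n" for k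
    using Suc.prems that by (auto intro!: mono[of _ k])
  have [measurable]: "T n \<in> borel_measurable (NS (region n))" unfolding T_def[abs_def]
    by (intro borel_measurable_sum borel_measurable_times) auto
  have ti: "integrable M (tilt h n)" using tilt_integrable(1)[of n h H] Suc.prems H by auto
  have bdd: "integrable M (\<lambda>w. f w * tilt h n w)" if "f \<in> borel_measurable M" "\<And>w. \<bar>f w\<bar> \<le> c" for f c
  proof (rule Bochner_Integration.integrable_bound[OF integrable_mult_right[OF ti, of c]])
    show "(\<lambda>w. f w * tilt h n w) \<in> borel_measurable M" using that borel_measurable_integrable[OF ti] by measurable
    have "\<bar>f w\<bar> \<le> \<bar>c\<bar>" for w using that(2)[of w] by linarith
    then show "AE w in M. norm (f w * tilt h n w) \<le> norm (c * tilt h n w)" by (auto simp: abs_mult intro!: AE_I2 mult_right_mono)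
  qed
  have [measurable]: "X n \<in> borel_measurable M" "h n \<in> borel_measurable M" using Suc.prems by (auto intro: noise_sigma_measurable_M)
  have XZ: "integrable M (\<lambda>w. X n w * tilt h n w)" by (rule bdd[of _ "C n"]) (auto simp: C)
  have XhZ: "integrable M (\<lambda>w. (vol n * X n w * h n w) * tilt h n w)"

  proof (rule bdd[of _ "vol n * C n * H n"])
    have "0 \<le> C n" using C[of n undefined] by linarith
    then show "\<bar>vol n * X n w * h n w\<bar> \<le> vol n * C n * H n" for w
      by (auto simp: abs_mult intro!: mult_mono C H)
  qed measurable
  have IH: "integrable M (\<lambda>w. msum X n w * tilt h n w)" "integrable M (\<lambda>w. T n w * tilt h n w)"
    "expectation (\<lambda>w. msum X n w * tilt h n w) = expectation (\<lambda>w. T n w * tilt h n w)"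
    using Suc unfolding T_def by auto
  note s1 = tilt_step[OF _ _ IH(1), of n "h n" "H n", folded e_def]
  note s2 = tilt_step[OF _ _ IH(2), of n "h n" "H n", folded e_def]
  note s3 = tilt_step[OF _ _ XZ, of n "h n" "H n", folded e_def]
  note s4 = tilt_step[OF _ _ XhZ, of n "h n" "H n", folded e_def]
  have tS: "tilt h (Suc n) w = tilt h n w * e w" for w by (simp add: tilt_def e_def)
  have e1: "msum X (Suc n) w * tilt h (Suc n) w = (msum X n w * tilt h n w) * e w + (X n w * tilt h n w) * \<xi> (cell n) w * e w" for w
    unfolding tS by (simp add: msum_def algebra_simps)
  have e2: "T (Suc n) w * tilt h (Suc n) w = (T n w * tilt h n w) * e w + ((vol n * X n w * h n w) * tilt h n w) * e w" for w
    unfolding tS by (simp add: T_def algebra_simps)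
  have a: "integrable M (\<lambda>w. msum X (Suc n) w * tilt h (Suc n) w)"
    unfolding e1 by (intro Bochner_Integration.integrable_add s1(1) s3(3)) (auto simp: H)
  have b: "integrable M (\<lambda>w. T (Suc n) w * tilt h (Suc n) w)"
    unfolding e2 by (intro Bochner_Integration.integrable_add s2(1) s4(1)) (auto simp: H)
  have "expectation (\<lambda>w. msum X (Suc n) w * tilt h (Suc n) w) = expectation (\<lambda>w. msum X n w * tilt h n w) + expectation (\<lambda>w. vol n * (X n w * tilt h n w) * h n w)"
    unfolding e1 by (subst Bochner_Integration.integral_add) (auto simp: s1 s3 H)
  also have "... = expectation (\<lambda>w. T n w * tilt h n w) + expectation (\<lambda>w. (vol n * X n w * h n w) * tilt h n w)"
    by (simp add: IH mult_ac)
  also have "... = expectation (\<lambda>w. T (Suc n) w * tilt h (Suc n) w)"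
    unfolding e2 by (subst Bochner_Integration.integral_add) (auto simp: s2 s4 H)
  finally show ?case using a b unfolding T_def by blast
qed

end

section \<open>The Walsh isometry\<close>

lemma strip_noise_sets:
  assumes "0 \<le> a" "A \<in> sets borel" "emeasure lborel A < \<infinity>"
  shows "{a<..b} \<times> A \<in> noise_sets"
proof -
  have "emeasure lborel ({a<..b} \<times> A) = emeasure lborel {a<..b} * emeasure lborel A"
    unfolding lborel_prod[symmetric] by (rule lborel.emeasure_pair_measure_Times) (use assms in auto)
  also have "... < \<infinity>" using assms by (cases "a \<le> b") (simp_all add: ennreal_mult_less_top)
  finally show ?thesis using assms by (auto simp: noise_sets_def borel_prod[symmetric])
qed

context noise
begin

lemma noise_second_moment:
  assumes "A \<in> noise_sets"
  shows "integrable M (\<xi> A)" "expectation (\<xi> A) = 0" "integrable M (\<lambda>w. (\<xi> A w)\<^sup>2)" "expectation (\<lambda>w. (\<xi> A w)\<^sup>2) = measure lborel A"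
proof -
  define v where "v = measure lborel A"
  have v: "0 \<le> v" by (simp add: v_def)
  note d = centered_gaussian_distr[OF gaussian_noise[OF assms] measure_nonneg prob_space_axioms, folded v_def]
  note [measurable] = d(1)
  have int: "integrable M (\<lambda>w. f (\<xi> A w)) \<longleftrightarrow> integrable \<gamma>0 (\<lambda>z. f (sqrt v * z))" if [measurable]: "f \<in> borel_measurable borel" for f :: "real \<Rightarrow> real"
    using integrable_distr_eq[of "\<xi> A" M borel f] integrable_distr_eq[of "\<lambda>z. sqrt v * z" \<gamma>0 borel f] d(2) by simp
  have ex: "(\<integral>w. f (\<xi> A w) \<partial>M) = (\<integral>z. f (sqrt v * z) \<partial>\<gamma>0)" if [measurable]: "f \<in> borel_measurable borel" for f :: "real \<Rightarrow> real"
  proof -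
    have "(\<integral>w. f (\<xi> A w) \<partial>M) = (\<integral>x. f x \<partial>distr M borel (\<xi> A))" by (rule integral_distr[symmetric]) auto
    also have "... = (\<integral>z. f (sqrt v * z) \<partial>\<gamma>0)" unfolding d(2) by (rule integral_distr) auto
    finally show ?thesis .
  qed
  have id: "(\<lambda>x::real. x) \<in> borel_measurable borel" and pw: "power2 \<in> borel_measurable (borel :: real measure)" by measurable
  have "integrable \<gamma>0 (\<lambda>z. sqrt v * z)" by (intro integrable_mult_right std_normal_first(1))
  then show "integrable M (\<xi> A)" using int[OF id] by iprover
  have "(\<integral>z. sqrt v * z \<partial>\<gamma>0) = 0" unfolding integral_mult_right_zero std_normal_first(2) by simp
  then show "expectation (\<xi> A) = 0" using ex[OF id] by metis
  have "integrable \<gamma>0 (\<lambda>z. v * z\<^sup>2)" by (intro integrable_mult_right std_normal_second(1))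
  then show "integrable M (\<lambda>w. (\<xi> A w)\<^sup>2)" unfolding int[OF pw] power_mult_distrib real_sqrt_pow2[OF v] .
  show "expectation (\<lambda>w. (\<xi> A w)\<^sup>2) = measure lborel A"
    unfolding ex[OF pw] power_mult_distrib real_sqrt_pow2[OF v] integral_mult_right_zero std_normal_second(2) by (simp add: v_def)
qed

lemma noise_cov:
  assumes A: "A \<in> noise_sets" and B: "B \<in> noise_sets"
  shows "integrable M (\<lambda>w. \<xi> A w * \<xi> B w)" "expectation (\<lambda>w. \<xi> A w * \<xi> B w) = measure lborel (A \<inter> B)"
proof -
  note [measurable] = noise_measurable[OF A] noise_measurable[OF B]
  show int: "integrable M (\<lambda>w. \<xi> A w * \<xi> B w)"
  proof (rule Bochner_Integration.integrable_bound[OF Bochner_Integration.integrable_add[OF noise_second_moment(3)[OF A] noise_second_moment(3)[OF B]]])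
    have "\<bar>x * y\<bar> \<le> x\<^sup>2 + y\<^sup>2" for x y :: real
    proof -
      have "2 * (\<bar>x\<bar> * \<bar>y\<bar>) \<le> x\<^sup>2 + y\<^sup>2" using zero_le_power2[of "\<bar>x\<bar> - \<bar>y\<bar>"] by (simp add: power2_diff)
      moreover have "0 \<le> \<bar>x\<bar> * \<bar>y\<bar>" by simp
      ultimately show ?thesis unfolding abs_mult by linarith
    qed
    then show "AE w in M. norm (\<xi> A w * \<xi> B w) \<le> norm ((\<xi> A w)\<^sup>2 + (\<xi> B w)\<^sup>2)" by (auto intro!: AE_I2)
  qed measurable
  show "expectation (\<lambda>w. \<xi> A w * \<xi> B w) = measure lborel (A \<inter> B)"
  proof (cases "A = B")
    case True
    then show ?thesis using noise_second_moment(4)[OF A] by (simp add: power2_eq_square)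
  next
    case False
    have l: "lin {A, B} (\<lambda>_. 1) = (\<lambda>w. \<xi> A w + \<xi> B w)" using False by (simp add: lin_def[abs_def])
    have lv: "linvar {A, B} (\<lambda>_. 1) = measure lborel A + measure lborel B + 2 * measure lborel (A \<inter> B)"
      using False by (simp add: linvar_def Int_commute)
    have AB: "finite {A, B}" "{A, B} \<subseteq> noise_sets" using A B by auto
    define v where "v = linvar {A, B} (\<lambda>_. 1)"
    have v: "0 \<le> v" using linvar_nonneg[OF AB] by (simp add: v_def)
    note d = centered_gaussian_distr[OF gaussian_lin[OF AB] linvar_nonneg[OF AB] prob_space_axioms, of "\<lambda>_. 1", folded v_def, unfolded l]
    have "expectation (\<lambda>w. (\<xi> A w + \<xi> B w)\<^sup>2) = (\<integral>z. (sqrt v * z)\<^sup>2 \<partial>\<gamma>0)"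
    proof -
      have "expectation (\<lambda>w. (\<xi> A w + \<xi> B w)\<^sup>2) = (\<integral>x. x\<^sup>2 \<partial>distr M borel (\<lambda>w. \<xi> A w + \<xi> B w))"
        by (rule integral_distr[symmetric]) auto
      also have "... = (\<integral>z. (sqrt v * z)\<^sup>2 \<partial>\<gamma>0)" unfolding d(2) by (rule integral_distr) auto
      finally show ?thesis .
    qed
    also have "... = v" using v std_normal_second(2) by (simp add: power_mult_distrib)
    finally have "expectation (\<lambda>w. (\<xi> A w)\<^sup>2 + (\<xi> B w)\<^sup>2 + 2 * (\<xi> A w * \<xi> B w)) = v" by (simp add: power2_sum mult.assoc)
    then show ?thesis using noise_second_moment[OF A] noise_second_moment[OF B] int by (simp add: v_def lv)
  qed
qed

lemma indep_mult:
  fixes X Y :: "'a \<Rightarrow> real"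
  assumes X: "X \<in> borel_measurable (NS U)" and Y: "Y \<in> borel_measurable (NS V)" and UV: "U \<inter> V = {}"
    and int: "integrable M X" "integrable M Y"
  shows "integrable M (\<lambda>w. X w * Y w)" "expectation (\<lambda>w. X w * Y w) = expectation X * expectation Y"
proof -
  have s: "sigma_sets (space M) {Z -` B \<inter> space M | B. B \<in> sets borel} \<subseteq> sets (NS W)" if "Z \<in> borel_measurable (NS W)" for Z :: "'a \<Rightarrow> real" and W
  proof -
    have "{Z -` B \<inter> space M | B. B \<in> sets borel} \<subseteq> sets (NS W)" using measurable_sets[OF that] by auto
    from sets.sigma_sets_subset[OF this] show ?thesis by simp
  qed
  have "indep_var borel X borel Y"
    unfolding indep_var_eq indep_sets2_eq
    using noise_indep[OF UV, unfolded indep_sets2_eq] s[OF X] s[OF Y] noise_sigma_measurable_M[OF X] noise_sigma_measurable_M[OF Y]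
    by (meson subset_iff)
  from indep_var_lebesgue_integral[OF this int] indep_var_integrable[OF this int]
  show "integrable M (\<lambda>w. X w * Y w)" "expectation (\<lambda>w. X w * Y w) = expectation X * expectation Y" by auto
qed

lemma integrable_bounded_mult:
  fixes X Y :: "'a \<Rightarrow> real"
  assumes "X \<in> borel_measurable M" "\<And>w. w \<in> space M \<Longrightarrow> \<bar>X w\<bar> \<le> C" "integrable M Y"
  shows "integrable M (\<lambda>w. X w * Y w)"
proof (rule Bochner_Integration.integrable_bound[OF integrable_mult_right[OF assms(3), of C]])
  show "(\<lambda>w. X w * Y w) \<in> borel_measurable M" using assms borel_measurable_integrable[OF assms(3)] by measurable
  have "\<bar>X w\<bar> \<le> \<bar>C\<bar>" if "w \<in> space M" for w using assms(2)[OF that] by linarith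
  then show "AE w in M. norm (X w * Y w) \<le> norm (C * Y w)" by (auto simp: abs_mult intro!: AE_I2 mult_right_mono)
qed

text \<open>The strip that starts earlier is cut at the later starting time \<open>a'\<close>. Its
  first part lies in the past of \<open>a'\<close>, so its product with the independent, centered
  \<open>\<xi> R'\<close> has mean 0; its second part and \<open>R'\<close> are independent of both
  coefficients.\<close>

lemma iso_pair_ordered:
  fixes X Y :: "'a \<Rightarrow> real" and a a' b b' :: real
  assumes a: "0 \<le> a" "a \<le> a'" and A: "A \<in> sets borel" "emeasure lborel A < \<infinity>" and A': "A' \<in> sets borel" "emeasure lborel A' < \<infinity>"
    and X: "X \<in> borel_measurable (NS ({0<..a} \<times> UNIV))" "\<And>w. w \<in> space M \<Longrightarrow> \<bar>X w\<bar> \<le> C"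
    and Y: "Y \<in> borel_measurable (NS ({0<..a'} \<times> UNIV))" "\<And>w. w \<in> space M \<Longrightarrow> \<bar>Y w\<bar> \<le> C'"
  defines "R \<equiv> {a<..b} \<times> A" and "R' \<equiv> {a'<..b'} \<times> A'"
  shows "integrable M (\<lambda>w. X w * Y w * (\<xi> R w * \<xi> R' w))"
    "expectation (\<lambda>w. X w * Y w * (\<xi> R w * \<xi> R' w)) = expectation (\<lambda>w. X w * Y w) * measure lborel (R \<inter> R')"
proof -
  let ?P = "{0<..a'} \<times> (UNIV :: real set)" and ?F = "{a'<..} \<times> (UNIV :: real set)"
  define R1 R2 where "R1 = {a<..min b a'} \<times> A" and "R2 = {max a a'<..b} \<times> A"
  have ns: "R \<in> noise_sets" "R' \<in> noise_sets" "R1 \<in> noise_sets" "R2 \<in> noise_sets"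
    unfolding R_def R'_def R1_def R2_def using a A A' by (auto intro!: strip_noise_sets)
  have R12: "R = R1 \<union> R2" "R1 \<inter> R2 = {}" "R \<inter> R' = R2 \<inter> R'" using a by (auto simp: R_def R'_def R1_def R2_def)
  have add: "AE w in M. \<xi> R w = \<xi> R1 w + \<xi> R2 w" unfolding R12(1) by (rule noise_add[OF ns(3,4) R12(2)])
  have XP: "X \<in> borel_measurable (NS ?P)" by (rule noise_sigma_measurable_mono[OF X(1)]) (use a in auto)
  note [measurable] = X(1)[THEN noise_sigma_measurable_M] Y(1)[THEN noise_sigma_measurable_M] ns[THEN noise_measurable]
  have XYP: "(\<lambda>w. X w * Y w) \<in> borel_measurable (NS ?P)" using XP Y(1) by measurable
  have XYb: "\<bar>X w * Y w\<bar> \<le> C * C'" if "w \<in> space M" for w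
    unfolding abs_mult by (intro mult_mono X(2) Y(2) that) (use X(2)[OF that] in auto)
  have XYi: "integrable M (\<lambda>w. X w * Y w)" by (rule integrable_const_bound[of _ "C * C'"]) (use XYb in \<open>auto intro!: AE_I2\<close>)
  show "integrable M (\<lambda>w. X w * Y w * (\<xi> R w * \<xi> R' w))"
    by (rule integrable_bounded_mult[OF _ XYb]) (auto intro: noise_cov ns)
  have r1: "\<xi> R1 \<in> borel_measurable (NS ?P)" using a by (intro noise_measurable_sigma ns) (auto simp: R1_def)
  have r2: "\<xi> R2 \<in> borel_measurable (NS ?F)" using a by (intro noise_measurable_sigma ns) (auto simp: R2_def)
  have r': "\<xi> R' \<in> borel_measurable (NS ?F)" using a by (intro noise_measurable_sigma ns) (auto simp: R'_def)
  have PF: "?P \<inter> ?F = {}" by auto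
  have i1: "integrable M (\<lambda>w. X w * Y w * \<xi> R1 w)" by (rule integrable_bounded_mult[OF _ XYb]) (auto intro: noise_second_moment ns)
  have i1P: "(\<lambda>w. X w * Y w * \<xi> R1 w) \<in> borel_measurable (NS ?P)" using XYP r1 by measurable
  note m1 = indep_mult[OF i1P r' PF i1 noise_second_moment(1)[OF ns(2)]]
  have r2r': "(\<lambda>w. \<xi> R2 w * \<xi> R' w) \<in> borel_measurable (NS ?F)" using r2 r' by measurable
  note m2 = indep_mult[OF XYP r2r' PF XYi noise_cov(1)[OF ns(4,2)]]
  have "expectation (\<lambda>w. X w * Y w * (\<xi> R w * \<xi> R' w)) = expectation (\<lambda>w. X w * Y w * \<xi> R1 w * \<xi> R' w + X w * Y w * (\<xi> R2 w * \<xi> R' w))"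
    using add by (intro integral_cong_AE) (auto elim!: eventually_mono simp: algebra_simps)
  also have "... = expectation (\<lambda>w. X w * Y w) * measure lborel (R \<inter> R')"
    using m1 m2 by (simp add: noise_second_moment ns noise_cov R12(3))
  finally show "expectation (\<lambda>w. X w * Y w * (\<xi> R w * \<xi> R' w)) = expectation (\<lambda>w. X w * Y w) * measure lborel (R \<inter> R')" .
qed

lemma iso_pair:
  fixes X Y :: "'a \<Rightarrow> real" and a a' b b' :: real
  assumes a: "0 \<le> a" "0 \<le> a'" and A: "A \<in> sets borel" "emeasure lborel A < \<infinity>" and A': "A' \<in> sets borel" "emeasure lborel A' < \<infinity>"
    and X: "X \<in> borel_measurable (NS ({0<..a} \<times> UNIV))" "\<And>w. w \<in> space M \<Longrightarrow> \<bar>X w\<bar> \<le> C"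
    and Y: "Y \<in> borel_measurable (NS ({0<..a'} \<times> UNIV))" "\<And>w. w \<in> space M \<Longrightarrow> \<bar>Y w\<bar> \<le> C'"
  defines "R \<equiv> {a<..b} \<times> A" and "R' \<equiv> {a'<..b'} \<times> A'"
  shows "integrable M (\<lambda>w. X w * Y w * (\<xi> R w * \<xi> R' w))"
    "expectation (\<lambda>w. X w * Y w * (\<xi> R w * \<xi> R' w)) = expectation (\<lambda>w. X w * Y w) * measure lborel (R \<inter> R')"
  using iso_pair_ordered[of a a' A A' X C Y C' b b'] iso_pair_ordered[of a' a A' A Y C' X C b' b] linear[of a a'] assms
  by (auto simp: mult_ac Int_commute)

text \<open>The rectangles may overlap, so all cross terms are computed. This makes the isometry
  applicable to the difference of two simple processes built on unrelated rectangles.\<close>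

theorem walsh_isometry:
  fixes X :: "'i \<Rightarrow> 'a \<Rightarrow> real" and C a b :: "'i \<Rightarrow> real"
  assumes fin: "finite I" and a: "\<And>i. i \<in> I \<Longrightarrow> 0 \<le> a i" and A: "\<And>i. i \<in> I \<Longrightarrow> A i \<in> sets borel" "\<And>i. i \<in> I \<Longrightarrow> emeasure lborel (A i) < \<infinity>"
    and X: "\<And>i. i \<in> I \<Longrightarrow> X i \<in> borel_measurable (NS ({0<..a i} \<times> UNIV))" "\<And>i w. i \<in> I \<Longrightarrow> w \<in> space M \<Longrightarrow> \<bar>X i w\<bar> \<le> C i"
  defines "R \<equiv> \<lambda>i. {a i<..b i} \<times> A i"
  shows "nnE M (\<lambda>w. (\<Sum>i\<in>I. X i w * \<xi> (R i) w)\<^sup>2) = (\<integral>\<^sup>+w. (nnE lborel (\<lambda>z. (\<Sum>i\<in>I. X i w * indicator (R i) z)\<^sup>2)) \<partial>M)"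
    "nnE M (\<lambda>w. (\<Sum>i\<in>I. X i w * \<xi> (R i) w)\<^sup>2) < \<infinity>"
proof -
  have ns: "R i \<in> noise_sets" if "i \<in> I" for i unfolding R_def using that a A by (intro strip_noise_sets) auto
  have Rs: "R i \<in> sets borel" "emeasure lborel (R i) < \<infinity>" if "i \<in> I" for i using ns[OF that] by (auto simp: noise_sets_def)
  have XM[measurable]: "X i \<in> borel_measurable M" if "i \<in> I" for i using X(1)[OF that] by (rule noise_sigma_measurable_M)
  have P: "integrable M (\<lambda>w. X i w * X j w * (\<xi> (R i) w * \<xi> (R j) w))"
    "expectation (\<lambda>w. X i w * X j w * (\<xi> (R i) w * \<xi> (R j) w)) = expectation (\<lambda>w. X i w * X j w) * measure lborel (R i \<inter> R j)"
    if "i \<in> I" "j \<in> I" for i j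
    unfolding R_def by (rule iso_pair[OF a[OF that(1)] a[OF that(2)] A(1)[OF that(1)] A(2)[OF that(1)] A(1)[OF that(2)] A(2)[OF that(2)]
       X(1)[OF that(1)] X(2)[OF that(1)] X(1)[OF that(2)] X(2)[OF that(2)]]; assumption)+
  have sq: "(\<Sum>i\<in>I. X i w * \<xi> (R i) w)\<^sup>2 = (\<Sum>i\<in>I. \<Sum>j\<in>I. X i w * X j w * (\<xi> (R i) w * \<xi> (R j) w))" for w
    by (simp add: power2_eq_square sum_product mult_ac)
  have i1: "integrable M (\<lambda>w. (\<Sum>i\<in>I. X i w * \<xi> (R i) w)\<^sup>2)"
    unfolding sq by (intro Bochner_Integration.integrable_sum P(1)) auto
  define V where "V w = (\<Sum>i\<in>I. \<Sum>j\<in>I. X i w * X j w * measure lborel (R i \<inter> R j))" for w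
  have XXi: "integrable M (\<lambda>w. X i w * X j w)" if "i \<in> I" "j \<in> I" for i j
    by (rule integrable_bounded_mult[of _ "C i"], (use that X in auto)[2], rule integrable_const_bound[of _ "C j"])
       (use that X in \<open>auto intro!: AE_I2\<close>)
  have iV: "integrable M V" unfolding V_def[abs_def] by (intro Bochner_Integration.integrable_sum integrable_mult_left XXi)
  have "expectation (\<lambda>w. (\<Sum>i\<in>I. X i w * \<xi> (R i) w)\<^sup>2) = (\<Sum>i\<in>I. \<Sum>j\<in>I. expectation (\<lambda>w. X i w * X j w) * measure lborel (R i \<inter> R j))"
    unfolding sq by (subst Bochner_Integration.integral_sum, intro Bochner_Integration.integrable_sum P(1), assumption+,
       intro sum.cong refl, subst Bochner_Integration.integral_sum, intro P(1), assumption+, intro sum.cong refl P(2), assumption+)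
  also have "... = expectation V" unfolding V_def
    by (subst Bochner_Integration.integral_sum, intro Bochner_Integration.integrable_sum integrable_mult_left XXi, assumption+,
       intro sum.cong refl, subst Bochner_Integration.integral_sum, intro integrable_mult_left XXi, assumption+, simp)
  finally have EV: "expectation (\<lambda>w. (\<Sum>i\<in>I. X i w * \<xi> (R i) w)\<^sup>2) = expectation V" .
  have Vz: "nnE lborel (\<lambda>z. (\<Sum>i\<in>I. X i w * indicator (R i) z)\<^sup>2) = ennreal (V w) \<and> 0 \<le> V w" for w
  proof -
    have sqz: "(\<Sum>i\<in>I. X i w * indicator (R i) z)\<^sup>2 = (\<Sum>i\<in>I. \<Sum>j\<in>I. X i w * X j w * indicator (R i \<inter> R j) z)" for z
      by (simp add: power2_eq_square sum_product mult_ac indicator_inter_arith)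
    have ii: "integrable lborel (\<lambda>z. X i w * X j w * indicat_real (R i \<inter> R j) z)" if "i \<in> I" "j \<in> I" for i j
      using Rs[OF that(1)] Rs[OF that(2)] le_less_trans[OF emeasure_mono[of "R i \<inter> R j" "R i" lborel]]
      by (intro integrable_mult_right integrable_real_indicator) auto
    have int: "integrable lborel (\<lambda>z. (\<Sum>i\<in>I. X i w * indicator (R i) z)\<^sup>2)"
      unfolding sqz by (intro Bochner_Integration.integrable_sum ii)
    have "(\<integral>z. (\<Sum>i\<in>I. X i w * indicator (R i) z)\<^sup>2 \<partial>lborel) = V w"
      unfolding sqz V_def
      by (subst Bochner_Integration.integral_sum, intro Bochner_Integration.integrable_sum ii, assumption+,
       intro sum.cong refl, subst Bochner_Integration.integral_sum, intro ii, assumption+, use Rs in auto)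
    with int show ?thesis by (auto simp: nn_integral_eq_integral simp flip: \<open>_ = V w\<close>)
  qed
  have "nnE M (\<lambda>w. (\<Sum>i\<in>I. X i w * \<xi> (R i) w)\<^sup>2) = ennreal (expectation V)"
    using i1 EV by (simp add: nn_integral_eq_integral)
  moreover have "(\<integral>\<^sup>+w. (nnE lborel (\<lambda>z. (\<Sum>i\<in>I. X i w * indicator (R i) z)\<^sup>2)) \<partial>M) = ennreal (expectation V)"
    using Vz iV by (simp add: nn_integral_eq_integral)
  ultimately show "nnE M (\<lambda>w. (\<Sum>i\<in>I. X i w * \<xi> (R i) w)\<^sup>2) = (\<integral>\<^sup>+w. (nnE lborel (\<lambda>z. (\<Sum>i\<in>I. X i w * indicator (R i) z)\<^sup>2)) \<partial>M)"
    "nnE M (\<lambda>w. (\<Sum>i\<in>I. X i w * \<xi> (R i) w)\<^sup>2) < \<infinity>" by simp_all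
qed

text \<open>The predictable sigma-algebra lives on positive times; the indicator extends the process
  by 0 to the whole plane. What is retained is joint measurability, for Fubini's theorem.\<close>

lemma predictable_measurable:
  assumes "predictable M \<xi> \<Phi>"
  shows "(\<lambda>(z, w). indicator {0<..} (fst z) * \<Phi> (fst z) (snd z) w) \<in> borel_measurable (borel \<Otimes>\<^sub>M M)"
proof -
  let ?G = "{{a<..b} \<times> A \<times> G | a b A G. 0 \<le> a \<and> a \<le> b \<and> A \<in> sets borel \<and> G \<in> sets (noise_filtration M \<xi> a)} :: (real \<times> real \<times> 'a) set set"
  let ?S = "({0<..} \<times> UNIV) \<times> space M :: ((real \<times> real) \<times> 'a) set"
  have S: "?S \<inter> space (borel \<Otimes>\<^sub>M M) \<in> sets (borel \<Otimes>\<^sub>M M)"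
    by (auto simp: space_pair_measure intro!: sets.Int pair_measureI) (auto simp: borel_prod[symmetric])
  have G: "G \<in> sets M" if "G \<in> sets (noise_filtration M \<xi> a)" for G a
    using that sets_noise_sigma_subset unfolding noise_filtration_eq by auto
  have "(\<lambda>(z, w). (fst z, snd z, w)) \<in> measurable (restrict_space (borel \<Otimes>\<^sub>M M) ?S) (predictable_algebra M \<xi>)"
    unfolding predictable_algebra_def
  proof (rule measurable_measure_of)
    show "?G \<subseteq> Pow ({0<..} \<times> UNIV \<times> space M)" using G sets.sets_into_space by fastforce
    show "(\<lambda>(z, w). (fst z, snd z, w)) \<in> space (restrict_space (borel \<Otimes>\<^sub>M M) ?S) \<rightarrow> {0<..} \<times> UNIV \<times> space M"
      by (auto simp: space_restrict_space space_pair_measure)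
    fix B assume "B \<in> ?G"
    then obtain a b A H where B: "B = {a<..b} \<times> A \<times> H" "0 \<le> a" "A \<in> sets borel" "H \<in> sets (noise_filtration M \<xi> a)" by auto
    have "(\<lambda>(z, w). (fst z, snd z, w)) -` B \<inter> space (restrict_space (borel \<Otimes>\<^sub>M M) ?S) = ?S \<inter> (({a<..b} \<times> A) \<times> H)"
      using B sets.sets_into_space[OF G[OF B(4)]] by (auto simp: space_restrict_space space_pair_measure)
    moreover have "({a<..b} \<times> A) \<times> H \<in> sets (borel \<Otimes>\<^sub>M M)"
      using B G[OF B(4)] by (intro pair_measureI) (auto simp: borel_prod[symmetric])
    ultimately show "(\<lambda>(z, w). (fst z, snd z, w)) -` B \<inter> space (restrict_space (borel \<Otimes>\<^sub>M M) ?S) \<in> sets (restrict_space (borel \<Otimes>\<^sub>M M) ?S)"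
      by (auto simp: sets_restrict_space)
  qed
  from measurable_compose[OF this assms[unfolded predictable_def]]
  have "(\<lambda>p. \<Phi> (fst (fst p)) (snd (fst p)) (snd p)) \<in> borel_measurable (restrict_space (borel \<Otimes>\<^sub>M M) ?S)"
    by (simp add: case_prod_beta)
  then have "(\<lambda>p. indicator ?S p *\<^sub>R \<Phi> (fst (fst p)) (snd (fst p)) (snd p)) \<in> borel_measurable (borel \<Otimes>\<^sub>M M)"
    by (subst (asm) borel_measurable_restrict_space_iff[OF S])
  then show ?thesis
    by (rule measurable_cong[THEN iffD1, rotated]) (auto simp: space_pair_measure indicator_def)
qed

text \<open>The section at \<open>(s, y)\<close> of a generator
  \<open>{a<..b} \<times> A \<times> G\<close> is empty or equal to \<open>G\<close>, and in the
  latter case \<open>G\<close> is known at time \<open>a < s\<close>.\<close>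

lemma predictable_adapted:
  assumes "predictable M \<xi> \<Phi>" "0 < s"
  shows "\<Phi> s y \<in> borel_measurable (NS ({0<..s} \<times> UNIV))"
proof -
  let ?G = "{{a<..b} \<times> A \<times> G | a b A G. 0 \<le> a \<and> a \<le> b \<and> A \<in> sets borel \<and> G \<in> sets (noise_filtration M \<xi> a)} :: (real \<times> real \<times> 'a) set set"
  have G: "G \<in> sets M" if "G \<in> sets (noise_filtration M \<xi> a)" for G a
    using that sets_noise_sigma_subset unfolding noise_filtration_eq by auto
  have "(\<lambda>w. (s, y, w)) \<in> measurable (NS ({0<..s} \<times> UNIV)) (predictable_algebra M \<xi>)"
    unfolding predictable_algebra_def
  proof (rule measurable_measure_of)
    show "?G \<subseteq> Pow ({0<..} \<times> UNIV \<times> space M)" using G sets.sets_into_space by fastforce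
    show "(\<lambda>w. (s, y, w)) \<in> space (NS ({0<..s} \<times> UNIV)) \<rightarrow> {0<..} \<times> UNIV \<times> space M" using assms by auto
    fix B assume "B \<in> ?G"
    then obtain a b A H where B: "B = {a<..b} \<times> A \<times> H" "0 \<le> a" "A \<in> sets borel" "H \<in> sets (NS ({0<..a} \<times> UNIV))"
      unfolding noise_filtration_eq by auto
    show "(\<lambda>w. (s, y, w)) -` B \<inter> space (NS ({0<..s} \<times> UNIV)) \<in> sets (NS ({0<..s} \<times> UNIV))"
    proof (cases "s \<in> {a<..b} \<and> y \<in> A")
      case True
      then have "(\<lambda>w. (s, y, w)) -` B \<inter> space (NS ({0<..s} \<times> UNIV)) = H"
        using B sets.sets_into_space[OF B(4)] by auto
      moreover have "sets (NS ({0<..a} \<times> UNIV)) \<subseteq> sets (NS ({0<..s} \<times> UNIV))" by (rule sets_noise_sigma_mono) (use True in auto)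
      ultimately show ?thesis using B by auto
    next
      case False
      then have "(\<lambda>w. (s, y, w)) -` B \<inter> space (NS ({0<..s} \<times> UNIV)) = {}" using B by auto
      then show ?thesis by simp
    qed
  qed
  from measurable_compose[OF this assms(1)[unfolded predictable_def]] show ?thesis by simp
qed

end

section \<open>Grid approximation of Walsh integrals\<close>

context noise
begin

text \<open>\<open>J\<close> is a limit of integrals of some unspecified simple processes. The
  isometry compares these with the given sum; the factor 4 comes from the triangle inequality for
  squares, used twice.\<close>

lemma walsh_close:
  fixes X :: "'i \<Rightarrow> 'a \<Rightarrow> real" and C a b :: "'i \<Rightarrow> real"
  assumes hw: "has_walsh_integral M \<xi> \<Phi> J"
    and fin: "finite I" and a: "\<And>i. i \<in> I \<Longrightarrow> 0 \<le> a i" and A: "\<And>i. i \<in> I \<Longrightarrow> A i \<in> sets borel" "\<And>i. i \<in> I \<Longrightarrow> emeasure lborel (A i) < \<infinity>"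
    and X: "\<And>i. i \<in> I \<Longrightarrow> X i \<in> borel_measurable (NS ({0<..a i} \<times> UNIV))" "\<And>i w. i \<in> I \<Longrightarrow> w \<in> space M \<Longrightarrow> \<bar>X i w\<bar> \<le> C i"
  defines "R \<equiv> \<lambda>i. {a i<..b i} \<times> A i"
  shows "(nnE M (\<lambda>w. (J w - (\<Sum>i\<in>I. X i w * \<xi> (R i) w))\<^sup>2))
    \<le> 4 * (\<integral>\<^sup>+w. (\<integral>\<^sup>+z\<in>{0<..} \<times> UNIV. ennreal (((\<Sum>i\<in>I. X i w * indicator (R i) z) - \<Phi> (fst z) (snd z) w)\<^sup>2) \<partial>lborel) \<partial>M)"
proof -
  obtain S where S: "\<And>n. is_simple_process M \<xi> (S n)"
    and S1: "(\<lambda>n. \<integral>\<^sup>+ w. (\<integral>\<^sup>+ z \<in> {0<..} \<times> UNIV. ennreal ((simple_process_val (S n) (fst z) (snd z) w - \<Phi> (fst z) (snd z) w)\<^sup>2) \<partial>lborel) \<partial>M) \<longlonglongrightarrow> 0"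
    and S2: "(\<lambda>n. \<integral>\<^sup>+ w. ennreal ((simple_walsh_integral \<xi> (S n) w - J w)\<^sup>2) \<partial>M) \<longlonglongrightarrow> 0"
    using hw unfolding has_walsh_integral_def by blast
  have pr: "predictable M \<xi> \<Phi>" and Jm[measurable]: "J \<in> borel_measurable M" using hw by (auto simp: has_walsh_integral_def)
  define G where "G w = (\<Sum>i\<in>I. X i w * \<xi> (R i) w)" for w
  define V where "V z w = (\<Sum>i\<in>I. X i w * indicator (R i) z)" for z w
  define P where "P z w = indicator {0<..} (fst z) * \<Phi> (fst z) (snd z) w" for z w
  have Pm[measurable]: "(\<lambda>(z, w). P z w) \<in> borel_measurable (borel \<Otimes>\<^sub>M M)" unfolding P_def by (rule predictable_measurable[OF pr])
  have Rns: "R i \<in> noise_sets" if "i \<in> I" for i unfolding R_def using that a A by (intro strip_noise_sets) auto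
  have Rb[measurable]: "R i \<in> sets borel" if "i \<in> I" for i using Rns[OF that] by (auto simp: noise_sets_def)
  have Xm[measurable]: "X i \<in> borel_measurable M" if "i \<in> I" for i using X(1)[OF that] by (rule noise_sigma_measurable_M)
  have xm[measurable]: "\<xi> (R i) \<in> borel_measurable M" if "i \<in> I" for i using Rns[OF that] by simp
  have Gm[measurable]: "G \<in> borel_measurable M" unfolding G_def[abs_def] by measurable
  have Vm[measurable]: "(\<lambda>(z, w). V z w) \<in> borel_measurable (borel \<Otimes>\<^sub>M M)"
    unfolding V_def[abs_def] case_prod_beta by measurable
  have V0: "V z w = 0" if "z \<notin> {0<..} \<times> UNIV" for z w
    unfolding V_def using that a by (intro sum.neutral) (force simp: R_def indicator_def)
  have restr: "(\<integral>\<^sup>+z\<in>{0<..} \<times> UNIV. ennreal ((f z - \<Phi> (fst z) (snd z) w)\<^sup>2) \<partial>lborel) = nnE lborel (\<lambda>z. (f z - P z w)\<^sup>2)"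
    if "\<And>z. z \<notin> {0<..} \<times> UNIV \<Longrightarrow> f z = 0" for f w
    using that by (intro nn_integral_cong) (auto simp: P_def indicator_def)
  define D where "D = (\<integral>\<^sup>+w. (nnE lborel (\<lambda>z. (V z w - P z w)\<^sup>2)) \<partial>M)"
  have D: "(\<integral>\<^sup>+w. (\<integral>\<^sup>+z\<in>{0<..} \<times> UNIV. ennreal (((\<Sum>i\<in>I. X i w * indicator (R i) z) - \<Phi> (fst z) (snd z) w)\<^sup>2) \<partial>lborel) \<partial>M) = D"
    unfolding D_def by (subst restr) (auto simp: V0[unfolded V_def] V_def)
  have sq: "(x - y)\<^sup>2 \<le> 2 * (x - wd)\<^sup>2 + 2 * (wd - y)\<^sup>2" for x y wd :: real
    using zero_le_power2[of "x + y - 2 * wd"] by (simp add: power2_eq_square algebra_simps)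
  have sqe: "ennreal ((x - y)\<^sup>2) \<le> 2 * ennreal ((x - wd)\<^sup>2) + 2 * ennreal ((wd - y)\<^sup>2)" for x y wd :: real
    using ennreal_leI[OF sq[of x y wd]] by (simp add: ennreal_mult')
  have bound: "nnE M (\<lambda>w. (J w - G w)\<^sup>2) \<le>
     2 * nnE M (\<lambda>w. (simple_walsh_integral \<xi> (S n) w - J w)\<^sup>2) +
     2 * (2 * (\<integral>\<^sup>+ w. (\<integral>\<^sup>+ z \<in> {0<..} \<times> UNIV. ennreal ((simple_process_val (S n) (fst z) (snd z) w - \<Phi> (fst z) (snd z) w)\<^sup>2) \<partial>lborel) \<partial>M) + 2 * D)" for n
  proof -
    define l where "l = length (S n)"
    define X' a' b' A' where "X' i = fst (S n ! i)" and "a' i = fst (snd (S n ! i))" and "b' i = fst (snd (snd (S n ! i)))" and "A' i = snd (snd (snd (S n ! i)))" for i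
    define R' where "R' i = {a' i<..b' i} \<times> A' i" for i
    have el: "S n ! i = (X' i, a' i, b' i, A' i)" for i by (simp add: X'_def a'_def b'_def A'_def)
    have sp: "0 \<le> a' i" "A' i \<in> sets borel" "emeasure lborel (A' i) < \<infinity>" "X' i \<in> borel_measurable (NS ({0<..a' i} \<times> UNIV))" "bounded (X' i ` space M)" if "i < l" for i
    proof -
      have mem: "(X' i, a' i, b' i, A' i) \<in> set (S n)" using nth_mem[of i "S n"] that by (simp only: el l_def)
      from bspec[OF S[of n, unfolded is_simple_process_def noise_filtration_eq] this]
      show "0 \<le> a' i" "A' i \<in> sets borel" "emeasure lborel (A' i) < \<infinity>" "X' i \<in> borel_measurable (NS ({0<..a' i} \<times> UNIV))" "bounded (X' i ` space M)"
        by simp_all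
    qed
    have "\<exists>C. \<forall>w\<in>space M. \<bar>X' i w\<bar> \<le> C" if "i < l" for i using sp(5)[OF that] by (auto simp: bounded_iff)
    then obtain C' where C': "\<And>i w. i < l \<Longrightarrow> w \<in> space M \<Longrightarrow> \<bar>X' i w\<bar> \<le> C' i" by metis
    have val: "simple_process_val (S n) (fst z) (snd z) w = (\<Sum>i<l. X' i w * indicator (R' i) z)" for z w
      unfolding simple_process_val_def sum_list_sum_nth l_def R'_def
      by (cases z) (auto simp: el atLeast0LessThan indicator_def intro!: sum.cong)
    have int: "simple_walsh_integral \<xi> (S n) w = (\<Sum>i<l. X' i w * \<xi> (R' i) w)" for w
      unfolding simple_walsh_integral_def sum_list_sum_nth l_def R'_def
      by (auto simp: el atLeast0LessThan intro!: sum.cong)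
    define F where "F z w = (\<Sum>i<l. X' i w * indicator (R' i) z)" for z w
    define FF where "FF w = (\<Sum>i<l. X' i w * \<xi> (R' i) w)" for w
    have R'ns: "R' i \<in> noise_sets" if "i < l" for i unfolding R'_def using sp that by (intro strip_noise_sets) auto
    have [measurable]: "R' i \<in> sets borel" "X' i \<in> borel_measurable M" "\<xi> (R' i) \<in> borel_measurable M" if "i < l" for i
      using R'ns[OF that] sp(4)[OF that] by (auto simp: noise_sets_def intro: noise_sigma_measurable_M)
    have FFm[measurable]: "FF \<in> borel_measurable M" unfolding FF_def[abs_def] by (intro borel_measurable_sum borel_measurable_times) auto
    have [measurable]: "(\<lambda>(z, w). F z w) \<in> borel_measurable (borel \<Otimes>\<^sub>M M)"
      unfolding F_def[abs_def] case_prod_beta by (intro borel_measurable_sum borel_measurable_times) auto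
    have F0: "F z w = 0" if "z \<notin> {0<..} \<times> UNIV" for z w
      unfolding F_def using that sp(1) by (intro sum.neutral) (force simp: R'_def indicator_def)
    have iso: "nnE M (\<lambda>w. (FF w - G w)\<^sup>2) = (\<integral>\<^sup>+w. (nnE lborel (\<lambda>z. (F z w - V z w)\<^sup>2)) \<partial>M)"
    proof -
      \<comment> \<open>The difference of the two elementary integrals is one elementary integral,
        indexed by the disjoint sum of the index sets.\<close>
      define XX where "XX = case_sum X' (\<lambda>i w. - X i w)"
      have "(nnE M (\<lambda>w. (\<Sum>i\<in>{..<l} <+> I. XX i w * \<xi> ({case_sum a' a i<..case_sum b' b i} \<times> case_sum A' A i) w)\<^sup>2))
        = (\<integral>\<^sup>+w. (nnE lborel (\<lambda>z. (\<Sum>i\<in>{..<l} <+> I. XX i w * indicator ({case_sum a' a i<..case_sum b' b i} \<times> case_sum A' A i) z)\<^sup>2)) \<partial>M)"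
        by (rule walsh_isometry(1)[where C = "case_sum C' C"]) (use fin a A X sp C' in \<open>auto simp: XX_def\<close>)
      then show ?thesis
        unfolding sum.Plus[OF finite_lessThan fin] XX_def FF_def G_def F_def V_def R_def R'_def o_def
        by (simp only: sum.case mult_minus_left sum_negf diff_conv_add_uminus)
    qed
    have "nnE M (\<lambda>w. (J w - G w)\<^sup>2) \<le> (\<integral>\<^sup>+w. 2 * ennreal ((FF w - J w)\<^sup>2) + 2 * ennreal ((FF w - G w)\<^sup>2) \<partial>M)"
      using sqe by (intro nn_integral_mono) (simp add: power2_commute[of "FF _" "J _"])
    also have "... = 2 * nnE M (\<lambda>w. (FF w - J w)\<^sup>2) + 2 * nnE M (\<lambda>w. (FF w - G w)\<^sup>2)"
      by (simp add: nn_integral_add nn_integral_cmult)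
    finally have 1: "nnE M (\<lambda>w. (J w - G w)\<^sup>2) \<le> 2 * nnE M (\<lambda>w. (FF w - J w)\<^sup>2) + 2 * nnE M (\<lambda>w. (FF w - G w)\<^sup>2)" .
    have inner: "nnE lborel (\<lambda>z. (F z w - V z w)\<^sup>2) \<le> 2 * nnE lborel (\<lambda>z. (F z w - P z w)\<^sup>2) + 2 * nnE lborel (\<lambda>z. (V z w - P z w)\<^sup>2)"
      if wd: "w \<in> space M" for w
    proof -
      have [measurable]: "(\<lambda>z. F z w) \<in> borel_measurable borel" "(\<lambda>z. V z w) \<in> borel_measurable borel" "(\<lambda>z. P z w) \<in> borel_measurable borel"
        using wd by measurable
      have "nnE lborel (\<lambda>z. (F z w - V z w)\<^sup>2) \<le> (\<integral>\<^sup>+z. 2 * ennreal ((F z w - P z w)\<^sup>2) + 2 * ennreal ((V z w - P z w)\<^sup>2) \<partial>lborel)"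
        using sqe by (intro nn_integral_mono) (metis power2_commute)
      also have "... = 2 * nnE lborel (\<lambda>z. (F z w - P z w)\<^sup>2) + 2 * nnE lborel (\<lambda>z. (V z w - P z w)\<^sup>2)"
        by (simp add: nn_integral_add nn_integral_cmult)
      finally show ?thesis .
    qed
    have m1[measurable]: "(\<lambda>w. \<integral>\<^sup>+z. ennreal ((F z w - P z w)\<^sup>2) \<partial>lborel) \<in> borel_measurable M"
         "(\<lambda>w. \<integral>\<^sup>+z. ennreal ((V z w - P z w)\<^sup>2) \<partial>lborel) \<in> borel_measurable M"
      by (intro lborel.borel_measurable_nn_integral; subst measurable_cong_sets[OF sets_pair_measure_cong[OF refl sets_lborel] refl], measurable)+
    have "nnE M (\<lambda>w. (FF w - G w)\<^sup>2) \<le> (\<integral>\<^sup>+w. 2 * nnE lborel (\<lambda>z. (F z w - P z w)\<^sup>2) + 2 * nnE lborel (\<lambda>z. (V z w - P z w)\<^sup>2) \<partial>M)"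
      unfolding iso by (intro nn_integral_mono inner)
    also have "... = 2 * (\<integral>\<^sup>+w. (nnE lborel (\<lambda>z. (F z w - P z w)\<^sup>2)) \<partial>M) + 2 * D"
      unfolding D_def by (simp add: nn_integral_add nn_integral_cmult)
    also have "(\<integral>\<^sup>+w. (nnE lborel (\<lambda>z. (F z w - P z w)\<^sup>2)) \<partial>M) = (\<integral>\<^sup>+ w. (\<integral>\<^sup>+ z \<in> {0<..} \<times> UNIV. ennreal ((simple_process_val (S n) (fst z) (snd z) w - \<Phi> (fst z) (snd z) w)\<^sup>2) \<partial>lborel) \<partial>M)"
      unfolding val F_def[symmetric] by (subst restr[OF F0]) simp_all
    finally have 2: "nnE M (\<lambda>w. (FF w - G w)\<^sup>2) \<le> 2 * (\<integral>\<^sup>+ w. (\<integral>\<^sup>+ z \<in> {0<..} \<times> UNIV. ennreal ((simple_process_val (S n) (fst z) (snd z) w - \<Phi> (fst z) (snd z) w)\<^sup>2) \<partial>lborel) \<partial>M) + 2 * D" .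
    show ?thesis unfolding int FF_def[symmetric] by (rule order_trans[OF 1 add_left_mono[OF mult_left_mono[OF 2]]]) simp
  qed
  have "(\<lambda>n. 2 * nnE M (\<lambda>w. (simple_walsh_integral \<xi> (S n) w - J w)\<^sup>2) +
     2 * (2 * (\<integral>\<^sup>+ w. (\<integral>\<^sup>+ z \<in> {0<..} \<times> UNIV. ennreal ((simple_process_val (S n) (fst z) (snd z) w - \<Phi> (fst z) (snd z) w)\<^sup>2) \<partial>lborel) \<partial>M) + 2 * D)) \<longlonglongrightarrow> 2 * 0 + 2 * (2 * 0 + 2 * D)"
    by (intro tendsto_add ennreal_tendsto_cmult tendsto_const S1 S2) auto
  then have "nnE M (\<lambda>w. (J w - G w)\<^sup>2) \<le> 2 * 0 + 2 * (2 * 0 + 2 * D)"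
    using bound by (intro LIMSEQ_le_const) auto
  also have "... = 4 * D" by (simp add: mult.assoc[symmetric])
  finally show ?thesis unfolding D G_def .
qed

end

text \<open>Cells of side 1/N tile (0, N] x (-N, N]. There are N^2 time strips of 2 N^2 cells each,
  numbered strip by strip and from left to right, so \<open>div\<close> yields the strip and
  \<open>mod\<close> the column.\<close>

definition grid_time :: "nat \<Rightarrow> nat \<Rightarrow> real" where
  "grid_time N k = real (k div (2 * N\<^sup>2)) / real N"

definition grid_pos :: "nat \<Rightarrow> nat \<Rightarrow> real" where
  "grid_pos N k = real (k mod (2 * N\<^sup>2)) / real N - real N"

definition grid_cell :: "nat \<Rightarrow> nat \<Rightarrow> (real \<times> real) set" where
  "grid_cell N k = {grid_time N k<..grid_time N k + 1 / real N} \<times> {grid_pos N k<..grid_pos N k + 1 / real N}"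

text \<open>All earlier strips, together with the part of the current strip to the left of the cell.
  Integrands known at the start of a strip are measurable over it, although the cells of that strip
  are revealed one after another.\<close>

definition grid_region :: "nat \<Rightarrow> nat \<Rightarrow> (real \<times> real) set" where
  "grid_region N k = {0<..grid_time N k} \<times> UNIV \<union> {grid_time N k<..grid_time N k + 1 / real N} \<times> {..grid_pos N k}"

definition grid_size :: "nat \<Rightarrow> nat" where
  "grid_size N = N\<^sup>2 * (2 * N\<^sup>2)"

text \<open>Strictly below \<open>x\<close>, since the grid cells are open on the left.\<close>

definition round_below :: "nat \<Rightarrow> real \<Rightarrow> real" where
  "round_below N x = (of_int \<lceil>real N * x\<rceil> - 1) / real N"

definition grid_step :: "nat \<Rightarrow> (real \<Rightarrow> real \<Rightarrow> real) \<Rightarrow> real \<times> real \<Rightarrow> real" where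
  "grid_step N f z = (\<Sum>k<grid_size N. f (grid_time N k) (grid_pos N k) * indicator (grid_cell N k) z)"

lemma grid_time_nonneg: "0 \<le> grid_time N k" by (simp add: grid_time_def)

lemma round_below_bounds:
  assumes "0 < N"
  shows "round_below N x < x" "x - 1 / real N \<le> round_below N x"
proof -
  have N: "0 < real N" using assms by simp
  have c: "of_int \<lceil>real N * x\<rceil> - 1 < real N * x" "real N * x \<le> of_int \<lceil>real N * x\<rceil>" using ceiling_correct[of "real N * x"] by auto
  show "round_below N x < x" using c N by (simp add: round_below_def field_simps)
  show "x - 1 / real N \<le> round_below N x" using c N by (simp add: round_below_def field_simps)
qed

lemma round_below_tendsto: "(\<lambda>N. round_below N x) \<longlonglongrightarrow> x"
proof (rule tendsto_sandwich[of "\<lambda>N. x - 1 / real N" _ _ "\<lambda>_. x"])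
  have "(\<lambda>N. x - 1 / real N) \<longlonglongrightarrow> x - 0" by (intro tendsto_intros lim_1_over_n)
  then show "(\<lambda>N. x - 1 / real N) \<longlonglongrightarrow> x" by simp
  show "\<forall>\<^sub>F N in sequentially. x - 1 / real N \<le> round_below N x" "\<forall>\<^sub>F N in sequentially. round_below N x \<le> x"
    using eventually_gt_at_top[of "0::nat"] by (eventually_elim, use round_below_bounds less_imp_le in blast)+
qed simp

text \<open>Cells are open on the left and closed on the right, so ceilings locate a point: the
  index is the ceiling minus 1 in each direction, shifted by N^2 in space.\<close>

lemma grid_cell_iff:
  assumes "0 < N" "k < grid_size N"
  shows "(s, y) \<in> grid_cell N k \<longleftrightarrow> 0 < s \<and> s \<le> N \<and> - real N < y \<and> y \<le> N \<and>
    k = nat (\<lceil>real N * s\<rceil> - 1) * (2 * N\<^sup>2) + nat (\<lceil>real N * y\<rceil> - 1 + int (N\<^sup>2))"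
proof -
  define m where "m = 2 * N\<^sup>2"
  define j i where "j = k div m" and "i = k mod m"
  have N: "0 < real N" and m: "0 < m" using assms by (auto simp: m_def)
  have k: "k = j * m + i" "i < m" "j < N\<^sup>2"
    using m assms(2) by (simp_all only: j_def i_def div_mult_mod_eq mod_less_divisor grid_size_def m_def[symmetric] less_mult_imp_div_less)
  have "(s, y) \<in> grid_cell N k \<longleftrightarrow> \<lceil>real N * s\<rceil> = int j + 1 \<and> \<lceil>real N * y\<rceil> = int i + 1 - int (N\<^sup>2)"
    unfolding grid_cell_def grid_time_def grid_pos_def m_def[symmetric] j_def[symmetric] i_def[symmetric] ceiling_eq_iff
    using N by (simp add: field_simps power2_eq_square)
  also have "... \<longleftrightarrow> 0 < s \<and> s \<le> N \<and> - real N < y \<and> y \<le> N \<and> k = nat (\<lceil>real N * s\<rceil> - 1) * m + nat (\<lceil>real N * y\<rceil> - 1 + int (N\<^sup>2))" (is "?L \<longleftrightarrow> ?R")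
  proof
    assume L: ?L
    have s: "real j < real N * s" "real N * s \<le> real j + 1" using L by (auto simp: ceiling_eq_iff)
    have y: "real i - real N * real N < real N * y" "real N * y \<le> real i + 1 - real N * real N" using L by (auto simp: ceiling_eq_iff power2_eq_square)
    have "0 < real N * s" using s by linarith
    then have "0 < s" using N by (simp add: zero_less_mult_iff)
    moreover have "real j + 1 \<le> real N * real N" using k(3) by (metis Suc_leI of_nat_Suc of_nat_le_iff of_nat_mult power2_eq_square add.commute)
    then have "real N * s \<le> real N * real N" using s by linarith
    then have "s \<le> N" using N by simp
    moreover have "real N * (- real N) < real N * y" using y by simp
    then have "- real N < y" using N mult_less_cancel_left_pos by blast
    moreover have "real i + 1 \<le> 2 * (real N * real N)" using k(2) unfolding m_def by (metis Suc_leI of_nat_Suc of_nat_le_iff of_nat_mult power2_eq_square add.commute of_nat_numeral)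
    then have "real N * y \<le> real N * real N" using y by linarith
    then have "y \<le> N" using N by simp
    ultimately show ?R using L k by simp
  next
    assume R: ?R
    have "0 < real N * s" "real N * s \<le> real N * real N" using R N by auto
    then have j1: "0 \<le> \<lceil>real N * s\<rceil> - 1" by simp
    have "real N * (- real N) < real N * y" using R N mult_less_cancel_left_pos by blast
    then have i0: "0 \<le> \<lceil>real N * y\<rceil> - 1 + int (N\<^sup>2)"
      by (smt (verit) less_ceiling_iff mult_minus_right of_int_minus of_int_of_nat_eq of_nat_mult power2_eq_square)
    have "real N * y \<le> real N * real N" using R N by simp
    then have i1: "\<lceil>real N * y\<rceil> - 1 + int (N\<^sup>2) < int m"
      by (simp add: m_def power2_eq_square) (smt (verit) ceiling_le_iff of_int_of_nat_eq of_nat_mult)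
    let ?i = "nat (\<lceil>real N * y\<rceil> - 1 + int (N\<^sup>2))"
    have "?i < m" using i0 i1 by linarith
    then have "j = nat (\<lceil>real N * s\<rceil> - 1)" "i = ?i" using R m by (auto simp: j_def i_def)
    then show ?L using j1 i0 by simp
  qed
  finally show ?thesis by (simp add: m_def)
qed

lemma grid_step_eq:
  assumes "0 < N"
  shows "grid_step N f (s, y) = (if 0 < s \<and> s \<le> N \<and> - real N < y \<and> y \<le> N then f (round_below N s) (round_below N y) else 0)"
proof (cases "0 < s \<and> s \<le> N \<and> - real N < y \<and> y \<le> N")
  case True
  define j i where "j = nat (\<lceil>real N * s\<rceil> - 1)" and "i = nat (\<lceil>real N * y\<rceil> - 1 + int (N\<^sup>2))"
  define k where "k = j * (2 * N\<^sup>2) + i"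
  have N: "0 < real N" using assms by simp
  have "0 < real N * s" "real N * s \<le> real N * real N" using True N by auto
  then have j1: "0 \<le> \<lceil>real N * s\<rceil> - 1" and j2: "\<lceil>real N * s\<rceil> - 1 < int (N\<^sup>2)"
    by (simp_all add: power2_eq_square) (smt (verit) ceiling_le_iff of_int_of_nat_eq of_nat_mult)
  have "real N * (- real N) < real N * y" using True N mult_less_cancel_left_pos by blast
  then have i0: "0 \<le> \<lceil>real N * y\<rceil> - 1 + int (N\<^sup>2)"
    by (smt (verit) less_ceiling_iff mult_minus_right of_int_minus of_int_of_nat_eq of_nat_mult power2_eq_square)
  have "real N * y \<le> real N * real N" using True N by simp
  then have i1: "\<lceil>real N * y\<rceil> - 1 + int (N\<^sup>2) < int (2 * N\<^sup>2)"
    by (simp add: power2_eq_square) (smt (verit) ceiling_le_iff of_int_of_nat_eq of_nat_mult)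
  have "int j < int (N\<^sup>2)" "int i < int (2 * N\<^sup>2)" using j1 j2 i0 i1 by (simp_all add: j_def i_def)
  then have ji: "j < N\<^sup>2" "i < 2 * N\<^sup>2" by (simp_all only: of_nat_less_iff)
  have "k < Suc j * (2 * N\<^sup>2)" using ji by (simp add: k_def)
  also have "... \<le> N\<^sup>2 * (2 * N\<^sup>2)" using ji by (intro mult_le_mono1) simp
  finally have k: "k < grid_size N" by (simp add: grid_size_def)
  have kd: "k div (2 * N\<^sup>2) = j" "k mod (2 * N\<^sup>2) = i" using ji assms by (simp_all add: k_def)
  have "real j = of_int \<lceil>real N * s\<rceil> - 1" using j1 by (simp add: j_def)
  then have gt: "grid_time N k = round_below N s" by (simp add: grid_time_def round_below_def kd)
  have "real i = of_int \<lceil>real N * y\<rceil> - 1 + real N * real N" using i0 by (simp add: i_def power2_eq_square)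
  then have gp: "grid_pos N k = round_below N y" using N by (simp add: grid_pos_def round_below_def kd field_simps)
  have "grid_step N f (s, y) = (\<Sum>k'<grid_size N. if k' = k then f (grid_time N k') (grid_pos N k') else 0)"
    unfolding grid_step_def by (intro sum.cong refl) (use True grid_cell_iff[OF assms, of _ s y] in \<open>auto simp: k_def i_def j_def indicator_def\<close>)
  also have "... = f (round_below N s) (round_below N y)" using k by (simp add: gt gp)
  finally show ?thesis using True by simp
next
  case False
  then show ?thesis unfolding grid_step_def using grid_cell_iff[OF assms, of _ s y] by (auto intro!: sum.neutral simp: indicator_def)
qed

lemma grid_step_0: "grid_step 0 f z = 0" by (simp add: grid_step_def grid_size_def)

lemma grid_step_tendsto:
  assumes "0 < s \<Longrightarrow> (\<lambda>N. f (round_below N s) (round_below N y)) \<longlonglongrightarrow> f s y"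
  shows "(\<lambda>N. grid_step N f (s, y)) \<longlonglongrightarrow> indicator {0<..} s * f s y"
proof (cases "0 < s")
  case True
  have "eventually (\<lambda>N. real N \<ge> s \<and> real N > \<bar>y\<bar> \<and> 0 < N) sequentially"
    by (intro eventually_conj eventually_gt_at_top filterlim_real_sequentially[unfolded filterlim_at_top, rule_format]
        filterlim_real_sequentially[unfolded filterlim_at_top_dense, rule_format])
  then have "eventually (\<lambda>N. f (round_below N s) (round_below N y) = grid_step N f (s, y)) sequentially"
    by eventually_elim (use True in \<open>auto simp: grid_step_eq\<close>)
  from Lim_transform_eventually[OF assms[OF True] this] show ?thesis using True by simp
next
  case False
  then have "grid_step N f (s, y) = 0" for N by (cases "N = 0") (auto simp: grid_step_0 grid_step_eq)
  then show ?thesis using False by simp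
qed

text \<open>The corner at which \<open>f\<close> is evaluated is within 1/N of the point in each
  coordinate, hence within 1; this is why the support grows by 1.\<close>

lemma grid_step_bound:
  assumes f: "\<And>s y. \<bar>f s y\<bar> \<le> C" "\<And>s y. \<not> (s \<le> T \<and> \<bar>y\<bar> \<le> R) \<Longrightarrow> f s y = 0"
  shows "\<bar>grid_step N f z\<bar> \<le> C * indicator ({0<..T + 1} \<times> {-(R + 1)..R + 1}) z"
proof -
  obtain s y where z: "z = (s, y)" by (cases z)
  have C: "0 \<le> C" using f(1)[of 0 0] by linarith
  show ?thesis
  proof (cases "N = 0")
    case True
    then show ?thesis using C by (simp add: grid_step_0)
  next
    case False
    then have N: "0 < N" "1 / real N \<le> 1" by auto
    show ?thesis
    proof (cases "0 < s \<and> s \<le> T + 1 \<and> \<bar>y\<bar> \<le> R + 1")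
      case True
      then show ?thesis using f(1) C N by (auto simp: z grid_step_eq indicator_def)
    next
      case F: False
      have "grid_step N f z = 0"
      proof (cases "0 < s")
        case True
        have "\<not> (round_below N s \<le> T \<and> \<bar>round_below N y\<bar> \<le> R)"
          using F True round_below_bounds[OF N(1), of s] round_below_bounds[OF N(1), of y] N(2) by auto
        then show ?thesis using f(2) N by (simp add: z grid_step_eq)
      qed (use N in \<open>simp add: z grid_step_eq\<close>)
      then show ?thesis using C by simp
    qed
  qed
qed

lemma grid_cell_noise: "grid_cell N k \<in> noise_sets"
  unfolding grid_cell_def by (intro strip_noise_sets grid_time_nonneg) auto

lemma grid_step_measurable[measurable]: "grid_step N f \<in> borel_measurable borel"
  unfolding grid_step_def[abs_def] using grid_cell_noise by (intro borel_measurable_sum borel_measurable_times borel_measurable_indicator) (auto simp: noise_sets_def)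

lemma nn_integral_grid_step:
  assumes "\<And>s y. 0 \<le> f s y"
  shows "nnE lborel (\<lambda>z. grid_step N f z) = ennreal (\<Sum>k<grid_size N. measure lborel (grid_cell N k) * f (grid_time N k) (grid_pos N k))"
proof -
  have int: "integrable lborel (\<lambda>z. f (grid_time N k) (grid_pos N k) * indicator (grid_cell N k) z)" for k
    using grid_cell_noise[of N k] by (intro integrable_mult_right integrable_real_indicator) (auto simp: noise_sets_def)
  have "integrable lborel (grid_step N f)" unfolding grid_step_def[abs_def] by (intro Bochner_Integration.integrable_sum int)
  then have "nnE lborel (\<lambda>z. grid_step N f z) = ennreal (\<integral>z. grid_step N f z \<partial>lborel)"
    by (rule nn_integral_eq_integral) (auto simp: grid_step_def intro!: sum_nonneg mult_nonneg_nonneg assms)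
  also have "(\<integral>z. grid_step N f z \<partial>lborel) = (\<Sum>k<grid_size N. measure lborel (grid_cell N k) * f (grid_time N k) (grid_pos N k))"
    unfolding grid_step_def using grid_cell_noise[of N] by (subst Bochner_Integration.integral_sum[OF int]) (auto simp: noise_sets_def mult.commute)
  finally show ?thesis .
qed

lemma emeasure_window: "emeasure lborel ({0<..a} \<times> {b..c} :: (real \<times> real) set) < \<infinity>"
proof -
  have "emeasure lborel ({0<..a} \<times> {b..c}) = emeasure lborel {0<..a} * emeasure lborel {b..c}"
    unfolding lborel_prod[symmetric] by (rule lborel.emeasure_pair_measure_Times) auto
  then show ?thesis by (cases "0 \<le> a"; cases "b \<le> c") (simp_all add: ennreal_mult_less_top)
qed

lemma window_measurable[measurable]: "({0<..a} \<times> {b..c} :: (real \<times> real) set) \<in> sets borel"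
  by (simp add: borel_prod[symmetric])

text \<open>Dominated convergence for \<open>grid_step\<close>, whose integral is the sum.
  Convergence at rounded points is a hypothesis and not deduced from continuity, because the
  functions in use jump at the edge of a box.\<close>

lemma riemann_sum_tendsto:
  assumes f: "\<And>s y. \<bar>f s y\<bar> \<le> C" "\<And>s y. \<not> (s \<le> T \<and> \<bar>y\<bar> \<le> R) \<Longrightarrow> f s y = 0" and nn: "\<And>s y. 0 \<le> f s y"
    and m: "(\<lambda>z. indicator {0<..} (fst z) * f (fst z) (snd z)) \<in> borel_measurable borel"
    and lim: "\<And>s y. 0 < s \<Longrightarrow> (\<lambda>N. f (round_below N s) (round_below N y)) \<longlonglongrightarrow> f s y"
  shows "(\<lambda>N. ennreal (\<Sum>k<grid_size N. measure lborel (grid_cell N k) * f (grid_time N k) (grid_pos N k)))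
    \<longlonglongrightarrow> (nnE lborel (\<lambda>z. indicator {0<..} (fst z) * f (fst z) (snd z)))"
proof -
  have "(\<lambda>N. \<integral>\<^sup>+z. ennreal (grid_step N f z) \<partial>lborel)
    \<longlonglongrightarrow> (nnE lborel (\<lambda>z. indicator {0<..} (fst z) * f (fst z) (snd z)))"
  proof (rule nn_integral_dominated_convergence[where w = "\<lambda>z. ennreal C * indicator ({0<..T + 1} \<times> {-(R + 1)..R + 1}) z"])
  show "AE z in lborel. ennreal (grid_step N f z) \<le> ennreal C * indicator ({0<..T + 1} \<times> {- (R + 1)..R + 1}) z" for N
  proof (rule AE_I2)
    fix z
    have "ennreal (grid_step N f z) \<le> ennreal (C * indicator ({0<..T + 1} \<times> {- (R + 1)..R + 1}) z)"
    proof (rule ennreal_leI)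
      have "\<bar>grid_step N f z\<bar> \<le> C * indicator ({0<..T + 1} \<times> {- (R + 1)..R + 1}) z"
        by (rule grid_step_bound) (use f in auto)
      then show "grid_step N f z \<le> C * indicator ({0<..T + 1} \<times> {- (R + 1)..R + 1}) z" by linarith
    qed
    then show "ennreal (grid_step N f z) \<le> ennreal C * indicator ({0<..T + 1} \<times> {- (R + 1)..R + 1}) z"
      by (auto simp: indicator_def)
  qed
  show "(\<integral>\<^sup>+z. ennreal C * indicator ({0<..T + 1} \<times> {- (R + 1)..R + 1}) z \<partial>lborel) < \<infinity>"
    using emeasure_window by (simp add: nn_integral_cmult_indicator ennreal_mult_less_top)
  show "AE z in lborel. (\<lambda>N. ennreal (grid_step N f z)) \<longlonglongrightarrow> ennreal (indicator {0<..} (fst z) * f (fst z) (snd z))"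
    using grid_step_tendsto[of _ f, OF lim] by (intro AE_I2 tendsto_ennrealI) (metis prod.collapse)
  qed (use m in auto)
  moreover have "nnE lborel (\<lambda>z. grid_step N f z) = ennreal (\<Sum>k<grid_size N. measure lborel (grid_cell N k) * f (grid_time N k) (grid_pos N k))" for N
    by (rule nn_integral_grid_step[OF nn])
  ultimately show ?thesis by simp
qed

section \<open>Grid cells as a revealing order, and approximation by step processes\<close>

context noise
begin

text \<open>The successor index either moves one cell to the right or opens the next strip; in both
  cases the region absorbs the current cell.\<close>

lemma grid_cells:
  assumes "0 < N"
  shows "noise_cells M \<xi> (grid_cell N) (grid_region N)"
proof unfold_locales
  fix k
  define m where "m = 2 * N\<^sup>2"
  have m: "0 < m" using assms by (simp add: m_def)
  have N: "0 < real N" using assms by simp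
  show "grid_cell N k \<in> noise_sets" by (rule grid_cell_noise)
  show "grid_cell N k \<inter> grid_region N k = {}" by (auto simp: grid_cell_def grid_region_def)
  have "(Suc k div m = k div m \<and> Suc k mod m = Suc (k mod m)) \<or> (Suc k div m = Suc (k div m) \<and> Suc k mod m = 0)"
    by (metis div_Suc mod_Suc)
  then consider "grid_time N (Suc k) = grid_time N k" "grid_pos N (Suc k) = grid_pos N k + 1 / real N"
    | "grid_time N (Suc k) = grid_time N k + 1 / real N"
    unfolding grid_time_def grid_pos_def m_def[symmetric] by (auto simp: add_divide_distrib)
  then have "grid_region N k \<subseteq> grid_region N (Suc k) \<and> grid_cell N k \<subseteq> grid_region N (Suc k)"
  proof cases
    case 1
    then show ?thesis using N by (auto simp: grid_region_def grid_cell_def; smt (verit) divide_nonneg_nonneg)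
  next
    case 2
    then show ?thesis using N grid_time_nonneg[of N k] by (auto simp: grid_region_def grid_cell_def; smt (verit) divide_nonneg_nonneg)
  qed
  then show "grid_region N k \<subseteq> grid_region N (Suc k)" "grid_cell N k \<subseteq> grid_region N (Suc k)" by auto
qed

text \<open>Dominated convergence twice, over space-time for a fixed sample point and then over the
  sample space. Boundedness and the common bounded support give a dominating function that does not
  depend on the sample point.\<close>

lemma step_conv:
  assumes C: "\<And>s y w. \<bar>f s y w\<bar> \<le> C" and supp: "\<And>s y w. \<not> (s \<le> T \<and> \<bar>y\<bar> \<le> R) \<Longrightarrow> f s y w = 0"
    and fm: "(\<lambda>(z, w). indicator {0<..} (fst z) * f (fst z) (snd z) w) \<in> borel_measurable (borel \<Otimes>\<^sub>M M)"
    and fk: "\<And>s y. 0 \<le> s \<Longrightarrow> f s y \<in> borel_measurable M"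
    and lim: "AE w in M. \<forall>s>0. \<forall>y. (\<lambda>N. f (round_below N s) (round_below N y) w) \<longlonglongrightarrow> f s y w"
  shows "(\<lambda>N. \<integral>\<^sup>+w. (nnE lborel (\<lambda>z. (grid_step N (\<lambda>s y. f s y w) z - indicator {0<..} (fst z) * f (fst z) (snd z) w)\<^sup>2)) \<partial>M) \<longlonglongrightarrow> 0"
    and "(\<lambda>(z, w). grid_step N (\<lambda>s y. f s y w) z) \<in> borel_measurable (borel \<Otimes>\<^sub>M M)"
proof -
  note [measurable] = fm
  define W where "W = ({0<..T + 1} \<times> {-(R + 1)..R + 1} :: (real \<times> real) set)"
  have Wm[measurable]: "W \<in> sets borel" by (simp add: W_def)
  have C0: "0 \<le> C" using C[of 0 0 undefined] by linarith
  have cm: "grid_cell N k \<in> sets borel" for N k using grid_cell_noise by (auto simp: noise_sets_def)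
  show gm[measurable]: "(\<lambda>(z, w). grid_step N (\<lambda>s y. f s y w) z) \<in> borel_measurable (borel \<Otimes>\<^sub>M M)" for N
    unfolding grid_step_def case_prod_beta
    using fk[OF grid_time_nonneg] cm by (intro borel_measurable_sum borel_measurable_times measurable_compose[OF measurable_snd] measurable_compose[OF measurable_fst]) auto
  let ?d = "\<lambda>N w z. ennreal ((grid_step N (\<lambda>s y. f s y w) z - indicator {0<..} (fst z) * f (fst z) (snd z) w)\<^sup>2)"
  have bnd: "?d N w z \<le> ennreal ((2 * C)\<^sup>2) * indicator W z" for N w z
  proof -
    have 1: "\<bar>grid_step N (\<lambda>s y. f s y w) z\<bar> \<le> C * indicator W z"
      unfolding W_def by (rule grid_step_bound) (use C supp in auto)
    have 2: "\<bar>indicator {0<..} (fst z) * f (fst z) (snd z) w\<bar> \<le> C * indicator W z"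
      using C[of "fst z" "snd z" w] supp[of "fst z" "snd z" w] C0 by (cases z) (auto simp: W_def indicator_def abs_le_iff)
    have "\<bar>grid_step N (\<lambda>s y. f s y w) z - indicator {0<..} (fst z) * f (fst z) (snd z) w\<bar> \<le> 2 * C * indicator W z"
      using 1 2 by linarith
    then have "(grid_step N (\<lambda>s y. f s y w) z - indicator {0<..} (fst z) * f (fst z) (snd z) w)\<^sup>2 \<le> (2 * C * indicator W z)\<^sup>2"
      by (metis abs_ge_zero power2_abs power_mono)
    then have "?d N w z \<le> ennreal ((2 * C * indicator W z)\<^sup>2)" by (rule ennreal_leI)
    then show ?thesis by (cases "z \<in> W") auto
  qed
  have Wf: "(\<integral>\<^sup>+z. ennreal ((2 * C)\<^sup>2) * indicator W z \<partial>lborel) < \<infinity>"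
    using emeasure_window by (simp add: nn_integral_cmult_indicator ennreal_mult_less_top W_def)
  have inner: "AE w in M. (\<lambda>N. \<integral>\<^sup>+z. ?d N w z \<partial>lborel) \<longlonglongrightarrow> 0"
    using lim AE_space
  proof eventually_elim
    case (elim w)
    then have wd: "w \<in> space M" by simp
    have [measurable]: "(\<lambda>z. indicator {0<..} (fst z) * f (fst z) (snd z) w) \<in> borel_measurable borel"
      using measurable_Pair1[OF fm wd] by simp
    have "(\<lambda>N. \<integral>\<^sup>+z. ?d N w z \<partial>lborel) \<longlonglongrightarrow> (\<integral>\<^sup>+z. 0 \<partial>(lborel :: (real \<times> real) measure))"
    proof (rule nn_integral_dominated_convergence[where w = "\<lambda>z. ennreal ((2 * C)\<^sup>2) * indicator W z"])
      show "AE z in lborel. (\<lambda>N. ?d N w z) \<longlonglongrightarrow> 0"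
      proof (rule AE_I2)
        fix z :: "real \<times> real"
        have "(\<lambda>N. grid_step N (\<lambda>s y. f s y w) z) \<longlonglongrightarrow> indicator {0<..} (fst z) * f (fst z) (snd z) w"
          using grid_step_tendsto[of "fst z" "\<lambda>s y. f s y w" "snd z"] elim by simp
        then have "(\<lambda>N. ?d N w z) \<longlonglongrightarrow> ennreal ((indicator {0<..} (fst z) * f (fst z) (snd z) w - indicator {0<..} (fst z) * f (fst z) (snd z) w)\<^sup>2)"
          by (intro tendsto_intros tendsto_ennrealI)
        then show "(\<lambda>N. ?d N w z) \<longlonglongrightarrow> 0" by simp
      qed
    qed (use bnd Wf in auto)
    then show ?case by simp
  qed
  have "(\<lambda>N. \<integral>\<^sup>+w. (\<integral>\<^sup>+z. ?d N w z \<partial>lborel) \<partial>M) \<longlonglongrightarrow> (\<integral>\<^sup>+w. 0 \<partial>M)"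
  proof (rule nn_integral_dominated_convergence[where w = "\<lambda>w. \<integral>\<^sup>+z. ennreal ((2 * C)\<^sup>2) * indicator W z \<partial>lborel"])
    show "(\<lambda>w. \<integral>\<^sup>+z. ?d N w z \<partial>lborel) \<in> borel_measurable M" for N
      by (intro lborel.borel_measurable_nn_integral; subst measurable_cong_sets[OF sets_pair_measure_cong[OF refl sets_lborel] refl], measurable)
    show "(\<integral>\<^sup>+w. (\<integral>\<^sup>+z. ennreal ((2 * C)\<^sup>2) * indicator W z \<partial>lborel) \<partial>M) < \<infinity>"
      using Wf by (simp add: emeasure_space_1)
  qed (use inner bnd in \<open>auto intro!: nn_integral_mono AE_I2\<close>)
  then show "(\<lambda>N. \<integral>\<^sup>+w. (\<integral>\<^sup>+z. ?d N w z \<partial>lborel) \<partial>M) \<longlonglongrightarrow> 0" by simp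
qed

end

section \<open>Approximating the mild solution\<close>

text \<open>L2 convergence gives almost sure convergence along a subsequence, and Fatou's lemma
  carries bounds on higher moments to the limit.\<close>

lemma (in prob_space) L2_limit_moment_le:
  fixes J :: "'a \<Rightarrow> real"
  assumes [measurable]: "J \<in> borel_measurable M" "\<And>n. S n \<in> borel_measurable M"
    and conv: "(\<lambda>n. \<integral>\<^sup>+w. ennreal ((J w - S n w)\<^sup>2) \<partial>M) \<longlonglongrightarrow> 0"
    and fin: "\<And>n. (nnE M (\<lambda>w. (J w - S n w)\<^sup>2)) < \<infinity>"
    and B: "\<And>n. (nnE M (\<lambda>w. S n w ^ (2 * q))) \<le> B n" "B \<longlonglongrightarrow> b"
  shows "nnE M (\<lambda>w. J w ^ (2 * q)) \<le> b"
proof -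
  have int: "integrable M (\<lambda>w. (J w - S n w)\<^sup>2)" for n
    using fin[of n] by (intro integrableI_nonneg) auto
  have "ennreal (\<integral>w. norm ((J w - S n w)\<^sup>2) \<partial>M) = nnE M (\<lambda>w. (J w - S n w)\<^sup>2)" for n
    using int[of n] by (simp add: nn_integral_eq_integral)
  with conv have "(\<lambda>n. ennreal (\<integral>w. norm ((J w - S n w)\<^sup>2) \<partial>M)) \<longlonglongrightarrow> ennreal 0" by simp
  then have "(\<lambda>n. \<integral>w. norm ((J w - S n w)\<^sup>2) \<partial>M) \<longlonglongrightarrow> 0"
    by (subst (asm) tendsto_ennreal_iff) auto
  from tendsto_L1_AE_subseq[OF int this] obtain r where r: "strict_mono r" "AE w in M. (\<lambda>n. (J w - S (r n) w)\<^sup>2) \<longlonglongrightarrow> 0" by auto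
  have "AE w in M. ennreal (J w ^ (2 * q)) = liminf (\<lambda>n. ennreal (S (r n) w ^ (2 * q)))"
    using r(2)
  proof eventually_elim
    case (elim w)
    then have "(\<lambda>n. J w - S (r n) w) \<longlonglongrightarrow> 0" using tendsto_real_sqrt[OF elim] by (simp add: tendsto_rabs_zero_iff)
    from tendsto_diff[OF tendsto_const[of "J w"] this] have "(\<lambda>n. S (r n) w) \<longlonglongrightarrow> J w" by simp
    then have "(\<lambda>n. ennreal (S (r n) w ^ (2 * q))) \<longlonglongrightarrow> ennreal (J w ^ (2 * q))" by (intro tendsto_intros tendsto_ennrealI)
    then show ?case by (intro lim_imp_Liminf[symmetric]) auto
  qed
  then have "nnE M (\<lambda>w. J w ^ (2 * q)) = (\<integral>\<^sup>+w. liminf (\<lambda>n. ennreal (S (r n) w ^ (2 * q))) \<partial>M)"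
    by (rule nn_integral_cong_AE)
  also have "... \<le> liminf (\<lambda>n. \<integral>\<^sup>+w. ennreal (S (r n) w ^ (2 * q)) \<partial>M)" by (rule nn_integral_liminf) measurable
  also have "... \<le> liminf (\<lambda>n. B (r n))" by (intro Liminf_mono always_eventually allI B)
  also have "... = b" using LIMSEQ_subseq_LIMSEQ[OF B(2) r(1)] by (simp add: lim_imp_Liminf o_def)
  finally show ?thesis .
qed

section \<open>Truncation in size and to a space-time box\<close>

definition clip :: "real \<Rightarrow> real \<Rightarrow> real" where "clip K z = max (- K) (min K z)"

lemma clip_bounds: "0 \<le> K \<Longrightarrow> \<bar>clip K z\<bar> \<le> K" "0 \<le> K \<Longrightarrow> \<bar>clip K z\<bar> \<le> \<bar>z\<bar>" "0 \<le> K \<Longrightarrow> \<bar>clip K z - z\<bar> \<le> \<bar>z\<bar>" "\<bar>z\<bar> \<le> K \<Longrightarrow> clip K z = z"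
  by (auto simp: clip_def max_def min_def)

lemma clip_lipschitz: "\<bar>clip K x - clip K y\<bar> \<le> \<bar>x - y\<bar>" by (auto simp: clip_def max_def min_def)

lemma continuous_clip[continuous_intros]: "continuous_on A f \<Longrightarrow> continuous_on A (\<lambda>x. clip K (f x))"
  unfolding clip_def by (intro continuous_intros)

lemma clip_measurable[measurable]: "clip K \<in> borel_measurable borel"
  unfolding clip_def[abs_def] by measurable

text \<open>Open on the left and closed on the right in space and closed at \<open>T\<close>: points
  converging from strictly below then lie in the box eventually if and only if their limit does. At
  time 0 the closed end is harmless, since rounding keeps positive times nonnegative.\<close>

definition in_box :: "real \<Rightarrow> real \<Rightarrow> real \<Rightarrow> real \<Rightarrow> bool" where
  "in_box T K s y \<longleftrightarrow> 0 \<le> s \<and> s \<le> T \<and> - K < y \<and> y \<le> K"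

lemma round_below_nonneg: "0 < s \<Longrightarrow> 0 \<le> round_below N s"
proof -
  assume s: "0 < s"
  show ?thesis
  proof (cases "N = 0")
    case False
    then have "0 < real N * s" using s by simp
    then have "1 \<le> \<lceil>real N * s\<rceil>" by linarith
    then show ?thesis by (simp add: round_below_def)
  qed (simp add: round_below_def)
qed

lemma in_box_round:
  assumes "0 < s"
  shows "eventually (\<lambda>N. in_box T K (round_below N s) (round_below N y) \<longleftrightarrow> in_box T K s y) sequentially"
proof -
  have lt: "eventually (\<lambda>N. round_below N x < x) sequentially" for x
    using eventually_gt_at_top[of "0::nat"] by eventually_elim (rule round_below_bounds)
  have gt: "eventually (\<lambda>N. a < x \<longrightarrow> a < round_below N x) sequentially" for a x
    by (cases "a < x") (use order_tendstoD(1)[OF round_below_tendsto, of a x] in auto)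
  show ?thesis
    using lt[of s] lt[of y] gt[of T s] gt[of "-K" y] gt[of K y]
  proof eventually_elim
    case (elim N)
    then show ?case using round_below_nonneg[OF assms, of N] assms unfolding in_box_def by linarith
  qed
qed

lemma box_round_tendsto:
  fixes g :: "real \<Rightarrow> real \<Rightarrow> real"
  assumes g: "continuous_on ({0..T} \<times> UNIV) (\<lambda>(s, y). g s y)" and s: "0 < s"
  shows "(\<lambda>N. if in_box T K (round_below N s) (round_below N y) then g (round_below N s) (round_below N y) else 0)
     \<longlonglongrightarrow> (if in_box T K s y then g s y else 0)"
proof (cases "in_box T K s y")
  case True
  have "((\<lambda>p. (\<lambda>(s, y). g s y) p) \<longlongrightarrow> (\<lambda>(s, y). g s y) (s, y)) (at (s, y) within {0..T} \<times> UNIV)"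
    using g True unfolding continuous_on_def in_box_def by auto
  moreover have "filterlim (\<lambda>N. (round_below N s, round_below N y)) (at (s, y) within {0..T} \<times> UNIV) sequentially"
    unfolding filterlim_at
  proof
    show "eventually (\<lambda>N. (round_below N s, round_below N y) \<in> {0..T} \<times> UNIV \<and> (round_below N s, round_below N y) \<noteq> (s, y)) sequentially"
      using in_box_round[OF s, of T K y] eventually_gt_at_top[of "0::nat"]
    proof eventually_elim
      case (elim N)
      then show ?case using True round_below_bounds(1)[of N s] by (auto simp: in_box_def)
    qed
    show "(\<lambda>N. (round_below N s, round_below N y)) \<longlonglongrightarrow> (s, y)" by (intro tendsto_Pair round_below_tendsto)
  qed
  ultimately have "(\<lambda>N. (\<lambda>(s, y). g s y) (round_below N s, round_below N y)) \<longlonglongrightarrow> (\<lambda>(s, y). g s y) (s, y)"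
    by (rule filterlim_compose)
  then have "(\<lambda>N. g (round_below N s) (round_below N y)) \<longlonglongrightarrow> g s y" by simp
  then have "(\<lambda>N. g (round_below N s) (round_below N y)) \<longlonglongrightarrow> (if in_box T K s y then g s y else 0)" using True by simp
  then show ?thesis
    by (rule Lim_transform_eventually) (use in_box_round[OF s, of T K y] True in \<open>auto elim: eventually_mono\<close>)
next
  case False
  have "eventually (\<lambda>N. (if in_box T K (round_below N s) (round_below N y) then g (round_below N s) (round_below N y) else 0) = 0) sequentially"
    using in_box_round[OF s, of T K y] by eventually_elim (use False in auto)
  then show ?thesis using False by (simp add: tendsto_eventually)
qed

lemma box_bounded:
  fixes g :: "real \<Rightarrow> real \<Rightarrow> real"
  assumes g: "continuous_on ({0..T} \<times> UNIV) (\<lambda>(s, y). g s y)"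
  obtains B where "0 \<le> B" "\<And>s y. in_box T K s y \<Longrightarrow> \<bar>g s y\<bar> \<le> B"
proof -
  have "compact ((\<lambda>(s, y). g s y) ` ({0..T} \<times> {-K..K}))"
    by (intro compact_continuous_image compact_Times compact_Icc continuous_on_subset[OF g]) auto
  then have "bounded ((\<lambda>(s, y). g s y) ` ({0..T} \<times> {-K..K}))" by (rule compact_imp_bounded)
  then obtain B where B: "\<And>s y. s \<in> {0..T} \<Longrightarrow> y \<in> {-K..K} \<Longrightarrow> \<bar>g s y\<bar> \<le> B" unfolding bounded_iff by fastforce
  show thesis by (rule that[of "max B 0"]) (use B in \<open>auto simp: in_box_def le_max_iff_disj\<close>)
qed

lemma measurable_fst_borel[measurable (raw)]:
  "f \<in> measurable N (borel :: (real \<times> real) measure) \<Longrightarrow> (\<lambda>x. fst (f x)) \<in> borel_measurable N"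
  by (simp add: borel_prod[symmetric] measurable_fst'')

lemma measurable_snd_borel[measurable (raw)]:
  "f \<in> measurable N (borel :: (real \<times> real) measure) \<Longrightarrow> (\<lambda>x. snd (f x)) \<in> borel_measurable N"
  by (simp add: borel_prod[symmetric] measurable_snd'')

lemma in_box_measurable[measurable]: "Measurable.pred borel (\<lambda>z :: real \<times> real. in_box T K (fst z) (snd z))"
  unfolding in_box_def by measurable

lemma box_measurable:
  fixes g :: "real \<Rightarrow> real \<Rightarrow> real"
  assumes g: "continuous_on ({0..T} \<times> UNIV) (\<lambda>(s, y). g s y)"
  shows "(\<lambda>z. if in_box T K (fst z) (snd z) then g (fst z) (snd z) else 0) \<in> borel_measurable borel"
proof -
  have S: "{0..T} \<times> (UNIV :: real set) \<in> sets borel" by (simp add: borel_prod[symmetric])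
  have "(\<lambda>z. indicator ({0..T} \<times> UNIV) z *\<^sub>R (\<lambda>(s, y). g s y) z) \<in> borel_measurable borel"
    using borel_measurable_continuous_on_restrict[OF g] S by (subst (asm) borel_measurable_restrict_space_iff) auto
  note [measurable] = this
  have "(\<lambda>z. if in_box T K (fst z) (snd z) then indicator ({0..T} \<times> UNIV) z *\<^sub>R (\<lambda>(s, y). g s y) z else 0) \<in> borel_measurable borel"
    by measurable
  then show ?thesis by (rule measurable_cong[THEN iffD1, rotated]) (auto simp: in_box_def indicator_def split: prod.splits)
qed

text \<open>Continuity is asked only before time \<open>t\<close>, as the heat kernel is singular
  there; square integrability is what the isometry requires.\<close>

definition kernel :: "real \<Rightarrow> (real \<Rightarrow> real \<Rightarrow> real) \<Rightarrow> bool" where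
  "kernel t ker \<longleftrightarrow> 0 < t \<and> continuous_on ({..<t} \<times> UNIV) (\<lambda>(s, y). ker s y) \<and>
     (nnE lborel (\<lambda>z. indicator {0<..<t} (fst z) * (ker (fst z) (snd z))\<^sup>2)) < \<infinity>"

lemma time_cutoff_less:
  assumes "s \<le> t - 1 / real K" "0 < K" shows "s < t"
proof -
  have "0 < 1 / real K" using assms by simp
  then show ?thesis using assms by linarith
qed

lemma kernel_box: "kernel t ker \<Longrightarrow> 0 < K \<Longrightarrow> continuous_on ({0..t - 1 / real K} \<times> UNIV) (\<lambda>(s, y). ker s y)"
  unfolding kernel_def by (auto elim!: continuous_on_subset dest: time_cutoff_less)

lemma kernel_measurable:
  assumes "kernel t ker"
  shows "(\<lambda>z. indicator {0<..<t} (fst z) * ker (fst z) (snd z)) \<in> borel_measurable borel"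
proof -
  have c: "continuous_on ({..<t} \<times> UNIV) (\<lambda>(s, y). ker s y)" using assms by (simp add: kernel_def)
  have S: "{..<t} \<times> (UNIV :: real set) \<in> sets borel" by (simp add: borel_prod[symmetric])
  have "(\<lambda>z. indicator ({..<t} \<times> UNIV) z *\<^sub>R (\<lambda>(s, y). ker s y) z) \<in> borel_measurable borel"
    using borel_measurable_continuous_on_restrict[OF c] S by (subst (asm) borel_measurable_restrict_space_iff) auto
  note [measurable] = this
  have "(\<lambda>z. indicator {0<..} (fst z) * (indicator ({..<t} \<times> UNIV) z *\<^sub>R (\<lambda>(s, y). ker s y) z)) \<in> borel_measurable borel"
    by measurable
  then show ?thesis by (rule measurable_cong[THEN iffD1, rotated]) (auto simp: indicator_def split: prod.splits)
qed

definition box_sum :: "real \<Rightarrow> real \<Rightarrow> nat \<Rightarrow> (real \<Rightarrow> real \<Rightarrow> real) \<Rightarrow> real" where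
  "box_sum T K N g = (\<Sum>k<grid_size N. measure lborel (grid_cell N k) *
     (if in_box T K (grid_time N k) (grid_pos N k) then g (grid_time N k) (grid_pos N k) else 0))"

text \<open>Stopping at \<open>t - 1 / real K\<close> makes the integrand bounded, so its Riemann
  sums converge; the limit is an integral over a subset of the full domain, and \<open>e\<close>
  absorbs the convergence.\<close>

lemma box_sum_eventually_le:
  assumes ker: "kernel t ker" and K: "0 < K"
    and D: "continuous_on ({0..t} \<times> UNIV) (\<lambda>(s, y). D s y)" "\<And>s y. 0 \<le> D s y"
    and I: "nnE lborel (\<lambda>z. indicator {0<..<t} (fst z) * ((ker (fst z) (snd z))\<^sup>2 * D (fst z) (snd z))) \<le> ennreal I" "0 \<le> I" and e: "0 < e"
  shows "eventually (\<lambda>N. box_sum (t - 1 / real K) (real K) N (\<lambda>s y. (ker s y)\<^sup>2 * D s y) \<le> I + e) sequentially"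
proof -
  let ?T = "t - 1 / real K"
  have c: "continuous_on ({0..?T} \<times> UNIV) (\<lambda>(s, y). (ker s y)\<^sup>2 * D s y)"
  proof -
    have "continuous_on ({0..?T} \<times> UNIV) (\<lambda>(s, y). D s y)"
      by (rule continuous_on_subset[OF D(1)]) (use K in \<open>auto dest!: time_cutoff_less intro: less_imp_le\<close>)
    then show ?thesis using kernel_box[OF ker K] by (auto simp: case_prod_beta intro!: continuous_intros)
  qed
  obtain B where B: "0 \<le> B" "\<And>s y. in_box ?T K s y \<Longrightarrow> \<bar>(ker s y)\<^sup>2 * D s y\<bar> \<le> B" by (rule box_bounded[OF c, where K = "real K"]) blast
  define f where "f s y = (if in_box ?T K s y then (ker s y)\<^sup>2 * D s y else 0)" for s y
  have "(\<lambda>N. ennreal (\<Sum>k<grid_size N. measure lborel (grid_cell N k) * f (grid_time N k) (grid_pos N k)))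
    \<longlonglongrightarrow> (nnE lborel (\<lambda>z. indicator {0<..} (fst z) * f (fst z) (snd z)))"
  proof (rule riemann_sum_tendsto[where C = B and T = ?T and R = K])
    show "\<bar>f s y\<bar> \<le> B" for s y using B by (simp add: f_def)
    show "\<not> (s \<le> ?T \<and> \<bar>y\<bar> \<le> real K) \<Longrightarrow> f s y = 0" for s y by (auto simp: f_def in_box_def)
    show "0 \<le> f s y" for s y using D by (simp add: f_def)
    show "(\<lambda>z. indicator {0<..} (fst z) * f (fst z) (snd z)) \<in> borel_measurable borel"
      unfolding f_def using box_measurable[OF c, of K] by measurable
    show "0 < s \<Longrightarrow> (\<lambda>N. f (round_below N s) (round_below N y)) \<longlonglongrightarrow> f s y" for s y
      unfolding f_def by (rule box_round_tendsto[OF c])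
  qed
  moreover have "nnE lborel (\<lambda>z. indicator {0<..} (fst z) * f (fst z) (snd z)) \<le> ennreal I"
    using K D(2) by (intro order_trans[OF nn_integral_mono I(1)] ennreal_leI) (auto simp: f_def in_box_def indicator_def dest: time_cutoff_less[OF _ K])
  moreover have "ennreal I < ennreal (I + e)" using I e by (simp add: ennreal_less_iff)
  ultimately have "eventually (\<lambda>N. ennreal (\<Sum>k<grid_size N. measure lborel (grid_cell N k) * f (grid_time N k) (grid_pos N k)) < ennreal (I + e)) sequentially"
    by (rule order_tendstoD(2)[OF _ le_less_trans])
  then show ?thesis
  proof eventually_elim
    case (elim N)
    have "0 \<le> I + e" using I e by simp
    from order_less_imp_le[OF elim] this show ?case by (simp add: box_sum_def f_def ennreal_le_iff)
  qed
qed

text \<open>The lower slope \<open>c0\<close> is what makes peaks grow. The upper slope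
  \<open>L\<close> is normalised to be at least 1 so that it can be divided by.\<close>

locale she = noise M \<xi> for M :: "'a measure" and \<xi> +
  fixes \<sigma> :: "real \<Rightarrow> real" and u :: "real \<Rightarrow> real \<Rightarrow> 'a \<Rightarrow> real" and L c0 :: real
  assumes lip: "\<And>a b. \<bar>\<sigma> a - \<sigma> b\<bar> \<le> L * \<bar>a - b\<bar>" and L: "1 \<le> L" and \<sigma>0: "\<sigma> 0 = 0"
    and c0: "0 < c0" "\<And>z. c0 * \<bar>z\<bar> \<le> \<bar>\<sigma> z\<bar>" and sol: "mild_solution M \<xi> \<sigma> u"
begin

lemma \<sigma>_le: "\<bar>\<sigma> z\<bar> \<le> L * \<bar>z\<bar>" using lip[of z 0] \<sigma>0 by simp

lemma \<sigma>_continuous: "continuous_on A \<sigma>"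
proof -
  have "L-lipschitz_on UNIV \<sigma>" using lip L by (intro lipschitz_onI) (auto simp: dist_real_def)
  then have "continuous_on UNIV \<sigma>" by (rule lipschitz_on_continuous_on)
  then show ?thesis by (rule continuous_on_subset) auto
qed

lemma \<sigma>_measurable[measurable]: "\<sigma> \<in> borel_measurable borel"
  by (intro borel_measurable_continuous_onI \<sigma>_continuous)

lemma u_0: "w \<in> space M \<Longrightarrow> u 0 x w = 1" using sol by (simp add: mild_solution_def)

lemma u_predictable: "predictable M \<xi> u" using sol by (simp add: mild_solution_def)

lemma u_adapted: "0 \<le> s \<Longrightarrow> u s y \<in> borel_measurable (NS ({0<..s} \<times> UNIV))"
proof (cases "s = 0")
  case True
  have "u 0 y \<in> borel_measurable (NS ({0<..s} \<times> UNIV)) \<longleftrightarrow> (\<lambda>_. 1 :: real) \<in> borel_measurable (NS ({0<..s} \<times> UNIV))"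
    by (rule measurable_cong) (simp add: u_0)
  then show ?thesis using True by simp
qed (use predictable_adapted[OF u_predictable, of s y] in auto)

lemma u_measurable: "0 \<le> s \<Longrightarrow> u s y \<in> borel_measurable M"
  using u_adapted noise_sigma_measurable_M by blast

lemma u_joint_measurable: "(\<lambda>(z, w). indicator {0<..} (fst z) * u (fst z) (snd z) w) \<in> borel_measurable (borel \<Otimes>\<^sub>M M)"
  by (rule predictable_measurable[OF u_predictable])

lemma u_continuous: "AE w in M. continuous_on ({0..} \<times> UNIV) (\<lambda>(s, x). u s x w)"
  using sol by (simp add: mild_solution_def)

lemma u_moment_bounded:
  assumes "0 < T" "2 \<le> k"
  obtains B where "0 \<le> B" "\<And>s x. 0 \<le> s \<Longrightarrow> s \<le> T \<Longrightarrow> nnE M (\<lambda>w. \<bar>u s x w\<bar> ^ k) \<le> ennreal B"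
proof -
  let ?S = "SUP s\<in>{0..T}. SUP x. \<integral>\<^sup>+ w. ennreal (\<bar>u s x w\<bar> ^ k) \<partial>M"
  have fin: "?S < \<infinity>" using sol assms unfolding mild_solution_def by blast
  show thesis
  proof (rule that[of "enn2real ?S"])
    fix s x assume s: "0 \<le> s" "s \<le> T"
    have "nnE M (\<lambda>w. \<bar>u s x w\<bar> ^ k) \<le> (SUP x. \<integral>\<^sup>+ w. ennreal (\<bar>u s x w\<bar> ^ k) \<partial>M)" by (rule SUP_upper) simp
    also have "... \<le> ?S" using s by (intro SUP_upper) simp
    finally show "nnE M (\<lambda>w. \<bar>u s x w\<bar> ^ k) \<le> ennreal (enn2real ?S)" using fin by simp
  qed simp
qed

lemma u_mild:
  assumes "0 < t"
  obtains J where "has_walsh_integral M \<xi> (\<lambda>s y w. indicator {0<..<t} s * heat_kernel (t - s) (y - x) * \<sigma> (u s y w)) J"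
    "AE w in M. u t x w = 1 + J w"
  using sol assms unfolding mild_solution_def by blast

text \<open>Left continuous in both variables, so that its values at the grid points converge.\<close>

definition approx_field :: "real \<Rightarrow> nat \<Rightarrow> (real \<Rightarrow> real \<Rightarrow> real) \<Rightarrow> real \<Rightarrow> real \<Rightarrow> 'a \<Rightarrow> real" where
  "approx_field t K ker s y w = (if in_box (t - 1 / real K) (real K) s y then ker s y * clip K (\<sigma> (u s y w)) else 0)"

definition grid_sum :: "nat \<Rightarrow> (real \<Rightarrow> real \<Rightarrow> 'a \<Rightarrow> real) \<Rightarrow> 'a \<Rightarrow> real" where
  "grid_sum N f w = (\<Sum>k<grid_size N. f (grid_time N k) (grid_pos N k) w * \<xi> (grid_cell N k) w)"

abbreviation approx_error :: "real \<Rightarrow> (real \<Rightarrow> real \<Rightarrow> real) \<Rightarrow> ('a \<Rightarrow> real) \<Rightarrow> nat \<Rightarrow> nat \<Rightarrow> ennreal" where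
  "approx_error t ker J K N \<equiv> nnE M (\<lambda>w. (J w - grid_sum N (approx_field t K ker) w)\<^sup>2)"

lemma approx_field_adapted: "0 \<le> s \<Longrightarrow> approx_field t K ker s y \<in> borel_measurable (NS ({0<..s} \<times> UNIV))"
  unfolding approx_field_def[abs_def] using u_adapted[of s y] by measurable

lemma approx_field_bounded:
  assumes ker: "kernel t ker" and K: "0 < K"
  obtains C where "0 \<le> C" "\<And>s y w. \<bar>approx_field t K ker s y w\<bar> \<le> C"
proof -
  obtain B where B: "0 \<le> B" "\<And>s y. in_box (t - 1 / real K) K s y \<Longrightarrow> \<bar>ker s y\<bar> \<le> B" by (rule box_bounded[OF kernel_box[OF ker K], where K = "real K"]) blast
  show thesis
    by (rule that[of "B * K"]) (use B clip_bounds(1)[of "real K"] in \<open>auto simp: approx_field_def abs_mult intro!: mult_mono\<close>)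
qed

text \<open>Stated for a general bounded continuous \<open>F\<close> so that it covers both the
  truncated integrand and its product with the drift. Values at rounded points converge for every
  sample point at which the solution is continuous.\<close>

lemma field_conv:
  fixes g :: "real \<Rightarrow> real \<Rightarrow> real" and F :: "real \<Rightarrow> real" and T K c :: real
  assumes g: "continuous_on ({0..T} \<times> UNIV) (\<lambda>(s, y). g s y)" and F: "continuous_on UNIV F" "\<And>z. \<bar>F z\<bar> \<le> c"
  defines "f \<equiv> \<lambda>s y w. if in_box T K s y then g s y * F (u s y w) else 0"
  shows "(\<lambda>N. \<integral>\<^sup>+w. (nnE lborel (\<lambda>z. (grid_step N (\<lambda>s y. f s y w) z - indicator {0<..} (fst z) * f (fst z) (snd z) w)\<^sup>2)) \<partial>M) \<longlonglongrightarrow> 0"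
    and "(\<lambda>(z, w). grid_step N (\<lambda>s y. f s y w) z) \<in> borel_measurable (borel \<Otimes>\<^sub>M M)"
    and "(\<lambda>(z, w). indicator {0<..} (fst z) * f (fst z) (snd z) w) \<in> borel_measurable (borel \<Otimes>\<^sub>M M)"
proof -
  obtain B where B: "0 \<le> B" "\<And>s y. in_box T K s y \<Longrightarrow> \<bar>g s y\<bar> \<le> B" by (rule box_bounded[OF g, where K = K]) blast
  have [measurable]: "F \<in> borel_measurable borel" by (intro borel_measurable_continuous_onI F)
  have bm[measurable]: "(\<lambda>z. if in_box T K (fst z) (snd z) then g (fst z) (snd z) else 0) \<in> borel_measurable borel" by (rule box_measurable[OF g])
  note [measurable] = u_joint_measurable
  have "(\<lambda>(z, w). indicator {0<..} (fst z) * ((if in_box T K (fst z) (snd z) then g (fst z) (snd z) else 0) * F (indicator {0<..} (fst z) * u (fst z) (snd z) w))) \<in> borel_measurable (borel \<Otimes>\<^sub>M M)"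
    by measurable
  then show m: "(\<lambda>(z, w). indicator {0<..} (fst z) * f (fst z) (snd z) w) \<in> borel_measurable (borel \<Otimes>\<^sub>M M)"
    by (rule measurable_cong[THEN iffD1, rotated]) (auto simp: f_def indicator_def)
  have fb: "\<bar>f s y w\<bar> \<le> B * c" for s y w
    using B F(2)[of "u s y w"] F(2)[of 0] by (auto simp: f_def abs_mult intro!: mult_mono)
  have supp: "\<not> (s \<le> T \<and> \<bar>y\<bar> \<le> K) \<Longrightarrow> f s y w = 0" for s y w by (auto simp: f_def in_box_def)
  have fk: "0 \<le> s \<Longrightarrow> f s y \<in> borel_measurable M" for s y unfolding f_def using u_measurable[of s y] by measurable
  have lim: "AE w in M. \<forall>s>0. \<forall>y. (\<lambda>N. f (round_below N s) (round_below N y) w) \<longlonglongrightarrow> f s y w"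
    using u_continuous
  proof eventually_elim
    case (elim w)
    have c: "continuous_on ({0..T} \<times> UNIV) (\<lambda>(s, y). g s y * F (u s y w))"
    proof -
      have "continuous_on ({0..T} \<times> UNIV) (\<lambda>p. (\<lambda>(s, y). g s y) p * F ((\<lambda>(s, y). u s y w) p))"
        by (intro continuous_intros g continuous_on_compose2[OF F(1)] continuous_on_subset[OF elim]) auto
      then show ?thesis by (simp add: case_prod_beta)
    qed
    show ?case unfolding f_def by (intro allI impI box_round_tendsto[OF c])
  qed
  show "(\<lambda>N. \<integral>\<^sup>+w. (nnE lborel (\<lambda>z. (grid_step N (\<lambda>s y. f s y w) z - indicator {0<..} (fst z) * f (fst z) (snd z) w)\<^sup>2)) \<partial>M) \<longlonglongrightarrow> 0"
    by (rule step_conv(1)[OF fb supp m fk lim])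
  show "(\<lambda>(z, w). grid_step N (\<lambda>s y. f s y w) z) \<in> borel_measurable (borel \<Otimes>\<^sub>M M)"
    by (rule step_conv(2)[OF fb supp m fk lim])
qed

lemma nn_swap:
  assumes "(\<lambda>(z, w). f z w) \<in> borel_measurable (borel \<Otimes>\<^sub>M M)"
  shows "(\<integral>\<^sup>+w. (\<integral>\<^sup>+z. f z w \<partial>(lborel :: (real \<times> real) measure)) \<partial>M) = (\<integral>\<^sup>+p. f (fst p) (snd p) \<partial>(lborel \<Otimes>\<^sub>M M))"
    "(\<integral>\<^sup>+z. (\<integral>\<^sup>+w. f z w \<partial>M) \<partial>(lborel :: (real \<times> real) measure)) = (\<integral>\<^sup>+p. f (fst p) (snd p) \<partial>(lborel \<Otimes>\<^sub>M M))"
proof -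
  interpret P: pair_sigma_finite "lborel :: (real \<times> real) measure" M ..
  have m: "(\<lambda>p. f (fst p) (snd p)) \<in> borel_measurable (lborel \<Otimes>\<^sub>M M)"
    using assms by (simp add: case_prod_beta measurable_cong_sets[OF sets_pair_measure_cong[OF sets_lborel refl] refl])
  show "(\<integral>\<^sup>+w. (\<integral>\<^sup>+z. f z w \<partial>lborel) \<partial>M) = (\<integral>\<^sup>+p. f (fst p) (snd p) \<partial>(lborel \<Otimes>\<^sub>M M))"
    using P.nn_integral_snd[of "\<lambda>p. f (fst p) (snd p)"] m by simp
  show "(\<integral>\<^sup>+z. (\<integral>\<^sup>+w. f z w \<partial>M) \<partial>lborel) = (\<integral>\<^sup>+p. f (fst p) (snd p) \<partial>(lborel \<Otimes>\<^sub>M M))"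
    using nn_integral_fst[OF m] by simp
qed

text \<open>Two limits in this order: \<open>K\<close> is taken large so that cutoff and truncation
  cost little in L2, then \<open>N\<close> is taken large for this \<open>K\<close> so that the step
  approximation does. The truncation error is dominated by the integrand itself, which is square
  integrable by the moment bound on the solution.\<close>

theorem grid_sum_approx:
  assumes ker: "kernel t ker"
    and hw: "has_walsh_integral M \<xi> (\<lambda>s y w. indicator {0<..<t} s * ker s y * \<sigma> (u s y w)) J" and e: "0 < e"
  obtains K0 where "\<And>K. K0 \<le> K \<Longrightarrow> 0 < K \<and> eventually (\<lambda>N. approx_error t ker J K N \<le> ennreal e) sequentially"
proof -
  define \<Phi> where "\<Phi> z w = indicator {0<..<t} (fst z) * ker (fst z) (snd z) * \<sigma> (u (fst z) (snd z) w)" for z w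
  have t: "0 < t" using ker by (simp add: kernel_def)
  note [measurable] = u_joint_measurable kernel_measurable[OF ker]
  have "(\<lambda>(z, w). (indicator {0<..<t} (fst z) * ker (fst z) (snd z)) * \<sigma> (indicator {0<..} (fst z) * u (fst z) (snd z) w)) \<in> borel_measurable (borel \<Otimes>\<^sub>M M)"
    by measurable
  then have \<Phi>m[measurable]: "(\<lambda>(z, w). \<Phi> z w) \<in> borel_measurable (borel \<Otimes>\<^sub>M M)"
    by (rule measurable_cong[THEN iffD1, rotated]) (auto simp: \<Phi>_def indicator_def)
  define F where "F K z w = indicator {0<..} (fst z) * approx_field t K ker (fst z) (snd z) w" for K z w
  have Fc: "continuous_on UNIV (\<lambda>z. clip K (\<sigma> z))" for K by (intro continuous_intros \<sigma>_continuous)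
  have FT: "(\<lambda>N. \<integral>\<^sup>+w. (nnE lborel (\<lambda>z. (grid_step N (\<lambda>s y. approx_field t K ker s y w) z - F K z w)\<^sup>2)) \<partial>M) \<longlonglongrightarrow> 0"
    and Gm: "\<And>N. (\<lambda>(z, w). grid_step N (\<lambda>s y. approx_field t K ker s y w) z) \<in> borel_measurable (borel \<Otimes>\<^sub>M M)"
    and Fm: "(\<lambda>(z, w). F K z w) \<in> borel_measurable (borel \<Otimes>\<^sub>M M)"
    if K: "0 < K" for K
    using field_conv[OF kernel_box[OF ker K] Fc[of "real K"], where c = "real K" and K = "real K"] clip_bounds(1)[of "real K"]
    unfolding F_def approx_field_def[abs_def] by simp_all
  obtain B where B: "0 \<le> B" "\<And>s x. 0 \<le> s \<Longrightarrow> s \<le> t \<Longrightarrow> nnE M (\<lambda>w. \<bar>u s x w\<bar> ^ 2) \<le> ennreal B"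
    by (rule u_moment_bounded[OF t, of 2]) auto
  have \<Phi>2: "(\<integral>\<^sup>+p. ennreal ((\<Phi> (fst p) (snd p))\<^sup>2) \<partial>(lborel \<Otimes>\<^sub>M M)) < \<infinity>"
  proof -
    have "(\<integral>\<^sup>+p. ennreal ((\<Phi> (fst p) (snd p))\<^sup>2) \<partial>(lborel \<Otimes>\<^sub>M M)) = (\<integral>\<^sup>+z. (nnE M (\<lambda>w. (\<Phi> z w)\<^sup>2)) \<partial>lborel)"
      by (rule nn_swap(2)[symmetric]) measurable
    also have "... \<le> (\<integral>\<^sup>+z. ennreal (indicator {0<..<t} (fst z) * (ker (fst z) (snd z))\<^sup>2) * ennreal (L\<^sup>2 * B) \<partial>lborel)"
    proof (rule nn_integral_mono)
      fix z :: "real \<times> real"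
      show "nnE M (\<lambda>w. (\<Phi> z w)\<^sup>2) \<le> ennreal (indicator {0<..<t} (fst z) * (ker (fst z) (snd z))\<^sup>2) * ennreal (L\<^sup>2 * B)"
      proof (cases "fst z \<in> {0<..<t}")
        case True
        note [measurable] = u_measurable[of "fst z" "snd z"]
        have "nnE M (\<lambda>w. (\<Phi> z w)\<^sup>2) \<le> (\<integral>\<^sup>+w. ennreal ((ker (fst z) (snd z))\<^sup>2 * L\<^sup>2) * ennreal (\<bar>u (fst z) (snd z) w\<bar>\<^sup>2) \<partial>M)"
        proof (rule nn_integral_mono)
          fix w
          have "(\<sigma> (u (fst z) (snd z) w))\<^sup>2 \<le> (L * \<bar>u (fst z) (snd z) w\<bar>)\<^sup>2"
            using \<sigma>_le[of "u (fst z) (snd z) w"] by (metis abs_ge_zero power2_abs power_mono)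
          then have "(\<Phi> z w)\<^sup>2 \<le> (ker (fst z) (snd z))\<^sup>2 * L\<^sup>2 * \<bar>u (fst z) (snd z) w\<bar>\<^sup>2"
            using True by (simp add: \<Phi>_def power_mult_distrib mult.assoc mult_left_mono)
          then show "ennreal ((\<Phi> z w)\<^sup>2) \<le> ennreal ((ker (fst z) (snd z))\<^sup>2 * L\<^sup>2) * ennreal (\<bar>u (fst z) (snd z) w\<bar>\<^sup>2)"
            by (simp add: ennreal_mult'[symmetric] ennreal_leI)
        qed
        also have "... = ennreal ((ker (fst z) (snd z))\<^sup>2 * L\<^sup>2) * nnE M (\<lambda>w. \<bar>u (fst z) (snd z) w\<bar>\<^sup>2)"
          using True by (intro nn_integral_cmult) auto
        also have "... \<le> ennreal ((ker (fst z) (snd z))\<^sup>2 * L\<^sup>2) * ennreal B" using True B by (intro mult_left_mono) auto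
        finally show ?thesis using True B by (simp add: ennreal_mult'[symmetric] mult_ac)
      qed (simp add: \<Phi>_def)
    qed
    also have "... = nnE lborel (\<lambda>z. indicator {0<..<t} (fst z) * (ker (fst z) (snd z))\<^sup>2) * ennreal (L\<^sup>2 * B)"
    proof (rule nn_integral_multc)
      have "(\<lambda>z. (indicator {0<..<t} (fst z) * ker (fst z) (snd z))\<^sup>2) \<in> borel_measurable borel" by measurable
      also have "(\<lambda>z. (indicator {0<..<t} (fst z) * ker (fst z) (snd z))\<^sup>2) = (\<lambda>z. indicator {0<..<t} (fst z) * (ker (fst z) (snd z))\<^sup>2)"
        by (auto simp: indicator_def fun_eq_iff)
      finally show "(\<lambda>z. ennreal (indicator {0<..<t} (fst z) * (ker (fst z) (snd z))\<^sup>2)) \<in> borel_measurable lborel" by simp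
    qed
    also have "... < \<infinity>" using ker by (simp add: kernel_def ennreal_mult_less_top)
    finally show ?thesis .
  qed
  have FK: "(\<lambda>K. \<integral>\<^sup>+p. ennreal ((F (Suc K) (fst p) (snd p) - \<Phi> (fst p) (snd p))\<^sup>2) \<partial>(lborel \<Otimes>\<^sub>M M)) \<longlonglongrightarrow> (\<integral>\<^sup>+p. 0 \<partial>((lborel :: (real \<times> real) measure) \<Otimes>\<^sub>M M))"
  proof (rule nn_integral_dominated_convergence[where w = "\<lambda>p. ennreal ((\<Phi> (fst p) (snd p))\<^sup>2)"])
    have mc: "f \<in> borel_measurable (borel \<Otimes>\<^sub>M M) \<Longrightarrow> f \<in> borel_measurable (lborel \<Otimes>\<^sub>M M)" for f :: "(real \<times> real) \<times> 'a \<Rightarrow> ennreal"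
      by (simp add: measurable_cong_sets[OF sets_pair_measure_cong[OF sets_lborel refl] refl])
    note [measurable] = Fm
    show "(\<lambda>p. ennreal ((F (Suc K) (fst p) (snd p) - \<Phi> (fst p) (snd p))\<^sup>2)) \<in> borel_measurable (lborel \<Otimes>\<^sub>M M)" for K
      using Fm[of "Suc K"] \<Phi>m unfolding case_prod_beta by (intro mc) simp
    show "(\<lambda>p. ennreal ((\<Phi> (fst p) (snd p))\<^sup>2)) \<in> borel_measurable (lborel \<Otimes>\<^sub>M M)"
      using \<Phi>m unfolding case_prod_beta by (intro mc) simp
    show "AE p in lborel \<Otimes>\<^sub>M M. ennreal ((F (Suc K) (fst p) (snd p) - \<Phi> (fst p) (snd p))\<^sup>2) \<le> ennreal ((\<Phi> (fst p) (snd p))\<^sup>2)" for K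
    proof (intro AE_I2 ennreal_leI)
      fix p :: "(real \<times> real) \<times> 'a"
      define s y w where "s = fst (fst p)" and "y = snd (fst p)" and "w = snd p"
      have "\<bar>F (Suc K) (fst p) (snd p) - \<Phi> (fst p) (snd p)\<bar> \<le> \<bar>\<Phi> (fst p) (snd p)\<bar>"
      proof (cases "0 < s \<and> in_box (t - 1 / real (Suc K)) (real (Suc K)) s y")
        case True
        have "s < t" using True by (auto simp: in_box_def intro: le_less_trans)
        then have "F (Suc K) (fst p) (snd p) - \<Phi> (fst p) (snd p) = ker s y * (clip (Suc K) (\<sigma> (u s y w)) - \<sigma> (u s y w))" "\<Phi> (fst p) (snd p) = ker s y * \<sigma> (u s y w)"
          using True by (auto simp: F_def \<Phi>_def approx_field_def s_def[symmetric] y_def[symmetric] w_def[symmetric] algebra_simps)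
        then show ?thesis using clip_bounds(3)[of "real (Suc K)" "\<sigma> (u s y w)"] by (simp add: abs_mult mult_left_mono)
      next
        case False
        then have "F (Suc K) (fst p) (snd p) = 0" by (auto simp: F_def approx_field_def s_def[symmetric] y_def[symmetric])
        then show ?thesis by simp
      qed
      then show "(F (Suc K) (fst p) (snd p) - \<Phi> (fst p) (snd p))\<^sup>2 \<le> (\<Phi> (fst p) (snd p))\<^sup>2" by (rule abs_le_square_iff[THEN iffD1])
    qed
    show "AE p in lborel \<Otimes>\<^sub>M M. (\<lambda>K. ennreal ((F (Suc K) (fst p) (snd p) - \<Phi> (fst p) (snd p))\<^sup>2)) \<longlonglongrightarrow> 0"
    proof (rule AE_I2)
      fix p :: "(real \<times> real) \<times> 'a"
      define s y w where "s = fst (fst p)" and "y = snd (fst p)" and "w = snd p"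
      have "eventually (\<lambda>K. F K (fst p) (snd p) = \<Phi> (fst p) (snd p)) sequentially"
      proof (cases "0 < s \<and> s < t")
        case True
        have "eventually (\<lambda>K. 1 / real K < t - s) sequentially" using order_tendstoD(2)[OF lim_1_over_n, of "t - s"] True by simp
        moreover have "eventually (\<lambda>K. \<bar>y\<bar> + \<bar>\<sigma> (u s y w)\<bar> < real K) sequentially"
          by (rule filterlim_real_sequentially[unfolded filterlim_at_top_dense, rule_format])
        ultimately show ?thesis
        proof eventually_elim
          case (elim K)
          then have "in_box (t - 1 / real K) K s y" "\<bar>\<sigma> (u s y w)\<bar> \<le> K" using True by (auto simp: in_box_def)
          then show ?case using True by (simp add: F_def \<Phi>_def approx_field_def s_def[symmetric] y_def[symmetric] w_def[symmetric] clip_bounds(4))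
        qed
      next
        case False
        have "F K (fst p) (snd p) = \<Phi> (fst p) (snd p)" if "0 < K" for K
          using False that time_cutoff_less[of s t K] by (auto simp: F_def \<Phi>_def approx_field_def s_def[symmetric] y_def[symmetric] in_box_def indicator_def)
        then show ?thesis by (rule eventually_mono[OF eventually_gt_at_top[of "0::nat"]])
      qed
      then have "eventually (\<lambda>K. F (Suc K) (fst p) (snd p) = \<Phi> (fst p) (snd p)) sequentially" by (subst eventually_sequentially_Suc)
      then show "(\<lambda>K. ennreal ((F (Suc K) (fst p) (snd p) - \<Phi> (fst p) (snd p))\<^sup>2)) \<longlonglongrightarrow> 0"
        by (intro tendsto_eventually) (auto elim!: eventually_mono)
    qed
    show "(\<integral>\<^sup>+p. ennreal ((\<Phi> (fst p) (snd p))\<^sup>2) \<partial>(lborel \<Otimes>\<^sub>M M)) < \<infinity>" by (rule \<Phi>2)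
  qed simp
  \<comment> \<open>The 16 accounts for the factor 4 of \<open>walsh_close\<close> and the factors 2
    of the triangle inequality for squares: 4 (2/16 + 2/16) = 1.\<close>
  then have "eventually (\<lambda>K. (\<integral>\<^sup>+p. ennreal ((F (Suc K) (fst p) (snd p) - \<Phi> (fst p) (snd p))\<^sup>2) \<partial>(lborel \<Otimes>\<^sub>M M)) < ennreal (e / 16)) sequentially"
    using e by (intro order_tendstoD(2)) auto
  then obtain K1 where K1: "\<And>K. K1 \<le> K \<Longrightarrow> (\<integral>\<^sup>+p. ennreal ((F (Suc K) (fst p) (snd p) - \<Phi> (fst p) (snd p))\<^sup>2) \<partial>(lborel \<Otimes>\<^sub>M M)) < ennreal (e / 16)"
    by (auto simp: eventually_sequentially)
  show thesis
  proof (rule that[of "Suc K1"])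
    fix K assume "Suc K1 \<le> K"
    then obtain K' where K': "K = Suc K'" "K1 \<le> K'" by (cases K) auto
    then have K: "0 < K" by simp
    obtain C where C: "0 \<le> C" "\<And>s y w. \<bar>approx_field t K ker s y w\<bar> \<le> C" by (rule approx_field_bounded[OF ker K]) blast
    have T2: "(\<integral>\<^sup>+w. (nnE lborel (\<lambda>z. (F K z w - \<Phi> z w)\<^sup>2)) \<partial>M) \<le> ennreal (e / 16)"
      using K1[OF K'(2)] Fm[OF K] by (subst nn_swap(1)) (auto simp: K'(1) intro: less_imp_le)
    have "eventually (\<lambda>N. (\<integral>\<^sup>+w. (nnE lborel (\<lambda>z. (grid_step N (\<lambda>s y. approx_field t K ker s y w) z - F K z w)\<^sup>2)) \<partial>M) < ennreal (e / 16)) sequentially"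
      using order_tendstoD(2)[OF FT[OF K], of "ennreal (e / 16)"] e by simp
    then have "eventually (\<lambda>N. approx_error t ker J K N \<le> ennreal e) sequentially"
    proof eventually_elim
      case (elim N)
      define G where "G z w = grid_step N (\<lambda>s y. approx_field t K ker s y w) z" for z w
      have [measurable]: "(\<lambda>(z, w). G z w) \<in> borel_measurable (borel \<Otimes>\<^sub>M M)" "(\<lambda>(z, w). F K z w) \<in> borel_measurable (borel \<Otimes>\<^sub>M M)"
        unfolding G_def by (rule Gm[OF K] Fm[OF K])+
      have wd: "(approx_error t ker J K N)
         \<le> 4 * (\<integral>\<^sup>+w. (\<integral>\<^sup>+z\<in>{0<..} \<times> UNIV. ennreal (((\<Sum>k\<in>{..<grid_size N}. approx_field t K ker (grid_time N k) (grid_pos N k) w * indicator (grid_cell N k) z)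
            - indicator {0<..<t} (fst z) * ker (fst z) (snd z) * \<sigma> (u (fst z) (snd z) w))\<^sup>2) \<partial>lborel) \<partial>M)"
        unfolding grid_sum_def grid_cell_def
        by (rule walsh_close[OF hw, where C = "\<lambda>_. C"]) (auto intro: approx_field_adapted grid_time_nonneg C)
      have sqe: "ennreal ((x - y)\<^sup>2) \<le> 2 * ennreal ((x - v)\<^sup>2) + 2 * ennreal ((v - y)\<^sup>2)" for x y v :: real
      proof -
        have "(x - y)\<^sup>2 \<le> 2 * (x - v)\<^sup>2 + 2 * (v - y)\<^sup>2"
          using zero_le_power2[of "x + y - 2 * v"] by (simp add: power2_eq_square algebra_simps)
        from ennreal_leI[OF this] show ?thesis by (simp add: ennreal_mult')
      qed
      have "(\<integral>\<^sup>+w. (\<integral>\<^sup>+z\<in>{0<..} \<times> UNIV. ennreal (((\<Sum>k\<in>{..<grid_size N}. approx_field t K ker (grid_time N k) (grid_pos N k) w * indicator (grid_cell N k) z)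
            - indicator {0<..<t} (fst z) * ker (fst z) (snd z) * \<sigma> (u (fst z) (snd z) w))\<^sup>2) \<partial>lborel) \<partial>M)
          \<le> (\<integral>\<^sup>+w. (\<integral>\<^sup>+z. 2 * ennreal ((G z w - F K z w)\<^sup>2) + 2 * ennreal ((F K z w - \<Phi> z w)\<^sup>2) \<partial>lborel) \<partial>M)"
      proof (intro nn_integral_mono)
        fix z :: "real \<times> real" and w
        show "ennreal (((\<Sum>k\<in>{..<grid_size N}. approx_field t K ker (grid_time N k) (grid_pos N k) w * indicator (grid_cell N k) z)
            - indicator {0<..<t} (fst z) * ker (fst z) (snd z) * \<sigma> (u (fst z) (snd z) w))\<^sup>2) * indicator ({0<..} \<times> UNIV) z \<le> 2 * ennreal ((G z w - F K z w)\<^sup>2) + 2 * ennreal ((F K z w - \<Phi> z w)\<^sup>2)"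
          using sqe[of "G z w" "\<Phi> z w" "F K z w"] unfolding G_def grid_step_def \<Phi>_def by (cases "z \<in> {0<..} \<times> UNIV") auto
      qed
      also have "... = (\<integral>\<^sup>+p. 2 * ennreal ((G (fst p) (snd p) - F K (fst p) (snd p))\<^sup>2) + 2 * ennreal ((F K (fst p) (snd p) - \<Phi> (fst p) (snd p))\<^sup>2) \<partial>(lborel \<Otimes>\<^sub>M M))"
        by (rule nn_swap) measurable
      also have "... = 2 * (\<integral>\<^sup>+p. ennreal ((G (fst p) (snd p) - F K (fst p) (snd p))\<^sup>2) \<partial>(lborel \<Otimes>\<^sub>M M)) + 2 * (\<integral>\<^sup>+p. ennreal ((F K (fst p) (snd p) - \<Phi> (fst p) (snd p))\<^sup>2) \<partial>(lborel \<Otimes>\<^sub>M M))"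
        by (subst nn_integral_add; (subst nn_integral_cmult)?; (subst nn_integral_cmult)?;
            (subst measurable_cong_sets[OF sets_pair_measure_cong[OF sets_lborel refl] refl], measurable)?; simp?)
      also have "(\<integral>\<^sup>+p. ennreal ((G (fst p) (snd p) - F K (fst p) (snd p))\<^sup>2) \<partial>(lborel \<Otimes>\<^sub>M M)) = (\<integral>\<^sup>+w. (nnE lborel (\<lambda>z. (G z w - F K z w)\<^sup>2)) \<partial>M)"
        by (rule nn_swap(1)[symmetric]) measurable
      also have "(\<integral>\<^sup>+p. ennreal ((F K (fst p) (snd p) - \<Phi> (fst p) (snd p))\<^sup>2) \<partial>(lborel \<Otimes>\<^sub>M M)) = (\<integral>\<^sup>+w. (nnE lborel (\<lambda>z. (F K z w - \<Phi> z w)\<^sup>2)) \<partial>M)"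
        by (rule nn_swap(1)[symmetric]) measurable
      finally have "approx_error t ker J K N \<le> 4 * (2 * (\<integral>\<^sup>+w. (nnE lborel (\<lambda>z. (G z w - F K z w)\<^sup>2)) \<partial>M) + 2 * (\<integral>\<^sup>+w. (nnE lborel (\<lambda>z. (F K z w - \<Phi> z w)\<^sup>2)) \<partial>M))"
        by (rule order_trans[OF wd mult_left_mono]) simp
      also have "... \<le> 4 * (2 * ennreal (e / 16) + 2 * ennreal (e / 16))"
        using elim T2 unfolding G_def by (intro mult_left_mono add_mono) (auto intro: less_imp_le)
      also have "... = ennreal (4 * (2 * (e / 16) + 2 * (e / 16)))"
      proof -
        have 1: "2 * ennreal (e / 16) = ennreal (e / 8)" using ennreal_mult'[of 2 "e / 16"] by simp
        have 2: "ennreal (e / 8) + ennreal (e / 8) = ennreal (e / 4)" using e ennreal_plus[of "e / 8" "e / 8"] by simp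
        show ?thesis unfolding 1 2 using ennreal_mult'[of 4 "e / 4"] by simp
      qed
      finally show ?case by simp
    qed
    then show "0 < K \<and> eventually (\<lambda>N. approx_error t ker J K N \<le> ennreal e) sequentially" using K by simp
  qed
qed

lemma grid_adapted:
  assumes "0 < N" "\<And>s y. 0 \<le> s \<Longrightarrow> f s y \<in> borel_measurable (NS ({0<..s} \<times> UNIV))"
  shows "f (grid_time N k) (grid_pos N k) \<in> borel_measurable (NS (grid_region N k))"
  by (rule noise_sigma_measurable_mono[OF assms(2)[OF grid_time_nonneg]]) (auto simp: grid_region_def)

lemma grid_sum_msum:
  assumes "0 < N"
  shows "grid_sum N f = noise_cells.msum \<xi> (grid_cell N) (\<lambda>k. f (grid_time N k) (grid_pos N k)) (grid_size N)"
  by (simp add: grid_sum_def[abs_def] noise_cells.msum_def[OF grid_cells[OF assms], abs_def])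

lemma grid_sum_measurable:
  assumes "\<And>s y. 0 \<le> s \<Longrightarrow> f s y \<in> borel_measurable (NS ({0<..s} \<times> UNIV))"
  shows "grid_sum N f \<in> borel_measurable M"
  unfolding grid_sum_def[abs_def] using assms[OF grid_time_nonneg, THEN noise_sigma_measurable_M] noise_measurable[OF grid_cell_noise]
  by (intro borel_measurable_sum borel_measurable_times) auto

text \<open>What later estimates use of a Walsh integral. The same truncation and the same grids
  serve every kernel with final time \<open>t\<close>, so differences of integrals can be
  treated.\<close>

definition approximable :: "real \<Rightarrow> (real \<Rightarrow> real \<Rightarrow> real) \<Rightarrow> ('a \<Rightarrow> real) \<Rightarrow> bool" where
  "approximable t ker J \<longleftrightarrow> J \<in> borel_measurable M \<and> (\<forall>e>0. \<exists>K0. \<forall>K\<ge>K0. 0 < K \<and>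
     eventually (\<lambda>N. approx_error t ker J K N \<le> ennreal e) sequentially)"

lemma approximableD:
  assumes "approximable t ker J" "0 < e"
  obtains K0 where "\<And>K. K0 \<le> K \<Longrightarrow> 0 < K \<and> eventually (\<lambda>N. approx_error t ker J K N \<le> ennreal e) sequentially"
  using assms unfolding approximable_def by blast

lemma walsh_approximable:
  assumes ker: "kernel t ker"
    and hw: "has_walsh_integral M \<xi> (\<lambda>s y w. indicator {0<..<t} s * ker s y * \<sigma> (u s y w)) J"
  shows "approximable t ker J"
  unfolding approximable_def
proof (intro conjI allI impI)
  show "J \<in> borel_measurable M" using hw by (simp add: has_walsh_integral_def)
  fix e :: real assume "0 < e"
  then obtain K0 where "\<And>K. K0 \<le> K \<Longrightarrow> 0 < K \<and> eventually (\<lambda>N. approx_error t ker J K N \<le> ennreal e) sequentially"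
    by (rule grid_sum_approx[OF ker hw]) blast
  then show "\<exists>K0. \<forall>K\<ge>K0. 0 < K \<and> eventually (\<lambda>N. approx_error t ker J K N \<le> ennreal e) sequentially"
    by (intro exI[of _ K0] allI impI)
qed

text \<open>Grid sums are linear in the kernel: the truncation acts only on \<open>\<sigma>\<close>
  of the solution, and the box depends on \<open>t\<close> and \<open>K\<close> alone.\<close>

lemma approximable_diff:
  assumes J: "approximable t ker J" and J': "approximable t ker' J'"
  shows "approximable t (\<lambda>s y. ker s y - ker' s y) (\<lambda>w. J w - J' w)"
  unfolding approximable_def
proof (intro conjI allI impI)
  have [measurable]: "J \<in> borel_measurable M" "J' \<in> borel_measurable M" using J J' by (simp_all add: approximable_def)
  show "(\<lambda>w. J w - J' w) \<in> borel_measurable M" by measurable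
  fix e :: real assume e: "0 < e"
  obtain K1 where K1: "\<And>K. K1 \<le> K \<Longrightarrow> 0 < K \<and> eventually (\<lambda>N. approx_error t ker J K N \<le> ennreal (e / 4)) sequentially"
    by (rule approximableD[OF J, of "e / 4"]) (use e in auto)
  obtain K2 where K2: "\<And>K. K2 \<le> K \<Longrightarrow> 0 < K \<and> eventually (\<lambda>N. approx_error t ker' J' K N \<le> ennreal (e / 4)) sequentially"
    by (rule approximableD[OF J', of "e / 4"]) (use e in auto)
  show "\<exists>K0. \<forall>K\<ge>K0. 0 < K \<and> eventually (\<lambda>N. nnE M (\<lambda>w. (J w - J' w - grid_sum N (approx_field t K (\<lambda>s y. ker s y - ker' s y)) w)\<^sup>2) \<le> ennreal e) sequentially"
  proof (intro exI[of _ "max K1 K2"] allI impI conjI)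
    fix K assume K: "max K1 K2 \<le> K"
    then show "0 < K" using K1[of K] by simp
    have "eventually (\<lambda>N. approx_error t ker J K N \<le> ennreal (e / 4)) sequentially"
      "eventually (\<lambda>N. approx_error t ker' J' K N \<le> ennreal (e / 4)) sequentially"
      using K1[of K] K2[of K] K by auto
    then show "eventually (\<lambda>N. nnE M (\<lambda>w. (J w - J' w - grid_sum N (approx_field t K (\<lambda>s y. ker s y - ker' s y)) w)\<^sup>2) \<le> ennreal e) sequentially"
    proof eventually_elim
      case (elim N)
      define S S' where "S = grid_sum N (approx_field t K ker)" and "S' = grid_sum N (approx_field t K ker')"
      have [measurable]: "S \<in> borel_measurable M" "S' \<in> borel_measurable M"
        unfolding S_def S'_def by (rule grid_sum_measurable[OF approx_field_adapted], assumption)+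
      have lin: "grid_sum N (approx_field t K (\<lambda>s y. ker s y - ker' s y)) w = S w - S' w" for w
        unfolding S_def S'_def grid_sum_def sum_subtractf[symmetric] approx_field_def
        by (intro sum.cong refl) (simp add: algebra_simps)
      have "nnE M (\<lambda>w. (J w - J' w - (S w - S' w))\<^sup>2) \<le> (\<integral>\<^sup>+w. 2 * ennreal ((J w - S w)\<^sup>2) + 2 * ennreal ((J' w - S' w)\<^sup>2) \<partial>M)"
      proof (rule nn_integral_mono)
        fix w
        have "(a - b - (c - d))\<^sup>2 \<le> 2 * (a - c)\<^sup>2 + 2 * (b - d)\<^sup>2" for a b c d :: real
          using zero_le_power2[of "(a - c) + (b - d)"] by (simp add: power2_eq_square algebra_simps)
        from ennreal_leI[OF this[of "J w" "J' w" "S w" "S' w"]]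
        show "ennreal ((J w - J' w - (S w - S' w))\<^sup>2) \<le> 2 * ennreal ((J w - S w)\<^sup>2) + 2 * ennreal ((J' w - S' w)\<^sup>2)"
          by (simp add: ennreal_mult')
      qed
      also have "... = 2 * nnE M (\<lambda>w. (J w - S w)\<^sup>2) + 2 * nnE M (\<lambda>w. (J' w - S' w)\<^sup>2)"
        by (simp add: nn_integral_add nn_integral_cmult)
      also have "... \<le> 2 * ennreal (e / 4) + 2 * ennreal (e / 4)"
        using elim unfolding S_def S'_def by (intro add_mono mult_left_mono) auto
      also have "... = ennreal e"
        using ennreal_mult'[of 2 "e / 4"] e ennreal_plus[of "e / 2" "e / 2"] by simp
      finally show ?case unfolding lin .
    qed
  qed
qed

text \<open>\<open>D\<close> bounds the squared L2q norm of \<open>\<sigma> (u s y w)\<close>.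
  \<open>msum_moment_le\<close> bounds the grid sums by Riemann sums of the squared kernel times
  \<open>D\<close>, and \<open>L2_limit_moment_le\<close> passes to the limit.\<close>

theorem walsh_moment_le:
  assumes ker: "kernel t ker" and hw: "approximable t ker J"
    and D: "continuous_on ({0..t} \<times> UNIV) (\<lambda>(s, y). D s y)" "\<And>s y. 0 \<le> D s y"
    and q: "1 \<le> q" and mom: "\<And>s y. 0 \<le> s \<Longrightarrow> s < t \<Longrightarrow> nnE M (\<lambda>w. \<sigma> (u s y w) ^ (2 * q)) \<le> ennreal (D s y ^ q)"
    and I: "nnE lborel (\<lambda>z. indicator {0<..<t} (fst z) * ((ker (fst z) (snd z))\<^sup>2 * D (fst z) (snd z))) \<le> ennreal I" "0 \<le> I"
  shows "nnE M (\<lambda>w. J w ^ (2 * q)) \<le> ennreal (((2 * real q - 1) * I) ^ q)"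
proof -
  have Jm: "J \<in> borel_measurable M" using hw by (simp add: approximable_def)
  define P where "P n K N \<longleftrightarrow> 0 < K \<and> 0 < N \<and> approx_error t ker J K N \<le> ennreal (1 / Suc n) \<and>
     box_sum (t - 1 / real K) (real K) N (\<lambda>s y. (ker s y)\<^sup>2 * D s y) \<le> I + 1 / Suc n" for n K N
  \<comment> \<open>First \<open>K\<close>, then \<open>N\<close> for this \<open>K\<close>, with
    both errors at most 1/(n + 1); the diagonal sequence of grid sums then tends to \<open>J\<close>
    in L2.\<close>
  have "\<exists>K N. P n K N" for n
  proof -
    obtain K where K: "\<And>K'. K \<le> K' \<Longrightarrow> 0 < K' \<and> eventually (\<lambda>N. nnE M (\<lambda>w. (J w - grid_sum N (approx_field t K' ker) w)\<^sup>2) \<le> ennreal (1 / Suc n)) sequentially"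
      by (rule approximableD[OF hw, of "1 / Suc n"]) auto
    have "eventually (\<lambda>N. 0 < N \<and> approx_error t ker J K N \<le> ennreal (1 / Suc n) \<and>
       box_sum (t - 1 / real K) (real K) N (\<lambda>s y. (ker s y)\<^sup>2 * D s y) \<le> I + 1 / Suc n) sequentially"
      using K[of K] by (intro eventually_conj eventually_gt_at_top box_sum_eventually_le[OF ker _ D I]) auto
        then obtain N where "0 < N \<and> approx_error t ker J K N \<le> ennreal (1 / Suc n) \<and>
       box_sum (t - 1 / real K) (real K) N (\<lambda>s y. (ker s y)\<^sup>2 * D s y) \<le> I + 1 / Suc n"
      by (rule eventually_happens'[OF sequentially_bot, THEN exE])
    then have "P n K N" using K[OF order_refl] unfolding P_def by simp
    then show ?thesis by blast
  qed
  then obtain K N where PKN: "\<And>n. P n (K n) (N n)" by metis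
  have KN: "0 < K n" "0 < N n"
    "nnE M (\<lambda>w. (J w - grid_sum (N n) (approx_field t (K n) ker) w)\<^sup>2) \<le> ennreal (1 / Suc n)"
    "box_sum (t - 1 / real (K n)) (real (K n)) (N n) (\<lambda>s y. (ker s y)\<^sup>2 * D s y) \<le> I + 1 / Suc n" for n
    using PKN[of n] unfolding P_def by blast+
  show ?thesis
  proof (rule L2_limit_moment_le[where S = "\<lambda>n. grid_sum (N n) (approx_field t (K n) ker)" and B = "\<lambda>n. ennreal (((2 * real q - 1) * (I + 1 / Suc n)) ^ q)"])
    show "grid_sum (N n) (approx_field t (K n) ker) \<in> borel_measurable M" for n by (rule grid_sum_measurable[OF approx_field_adapted])
    show "nnE M (\<lambda>w. (J w - grid_sum (N n) (approx_field t (K n) ker) w)\<^sup>2) < \<infinity>" for n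
      using KN(3)[of n] by (auto intro: le_less_trans)
    show "(\<lambda>n. \<integral>\<^sup>+w. ennreal ((J w - grid_sum (N n) (approx_field t (K n) ker) w)\<^sup>2) \<partial>M) \<longlonglongrightarrow> 0"
    proof (rule tendsto_sandwich[where f = "\<lambda>_. 0" and h = "\<lambda>n. ennreal (1 / Suc n)"])
      have "(\<lambda>n. ennreal (1 / real (Suc n))) \<longlonglongrightarrow> ennreal 0" by (intro tendsto_ennrealI LIMSEQ_Suc[OF lim_1_over_n])
      then show "(\<lambda>n. ennreal (1 / real (Suc n))) \<longlonglongrightarrow> 0" by simp
    qed (use KN(3) in auto)
    have "(\<lambda>n. ennreal (((2 * real q - 1) * (I + 1 / real (Suc n))) ^ q)) \<longlonglongrightarrow> ennreal (((2 * real q - 1) * (I + 0)) ^ q)"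
      by (intro tendsto_ennrealI tendsto_intros LIMSEQ_Suc[OF lim_1_over_n])
    then show "(\<lambda>n. ennreal (((2 * real q - 1) * (I + 1 / real (Suc n))) ^ q)) \<longlonglongrightarrow> ennreal (((2 * real q - 1) * I) ^ q)" by simp
    show "nnE M (\<lambda>w. grid_sum (N n) (approx_field t (K n) ker) w ^ (2 * q)) \<le> ennreal (((2 * real q - 1) * (I + 1 / real (Suc n))) ^ q)" for n
    proof -
      interpret C: noise_cells M \<xi> "grid_cell (N n)" "grid_region (N n)" by (rule grid_cells[OF KN(2)])
      define T where "T = t - 1 / real (K n)"
      define b where "b k = (if in_box T (K n) (grid_time (N n) k) (grid_pos (N n) k) then (ker (grid_time (N n) k) (grid_pos (N n) k))\<^sup>2 * D (grid_time (N n) k) (grid_pos (N n) k) else 0)" for k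
      have "nnE M (\<lambda>w. grid_sum (N n) (approx_field t (K n) ker) w ^ (2 * q)) \<le> ennreal (((2 * real q - 1) * (\<Sum>k<grid_size (N n). measure lborel (grid_cell (N n) k) * b k)) ^ q)"
        unfolding grid_sum_msum[OF KN(2)]
      proof (rule C.msum_moment_le[OF _ _ q])
        show "approx_field t (K n) ker (grid_time (N n) k) (grid_pos (N n) k) \<in> borel_measurable (NS (grid_region (N n) k))" for k
          by (rule grid_adapted[OF KN(2) approx_field_adapted])
        show "0 \<le> b k" for k using D by (simp add: b_def)
        show "nnE M (\<lambda>w. approx_field t (K n) ker (grid_time (N n) k) (grid_pos (N n) k) w ^ (2 * q)) \<le> ennreal (b k ^ q)" for k
        proof (cases "in_box T (K n) (grid_time (N n) k) (grid_pos (N n) k)")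
          case True
          define s y where "s = grid_time (N n) k" and "y = grid_pos (N n) k"
          have s: "0 \<le> s" "s < t" using True KN(1)[of n] by (auto simp: s_def in_box_def T_def dest: time_cutoff_less)
          note [measurable] = u_measurable[OF s(1), of y]
          have "nnE M (\<lambda>w. approx_field t (K n) ker s y w ^ (2 * q)) \<le> (\<integral>\<^sup>+w. ennreal (ker s y ^ (2 * q)) * ennreal (\<sigma> (u s y w) ^ (2 * q)) \<partial>M)"
          proof (rule nn_integral_mono)
            fix w
            have "clip (K n) (\<sigma> (u s y w)) ^ (2 * q) \<le> \<sigma> (u s y w) ^ (2 * q)"
              using power_mono[OF clip_bounds(2)[of "real (K n)" "\<sigma> (u s y w)"], of "2 * q"] by (simp add: power_even_abs)
            then have "approx_field t (K n) ker s y w ^ (2 * q) \<le> ker s y ^ (2 * q) * \<sigma> (u s y w) ^ (2 * q)"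
              using True by (simp add: approx_field_def s_def y_def T_def power_mult_distrib mult_left_mono)
            then show "ennreal (approx_field t (K n) ker s y w ^ (2 * q)) \<le> ennreal (ker s y ^ (2 * q)) * ennreal (\<sigma> (u s y w) ^ (2 * q))"
              by (simp add: ennreal_mult'[symmetric] ennreal_leI)
          qed
          also have "... = ennreal (ker s y ^ (2 * q)) * nnE M (\<lambda>w. \<sigma> (u s y w) ^ (2 * q))" by (rule nn_integral_cmult) measurable
          also have "... \<le> ennreal (ker s y ^ (2 * q)) * ennreal (D s y ^ q)" by (intro mult_left_mono mom s) auto
          also have "... = ennreal (b k ^ q)"
            using True D(2)[of s y] by (simp add: b_def s_def y_def ennreal_mult'[symmetric] power_mult_distrib power_mult)
          finally show ?thesis by (simp add: s_def y_def)
        next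
          case False
          then have "approx_field t (K n) ker (grid_time (N n) k) (grid_pos (N n) k) w = 0" for w by (simp add: approx_field_def T_def)
          then show ?thesis using q by (simp add: power_0_left)
        qed
      qed
      also have "... \<le> ennreal (((2 * real q - 1) * (I + 1 / real (Suc n))) ^ q)"
      proof (intro ennreal_leI power_mono mult_left_mono)
        show "(\<Sum>k<grid_size (N n). measure lborel (grid_cell (N n) k) * b k) \<le> I + 1 / real (Suc n)"
          using KN(4)[of n] by (simp add: box_sum_def b_def T_def)
        show "0 \<le> (2 * real q - 1) * (\<Sum>k<grid_size (N n). measure lborel (grid_cell (N n) k) * b k)"
          using q D by (intro mult_nonneg_nonneg sum_nonneg) (auto simp: b_def)
      qed (use q in simp)
      finally show ?thesis .
    qed
  qed (rule Jm)
qed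

end

section \<open>Moment bounds\<close>

lemma heat_kernel_normal: "0 < r \<Longrightarrow> heat_kernel r z = normal_density 0 (sqrt r) z"
  by (simp add: heat_kernel_def normal_density_def)

lemma heat_kernel_nonneg: "0 < r \<Longrightarrow> 0 \<le> heat_kernel r z"
  by (simp add: heat_kernel_def)

text \<open>Replaces one factor of a squared kernel and leaves a probability density in
  space.\<close>

lemma heat_kernel_le:
  assumes r: "0 < r"
  shows "heat_kernel r z \<le> 1 / sqrt r"
proof -
  have "exp (- (z\<^sup>2 / (2 * r))) \<le> 1" using r by simp
  moreover have "sqrt r \<le> sqrt (2 * pi * r)" using r pi_ge_two by (intro real_sqrt_le_mono) simp
  ultimately show ?thesis unfolding heat_kernel_def using r by (intro frac_le) auto
qed

lemma heat_kernel_measurable[measurable]: "(\<lambda>z. heat_kernel r z) \<in> borel_measurable borel"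
  unfolding heat_kernel_def by measurable

lemma nn_integral_heat_kernel_shift:
  assumes r: "0 < r" and [measurable]: "g \<in> borel_measurable borel"
  shows "(\<integral>\<^sup>+y. ennreal (heat_kernel r (y - x)) * g (y - x) \<partial>lborel) = (\<integral>\<^sup>+z. ennreal (heat_kernel r z) * g z \<partial>lborel)"
  by (subst nn_integral_real_affine[where c = 1 and t = x]) auto

lemma nn_integral_heat_kernel: "0 < r \<Longrightarrow> nnE lborel (\<lambda>y. heat_kernel r (y - x)) = 1"
proof -
  assume r: "0 < r"
  interpret prob_space "density lborel (\<lambda>z. ennreal (normal_density 0 (sqrt r) z))" by (rule prob_space_normal_density) (use r in simp)
  have "nnE lborel (\<lambda>z. heat_kernel r z) = 1"
    using emeasure_space_1 r by (simp add: emeasure_density heat_kernel_normal)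
  then show ?thesis using nn_integral_heat_kernel_shift[OF r, of "\<lambda>_. 1" x] by simp
qed

text \<open>exp |z| is at most exp z + exp(-z), and each exponential moment equals exp(r/2) after
  completing the square. Such a weight measures the distance to the boundary in the
  localization.\<close>

lemma nn_integral_heat_kernel_exp:
  assumes r: "0 < r"
  shows "nnE lborel (\<lambda>y. heat_kernel r (y - x) * exp \<bar>y - x\<bar>) \<le> ennreal (2 * exp (r / 2))"
proof -
  have e: "nnE lborel (\<lambda>z. heat_kernel r z * exp (a * z)) = ennreal (exp (r / 2))" if a: "a = 1 \<or> a = -1" for a
  proof -
    have "heat_kernel r z * exp (a * z) = exp (r / 2) * heat_kernel r (z - a * r)" for z
    proof -
      have "- (z\<^sup>2 / (2 * r)) + a * z = r / 2 + - ((z - a * r)\<^sup>2 / (2 * r))"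
        using r a by (auto simp: field_simps power2_eq_square)
      then show ?thesis by (simp add: heat_kernel_def mult_exp_exp)
    qed
    then have "nnE lborel (\<lambda>z. heat_kernel r z * exp (a * z)) = (\<integral>\<^sup>+z. ennreal (exp (r / 2)) * ennreal (heat_kernel r (z - a * r)) \<partial>lborel)"
      by (simp add: ennreal_mult')
    also have "... = ennreal (exp (r / 2))" by (simp add: nn_integral_cmult nn_integral_heat_kernel r)
    finally show ?thesis .
  qed
  have "nnE lborel (\<lambda>y. heat_kernel r (y - x) * exp \<bar>y - x\<bar>) = nnE lborel (\<lambda>z. heat_kernel r z * exp \<bar>z\<bar>)"
    using nn_integral_heat_kernel_shift[OF r, of "\<lambda>z. ennreal (exp \<bar>z\<bar>)" x] by (simp add: ennreal_mult'')
  also have "... \<le> (\<integral>\<^sup>+z. ennreal (heat_kernel r z * exp (1 * z)) + ennreal (heat_kernel r z * exp (-1 * z)) \<partial>lborel)"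
  proof (rule nn_integral_mono)
    fix z
    have "heat_kernel r z * exp \<bar>z\<bar> \<le> heat_kernel r z * exp (1 * z) + heat_kernel r z * exp (-1 * z)"
      using heat_kernel_nonneg[OF r, of z] by (cases "0 \<le> z") auto
    then show "ennreal (heat_kernel r z * exp \<bar>z\<bar>) \<le> ennreal (heat_kernel r z * exp (1 * z)) + ennreal (heat_kernel r z * exp (-1 * z))"
      using heat_kernel_nonneg[OF r, of z] by (simp add: ennreal_plus[symmetric] ennreal_leI del: ennreal_plus)
  qed
  also have "... = ennreal (exp (r / 2)) + ennreal (exp (r / 2))"
    by (subst nn_integral_add, measurable) (simp only: e[OF disjI1[OF refl]] e[OF disjI2[OF refl]])
  also have "... = ennreal (2 * exp (r / 2))" by (simp add: ennreal_plus[symmetric] del: ennreal_plus)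
  finally show ?thesis .
qed

lemma nn_integral_plane:
  assumes [measurable]: "(\<lambda>z. f (fst z) (snd z)) \<in> borel_measurable (borel :: (real \<times> real) measure)"
  shows "(\<integral>\<^sup>+z. f (fst z) (snd z) \<partial>lborel) = (\<integral>\<^sup>+s. (\<integral>\<^sup>+y. f s y \<partial>lborel) \<partial>lborel)"
proof -
  have "(\<lambda>z. f (fst z) (snd z)) \<in> borel_measurable (lborel \<Otimes>\<^sub>M lborel)" using assms by (simp add: lborel_prod)
  from lborel.nn_integral_fst[OF this] show ?thesis by (simp add: lborel_prod)
qed

lemma nn_integral_exp_decay:
  assumes \<beta>: "0 < \<beta>"
  shows "nnE lborel (\<lambda>r. indicator {0<..} r * exp (- \<beta> * r)) = ennreal (1 / \<beta>)"
proof -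
  have "emeasure (density lborel (exponential_density \<beta>)) (space (density lborel (exponential_density \<beta>))) = 1"
    using prob_space.emeasure_space_1[OF prob_space_exponential_density[OF \<beta>]] .
  then have "nnE lborel (\<lambda>r. exponential_density \<beta> r) = 1" by (simp add: emeasure_density)
  moreover have "nnE lborel (\<lambda>r. indicator {0<..} r * exp (- \<beta> * r)) = (\<integral>\<^sup>+r. ennreal (1 / \<beta>) * ennreal (exponential_density \<beta> r) \<partial>lborel)"
  proof (rule nn_integral_cong_AE)
    have "AE r in lborel. r \<noteq> (0 :: real)" by (rule AE_lborel_singleton)
    then show "AE r in lborel. ennreal (indicator {0<..} r * exp (- \<beta> * r)) = ennreal (1 / \<beta>) * ennreal (exponential_density \<beta> r)"
    proof eventually_elim
      case (elim r)
      then show ?case using \<beta> by (auto simp: exponential_density_def indicator_def ennreal_mult'[symmetric] mult_ac)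
    qed
  qed
  ultimately show ?thesis by (simp add: nn_integral_cmult)
qed

lemma nn_integral_powr_near_0:
  assumes "-1 < a" "0 \<le> c"
  shows "nnE lborel (\<lambda>r. indicator {0..c} r * r powr a) = ennreal (c powr (a + 1) / (a + 1))"
proof (rule nn_integral_has_integral_lborel)
  have eq: "(\<lambda>r. indicator {0..c} r * r powr a) = (\<lambda>r. if r \<in> {0..c} then r powr a else 0)" by (auto simp: indicator_def)
  show "((\<lambda>r. indicator {0..c} r * r powr a) has_integral c powr (a + 1) / (a + 1)) UNIV"
    unfolding eq has_integral_restrict_UNIV by (rule has_integral_powr_from_0[OF assms])
qed auto

text \<open>In the variable r = t - s the integral is split at 1/\<beta>: the singular part gives
  2/sqrt \<beta> and the exponential tail 1/sqrt \<beta>. The decay in \<beta> is what makes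
  iterations of the mild equation contract.\<close>

lemma time_weight:
  assumes t: "0 < t" and \<beta>: "0 < \<beta>"
  shows "nnE lborel (\<lambda>s. indicator {0<..<t} s * (1 / sqrt (t - s) * exp (\<beta> * s))) \<le> ennreal (3 * exp (\<beta> * t) / sqrt \<beta>)"
proof -
  have b: "indicator {0<..<t} (t - r) * (1 / sqrt r * exp (\<beta> * (t - r))) \<le>
    exp (\<beta> * t) * (indicator {0..1 / \<beta>} r * r powr (- 1 / 2)) + exp (\<beta> * t) * sqrt \<beta> * (indicator {0<..} r * exp (- \<beta> * r))" for r
  proof (cases "0 < r \<and> r < t")
    case True
    then have r: "0 < r" by simp
    have e: "exp (\<beta> * (t - r)) = exp (\<beta> * t) * exp (- \<beta> * r)" by (simp add: exp_add[symmetric] algebra_simps)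
    have p: "r powr (- 1 / 2) = 1 / sqrt r" using r by (simp add: powr_minus_divide powr_half_sqrt)
    show ?thesis
    proof (cases "r \<le> 1 / \<beta>")
      case True
      have "1 / sqrt r * exp (- \<beta> * r) \<le> 1 / sqrt r * 1" using r \<beta> by (intro mult_left_mono) auto
      then have "exp (\<beta> * t) * (1 / sqrt r * exp (- \<beta> * r)) \<le> exp (\<beta> * t) * (1 / sqrt r)" by (intro mult_left_mono) auto
      moreover have "0 \<le> exp (\<beta> * t) * sqrt \<beta> * exp (- \<beta> * r)" using \<beta> by simp
      ultimately show ?thesis using True r \<open>0 < r \<and> r < t\<close> unfolding e p by (simp add: mult_ac)
    next
      case False
      then have "1 / \<beta> \<le> r" by simp
      then have "1 \<le> \<beta> * r" using \<beta> by (simp add: field_simps)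
      then have "1 \<le> sqrt \<beta> * sqrt r" by (simp add: real_sqrt_mult[symmetric])
      then have "1 / sqrt r \<le> sqrt \<beta>" using r by (simp add: field_simps)
      then have "1 / sqrt r * (exp (\<beta> * t) * exp (- \<beta> * r)) \<le> sqrt \<beta> * (exp (\<beta> * t) * exp (- \<beta> * r))" by (intro mult_right_mono) auto
      then show ?thesis using False r \<open>0 < r \<and> r < t\<close> unfolding e p by (simp add: mult_ac)
    qed
  qed (use \<beta> in \<open>auto simp: indicator_def\<close>)
  have "(nnE lborel (\<lambda>s. indicator {0<..<t} s * (1 / sqrt (t - s) * exp (\<beta> * s))))
      = nnE lborel (\<lambda>r. indicator {0<..<t} (t - r) * (1 / sqrt r * exp (\<beta> * (t - r))))"
    by (subst nn_integral_real_affine[where c = "-1" and t = t]) auto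
  also have "... \<le> (\<integral>\<^sup>+r. ennreal (exp (\<beta> * t)) * ennreal (indicator {0..1 / \<beta>} r * r powr (- 1 / 2)) + ennreal (exp (\<beta> * t) * sqrt \<beta>) * ennreal (indicator {0<..} r * exp (- \<beta> * r)) \<partial>lborel)"
    using ennreal_leI[OF b] \<beta> by (intro nn_integral_mono) (simp add: ennreal_mult' ennreal_plus)
  also have "... = ennreal (exp (\<beta> * t)) * ennreal ((1 / \<beta>) powr (1 / 2) / (1 / 2)) + ennreal (exp (\<beta> * t) * sqrt \<beta>) * ennreal (1 / \<beta>)"
    using nn_integral_powr_near_0[of "-1/2" "1 / \<beta>"] nn_integral_exp_decay[OF \<beta>] \<beta>
    by (subst nn_integral_add) (auto simp: nn_integral_cmult)
  also have "... = ennreal (exp (\<beta> * t) * ((1 / \<beta>) powr (1 / 2) / (1 / 2)) + exp (\<beta> * t) * sqrt \<beta> * (1 / \<beta>))"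
    using \<beta> by (simp add: ennreal_mult'[symmetric] ennreal_plus[symmetric] del: ennreal_plus)
  also have "exp (\<beta> * t) * ((1 / \<beta>) powr (1 / 2) / (1 / 2)) + exp (\<beta> * t) * sqrt \<beta> * (1 / \<beta>) = 3 * exp (\<beta> * t) / sqrt \<beta>"
  proof -
    have "(1 / \<beta>) powr (1 / 2) = 1 / sqrt \<beta>" using \<beta> by (simp add: powr_half_sqrt real_sqrt_divide)
    moreover have "sqrt \<beta> * (1 / \<beta>) = 1 / sqrt \<beta>" using \<beta> by (simp add: field_simps)
    then have "exp (\<beta> * t) * sqrt \<beta> * (1 / \<beta>) = exp (\<beta> * t) * (1 / sqrt \<beta>)" by (simp only: mult.assoc)
    ultimately show ?thesis by simp
  qed
  finally show ?thesis .
qed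

lemma heat_kernel_continuous: "continuous_on ({..<t} \<times> UNIV) (\<lambda>(s, y). heat_kernel (t - s) (y - x))"
  unfolding heat_kernel_def case_prod_beta by (intro continuous_intros) auto

lemma heat_kernel_indicator_measurable[measurable]:
  "(\<lambda>z. indicator {0<..<t} (fst z) * heat_kernel (t - fst z) (snd z - x)) \<in> borel_measurable (borel :: (real \<times> real) measure)"
proof -
  have S: "{..<t} \<times> (UNIV :: real set) \<in> sets borel" by (simp add: borel_prod[symmetric])
  have "(\<lambda>z. indicator ({..<t} \<times> UNIV) z *\<^sub>R (\<lambda>(s, y). heat_kernel (t - s) (y - x)) z) \<in> borel_measurable borel"
    using borel_measurable_continuous_on_restrict[OF heat_kernel_continuous[of t x]] S by (subst (asm) borel_measurable_restrict_space_iff) auto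
  note [measurable] = this
  have "(\<lambda>z. indicator {0<..} (fst z) * (indicator ({..<t} \<times> UNIV) z *\<^sub>R (\<lambda>(s, y). heat_kernel (t - s) (y - x)) z)) \<in> borel_measurable borel"
    by measurable
  then show ?thesis by (rule measurable_cong[THEN iffD1, rotated]) (auto simp: indicator_def split: prod.splits)
qed

text \<open>The squared kernel is at most 1/sqrt(t - s) times a heat density, so integration in
  space only sees the bound \<open>c\<close> and integration in time is \<open>time_weight\<close>.
  Nonconstant \<open>W\<close> is for the localization.\<close>

lemma heat_kernel_weight:
  assumes t: "0 < t" and \<beta>: "0 < \<beta>" and W[measurable]: "W \<in> borel_measurable borel" and W0: "\<And>y. 0 \<le> W y" and c: "0 \<le> c"
    and Wc: "\<And>r. 0 < r \<Longrightarrow> r < t \<Longrightarrow> nnE lborel (\<lambda>y. heat_kernel r (y - x) * W y) \<le> ennreal c"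
  shows "(nnE lborel (\<lambda>z. indicator {0<..<t} (fst z) * ((heat_kernel (t - fst z) (snd z - x))\<^sup>2 * (exp (\<beta> * fst z) * W (snd z)))))
     \<le> ennreal (c * (3 * exp (\<beta> * t) / sqrt \<beta>))"
proof -
  have "(\<lambda>z. (indicator {0<..<t} (fst z) * heat_kernel (t - fst z) (snd z - x))\<^sup>2 * (exp (\<beta> * fst z) * W (snd z))) \<in> borel_measurable borel"
    by measurable
  also have "(\<lambda>z. (indicator {0<..<t} (fst z) * heat_kernel (t - fst z) (snd z - x))\<^sup>2 * (exp (\<beta> * fst z) * W (snd z))) =
    (\<lambda>z. indicator {0<..<t} (fst z) * ((heat_kernel (t - fst z) (snd z - x))\<^sup>2 * (exp (\<beta> * fst z) * W (snd z))))" by (auto simp: indicator_def fun_eq_iff)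
  finally have m: "(\<lambda>z. ennreal (indicator {0<..<t} (fst z) * ((heat_kernel (t - fst z) (snd z - x))\<^sup>2 * (exp (\<beta> * fst z) * W (snd z))))) \<in> borel_measurable borel" by measurable
  have "(nnE lborel (\<lambda>z. indicator {0<..<t} (fst z) * ((heat_kernel (t - fst z) (snd z - x))\<^sup>2 * (exp (\<beta> * fst z) * W (snd z)))))
     = (\<integral>\<^sup>+s. (nnE lborel (\<lambda>y. indicator {0<..<t} s * ((heat_kernel (t - s) (y - x))\<^sup>2 * (exp (\<beta> * s) * W y)))) \<partial>lborel)"
    by (rule nn_integral_plane[OF m])
  also have "... \<le> (\<integral>\<^sup>+s. ennreal c * ennreal (indicator {0<..<t} s * (1 / sqrt (t - s) * exp (\<beta> * s))) \<partial>lborel)"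
  proof (rule nn_integral_mono)
    fix s
    show "nnE lborel (\<lambda>y. indicator {0<..<t} s * ((heat_kernel (t - s) (y - x))\<^sup>2 * (exp (\<beta> * s) * W y))) \<le> ennreal c * ennreal (indicator {0<..<t} s * (1 / sqrt (t - s) * exp (\<beta> * s)))"
    proof (cases "0 < s \<and> s < t")
      case True
      then have r: "0 < t - s" by simp
      have "(nnE lborel (\<lambda>y. indicator {0<..<t} s * ((heat_kernel (t - s) (y - x))\<^sup>2 * (exp (\<beta> * s) * W y))))
        \<le> (\<integral>\<^sup>+y. ennreal (1 / sqrt (t - s) * exp (\<beta> * s)) * ennreal (heat_kernel (t - s) (y - x) * W y) \<partial>lborel)"
      proof (rule nn_integral_mono)
        fix y
        have "(heat_kernel (t - s) (y - x))\<^sup>2 \<le> 1 / sqrt (t - s) * heat_kernel (t - s) (y - x)"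
          unfolding power2_eq_square using heat_kernel_le[OF r] heat_kernel_nonneg[OF r] by (intro mult_right_mono)
        then have "(heat_kernel (t - s) (y - x))\<^sup>2 * (exp (\<beta> * s) * W y) \<le> (1 / sqrt (t - s) * heat_kernel (t - s) (y - x)) * (exp (\<beta> * s) * W y)"
          using W0[of y] by (intro mult_right_mono) auto
        then have "indicator {0<..<t} s * ((heat_kernel (t - s) (y - x))\<^sup>2 * (exp (\<beta> * s) * W y)) \<le> (1 / sqrt (t - s) * exp (\<beta> * s)) * (heat_kernel (t - s) (y - x) * W y)"
          using True by (simp add: mult_ac)
        then show "ennreal (indicator {0<..<t} s * ((heat_kernel (t - s) (y - x))\<^sup>2 * (exp (\<beta> * s) * W y))) \<le> ennreal (1 / sqrt (t - s) * exp (\<beta> * s)) * ennreal (heat_kernel (t - s) (y - x) * W y)"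
          using r by (subst ennreal_mult'[symmetric]) (auto intro: ennreal_leI)
      qed
      also have "... = ennreal (1 / sqrt (t - s) * exp (\<beta> * s)) * nnE lborel (\<lambda>y. heat_kernel (t - s) (y - x) * W y)"
        by (rule nn_integral_cmult) measurable
      also have "... \<le> ennreal (1 / sqrt (t - s) * exp (\<beta> * s)) * ennreal c"
        using True by (intro mult_left_mono Wc) auto
      finally show ?thesis using True by (simp add: mult.commute)
    qed simp
  qed
  also have "... = ennreal c * nnE lborel (\<lambda>s. indicator {0<..<t} s * (1 / sqrt (t - s) * exp (\<beta> * s)))"
    by (rule nn_integral_cmult) measurable
  also have "... \<le> ennreal c * ennreal (3 * exp (\<beta> * t) / sqrt \<beta>)" by (intro mult_left_mono time_weight t \<beta>) simp
  also have "... = ennreal (c * (3 * exp (\<beta> * t) / sqrt \<beta>))" using c by (rule ennreal_mult'[symmetric])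
  finally show ?thesis .
qed

lemma kernel_heat:
  assumes t: "0 < t" shows "kernel t (\<lambda>s y. heat_kernel (t - s) (y - x))"
  unfolding kernel_def
proof (intro conjI t heat_kernel_continuous)
  have "(nnE lborel (\<lambda>z. indicator {0<..<t} (fst z) * (heat_kernel (t - fst z) (snd z - x))\<^sup>2))
     \<le> nnE lborel (\<lambda>z. indicator {0<..<t} (fst z) * ((heat_kernel (t - fst z) (snd z - x))\<^sup>2 * (exp (1 * fst z) * 1)))"
  proof (intro nn_integral_mono ennreal_leI)
    fix z :: "real \<times> real"
    show "indicator {0<..<t} (fst z) * (heat_kernel (t - fst z) (snd z - x))\<^sup>2 \<le> indicator {0<..<t} (fst z) * ((heat_kernel (t - fst z) (snd z - x))\<^sup>2 * (exp (1 * fst z) * 1))"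
      using mult_left_mono[of 1 "exp (fst z)" "(heat_kernel (t - fst z) (snd z - x))\<^sup>2"] by (auto simp: indicator_def)
  qed
  also have "... \<le> ennreal (1 * (3 * exp (1 * t) / sqrt 1))"
    by (rule heat_kernel_weight[OF t, where W = "\<lambda>_. 1"]) (auto simp: nn_integral_heat_kernel)
  also have "... < \<infinity>" by simp
  finally show "nnE lborel (\<lambda>z. indicator {0<..<t} (fst z) * (heat_kernel (t - fst z) (snd z - x))\<^sup>2) < \<infinity>" .
qed

text \<open>The derivative is z/r times the kernel, and it is bounded by 1/r because sqrt(2 v)
  exp(-v) is at most 1 for v = z^2/(2 r).\<close>

lemma heat_kernel_diff_le:
  assumes r: "0 < r"
  shows "\<bar>heat_kernel r a - heat_kernel r b\<bar> \<le> \<bar>a - b\<bar> / r"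
proof -
  have der: "((\<lambda>z. heat_kernel r z) has_field_derivative (- (z / r) * heat_kernel r z)) (at z within UNIV)" for z
    unfolding heat_kernel_def using r by (auto intro!: derivative_eq_intros simp: field_simps power2_eq_square)
  have bd: "norm (- (z / r) * heat_kernel r z) \<le> 1 / r" for z
  proof -
    define wd where "wd = z\<^sup>2 / (2 * r)"
    have w0: "0 \<le> wd" using r by (simp add: wd_def)
    have "1 + wd \<le> exp wd" by simp
    moreover have "sqrt (2 * wd) \<le> 1 + wd"
    proof (rule real_le_lsqrt)
      show "2 * wd \<le> (1 + wd)\<^sup>2" using w0 by (simp add: power2_eq_square algebra_simps)
    qed (use w0 in auto)
    ultimately have "sqrt (2 * wd) \<le> exp wd" by linarith
    then have 1: "sqrt (2 * wd) * exp (- wd) \<le> 1" by (simp add: exp_minus field_simps)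
    have "\<bar>z\<bar> = sqrt (2 * wd) * sqrt r" using r by (simp add: wd_def real_sqrt_mult[symmetric])
    then have "\<bar>z\<bar> * heat_kernel r z = (sqrt (2 * wd) * exp (- wd)) * (sqrt r / sqrt (2 * pi * r))" by (simp add: heat_kernel_def wd_def)
    also have "... \<le> 1 * 1"
    proof (rule mult_mono[OF 1])
      have "sqrt r \<le> sqrt (2 * pi * r)" using r pi_ge_two by (intro real_sqrt_le_mono) simp
      then show "sqrt r / sqrt (2 * pi * r) \<le> 1" using r by (simp add: divide_le_eq)
    qed (use r in auto)
    finally show ?thesis using r heat_kernel_nonneg[OF r, of z] by (simp add: abs_mult divide_right_mono)
  qed
  have "norm (heat_kernel r a - heat_kernel r b) \<le> 1 / r * norm (a - b)"
    by (rule field_differentiable_bound[OF convex_UNIV der bd]) auto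
  then show ?thesis by simp
qed

text \<open>One factor of the square is bounded by the geometric mean of d/r and 1/sqrt r, that is
  sqrt d times r^(-3/4), which is integrable at 0; the other factor has mass at most 2. The power of
  d is not optimal, but chaining with high moments works with any positive power.\<close>

lemma kernel_heat_diff:
  fixes x x' :: real
  assumes t: "0 < t"
  defines "ker \<equiv> \<lambda>s y. heat_kernel (t - s) (y - x) - heat_kernel (t - s) (y - x')"
  shows "nnE lborel (\<lambda>z. indicator {0<..<t} (fst z) * (ker (fst z) (snd z))\<^sup>2) \<le> ennreal (8 * t powr (1/4) * sqrt \<bar>x - x'\<bar>)"
    and "kernel t ker"
proof -
  define d where "d = \<bar>x - x'\<bar>"
  note hm = heat_kernel_indicator_measurable[of t x] heat_kernel_indicator_measurable[of t x']
  have "(\<lambda>z. (indicator {0<..<t} (fst z) * heat_kernel (t - fst z) (snd z - x) - indicator {0<..<t} (fst z) * heat_kernel (t - fst z) (snd z - x'))\<^sup>2) \<in> borel_measurable borel"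
    by measurable
  also have "(\<lambda>z. (indicator {0<..<t} (fst z) * heat_kernel (t - fst z) (snd z - x) - indicator {0<..<t} (fst z) * heat_kernel (t - fst z) (snd z - x'))\<^sup>2)
    = (\<lambda>z. indicator {0<..<t} (fst z) * (ker (fst z) (snd z))\<^sup>2)" by (auto simp: indicator_def fun_eq_iff ker_def)
  finally have m: "(\<lambda>z. ennreal (indicator {0<..<t} (fst z) * (ker (fst z) (snd z))\<^sup>2)) \<in> borel_measurable borel" by measurable
  have "nnE lborel (\<lambda>z. indicator {0<..<t} (fst z) * (ker (fst z) (snd z))\<^sup>2) = (\<integral>\<^sup>+s. (nnE lborel (\<lambda>y. indicator {0<..<t} s * (ker s y)\<^sup>2)) \<partial>lborel)"
    by (rule nn_integral_plane[OF m])
  also have "... \<le> (\<integral>\<^sup>+s. ennreal (2 * sqrt d) * ennreal (indicator {0<..<t} s * (t - s) powr (-3/4)) \<partial>lborel)"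
  proof (rule nn_integral_mono)
    fix s
    show "nnE lborel (\<lambda>y. indicator {0<..<t} s * (ker s y)\<^sup>2) \<le> ennreal (2 * sqrt d) * ennreal (indicator {0<..<t} s * (t - s) powr (-3/4))"
    proof (cases "0 < s \<and> s < t")
      case True
      define r where "r = t - s"
      have r: "0 < r" using True by (simp add: r_def)
      have kb: "\<bar>ker s y\<bar> \<le> sqrt d * r powr (-3/4)" for y
      proof -
        have 1: "\<bar>ker s y\<bar> \<le> d / r" using heat_kernel_diff_le[OF r, of "y - x" "y - x'"] by (simp add: ker_def r_def[symmetric] d_def abs_minus_commute)
        have 2: "\<bar>ker s y\<bar> \<le> 1 / sqrt r"
          using heat_kernel_le[OF r, of "y - x"] heat_kernel_le[OF r, of "y - x'"] heat_kernel_nonneg[OF r, of "y - x"] heat_kernel_nonneg[OF r, of "y - x'"]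
          unfolding ker_def r_def[symmetric] by linarith
        have "\<bar>ker s y\<bar>\<^sup>2 \<le> (d / r) * (1 / sqrt r)" unfolding power2_eq_square using 1 2 by (intro mult_mono) (auto simp: d_def r_def intro: order_trans[OF abs_ge_zero])
        then have "\<bar>ker s y\<bar> \<le> sqrt ((d / r) * (1 / sqrt r))" by (rule real_le_rsqrt)
        also have "... = sqrt d * sqrt (1 / (r * sqrt r))" by (simp add: real_sqrt_mult[symmetric] real_sqrt_divide)
        also have "sqrt (1 / (r * sqrt r)) = r powr (-3/4)"
        proof -
          have "1 / (r * sqrt r) = r powr (-3/2)" using r by (simp add: powr_half_sqrt[symmetric] powr_mult_base powr_minus_divide)
          also have "sqrt (r powr (-3/2)) = r powr (-3/4)" using r by (simp add: powr_half_sqrt[symmetric] powr_powr)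
          finally show ?thesis .
        qed
        finally show ?thesis .
      qed
      have "(nnE lborel (\<lambda>y. indicator {0<..<t} s * (ker s y)\<^sup>2))
        \<le> (\<integral>\<^sup>+y. ennreal (sqrt d * r powr (-3/4)) * (ennreal (heat_kernel r (y - x)) + ennreal (heat_kernel r (y - x'))) \<partial>lborel)"
      proof (rule nn_integral_mono)
        fix y
        have "\<bar>ker s y\<bar> \<le> heat_kernel r (y - x) + heat_kernel r (y - x')"
          using heat_kernel_nonneg[OF r, of "y - x"] heat_kernel_nonneg[OF r, of "y - x'"] unfolding ker_def r_def[symmetric] by linarith
        then have "\<bar>ker s y\<bar> * \<bar>ker s y\<bar> \<le> (sqrt d * r powr (-3/4)) * (heat_kernel r (y - x) + heat_kernel r (y - x'))"
          using kb[of y] by (intro mult_mono) (auto simp: d_def)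
        then have "indicator {0<..<t} s * (ker s y)\<^sup>2 \<le> (sqrt d * r powr (-3/4)) * (heat_kernel r (y - x) + heat_kernel r (y - x'))"
          using True by (simp add: power2_eq_square)
        then show "ennreal (indicator {0<..<t} s * (ker s y)\<^sup>2) \<le> ennreal (sqrt d * r powr (-3/4)) * (ennreal (heat_kernel r (y - x)) + ennreal (heat_kernel r (y - x')))"
          using heat_kernel_nonneg[OF r, of "y - x"] heat_kernel_nonneg[OF r, of "y - x'"]
          by (simp add: ennreal_plus[symmetric] ennreal_mult[symmetric] ennreal_leI d_def del: ennreal_plus)
      qed
      also have "... = ennreal (sqrt d * r powr (-3/4)) * 2"
        by (simp add: nn_integral_cmult nn_integral_add nn_integral_heat_kernel r one_add_one)
      also have "... = ennreal (2 * sqrt d) * ennreal (indicator {0<..<t} s * (t - s) powr (-3/4))"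
        using True by (simp add: r_def[symmetric] ennreal_mult d_def mult_ac)
      finally show ?thesis .
    qed simp
  qed
  also have "... = ennreal (2 * sqrt d) * nnE lborel (\<lambda>s. indicator {0<..<t} s * (t - s) powr (-3/4))"
    by (rule nn_integral_cmult) measurable
  also have "nnE lborel (\<lambda>s. indicator {0<..<t} s * (t - s) powr (-3/4)) = nnE lborel (\<lambda>r. indicator {0<..<t} (t - r) * r powr (-3/4))"
    by (subst nn_integral_real_affine[where c = "-1" and t = t]) auto
  also have "ennreal (2 * sqrt d) * ... \<le> ennreal (2 * sqrt d) * nnE lborel (\<lambda>r. indicator {0..t} r * r powr (-3/4))"
    by (intro mult_left_mono nn_integral_mono ennreal_leI) (auto simp: indicator_def)
  also have "... = ennreal (2 * sqrt d) * ennreal (t powr (1/4) / (1/4))"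
    using nn_integral_powr_near_0[of "-3/4" t] t by simp
  also have "... = ennreal (8 * t powr (1/4) * sqrt d)"
    by (subst ennreal_mult[symmetric]) (auto simp: d_def mult_ac)
  finally show a: "nnE lborel (\<lambda>z. indicator {0<..<t} (fst z) * (ker (fst z) (snd z))\<^sup>2) \<le> ennreal (8 * t powr (1/4) * sqrt \<bar>x - x'\<bar>)"
    unfolding d_def .
  have "continuous_on ({..<t} \<times> UNIV) (\<lambda>(s, y). ker s y)"
    using heat_kernel_continuous[of t x] heat_kernel_continuous[of t x'] unfolding ker_def case_prod_beta by (intro continuous_on_diff)
  then show "kernel t ker" using t a by (auto simp: kernel_def intro: le_less_trans)
qed

section \<open>Moments of the solution and of its increments\<close>

context she
begin

lemma \<sigma>_moment_le:
  assumes "X \<in> borel_measurable M" "0 \<le> b" "nnE M (\<lambda>w. X w ^ (2 * q)) \<le> ennreal (b ^ q)"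
  shows "nnE M (\<lambda>w. \<sigma> (X w) ^ (2 * q)) \<le> ennreal ((L\<^sup>2 * b) ^ q)"
proof -
  have "nnE M (\<lambda>w. \<sigma> (X w) ^ (2 * q)) \<le> (\<integral>\<^sup>+w. ennreal (L ^ (2 * q)) * ennreal (X w ^ (2 * q)) \<partial>M)"
  proof (rule nn_integral_mono)
    fix w
    have "\<bar>\<sigma> (X w)\<bar> ^ (2 * q) \<le> (L * \<bar>X w\<bar>) ^ (2 * q)" by (intro power_mono \<sigma>_le) auto
    then have "\<sigma> (X w) ^ (2 * q) \<le> L ^ (2 * q) * X w ^ (2 * q)" by (simp add: power_mult_distrib power_even_abs)
    then show "ennreal (\<sigma> (X w) ^ (2 * q)) \<le> ennreal (L ^ (2 * q)) * ennreal (X w ^ (2 * q))" using L by (simp add: ennreal_mult'[symmetric] ennreal_leI)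
  qed
  also have "... = ennreal (L ^ (2 * q)) * nnE M (\<lambda>w. X w ^ (2 * q))" using assms by (intro nn_integral_cmult) auto
  also have "... \<le> ennreal (L ^ (2 * q)) * ennreal (b ^ q)" by (intro mult_left_mono assms) auto
  also have "... = ennreal ((L\<^sup>2 * b) ^ q)" using L by (simp add: ennreal_mult'[symmetric] power_mult_distrib power_mult)
  finally show ?thesis .
qed

text \<open>The square of 12 (2q - 1) L^2, chosen so that \<open>moment_step\<close> contracts by
  1/2. Its quadratic growth in \<open>q\<close> is the source of the cubic exponent of the
  moments.\<close>

definition growth_rate :: "nat \<Rightarrow> real" where "growth_rate q = 144 * (2 * real q - 1)\<^sup>2 * L ^ 4"

lemma growth_rate_pos: "1 \<le> q \<Longrightarrow> 0 < growth_rate q"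
  using L by (simp add: growth_rate_def)

text \<open>(1 + J)^2 is at most 2 + 2 J^2, and with the chosen rate the stochastic integral
  contributes at most \<open>N / 2\<close> in the norm weighted by exp(-\<beta> s).\<close>

lemma moment_step:
  assumes q: "1 \<le> q" and T: "0 < T" and N: "0 \<le> N"
    and bd: "\<And>s x. 0 \<le> s \<Longrightarrow> s \<le> T \<Longrightarrow> nnE M (\<lambda>w. u s x w ^ (2 * q)) \<le> ennreal ((N * exp (growth_rate q * s)) ^ q)"
    and t: "0 \<le> t" "t \<le> T"
  shows "nnE M (\<lambda>w. u t x w ^ (2 * q)) \<le> ennreal (((2 + N / 2) * exp (growth_rate q * t)) ^ q)"
proof (cases "t = 0")
  case True
  have "nnE M (\<lambda>w. u 0 x w ^ (2 * q)) = (\<integral>\<^sup>+w. 1 \<partial>M)" by (rule nn_integral_cong) (simp add: u_0)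
  also have "... = ennreal (1 ^ q)" by (simp add: emeasure_space_1)
  also have "... \<le> ennreal ((2 + N / 2) ^ q)" using N by (intro ennreal_leI power_mono) auto
  finally show ?thesis using True by simp
next
  case False
  with t have t0: "0 < t" by simp
  define \<beta> where "\<beta> = growth_rate q"
  have \<beta>: "0 < \<beta>" using growth_rate_pos[OF q] by (simp add: \<beta>_def)
  obtain J where hw: "has_walsh_integral M \<xi> (\<lambda>s y w. indicator {0<..<t} s * heat_kernel (t - s) (y - x) * \<sigma> (u s y w)) J"
    and uJ: "AE w in M. u t x w = 1 + J w" by (rule u_mild[OF t0])
  have [measurable]: "J \<in> borel_measurable M" using hw by (simp add: has_walsh_integral_def)
  define I where "I = L\<^sup>2 * N * (3 * exp (\<beta> * t) / sqrt \<beta>)"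
  have I0: "0 \<le> I" using N \<beta> by (simp add: I_def)
  have sb: "sqrt \<beta> = 12 * (2 * real q - 1) * L\<^sup>2"
  proof -
    have "\<beta> = (12 * (2 * real q - 1) * L\<^sup>2)\<^sup>2" unfolding \<beta>_def growth_rate_def by algebra
    then show ?thesis using q by (simp add: real_sqrt_abs abs_mult)
  qed
  have J2: "nnE M (\<lambda>w. J w ^ (2 * q)) \<le> ennreal (((2 * real q - 1) * I) ^ q)"
  proof (rule walsh_moment_le[OF kernel_heat[OF t0] walsh_approximable[OF kernel_heat[OF t0] hw], where D = "\<lambda>s y. exp (\<beta> * s) * (L\<^sup>2 * N)"])
    show "continuous_on ({0..t} \<times> UNIV) (\<lambda>(s, y). exp (\<beta> * s) * (L\<^sup>2 * N))" unfolding case_prod_beta by (intro continuous_intros)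
    show "nnE M (\<lambda>w. \<sigma> (u s y w) ^ (2 * q)) \<le> ennreal ((exp (\<beta> * s) * (L\<^sup>2 * N)) ^ q)" if "0 \<le> s" "s < t" for s y
      using \<sigma>_moment_le[OF u_measurable[OF that(1)] _ bd[OF that(1)], of y] that t N by (simp add: \<beta>_def mult_ac)
    show "nnE lborel (\<lambda>z. indicator {0<..<t} (fst z) * ((heat_kernel (t - fst z) (snd z - x))\<^sup>2 * (exp (\<beta> * fst z) * (L\<^sup>2 * N)))) \<le> ennreal I"
      unfolding I_def
    proof (rule heat_kernel_weight[OF t0 \<beta>, where W = "\<lambda>_. L\<^sup>2 * N"])
      show "nnE lborel (\<lambda>y. heat_kernel r (y - x) * (L\<^sup>2 * N)) \<le> ennreal (L\<^sup>2 * N)" if "0 < r" for r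
        using N that by (simp add: ennreal_mult'' nn_integral_multc nn_integral_heat_kernel)
    qed (use N in auto)
  qed (use N q I0 in auto)
  have small: "2 * ((2 * real q - 1) * I) \<le> N / 2 * exp (\<beta> * t)"
  proof -
    have q1: "0 < 2 * real q - 1" using q by simp
    have "2 * ((2 * real q - 1) * I) * sqrt \<beta> = (N / 2 * exp (\<beta> * t)) * sqrt \<beta>"
    proof -
      have "I * sqrt \<beta> = L\<^sup>2 * N * (3 * exp (\<beta> * t))" using \<beta> by (simp add: I_def)
      then have "2 * ((2 * real q - 1) * I) * sqrt \<beta> = 2 * ((2 * real q - 1) * (L\<^sup>2 * N * (3 * exp (\<beta> * t))))" by (simp only: mult.assoc)
      also have "... = (N / 2 * exp (\<beta> * t)) * (12 * (2 * real q - 1) * L\<^sup>2)" by (simp add: algebra_simps)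
      finally show ?thesis unfolding sb .
    qed
    then show ?thesis using \<beta> by simp
  qed
  have "nnE M (\<lambda>w. u t x w ^ (2 * q)) = nnE M (\<lambda>w. (1 + J w) ^ (2 * q))"
    using uJ by (intro nn_integral_cong_AE) (auto elim: eventually_mono)
  also have "... \<le> nnE M (\<lambda>w. (2 + 2 * (J w)\<^sup>2) ^ q)"
  proof (intro nn_integral_mono ennreal_leI)
    fix w
    have "(1 + J w)\<^sup>2 \<le> 2 + 2 * (J w)\<^sup>2" using zero_le_power2[of "1 - J w"] by (simp add: power2_eq_square algebra_simps)
    then show "(1 + J w) ^ (2 * q) \<le> (2 + 2 * (J w)\<^sup>2) ^ q" unfolding power_mult by (intro power_mono) auto
  qed
  also have "... \<le> ennreal ((2 + 2 * ((2 * real q - 1) * I)) ^ q)"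
  proof (rule moment_add_le)
    show "nnE M (\<lambda>w. 2 ^ q) \<le> ennreal (2 ^ q)" by (simp add: emeasure_space_1)
    have "nnE M (\<lambda>w. (2 * (J w)\<^sup>2) ^ q) = ennreal (2 ^ q) * nnE M (\<lambda>w. J w ^ (2 * q))"
      by (subst nn_integral_cmult[symmetric]) (auto simp: power_mult_distrib power_mult ennreal_mult')
    also have "... \<le> ennreal (2 ^ q) * ennreal (((2 * real q - 1) * I) ^ q)" by (intro mult_left_mono J2) simp
    also have "... = ennreal ((2 * ((2 * real q - 1) * I)) ^ q)" unfolding power_mult_distrib[of 2] by (rule ennreal_mult'[symmetric]) simp
    finally show "nnE M (\<lambda>w. (2 * (J w)\<^sup>2) ^ q) \<le> ennreal ((2 * ((2 * real q - 1) * I)) ^ q)" .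
  qed (use I0 q in auto)
  also have "... \<le> ennreal (((2 + N / 2) * exp (\<beta> * t)) ^ q)"
  proof (intro ennreal_leI power_mono)
    have "1 \<le> exp (\<beta> * t)" using \<beta> t0 by simp
    then show "2 + 2 * ((2 * real q - 1) * I) \<le> (2 + N / 2) * exp (\<beta> * t)" using small unfolding distrib_right by linarith
  qed (use I0 q in auto)
  finally show ?thesis by (simp add: \<beta>_def)
qed

text \<open>The map N -> 2 + N/2 has the fixed point 4, approached geometrically. Some finite bound
  is needed to start; the definition of a mild solution supplies it on [0, t + 1].\<close>

theorem u_moment_le:
  assumes q: "1 \<le> q" and t: "0 \<le> t"
  shows "nnE M (\<lambda>w. u t x w ^ (2 * q)) \<le> ennreal ((4 * exp (growth_rate q * t)) ^ q)"
proof -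
  define T where "T = t + 1"
  have T: "0 < T" using t by (simp add: T_def)
  obtain B where B: "0 \<le> B" "\<And>s x. 0 \<le> s \<Longrightarrow> s \<le> T \<Longrightarrow> nnE M (\<lambda>w. \<bar>u s x w\<bar> ^ (2 * q)) \<le> ennreal B"
    by (rule u_moment_bounded[OF T, of "2 * q"]) (use q in auto)
  define N where "N = max B 1"
  have N: "1 \<le> N" "B \<le> N ^ q"
  proof -
    show N1: "1 \<le> N" by (simp add: N_def)
    have "B \<le> N" by (simp add: N_def)
    also have "N \<le> N ^ q" using power_increasing[OF q N1] by simp
    finally show "B \<le> N ^ q" .
  qed
  have "\<forall>s x. 0 \<le> s \<longrightarrow> s \<le> T \<longrightarrow> (nnE M (\<lambda>w. u s x w ^ (2 * q))) \<le> ennreal (((4 + N / 2 ^ n) * exp (growth_rate q * s)) ^ q)" for n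
  proof (induction n)
    case 0
    show ?case
    proof (intro allI impI)
      fix s x assume s: "0 \<le> s" "s \<le> T"
      have e1: "1 \<le> exp (growth_rate q * s)" using growth_rate_pos[OF q] s by simp
      have "N * 1 \<le> (4 + N) * exp (growth_rate q * s)" using N e1 by (intro mult_mono) auto
      then have "N ^ q \<le> ((4 + N / 2 ^ 0) * exp (growth_rate q * s)) ^ q" using N by (intro power_mono) auto
      then have "ennreal B \<le> ennreal (((4 + N / 2 ^ 0) * exp (growth_rate q * s)) ^ q)" using N by (intro ennreal_leI) simp
      then show "nnE M (\<lambda>w. u s x w ^ (2 * q)) \<le> ennreal (((4 + N / 2 ^ 0) * exp (growth_rate q * s)) ^ q)"
        using order_trans[OF B(2)[OF s, of x]] by (simp add: power_even_abs)
    qed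
  next
    case (Suc n)
    have e: "4 + N / 2 ^ Suc n = 2 + (4 + N / 2 ^ n) / 2" by simp
    have "0 \<le> 4 + N / 2 ^ n" using N by (intro add_nonneg_nonneg divide_nonneg_nonneg) auto
    then show ?case unfolding e using moment_step[OF q T, of "4 + N / 2 ^ n"] Suc by blast
  qed
  then have "nnE M (\<lambda>w. u t x w ^ (2 * q)) \<le> ennreal (((4 + N / 2 ^ n) * exp (growth_rate q * t)) ^ q)" for n
    using t by (simp add: T_def)
  moreover have "(\<lambda>n. N / 2 ^ n) \<longlonglongrightarrow> 0" by real_asymp
  then have "(\<lambda>n. ennreal (((4 + N / 2 ^ n) * exp (growth_rate q * t)) ^ q)) \<longlonglongrightarrow> ennreal (((4 + 0) * exp (growth_rate q * t)) ^ q)"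
    by (intro tendsto_ennrealI tendsto_intros)
  ultimately show ?thesis by (intro LIMSEQ_le_const[where a = "nnE M (\<lambda>w. u t x w ^ (2 * q))"]) auto
qed

text \<open>Both points share the final time \<open>t\<close>, so the increment is the integral of a
  difference of kernels, to which \<open>walsh_moment_le\<close> applies.\<close>

theorem u_increment_moment_le:
  assumes q: "1 \<le> q" and t: "0 < t"
  shows "(nnE M (\<lambda>w. (u t x w - u t x' w) ^ (2 * q)))
    \<le> ennreal (((2 * real q - 1) * (L\<^sup>2 * (4 * exp (growth_rate q * t)) * (8 * t powr (1/4) * sqrt \<bar>x - x'\<bar>))) ^ q)"
proof -
  obtain J where hw: "has_walsh_integral M \<xi> (\<lambda>s y w. indicator {0<..<t} s * heat_kernel (t - s) (y - x) * \<sigma> (u s y w)) J"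
    and uJ: "AE w in M. u t x w = 1 + J w" by (rule u_mild[OF t])
  obtain J' where hw': "has_walsh_integral M \<xi> (\<lambda>s y w. indicator {0<..<t} s * heat_kernel (t - s) (y - x') * \<sigma> (u s y w)) J'"
    and uJ': "AE w in M. u t x' w = 1 + J' w" by (rule u_mild[OF t])
  note app = approximable_diff[OF walsh_approximable[OF kernel_heat[OF t] hw] walsh_approximable[OF kernel_heat[OF t] hw']]
  define E where "E = 4 * exp (growth_rate q * t)"
  have "nnE M (\<lambda>w. (u t x w - u t x' w) ^ (2 * q)) = nnE M (\<lambda>w. (J w - J' w) ^ (2 * q))"
    using uJ uJ' by (intro nn_integral_cong_AE) (auto elim: eventually_mono)
  also have "... \<le> ennreal (((2 * real q - 1) * (L\<^sup>2 * E * (8 * t powr (1/4) * sqrt \<bar>x - x'\<bar>))) ^ q)"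
  proof (rule walsh_moment_le[OF kernel_heat_diff(2)[OF t] app, where D = "\<lambda>s y. L\<^sup>2 * E"])
    show "continuous_on ({0..t} \<times> UNIV) (\<lambda>(s, y). L\<^sup>2 * E)" unfolding case_prod_beta by (intro continuous_intros)
    show "nnE M (\<lambda>w. \<sigma> (u s y w) ^ (2 * q)) \<le> ennreal ((L\<^sup>2 * E) ^ q)" if "0 \<le> s" "s < t" for s y
    proof (rule \<sigma>_moment_le[OF u_measurable[OF that(1)]])
      have "4 * exp (growth_rate q * s) \<le> E" using that growth_rate_pos[OF q] by (simp add: E_def)
      then show "nnE M (\<lambda>w. u s y w ^ (2 * q)) \<le> ennreal (E ^ q)"
        by (intro order_trans[OF u_moment_le[OF q that(1)]] ennreal_leI power_mono) auto
    qed (simp add: E_def)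
    let ?ker = "\<lambda>s y. heat_kernel (t - s) (y - x) - heat_kernel (t - s) (y - x')"
    have "nnE lborel (\<lambda>z. indicator {0<..<t} (fst z) * ((?ker (fst z) (snd z))\<^sup>2 * (L\<^sup>2 * E))) = (\<integral>\<^sup>+z. ennreal (L\<^sup>2 * E) * ennreal (indicator {0<..<t} (fst z) * (?ker (fst z) (snd z))\<^sup>2) \<partial>lborel)"
      by (intro nn_integral_cong) (simp add: ennreal_mult'[symmetric] E_def mult_ac)
    also have "... = ennreal (L\<^sup>2 * E) * nnE lborel (\<lambda>z. indicator {0<..<t} (fst z) * (?ker (fst z) (snd z))\<^sup>2)"
    proof (rule nn_integral_cmult)
      have "(\<lambda>z. (indicator {0<..<t} (fst z) * ?ker (fst z) (snd z))\<^sup>2) \<in> borel_measurable borel"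
        using kernel_measurable[OF kernel_heat_diff(2)[OF t, of x x']] by measurable
      also have "(\<lambda>z. (indicator {0<..<t} (fst z) * ?ker (fst z) (snd z))\<^sup>2) = (\<lambda>z. indicator {0<..<t} (fst z) * (?ker (fst z) (snd z))\<^sup>2)"
        by (auto simp: indicator_def fun_eq_iff)
      finally show "(\<lambda>z. ennreal (indicator {0<..<t} (fst z) * (?ker (fst z) (snd z))\<^sup>2)) \<in> borel_measurable lborel" by simp
    qed
    also have "... \<le> ennreal (L\<^sup>2 * E) * ennreal (8 * t powr (1/4) * sqrt \<bar>x - x'\<bar>)" by (intro mult_left_mono kernel_heat_diff t) simp
    also have "... = ennreal (L\<^sup>2 * E * (8 * t powr (1/4) * sqrt \<bar>x - x'\<bar>))" by (rule ennreal_mult'[symmetric]) (simp add: E_def)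
    finally show "nnE lborel (\<lambda>z. indicator {0<..<t} (fst z) * ((?ker (fst z) (snd z))\<^sup>2 * (L\<^sup>2 * E))) \<le> ennreal (L\<^sup>2 * E * (8 * t powr (1/4) * sqrt \<bar>x - x'\<bar>))" .
  qed (use q in \<open>auto simp: E_def\<close>)
  finally show ?thesis by (simp add: E_def)
qed

end

section \<open>Upper bound for the dimension of tall peaks\<close>

text \<open>The allowed increments sum to \<Lambda>/2, as the powers (9/10)^l with l at least 1 sum
  to 9; the other half is left for the value at the left end. Every point is the limit of its dyadic
  roundings from below.\<close>

lemma dyadic_chaining:
  fixes f :: "real \<Rightarrow> real"
  assumes f: "continuous_on {a..a + 1} f" and f0: "\<bar>f a\<bar> < \<Lambda> / 2" and x: "a \<le> x" "x < a + 1" and \<Lambda>: "0 < \<Lambda>"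
    and incr: "\<And>l i. i < 2 ^ Suc l \<Longrightarrow> \<bar>f (a + real (Suc i) / 2 ^ Suc l) - f (a + real i / 2 ^ Suc l)\<bar> < \<Lambda> * (9/10) ^ Suc l / 18"
  shows "\<bar>f x\<bar> < \<Lambda>"
proof -
  define y where "y = x - a"
  have y: "0 \<le> y" "y < 1" using x by (auto simp: y_def)
  define k where "k l = nat \<lfloor>2 ^ l * y\<rfloor>" for l :: nat
  have k: "real (k l) \<le> 2 ^ l * y" "2 ^ l * y < real (k l) + 1" for l
  proof -
    have "0 \<le> 2 ^ l * y" using y by simp
    then have "real (k l) = of_int \<lfloor>2 ^ l * y\<rfloor>" by (simp add: k_def)
    then show "real (k l) \<le> 2 ^ l * y" "2 ^ l * y < real (k l) + 1" by linarith+
  qed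
  have kb: "k l < 2 ^ l" for l
  proof -
    have "2 ^ l * y < 2 ^ l * 1" using y by (intro mult_strict_left_mono) auto
    then have "real (k l) < 2 ^ l" using k(1)[of l] by linarith
    then show ?thesis by (metis of_nat_less_iff of_nat_numeral of_nat_power)
  qed
  have kS: "k (Suc l) = 2 * k l \<or> k (Suc l) = Suc (2 * k l)" for l
  proof -
    have "real (k (Suc l)) < 2 * real (k l) + 2" "2 * real (k l) < real (k (Suc l)) + 1"
      using k[of l] k[of "Suc l"] by auto
    then show ?thesis by linarith
  qed
  define p where "p l = a + real (k l) / 2 ^ l" for l
  have step: "\<bar>f (p (Suc l)) - f (p l)\<bar> \<le> \<Lambda> * (9/10) ^ Suc l / 18" for l
  proof -
    have pl: "p l = a + real (2 * k l) / 2 ^ Suc l" by (simp add: p_def)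
    from kS[of l] show ?thesis
    proof
      assume "k (Suc l) = 2 * k l"
      then have "p (Suc l) = p l" by (simp add: p_def)
      then show ?thesis using \<Lambda> by simp
    next
      assume e: "k (Suc l) = Suc (2 * k l)"
      have "p (Suc l) = a + real (Suc (2 * k l)) / 2 ^ Suc l" by (simp only: p_def e)
      moreover have "2 * k l < 2 ^ Suc l" using kb[of l] by simp
      ultimately show ?thesis using incr[of "2 * k l" l] pl by (simp only: less_imp_le)
    qed
  qed
  have bound: "\<bar>f (p l)\<bar> \<le> \<bar>f a\<bar> + \<Lambda> / 2 * (1 - (9/10) ^ l)" for l
  proof (induction l)
    case 0
    have "k 0 = 0" using kb[of 0] by simp
    then show ?case by (simp add: p_def)
  next
    case (Suc l)
    have "\<bar>f (p (Suc l))\<bar> \<le> \<bar>f (p l)\<bar> + \<Lambda> * (9/10) ^ Suc l / 18" using step[of l] by linarith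
    also have "... \<le> \<bar>f a\<bar> + \<Lambda> / 2 * (1 - (9/10) ^ l) + \<Lambda> * (9/10) ^ Suc l / 18" using Suc by simp
    also have "... = \<bar>f a\<bar> + \<Lambda> / 2 * (1 - (9/10) ^ Suc l)" by (simp add: algebra_simps)
    finally show ?case .
  qed
  have bound2: "\<bar>f (p l)\<bar> \<le> \<bar>f a\<bar> + \<Lambda> / 2" for l
  proof -
    have "\<Lambda> / 2 * (1 - (9/10) ^ l) \<le> \<Lambda> / 2 * 1" using \<Lambda> by (intro mult_left_mono) auto
    then show ?thesis using bound[of l] by linarith
  qed
  have "p \<longlonglongrightarrow> x"
  proof (rule tendsto_sandwich[of "\<lambda>l. x - 1 / 2 ^ l" _ _ "\<lambda>_. x"])
    have "(\<lambda>l. x - (1 / 2) ^ l) \<longlonglongrightarrow> x - 0" by (intro tendsto_intros LIMSEQ_power_zero) auto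
    then show "(\<lambda>l. x - 1 / 2 ^ l) \<longlonglongrightarrow> x" by (simp add: power_one_over)
    have "x - 1 / 2 ^ l \<le> p l \<and> p l \<le> x" for l
    proof -
      have "real (k l) / 2 ^ l \<le> y" using k(1)[of l] by (simp add: divide_le_eq mult.commute)
      moreover have "y < (real (k l) + 1) / 2 ^ l" using k(2)[of l] by (simp add: less_divide_eq mult.commute)
      ultimately show ?thesis by (simp add: p_def y_def add_divide_distrib)
    qed
    then show "\<forall>\<^sub>F l in sequentially. x - 1 / 2 ^ l \<le> p l" "\<forall>\<^sub>F l in sequentially. p l \<le> x" by auto
  qed simp
  moreover have "p l \<in> {a..a + 1}" for l
  proof -
    have "real (k l) \<le> 2 ^ l" using kb[of l] by (metis less_imp_le of_nat_le_iff of_nat_numeral of_nat_power)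
    then show ?thesis by (simp add: p_def divide_le_eq)
  qed
  ultimately have "(\<lambda>l. f (p l)) \<longlonglongrightarrow> f x"
    using x by (intro continuous_on_tendsto_compose[OF f]) auto
  then have "(\<lambda>l. \<bar>f (p l)\<bar>) \<longlonglongrightarrow> \<bar>f x\<bar>" by (rule tendsto_rabs)
  then have "\<bar>f x\<bar> \<le> \<bar>f a\<bar> + \<Lambda> / 2" by (rule LIMSEQ_le_const2) (use bound2 in auto)
  then show ?thesis using f0 by linarith
qed

lemma (in prob_space) markov_even_power:
  assumes [measurable]: "X \<in> borel_measurable M" and c: "0 < c" and b: "0 \<le> b"
    and m: "nnE M (\<lambda>w. X w ^ (2 * q)) \<le> ennreal b"
  shows "prob {w \<in> space M. c \<le> \<bar>X w\<bar>} \<le> b / c ^ (2 * q)"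
proof -
  have "ennreal (c ^ (2 * q)) * emeasure M {w \<in> space M. c \<le> \<bar>X w\<bar>} = (\<integral>\<^sup>+w. ennreal (c ^ (2 * q)) * indicator {w \<in> space M. c \<le> \<bar>X w\<bar>} w \<partial>M)"
    by (simp add: nn_integral_cmult_indicator)
  also have "... \<le> nnE M (\<lambda>w. X w ^ (2 * q))"
  proof (rule nn_integral_mono)
    fix w
    have "c \<le> \<bar>X w\<bar> \<Longrightarrow> c ^ (2 * q) \<le> \<bar>X w\<bar> ^ (2 * q)" using c by (intro power_mono) auto
    then show "ennreal (c ^ (2 * q)) * indicator {w \<in> space M. c \<le> \<bar>X w\<bar>} w \<le> ennreal (X w ^ (2 * q))"
      by (auto simp: indicator_def power_even_abs intro: ennreal_leI)
  qed
  also have "... \<le> ennreal b" by (rule m)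
  finally have "ennreal (c ^ (2 * q) * prob {w \<in> space M. c \<le> \<bar>X w\<bar>}) \<le> ennreal b"
    using c by (simp add: emeasure_eq_measure ennreal_mult')
  then have "c ^ (2 * q) * prob {w \<in> space M. c \<le> \<bar>X w\<bar>} \<le> b" using b by simp
  then show ?thesis using c by (simp add: pos_le_divide_eq mult.commute)
qed

section \<open>Probability that a unit interval carries a peak\<close>

context she
begin

definition increment_bad :: "real \<Rightarrow> real \<Rightarrow> real \<Rightarrow> nat \<Rightarrow> nat \<Rightarrow> 'a set" where
  "increment_bad t a \<Lambda> l i = {w \<in> space M. \<Lambda> * (9/10) ^ Suc l / 18 \<le> \<bar>u t (a + real (Suc i) / 2 ^ Suc l) w - u t (a + real i / 2 ^ Suc l) w\<bar>}"

definition bad :: "real \<Rightarrow> real \<Rightarrow> real \<Rightarrow> 'a set" where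
  "bad t a \<Lambda> = {w \<in> space M. \<Lambda> / 2 \<le> \<bar>u t a w\<bar>} \<union> (\<Union>l. \<Union>i<2 ^ Suc l. increment_bad t a \<Lambda> l i)"

lemma increment_bad_sets: "0 \<le> t \<Longrightarrow> increment_bad t a \<Lambda> l i \<in> sets M"
  unfolding increment_bad_def using u_measurable by measurable

lemma bad_sets: "0 \<le> t \<Longrightarrow> bad t a \<Lambda> \<in> sets M"
  unfolding bad_def using u_measurable increment_bad_sets by (intro sets.Un sets.countable_UN'') auto

lemma not_bad:
  assumes "0 \<le> t" "0 < \<Lambda>" "w \<in> space M" "w \<notin> bad t a \<Lambda>" "continuous_on ({0..} \<times> UNIV) (\<lambda>(s, x). u s x w)" "a \<le> x" "x < a + 1"
  shows "\<bar>u t x w\<bar> < \<Lambda>"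
proof (rule dyadic_chaining[where a = a and f = "\<lambda>x. u t x w"])
  have "continuous_on {a..a + 1} (\<lambda>x. (\<lambda>(s, x). u s x w) (t, x))"
    by (rule continuous_on_compose2[OF assms(5)]) (use assms(1) in \<open>auto intro!: continuous_intros\<close>)
  then show "continuous_on {a..a + 1} (\<lambda>x. u t x w)" by simp
  show "\<bar>u t (a + real (Suc i) / 2 ^ Suc l) w - u t (a + real i / 2 ^ Suc l) w\<bar> < \<Lambda> * (9 / 10) ^ Suc l / 18" if "i < 2 ^ Suc l" for l i :: nat
    using assms(3,4) that unfolding bad_def increment_bad_def by (force simp: not_le)
qed (use assms in \<open>auto simp: bad_def not_le\<close>)

text \<open>Each increment at level l has a probability with the factor (sqrt(1/2) * 100/81)^(q l),
  where the first number comes from the increment bound and the second from the shrinking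
  thresholds. For q at least 12 the q-th power of this base is at most 1/4, which beats the 2^l
  increments. The 324 is 18^2.\<close>

lemma bad_prob_le:
  assumes q: "12 \<le> q" and t: "0 < t" and \<Lambda>: "0 < \<Lambda>"
  defines "E \<equiv> 4 * exp (growth_rate q * t)"
  defines "D \<equiv> (2 * real q - 1) * (L\<^sup>2 * E * (8 * t powr (1/4)))"
  shows "prob (bad t a \<Lambda>) \<le> ((4 * E) ^ q + (324 * D) ^ q) / \<Lambda> ^ (2 * q)"
proof -
  have q1: "1 \<le> q" using q by simp
  have t0: "0 \<le> t" using t by simp
  have E0: "0 \<le> E" and D0: "0 \<le> D" using q by (auto simp: E_def D_def)
  have p1: "prob {w \<in> space M. \<Lambda> / 2 \<le> \<bar>u t a w\<bar>} \<le> (4 * E) ^ q / \<Lambda> ^ (2 * q)"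
  proof -
    have "prob {w \<in> space M. \<Lambda> / 2 \<le> \<bar>u t a w\<bar>} \<le> E ^ q / (\<Lambda> / 2) ^ (2 * q)"
      unfolding E_def by (rule markov_even_power[OF u_measurable[OF t0] _ _ u_moment_le[OF q1 t0]]) (use \<Lambda> in auto)
    also have "... = (4 * E) ^ q / \<Lambda> ^ (2 * q)" by (simp add: power_divide power_mult power_mult_distrib)
    finally show ?thesis .
  qed
  have pi: "prob (increment_bad t a \<Lambda> l i) \<le> (324 * D) ^ q / \<Lambda> ^ (2 * q) * (1 / 4) ^ Suc l" if "i < 2 ^ Suc l" for l i
  proof -
    have "nnE M (\<lambda>w. (u t (a + real (Suc i) / 2 ^ Suc l) w - u t (a + real i / 2 ^ Suc l) w) ^ (2 * q)) \<le> ennreal ((D * sqrt (1 / 2 ^ Suc l)) ^ q)"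
    proof -
      have "(a + real (Suc i) / 2 ^ Suc l) - (a + real i / 2 ^ Suc l) = 1 / 2 ^ Suc l" by (simp add: add_divide_distrib)
      then have "\<bar>(a + real (Suc i) / 2 ^ Suc l) - (a + real i / 2 ^ Suc l)\<bar> = 1 / 2 ^ Suc l" by simp
      then show ?thesis using u_increment_moment_le[OF q1 t, of "a + real (Suc i) / 2 ^ Suc l" "a + real i / 2 ^ Suc l"]
        by (simp add: D_def E_def mult.assoc)
    qed
    then have "prob (increment_bad t a \<Lambda> l i) \<le> (D * sqrt (1 / 2 ^ Suc l)) ^ q / (\<Lambda> * (9/10) ^ Suc l / 18) ^ (2 * q)"
      unfolding increment_bad_def using u_measurable[OF t0] \<Lambda> D0 by (intro markov_even_power) auto
    also have "... = (324 * D) ^ q / \<Lambda> ^ (2 * q) * ((sqrt (1 / 2) * (100 / 81)) ^ q) ^ Suc l"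
    proof -
      have s: "sqrt (1 / 2 ^ Suc l) = sqrt (1 / 2) ^ Suc l" by (metis power_one_over real_sqrt_power)
      have "(D * sqrt (1 / 2 ^ Suc l)) ^ q / (\<Lambda> * (9/10) ^ Suc l / 18) ^ (2 * q) = (D * sqrt (1 / 2) ^ Suc l) ^ q / ((\<Lambda> * (9/10) ^ Suc l / 18)\<^sup>2) ^ q"
        unfolding s power_mult ..
      also have "... = ((D * sqrt (1 / 2) ^ Suc l) / (\<Lambda> * (9/10) ^ Suc l / 18)\<^sup>2) ^ q" by (simp only: power_divide)
      also have "(D * sqrt (1 / 2) ^ Suc l) / (\<Lambda> * (9/10) ^ Suc l / 18)\<^sup>2 = (324 * D / \<Lambda>\<^sup>2) * (sqrt (1 / 2) * (100 / 81)) ^ Suc l"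
      proof -
        have "((9/10) ^ Suc l)\<^sup>2 = ((81/100) ^ Suc l :: real)" by (simp add: power2_eq_square flip: power_mult_distrib)
        then show ?thesis by (simp only: power_divide[of "\<Lambda> * (9/10) ^ Suc l" 18] power_mult_distrib[of \<Lambda>] power_mult_distrib[of "sqrt (1/2)"])
           (simp add: field_simps power_divide)
      qed
      also have "((324 * D / \<Lambda>\<^sup>2) * (sqrt (1 / 2) * (100 / 81)) ^ Suc l) ^ q = (324 * D) ^ q / \<Lambda> ^ (2 * q) * ((sqrt (1 / 2) * (100 / 81)) ^ q) ^ Suc l"
        unfolding power_mult_distrib[of "324 * D / \<Lambda>\<^sup>2"] power_divide power_mult by (simp only: power_mult[symmetric] mult.commute)
      finally show ?thesis .
    qed
    also have "... \<le> (324 * D) ^ q / \<Lambda> ^ (2 * q) * (1 / 4) ^ Suc l"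
    proof (intro mult_left_mono power_mono)
      have "(sqrt (1 / 2) * (100 / 81)) ^ q \<le> (sqrt (1 / 2) * (100 / 81)) ^ 12"
      proof (rule power_decreasing[OF q])
        have "sqrt (1 / 2) \<le> 81 / 100" by (rule real_le_lsqrt) (simp_all add: power2_eq_square)
        then show "sqrt (1 / 2) * (100 / 81) \<le> 1" by simp
      qed simp
      also have "(sqrt (1 / 2) * (100 / 81)) ^ 12 = ((sqrt (1 / 2))\<^sup>2) ^ 6 * ((100 / 81) ^ 12 :: real)"
        by (simp only: power_mult_distrib power_mult[symmetric]) simp
      also have "... \<le> 1 / 4" by (simp add: power_divide divide_le_eq)
      finally show "(sqrt (1 / 2) * (100 / 81)) ^ q \<le> 1 / 4" .
    qed (use D0 \<Lambda> in auto)
    finally show ?thesis .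
  qed
  define P where "P = (324 * D) ^ q / \<Lambda> ^ (2 * q)"
  have P0: "0 \<le> P" using D0 by (simp add: P_def)
  have pl: "prob (\<Union>i<2 ^ Suc l. increment_bad t a \<Lambda> l i) \<le> P * (1 / 2) ^ Suc l" for l
  proof -
    have "prob (\<Union>i<2 ^ Suc l. increment_bad t a \<Lambda> l i) \<le> (\<Sum>i<2 ^ Suc l. prob (increment_bad t a \<Lambda> l i))"
      using increment_bad_sets[OF t0] by (intro finite_measure_subadditive_finite) auto
    also have "... \<le> (\<Sum>i<(2::nat) ^ Suc l. P * (1 / 4) ^ Suc l)" unfolding P_def by (intro sum_mono pi) auto
    also have "... = P * (2 ^ Suc l * (1 / 4) ^ Suc l)" by simp
    also have "(2 ^ Suc l * (1 / 4) ^ Suc l :: real) = (1 / 2) ^ Suc l" by (simp only: power_mult_distrib[symmetric]) simp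
    finally show ?thesis .
  qed
  have sm: "(\<lambda>l. P * (1 / 2) ^ Suc l) sums (P * 1)"
    by (intro sums_mult) (rule power_half_series)
  have "prob (\<Union>l. \<Union>i<2 ^ Suc l. increment_bad t a \<Lambda> l i) \<le> (\<Sum>l. prob (\<Union>i<2 ^ Suc l. increment_bad t a \<Lambda> l i))"
  proof (rule finite_measure_subadditive_countably)
    show "summable (\<lambda>l. prob (\<Union>i<2 ^ Suc l. increment_bad t a \<Lambda> l i))"
      by (rule summable_comparison_test'[OF sums_summable[OF sm]]) (use pl in auto)
  qed (use increment_bad_sets[OF t0] in auto)
  also have "... \<le> (\<Sum>l. P * (1 / 2) ^ Suc l)"
    by (intro suminf_le pl summable_comparison_test'[OF sums_summable[OF sm]] sums_summable[OF sm]) (use pl in auto)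
  also have "... = P" using sums_unique[OF sm] by simp
  finally have p2: "prob (\<Union>l. \<Union>i<2 ^ Suc l. increment_bad t a \<Lambda> l i) \<le> P" .
  have "prob (bad t a \<Lambda>) \<le> prob {w \<in> space M. \<Lambda> / 2 \<le> \<bar>u t a w\<bar>} + prob (\<Union>l. \<Union>i<2 ^ Suc l. increment_bad t a \<Lambda> l i)"
    unfolding bad_def using u_measurable[OF t0] increment_bad_sets[OF t0] by (intro measure_Un_le sets.countable_UN'') auto
  also have "... \<le> (4 * E) ^ q / \<Lambda> ^ (2 * q) + P" by (intro add_mono p1 p2)
  finally show ?thesis by (simp add: P_def add_divide_distrib)
qed

text \<open>\<open>growth_rate\<close> is quadratic in \<open>q\<close>, and the q-th power makes
  the exponent cubic; polynomial factors in \<open>q\<close> are absorbed into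
  \<open>C\<close>.\<close>

lemma bad_prob_exp:
  assumes t: "0 < t"
  obtains C where "0 < C" "\<And>q a l. 12 \<le> q \<Longrightarrow> prob (bad t a (exp l)) \<le> exp (C * real q ^ 3 - 2 * real q * l)"
proof -
  define A where "A = 16 + 20736 * L\<^sup>2 * t powr (1/4)"
  have A: "16 \<le> A" by (simp add: A_def)
  define C where "C = ln (2 * A) + 1 + 576 * L ^ 4 * t"
  have lnA: "0 \<le> ln (2 * A)" using A by simp
  have C: "0 < C" using lnA t by (simp add: C_def add_nonneg_pos add_pos_nonneg)
  show thesis
  proof (rule that[OF C])
    fix q :: nat and a l :: real assume q: "12 \<le> q"
    define E where "E = 4 * exp (growth_rate q * t)"
    define D where "D = (2 * real q - 1) * (L\<^sup>2 * E * (8 * t powr (1/4)))"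
    define B where "B = A * real q * exp (growth_rate q * t)"
    have q1: "1 \<le> real q" using q by simp
    have b1: "4 * E \<le> B"
    proof -
      have "16 * 1 \<le> A * real q" using A q1 by (intro mult_mono) auto
      then have "16 * exp (growth_rate q * t) \<le> A * real q * exp (growth_rate q * t)" by (intro mult_right_mono) auto
      then show ?thesis by (simp add: E_def B_def)
    qed
    have b2: "324 * D \<le> B"
    proof -
      have "324 * D = (2 * real q - 1) * (10368 * L\<^sup>2 * t powr (1/4)) * exp (growth_rate q * t)" by (simp add: D_def E_def)
      also have "... \<le> (2 * real q) * (10368 * L\<^sup>2 * t powr (1/4)) * exp (growth_rate q * t)"
        using q by (intro mult_right_mono) auto
      also have "... = (20736 * L\<^sup>2 * t powr (1/4)) * real q * exp (growth_rate q * t)" by simp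
      also have "... \<le> B" unfolding B_def A_def by (intro mult_right_mono) auto
      finally show ?thesis .
    qed
    have E0: "0 \<le> E" and D0: "0 \<le> D" using q by (auto simp: E_def D_def)
    have B0: "0 < B" using A q by (simp add: B_def)
    have "(4 * E) ^ q + (324 * D) ^ q \<le> B ^ q + B ^ q" using b1 b2 E0 D0 by (intro add_mono power_mono) auto
    also have "... = 2 * B ^ q" by simp
    also have "... \<le> 2 ^ q * B ^ q" using q by (intro mult_right_mono self_le_power) (use B0 in auto)
    also have "... = (2 * B) ^ q" by (simp add: power_mult_distrib)
    also have "... \<le> exp (C * (real q)\<^sup>2) ^ q"
    proof (rule power_mono)
      have "real q \<le> exp (real q)" using exp_ge_add_one_self[of "real q"] by linarith
      then have "2 * B \<le> exp (ln (2 * A)) * exp (real q) * exp (growth_rate q * t)"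
        unfolding B_def using A by simp
      also have "... = exp (ln (2 * A) + real q + growth_rate q * t)" by (simp add: exp_add)
      also have "... \<le> exp (C * (real q)\<^sup>2)"
      proof -
        have qq: "1 \<le> (real q)\<^sup>2" using q1 by simp
        have "ln (2 * A) * 1 \<le> ln (2 * A) * (real q)\<^sup>2" using lnA qq by (intro mult_left_mono) auto
        moreover have "real q \<le> 1 * (real q)\<^sup>2" using q1 by (simp add: power2_eq_square)
        moreover have "growth_rate q * t \<le> 576 * L ^ 4 * t * (real q)\<^sup>2"
        proof -
          have "(2 * real q - 1)\<^sup>2 \<le> (2 * real q)\<^sup>2" using q1 by (intro power_mono) auto
          then have "144 * (2 * real q - 1)\<^sup>2 * (L ^ 4 * t) \<le> 144 * (2 * real q)\<^sup>2 * (L ^ 4 * t)"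
            using t by (intro mult_right_mono mult_left_mono) auto
          then show ?thesis by (simp add: growth_rate_def power_mult_distrib mult_ac)
        qed
        ultimately have "ln (2 * A) + real q + growth_rate q * t \<le> C * (real q)\<^sup>2" unfolding C_def distrib_right by linarith
        then show ?thesis by simp
      qed
      finally show "2 * B \<le> exp (C * (real q)\<^sup>2)" .
    qed (use B0 in simp)
    also have "... = exp (C * real q ^ 3)" by (simp add: exp_of_nat_mult[symmetric] power2_eq_square power3_eq_cube mult_ac)
    finally have num: "(4 * E) ^ q + (324 * D) ^ q \<le> exp (C * real q ^ 3)" .
    have "prob (bad t a (exp l)) \<le> ((4 * E) ^ q + (324 * D) ^ q) / exp l ^ (2 * q)"
      unfolding E_def D_def by (rule bad_prob_le[OF q t]) simp
    also have "... \<le> exp (C * real q ^ 3) / exp l ^ (2 * q)" by (intro divide_right_mono num) simp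
    also have "... = exp (C * real q ^ 3 - 2 * real q * l)" by (simp add: exp_diff exp_of_nat_mult[symmetric])
    finally show "prob (bad t a (exp l)) \<le> exp (C * real q ^ 3 - 2 * real q * l)" .
  qed
qed

text \<open>For l = g (log x)^(2/3) the exponent C q^3 - 2 q l is smallest for q of order (log
  x)^(1/3), where it is a negative multiple of log x.\<close>

lemma bad_prob_powr:
  assumes t: "0 < t" and g: "0 < g"
  obtains f x0 where "0 < f" "f \<le> 1 / 2" "1 \<le> x0" "\<And>a x. x0 \<le> x \<Longrightarrow> prob (bad t a (exp (g * ln x powr (2/3)))) \<le> x powr (- f)"
proof -
  obtain C where C: "0 < C" "\<And>q a l. 12 \<le> q \<Longrightarrow> prob (bad t a (exp l)) \<le> exp (C * real q ^ 3 - 2 * real q * l)"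
    by (rule bad_prob_exp[OF t]) blast
  \<comment> \<open>With \<open>q\<close> close to \<open>c * m\<close>, where \<open>m\<close> is
    the cube root of \<open>ln x\<close>, the cost C q^3 is at most c g m^3 / 2 and the gain 2 q l
    at least c g m^3.\<close>
  define c where "c = sqrt (g / (2 * C))"
  have c: "0 < c" "c\<^sup>2 = g / (2 * C)" using g C(1) by (auto simp: c_def)
  define f where "f = min (c * g / 2) (1 / 2)"
  \<comment> \<open>Makes \<open>c * m\<close> at least 24, hence the rounded \<open>q\<close> at
    least 12 and at least half of \<open>c * m\<close>.\<close>
  define x0 where "x0 = exp ((24 / c) powr 3)"
  show thesis
  proof (rule that[of f x0])
    show "0 < f" "f \<le> 1 / 2" using c g by (auto simp: f_def)
    show "1 \<le> x0" by (simp add: x0_def)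
    fix a x assume x: "x0 \<le> x"
    then have x1: "1 \<le> x" using \<open>1 \<le> x0\<close> by simp
    define m where "m = ln x powr (1/3)"
    have lx: "(24 / c) powr 3 \<le> ln x" using x by (simp add: x0_def ln_ge_iff x1 less_le_trans[OF exp_gt_zero x[unfolded x0_def]])
    then have lnx: "0 \<le> ln x" using x1 by simp
    have "((24 / c) powr 3) powr (1/3) \<le> m" unfolding m_def using lx by (intro powr_mono2) auto
    moreover have "((24 / c) powr 3) powr (1/3) = (24 / c) powr (3 * (1/3))" by (rule powr_powr)
    ultimately have m24: "24 / c \<le> m" using c by simp
    then have cm: "24 \<le> c * m" using c by (simp add: field_simps)
    have m0: "0 \<le> m" by (simp add: m_def)
    have m2: "ln x powr (2/3) = m\<^sup>2" and m3: "ln x = m ^ 3"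
    proof -
      have "m powr 2 = m\<^sup>2" "m powr 3 = m ^ 3" using m0 by simp_all
      moreover have "m powr 2 = ln x powr (1/3 * 2)" "m powr 3 = ln x powr (1/3 * 3)" by (simp_all only: m_def powr_powr)
      ultimately show "ln x powr (2/3) = m\<^sup>2" "ln x = m ^ 3" using lnx by simp_all
    qed
    define q where "q = nat \<lfloor>c * m\<rfloor>"
    have q: "real q \<le> c * m" "c * m - 1 < real q" using cm unfolding q_def by linarith+
    have q12: "12 \<le> q" using q cm by linarith
    have qh: "c * m / 2 \<le> real q" using q cm by linarith
    have "C * real q ^ 3 \<le> C * (c * m) ^ 3" using C(1) q by (intro mult_left_mono power_mono) auto
    also have "... = c * g / 2 * m ^ 3"
    proof -
      have "C * (c * m) ^ 3 = (C * c\<^sup>2) * c * m ^ 3" by (simp add: power_mult_distrib power2_eq_square power3_eq_cube)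
      also have "C * c\<^sup>2 = g / 2" using C(1) by (simp add: c(2))
      finally show ?thesis by simp
    qed
    finally have 1: "C * real q ^ 3 \<le> c * g / 2 * m ^ 3" .
    have "2 * (c * m / 2) * (g * m\<^sup>2) \<le> 2 * real q * (g * m\<^sup>2)" using qh g by (intro mult_right_mono) auto
    moreover have "2 * (c * m / 2) * (g * m\<^sup>2) = c * g * m ^ 3" by (simp add: power2_eq_square power3_eq_cube)
    ultimately have 2: "c * g * m ^ 3 \<le> 2 * real q * (g * m\<^sup>2)" by linarith
    have "prob (bad t a (exp (g * ln x powr (2/3)))) \<le> exp (C * real q ^ 3 - 2 * real q * (g * ln x powr (2/3)))" by (rule C(2)[OF q12])
    also have "... \<le> exp (- (c * g / 2) * ln x)" unfolding m2 unfolding m3 using 1 2 by (simp add: field_simps)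
    also have "... \<le> exp (- f * ln x)" using mult_right_mono[OF min.cobounded1[of "c * g / 2" "1 / 2"] lnx] by (simp add: f_def)
    also have "... = x powr (- f)" using x1 by (simp add: powr_def)
    finally show "prob (bad t a (exp (g * ln x powr (2/3)))) \<le> x powr (- f)" .
  qed
qed

end

section \<open>Macroscopic dimension of the peaks from above\<close>

lemma shell_real: "x \<in> shell (Suc n) \<longleftrightarrow> (- exp (real (Suc n)) \<le> x \<and> x < exp (real (Suc n))) \<and> \<not> (- exp (real n) \<le> x \<and> x < exp (real n))" for x :: real
  by (simp add: shell_cube_def)

lemma upright_box_real: "upright_box x r = {x..<x + r}" for x :: real
  by (auto simp: upright_box_def)

lemma macro_content_le:
  fixes E :: "real set"
  assumes E: "\<And>x. x \<in> E \<Longrightarrow> 0 \<le> x" and S: "finite S" "\<And>x. x \<in> E \<Longrightarrow> exp (real n) \<le> x \<Longrightarrow> x < exp (real (Suc n)) \<Longrightarrow> nat \<lfloor>x\<rfloor> \<in> S"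
  shows "macro_content (Suc n) \<rho> E \<le> ennreal (real (card S) * exp (- real (Suc n) * \<rho>))"
proof -
  define Q where "Q = map (\<lambda>j. (real j, 1 :: real)) (sorted_list_of_set S)"
  have "(\<Sum>(x, r)\<leftarrow>Q. ennreal ((r / exp (real (Suc n))) powr \<rho>)) = (\<Sum>j\<leftarrow>sorted_list_of_set S. ennreal (exp (- real (Suc n) * \<rho>)))"
    unfolding Q_def map_map o_def by (simp add: powr_def ln_div mult.commute)
  also have "... = ennreal (real (card S) * exp (- real (Suc n) * \<rho>))"
    using S(1) by (simp add: sum_list_triv ennreal_mult' ennreal_of_nat_eq_real_of_nat)
  finally have eq: "(\<Sum>(x, r)\<leftarrow>Q. ennreal ((r / exp (real (Suc n))) powr \<rho>)) = ennreal (real (card S) * exp (- real (Suc n) * \<rho>))" .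
  have cover: "E \<inter> shell (Suc n) \<subseteq> (\<Union>(x, r) \<in> set Q. upright_box x r)"
  proof
    fix x assume x: "x \<in> E \<inter> shell (Suc n)"
    then have x0: "0 \<le> x" using E by auto
    then have "- exp (real n) \<le> x" by (intro order_trans[OF _ x0]) simp
    then have "exp (real n) \<le> x" "x < exp (real (Suc n))" using x unfolding Int_iff shell_real by linarith+
    then have "nat \<lfloor>x\<rfloor> \<in> S" using S(2) x by auto
    then have "(real (nat \<lfloor>x\<rfloor>), 1) \<in> set Q" using S(1) by (auto simp: Q_def)
    moreover have "x \<in> upright_box (real (nat \<lfloor>x\<rfloor>)) 1" using x0 unfolding upright_box_real by (simp; linarith)
    ultimately show "x \<in> (\<Union>(x, r) \<in> set Q. upright_box x r)" by blast
  qed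
  show ?thesis unfolding macro_content_def
  proof (rule Inf_lower, rule CollectI, rule exI[of _ Q], intro conjI)
    show "\<forall>(x, r)\<in>set Q. 1 \<le> r" by (auto simp: Q_def)
  qed (rule eq[symmetric] cover)+
qed

lemma macro_dim_le:
  assumes "0 < \<rho>" "(\<Sum>n. macro_content (Suc n) \<rho> E) < \<infinity>"
  shows "macro_dim E \<le> ereal \<rho>"
  unfolding macro_dim_def by (rule Inf_lower) (use assms in auto)

context she
begin

text \<open>The expected number of unit intervals with a peak in shell n is at most of order exp(n
  (1 - f)). The contents with exponent 1 - f/2 thus have summable expectations, so their sum is
  almost surely finite.\<close>

theorem macro_dim_peaks_le:
  assumes t: "0 < t" and \<gamma>: "0 < \<gamma>"
  obtains f where "0 < f" "AE w in M. macro_dim (tall_peaks t (\<lambda>x. ln (u t x w)) \<gamma>) \<le> ereal (1 - f)"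
proof -
  define g where "g = \<gamma> * t powr (1/3)"
  have g: "0 < g" using t \<gamma> by (simp add: g_def)
  obtain f x0 where f: "0 < f" "f \<le> 1 / 2" "1 \<le> x0" and bp: "\<And>a x. x0 \<le> x \<Longrightarrow> prob (bad t a (exp (g * ln x powr (2/3)))) \<le> x powr (- f)"
    by (rule bad_prob_powr[OF t g]) blast
  define \<rho> where "\<rho> = 1 - f / 2"
  have \<rho>: "0 < \<rho>" using f by (simp add: \<rho>_def)
  define B where "B j = bad t (real j) (exp (g * ln (real j) powr (2/3)))" for j :: nat
  have Bm[measurable]: "B j \<in> sets M" for j unfolding B_def using t by (intro bad_sets) simp
  define C where "C = x0 + 3"
  have C: "0 < C" using f by (simp add: C_def)
  \<comment> \<open>Shifting to \<open>real j + 1\<close> and enlarging the constant removes the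
    threshold \<open>x0\<close> and the singular value at \<open>j = 0\<close>.\<close>
  have PB: "prob (B j) \<le> C * (real j + 1) powr (- f)" for j
  proof (cases "x0 \<le> real j")
    case True
    then have j: "1 \<le> real j" using f by simp
    have "prob (B j) \<le> real j powr (- f)" unfolding B_def by (rule bp[OF True])
    also have "real j powr (- f) \<le> ((real j + 1) / 2) powr (- f)" using j f by (intro powr_mono2') auto
    also have "... = 2 powr f * (real j + 1) powr (- f)" by (simp add: powr_divide powr_minus_divide divide_simps)
    also have "... \<le> C * (real j + 1) powr (- f)"
    proof (rule mult_right_mono)
      have "2 powr f \<le> 2 powr 1" using f by (intro powr_mono) auto
      then show "2 powr f \<le> C" using f by (simp add: C_def)
    qed simp
    finally show ?thesis .
  next
    case False
    have "1 = (real j + 1) powr f * (real j + 1) powr (- f)" by (simp add: powr_add[symmetric])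
    also have "... \<le> C * (real j + 1) powr (- f)"
    proof (rule mult_right_mono)
      have "(real j + 1) powr f \<le> (real j + 1) powr 1" using f by (intro powr_mono) auto
      then show "(real j + 1) powr f \<le> C" using False by (simp add: C_def)
    qed simp
    finally show ?thesis using prob_le_1[of "B j"] by linarith
  qed
  \<comment> \<open>The integers whose unit interval meets the positive half of the shell.\<close>
  define S where "S n = {j :: nat. exp (real n) < real j + 1 \<and> real j < exp (real (Suc n))}" for n
  have Sfin: "finite (S n)" and Scard: "real (card (S n)) \<le> 2 * exp (real (Suc n))" for n
  proof -
    have sub: "S n \<subseteq> {..nat \<lfloor>exp (real (Suc n))\<rfloor>}" by (auto simp: S_def le_nat_iff le_floor_iff)
    then show "finite (S n)" using finite_subset by blast
    have "card (S n) \<le> card {..nat \<lfloor>exp (real (Suc n))\<rfloor>}" by (intro card_mono sub) simp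
    then have "real (card (S n)) \<le> real (Suc (nat \<lfloor>exp (real (Suc n))\<rfloor>))" by (simp only: of_nat_le_iff card_atMost)
    then have "real (card (S n)) \<le> real (nat \<lfloor>exp (real (Suc n))\<rfloor>) + 1" by (simp only: of_nat_Suc add.commute)
    also have "... \<le> exp (real (Suc n)) + 1" by (simp add: of_nat_nat)
    also have "... \<le> 2 * exp (real (Suc n))" using one_le_exp_iff[of "real (Suc n)"] by simp
    finally show "real (card (S n)) \<le> 2 * exp (real (Suc n))" .
  qed
  define cnt where "cnt n w = (\<Sum>j\<in>S n. ennreal (exp (- real (Suc n) * \<rho>)) * indicator (B j) w)" for n w
  have [measurable]: "cnt n \<in> borel_measurable M" for n unfolding cnt_def[abs_def] by measurable
  define r where "r = exp (- f / 2)"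
  have r: "0 < r" "r < 1" using f by (auto simp: r_def)
  have Ecnt: "(\<integral>\<^sup>+w. cnt n w \<partial>M) \<le> ennreal (2 * C * exp f * r ^ Suc n)" for n
  proof -
    have "(\<integral>\<^sup>+w. cnt n w \<partial>M) = (\<Sum>j\<in>S n. ennreal (exp (- real (Suc n) * \<rho>)) * emeasure M (B j))"
      unfolding cnt_def by (simp add: nn_integral_sum nn_integral_cmult_indicator)
    also have "... \<le> (\<Sum>j\<in>S n. ennreal (exp (- real (Suc n) * \<rho>) * (C * exp (- real n * f))))"
    proof (rule sum_mono)
      fix j assume j: "j \<in> S n"
      have "(real j + 1) powr (- f) \<le> exp (real n) powr (- f)" using j f by (intro powr_mono2') (auto simp: S_def)
      also have "... = exp (- real n * f)" by (simp add: powr_def)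
      finally have "prob (B j) \<le> C * exp (- real n * f)" using PB[of j] C by (meson mult_left_mono order_trans less_imp_le)
      then show "ennreal (exp (- real (Suc n) * \<rho>)) * emeasure M (B j) \<le> ennreal (exp (- real (Suc n) * \<rho>) * (C * exp (- real n * f)))"
        by (subst ennreal_mult') (auto simp: emeasure_eq_measure intro!: mult_left_mono ennreal_leI)
    qed
    also have "... = ennreal (real (card (S n)) * (exp (- real (Suc n) * \<rho>) * (C * exp (- real n * f))))"
      by (simp add: ennreal_mult' ennreal_of_nat_eq_real_of_nat)
    also have "... \<le> ennreal (2 * exp (real (Suc n)) * (exp (- real (Suc n) * \<rho>) * (C * exp (- real n * f))))"
      using Scard[of n] C by (intro ennreal_leI mult_right_mono) auto
    also have "2 * exp (real (Suc n)) * (exp (- real (Suc n) * \<rho>) * (C * exp (- real n * f))) = 2 * C * exp f * r ^ Suc n"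
    proof -
      have "exp (real (Suc n)) * (exp (- real (Suc n) * \<rho>) * exp (- real n * f)) = exp f * r ^ Suc n"
        unfolding r_def exp_of_nat_mult[symmetric] exp_add[symmetric] by (simp add: \<rho>_def field_simps)
      then show ?thesis by (simp add: mult_ac)
    qed
    finally show ?thesis .
  qed
  have "(\<integral>\<^sup>+w. (\<Sum>n. cnt n w) \<partial>M) = (\<Sum>n. \<integral>\<^sup>+w. cnt n w \<partial>M)" by (rule nn_integral_suminf) measurable
  also have "... \<le> (\<Sum>n. ennreal (2 * C * exp f * r ^ Suc n))" by (intro suminf_le Ecnt) auto
  also have "... < \<infinity>"
  proof -
    have s: "summable (\<lambda>n. 2 * C * exp f * r ^ Suc n)" using r by (intro summable_mult) (simp add: summable_Suc_iff summable_geometric)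
    have "(\<Sum>n. ennreal (2 * C * exp f * r ^ Suc n)) = ennreal (\<Sum>n. 2 * C * exp f * r ^ Suc n)"
      by (rule suminf_ennreal2[OF _ s]) (use C r in auto)
    then show ?thesis by simp
  qed
  finally have fin: "(\<integral>\<^sup>+w. (\<Sum>n. cnt n w) \<partial>M) \<noteq> \<infinity>" by simp
  have "AE w in M. (\<Sum>n. cnt n w) \<noteq> \<infinity>" by (rule nn_integral_PInf_AE[OF _ fin]) measurable
  then have "AE w in M. macro_dim (tall_peaks t (\<lambda>x. ln (u t x w)) \<gamma>) \<le> ereal (1 - f / 2)"
    using u_continuous AE_space
  proof eventually_elim
    case (elim w)
    define P where "P = tall_peaks t (\<lambda>x. ln (u t x w)) \<gamma>"
    have content: "macro_content (Suc n) \<rho> P \<le> cnt n w" for n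
    proof -
      have "macro_content (Suc n) \<rho> P \<le> ennreal (real (card {j \<in> S n. w \<in> B j}) * exp (- real (Suc n) * \<rho>))"
      proof (rule macro_content_le)
        show "finite {j \<in> S n. w \<in> B j}" using Sfin by simp
        have ee: "0 < exp (exp 1 :: real)" by simp
        show "0 \<le> x" if "x \<in> P" for x using that ee unfolding P_def tall_peaks_def by (simp, linarith)
        fix x assume x: "x \<in> P" "exp (real n) \<le> x" "x < exp (real (Suc n))"
        define j where "j = nat \<lfloor>x\<rfloor>"
        have xe: "exp (exp 1) \<le> x" and h: "g * ln x powr (2/3) \<le> ln (u t x w)" using x by (auto simp: P_def tall_peaks_def g_def)
        have e3: "2 \<le> exp (exp 1 :: real)"
        proof -
          have "1 + exp 1 \<le> exp (exp 1 :: real)" by (rule exp_ge_add_one_self)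
          moreover have "1 + 1 \<le> exp (1::real)" by (rule exp_ge_add_one_self)
          ultimately show ?thesis by linarith
        qed
        have "real j = of_int \<lfloor>x\<rfloor>" using xe e3 by (simp add: j_def)
        then have jx: "real j \<le> x" "x < real j + 1" by linarith+
        then have j1: "1 \<le> real j" using xe e3 by linarith
        have "w \<in> B j"
        proof (rule ccontr)
          assume "w \<notin> B j"
          then have lt: "\<bar>u t x w\<bar> < exp (g * ln (real j) powr (2/3))"
            unfolding B_def by (intro not_bad[OF _ _ _ _ _ jx(1,2)]) (use t elim in auto)
          have "ln (real j) powr (2/3) \<le> ln x powr (2/3)" using j1 jx by (intro powr_mono2) auto
          then have le: "g * ln (real j) powr (2/3) \<le> ln (u t x w)" using h g by (meson mult_left_mono order_trans less_imp_le)
          \<comment> \<open>\<open>ln\<close> of a negative number is the logarithm of its absolute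
            value, and \<open>ln 0\<close> is 0; so a positive height excludes the value 0 and
            determines the absolute value of the solution.\<close>
          have "0 < g * ln x powr (2/3)" using g xe e3 by (intro mult_pos_pos) auto
          then have "u t x w \<noteq> 0" using h by auto
          then have "\<bar>u t x w\<bar> = exp (ln (u t x w))" by (rule exp_ln_abs[symmetric])
          then show False using lt le by simp
        qed
        moreover have "j \<in> S n" using x jx by (auto simp: S_def)
        ultimately show "nat \<lfloor>x\<rfloor> \<in> {j \<in> S n. w \<in> B j}" by (simp add: j_def)
      qed
      also have "... = cnt n w"
      proof -
        have "cnt n w = (\<Sum>j\<in>{j \<in> S n. w \<in> B j}. ennreal (exp (- real (Suc n) * \<rho>)))"
          unfolding cnt_def by (rule sum.mono_neutral_cong_right) (use Sfin in \<open>auto simp: indicator_def\<close>)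
        then show ?thesis by (simp add: ennreal_mult' ennreal_of_nat_eq_real_of_nat)
      qed
      finally show ?thesis .
    qed
    have "(\<Sum>n. macro_content (Suc n) \<rho> P) \<le> (\<Sum>n. cnt n w)" by (intro suminf_le content) auto
    also have "... < \<infinity>" using elim(1) by (simp add: top.not_eq_extremum)
    finally have "macro_dim P \<le> ereal \<rho>" by (rule macro_dim_le[OF \<rho>])
    then show ?case by (simp add: P_def \<rho>_def)
  qed
  then show thesis using f by (intro that[of "f / 2"]) auto
qed

end

section \<open>Lower bound for the tail of the solution\<close>

text \<open>A trapezoid with plateau \<open>A\<close> up to distance \<open>l\<close> and support up
  to distance \<open>2 * l\<close>. The plateau produces the growth; the slopes make it continuous,
  so that its values at grid points converge.\<close>

definition bump :: "real \<Rightarrow> real \<Rightarrow> real \<Rightarrow> real \<Rightarrow> real" where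
  "bump A l x y = A * max 0 (min 1 (2 - \<bar>y - x\<bar> / l))"

lemma bump_bounds: "0 \<le> A \<Longrightarrow> 0 \<le> bump A l x y" "0 \<le> A \<Longrightarrow> bump A l x y \<le> A"
  by (auto simp: bump_def mult_left_le)

lemma bump_inside: "0 < l \<Longrightarrow> \<bar>y - x\<bar> \<le> l \<Longrightarrow> bump A l x y = A"
  by (simp add: bump_def min_def max_def divide_le_eq)

lemma bump_outside: "0 < l \<Longrightarrow> 2 * l \<le> \<bar>y - x\<bar> \<Longrightarrow> bump A l x y = 0"
  by (cases "\<bar>y - x\<bar> / l = 2") (auto simp: bump_def min_def max_def field_simps)

lemma bump_continuous: "0 < l \<Longrightarrow> continuous_on S (bump A l x)"
  unfolding bump_def by (intro continuous_intros) auto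

text \<open>Cauchy-Schwarz in the form of Young's inequality; the free parameter \<open>r\<close>
  replaces square roots of integrals.\<close>

lemma (in prob_space) product_small:
  assumes [measurable]: "X \<in> borel_measurable M" "Z \<in> borel_measurable M"
    and X: "nnE M (\<lambda>w. (X w)\<^sup>2) \<le> ennreal e" and Z: "nnE M (\<lambda>w. (Z w)\<^sup>2) \<le> ennreal C"
    and "0 \<le> e" "0 \<le> C" "0 < r"
  shows "(\<integral>\<^sup>+w. ennreal \<bar>X w * Z w\<bar> \<partial>M) \<le> ennreal (r * e / 2 + C / (2 * r))"
proof -
  have "(\<integral>\<^sup>+w. ennreal \<bar>X w * Z w\<bar> \<partial>M) \<le> (\<integral>\<^sup>+w. ennreal (r / 2) * ennreal ((X w)\<^sup>2) + ennreal (1 / (2 * r)) * ennreal ((Z w)\<^sup>2) \<partial>M)"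
  proof (rule nn_integral_mono)
    fix w
    have "0 \<le> (r * \<bar>X w\<bar> - \<bar>Z w\<bar>)\<^sup>2" by simp
    then have "2 * r * (\<bar>X w\<bar> * \<bar>Z w\<bar>) \<le> r\<^sup>2 * (X w)\<^sup>2 + (Z w)\<^sup>2" by (simp add: power2_diff power_mult_distrib mult_ac)
    then have "\<bar>X w * Z w\<bar> \<le> r / 2 * (X w)\<^sup>2 + 1 / (2 * r) * (Z w)\<^sup>2"
      using \<open>0 < r\<close> by (simp add: abs_mult field_simps power2_eq_square)
    then show "ennreal \<bar>X w * Z w\<bar> \<le> ennreal (r / 2) * ennreal ((X w)\<^sup>2) + ennreal (1 / (2 * r)) * ennreal ((Z w)\<^sup>2)"
      using \<open>0 < r\<close> by (simp add: ennreal_mult'[symmetric] ennreal_plus[symmetric] ennreal_leI del: ennreal_plus)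
  qed
  also have "... = ennreal (r / 2) * nnE M (\<lambda>w. (X w)\<^sup>2) + ennreal (1 / (2 * r)) * nnE M (\<lambda>w. (Z w)\<^sup>2)"
    by (simp add: nn_integral_add nn_integral_cmult)
  also have "... \<le> ennreal (r / 2) * ennreal e + ennreal (1 / (2 * r)) * ennreal C" by (intro add_mono mult_left_mono X Z) auto
  also have "... = ennreal (r * e / 2 + C / (2 * r))"
    using assms by (simp add: ennreal_mult'[symmetric] ennreal_plus[symmetric] del: ennreal_plus)
  finally show ?thesis .
qed

text \<open>\<open>clip 1 (z / d)\<close> is a continuous substitute for the sign of
  \<open>z\<close>. The product falls short of the absolute value by at most \<open>d\<close> for
  small \<open>z\<close> and by at most z^2/K for large \<open>z\<close>.\<close>

lemma clip_product_ge:
  assumes "0 < d" "d \<le> K"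
  shows "0 \<le> clip K z * clip 1 (z / d)" "\<bar>z\<bar> \<le> clip K z * clip 1 (z / d) + (1 / K * z\<^sup>2 + d)"
proof -
  have main: "0 \<le> clip K z * clip 1 (z / d) \<and> \<bar>z\<bar> \<le> clip K z * clip 1 (z / d) + (1 / K * z\<^sup>2 + d)" if z: "0 \<le> z" for z
  proof -
    have K: "0 < K" using assms by simp
    have e: "clip K z = min K z" "clip 1 (z / d) = min 1 (z / d)"
      using z K divide_nonneg_pos[OF z assms(1)] unfolding clip_def by linarith+
    have nn: "0 \<le> min K z * min 1 (z / d)" using z K assms by (intro mult_nonneg_nonneg) auto
    have q: "0 \<le> 1 / K * z\<^sup>2" using K by simp
    have "z \<le> min K z * min 1 (z / d) + (1 / K * z\<^sup>2 + d)"
    proof (cases "z \<le> d")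
      case True
      then show ?thesis using nn q by linarith
    next
      case False
      then have 1: "min 1 (z / d) = 1" using assms by (simp add: le_divide_eq)
      show ?thesis
      proof (cases "z \<le> K")
        case True
        then show ?thesis using 1 q assms by simp
      next
        case F: False
        then have "K * z \<le> z * z" using z by (intro mult_right_mono) auto
        then have "z \<le> 1 / K * z\<^sup>2" using K by (simp add: field_simps power2_eq_square)
        then show ?thesis using nn assms by linarith
      qed
    qed
    then show ?thesis using e nn z by simp
  qed
  have neg: "clip K z * clip 1 (z / d) = clip K (- z) * clip 1 (- z / d)"
    by (simp add: clip_def max_def min_def) (use assms in \<open>auto simp: field_simps\<close>)
  show "0 \<le> clip K z * clip 1 (z / d)" "\<bar>z\<bar> \<le> clip K z * clip 1 (z / d) + (1 / K * z\<^sup>2 + d)"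
    using main[of z] main[of "- z"] neg by (cases "0 \<le> z"; simp)+
qed

section \<open>Growth of the solution under a discretised change of measure\<close>

locale she_tilt = she M \<xi> \<sigma> u L c0 for M :: "'a measure" and \<xi> \<sigma> u L c0 +
  fixes t A l x0 K0 :: real
  assumes t: "0 < t" and A: "0 < A" and l: "0 < l" and K0: "\<bar>x0\<bar> + 2 * l \<le> K0"
begin

text \<open>The smoothed sign makes the product of the drift with \<open>\<sigma> (u s y w)\<close>
  close to the bump times the absolute value of \<open>\<sigma> (u s y w)\<close>, so the mean grows
  whatever the sign. The scale \<open>c0 / 4\<close> is the loss budgeted in
  \<open>tilted_lower_sigma\<close>. The box contains the support of the bump in space because of
  the bound on \<open>K0\<close>.\<close>

definition drift :: "real \<Rightarrow> real \<Rightarrow> 'a \<Rightarrow> real" where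
  "drift s y w = (if in_box t K0 s y then bump A l x0 y * clip 1 (\<sigma> (u s y w) / (c0 / 4)) else 0)"

text \<open>The density is kept on the grid: no limit in \<open>N\<close> is formed, only bounds
  valid for all large \<open>N\<close>, and in the end one such \<open>N\<close> is used.\<close>

definition Z :: "nat \<Rightarrow> 'a \<Rightarrow> real" where
  "Z N = noise_cells.tilt \<xi> (grid_cell N) (\<lambda>k. drift (grid_time N k) (grid_pos N k)) (grid_size N)"

definition drift_bound :: "real \<Rightarrow> real \<Rightarrow> real" where
  "drift_bound s y = (if in_box t K0 s y then bump A l x0 y else 0)"

lemma drift_le: "\<bar>drift s y w\<bar> \<le> drift_bound s y"
  using clip_bounds(1)[of 1 "\<sigma> (u s y w) / (c0 / 4)"] bump_bounds(1)[of A l x0 y] A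
  by (auto simp: drift_def drift_bound_def abs_mult intro: mult_left_le)

lemma drift_adapted: "0 \<le> s \<Longrightarrow> drift s y \<in> borel_measurable (NS ({0<..s} \<times> UNIV))"
  unfolding drift_def[abs_def] using u_adapted[of s y] by measurable

text \<open>4 A^2 l t bounds the integral of the squared drift, whose support has width 4 l. The 1
  is slack for the Riemann sums and the 6 comes from \<open>tilt_fourth_moment\<close>.\<close>

definition CZ :: real where "CZ = exp (6 * (4 * A\<^sup>2 * l * t + 1))"

lemma CZ: "1 \<le> CZ" using t l by (simp add: CZ_def)

lemma Z_pos: "0 < N \<Longrightarrow> 0 < Z N w"
  unfolding Z_def by (rule noise_cells.tilt_pos[OF grid_cells])

lemma Z_integrable:
  assumes N: "0 < N"
  shows "integrable M (Z N)" "expectation (Z N) = 1" "nnE M (\<lambda>w. Z N w) = 1"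
proof -
  interpret C: noise_cells M \<xi> "grid_cell N" "grid_region N" by (rule grid_cells[OF N])
  have a: "drift (grid_time N k) (grid_pos N k) \<in> borel_measurable (NS (grid_region N k))" for k by (rule grid_adapted[OF N drift_adapted])
  show i: "integrable M (Z N)" "expectation (Z N) = 1" unfolding Z_def
    by (rule C.tilt_integrable[where H = "\<lambda>k. drift_bound (grid_time N k) (grid_pos N k)", OF a drift_le])+
  then show "nnE M (\<lambda>w. Z N w) = 1"
    using Z_pos[OF N] by (subst nn_integral_eq_integral) (auto intro: less_imp_le)
qed

lemma Z_measurable: "0 < N \<Longrightarrow> Z N \<in> borel_measurable M" using Z_integrable(1) by (rule borel_measurable_integrable)

lemma bump_sq_integral: "nnE lborel (\<lambda>z. indicator {0<..} (fst z) * (drift_bound (fst z) (snd z))\<^sup>2) \<le> ennreal (4 * A\<^sup>2 * l * t)"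
proof -
  have "nnE lborel (\<lambda>z. indicator {0<..} (fst z) * (drift_bound (fst z) (snd z))\<^sup>2) \<le> (\<integral>\<^sup>+z. ennreal (A\<^sup>2) * indicator ({0<..t} \<times> {x0 - 2 * l..x0 + 2 * l}) z \<partial>lborel)"
  proof (rule nn_integral_mono)
    fix z :: "real \<times> real"
    show "ennreal (indicator {0<..} (fst z) * (drift_bound (fst z) (snd z))\<^sup>2) \<le> ennreal (A\<^sup>2) * indicator ({0<..t} \<times> {x0 - 2 * l..x0 + 2 * l}) z"
    proof (cases "z \<in> {0<..t} \<times> {x0 - 2 * l..x0 + 2 * l}")
      case True
      have "0 \<le> drift_bound (fst z) (snd z)" "drift_bound (fst z) (snd z) \<le> A" using A bump_bounds[of A l x0 "snd z"] by (auto simp: drift_bound_def)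
      then have "(drift_bound (fst z) (snd z))\<^sup>2 \<le> A\<^sup>2" by (intro power_mono)
      then show ?thesis using True by (auto simp: indicator_def intro: ennreal_leI)
    next
      case False
      then have "\<not> (0 < fst z \<and> fst z \<le> t) \<or> 2 * l \<le> \<bar>snd z - x0\<bar>" by (cases z) auto
      then have "indicator {0<..} (fst z) * (drift_bound (fst z) (snd z))\<^sup>2 = 0" using bump_outside[OF l, of "snd z" x0 A] by (auto simp: drift_bound_def in_box_def)
      then show ?thesis by (simp only: ennreal_0 zero_le)
    qed
  qed
  also have "... = ennreal (A\<^sup>2) * emeasure lborel ({0<..t} \<times> {x0 - 2 * l..x0 + 2 * l})" by (simp add: nn_integral_cmult_indicator)
  also have "emeasure lborel ({0<..t} \<times> {x0 - 2 * l..x0 + 2 * l}) = emeasure lborel {0<..t} * emeasure lborel {x0 - 2 * l..x0 + 2 * l}"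
    unfolding lborel_prod[symmetric] by (rule lborel.emeasure_pair_measure_Times) auto
  also have "... = ennreal (t * (4 * l))" using t l by (simp add: ennreal_mult'[symmetric])
  also have "ennreal (A\<^sup>2) * ennreal (t * (4 * l)) = ennreal (4 * A\<^sup>2 * l * t)" by (simp add: ennreal_mult'[symmetric] mult_ac)
  finally show ?thesis .
qed

lemma Z_fourth: "eventually (\<lambda>N. nnE M (\<lambda>w. Z N w ^ 4) \<le> ennreal CZ) sequentially"
proof -
  have c: "continuous_on ({0..t} \<times> UNIV) (\<lambda>(s, y). (bump A l x0 y)\<^sup>2)"
    unfolding case_prod_beta by (intro continuous_intros continuous_on_compose2[OF bump_continuous[OF l, of UNIV A x0]]) auto
  have c': "(\<lambda>s y. (drift_bound s y)\<^sup>2) = (\<lambda>s y. if in_box t K0 s y then (bump A l x0 y)\<^sup>2 else 0)"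
    by (auto simp: drift_bound_def fun_eq_iff)
  have "(\<lambda>N. ennreal (\<Sum>k<grid_size N. measure lborel (grid_cell N k) * (drift_bound (grid_time N k) (grid_pos N k))\<^sup>2))
    \<longlonglongrightarrow> (nnE lborel (\<lambda>z. indicator {0<..} (fst z) * (drift_bound (fst z) (snd z))\<^sup>2))"
  proof (rule riemann_sum_tendsto[where C = "A\<^sup>2" and T = t and R = K0])
    show "\<bar>(drift_bound s y)\<^sup>2\<bar> \<le> A\<^sup>2" for s y
      using A bump_bounds[of A l x0 y] by (auto simp: drift_bound_def intro!: power_mono)
    show "\<not> (s \<le> t \<and> \<bar>y\<bar> \<le> K0) \<Longrightarrow> (drift_bound s y)\<^sup>2 = 0" for s y by (auto simp: drift_bound_def in_box_def)
    have "(\<lambda>z. if in_box t K0 (fst z) (snd z) then (bump A l x0 (snd z))\<^sup>2 else 0) \<in> borel_measurable borel"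
      by (rule box_measurable[OF c])
    then show "(\<lambda>z. indicator {0<..} (fst z) * (drift_bound (fst z) (snd z))\<^sup>2) \<in> borel_measurable borel"
      unfolding fun_cong[OF fun_cong[OF c']] by measurable
    show "0 < s \<Longrightarrow> (\<lambda>N. (drift_bound (round_below N s) (round_below N y))\<^sup>2) \<longlonglongrightarrow> (drift_bound s y)\<^sup>2" for s y
      unfolding fun_cong[OF fun_cong[OF c']] by (rule box_round_tendsto[OF c])
  qed simp
  moreover have "nnE lborel (\<lambda>z. indicator {0<..} (fst z) * (drift_bound (fst z) (snd z))\<^sup>2) < ennreal (4 * A\<^sup>2 * l * t + 1)"
    by (rule le_less_trans[OF bump_sq_integral]) (use t l in \<open>simp add: ennreal_less_iff\<close>)
  ultimately have "eventually (\<lambda>N. ennreal (\<Sum>k<grid_size N. measure lborel (grid_cell N k) * (drift_bound (grid_time N k) (grid_pos N k))\<^sup>2) < ennreal (4 * A\<^sup>2 * l * t + 1)) sequentially"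
    by (rule order_tendstoD(2))
  then show ?thesis using eventually_gt_at_top[of "0::nat"]
  proof eventually_elim
    case (elim N)
    interpret C: noise_cells M \<xi> "grid_cell N" "grid_region N" by (rule grid_cells[OF elim(2)])
    have a: "drift (grid_time N k) (grid_pos N k) \<in> borel_measurable (NS (grid_region N k))" for k by (rule grid_adapted[OF elim(2) drift_adapted])
    have "nnE M (\<lambda>w. Z N w ^ 4) \<le> ennreal (exp (6 * (\<Sum>k<grid_size N. (drift_bound (grid_time N k) (grid_pos N k))\<^sup>2 * measure lborel (grid_cell N k))))"
      unfolding Z_def by (rule C.tilt_fourth_moment[OF a drift_le])
    also have "... \<le> ennreal CZ"
    proof (rule ennreal_leI)
      have nn: "0 \<le> 4 * A\<^sup>2 * l * t + 1" using t l by simp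
      have "(\<Sum>k<grid_size N. measure lborel (grid_cell N k) * (drift_bound (grid_time N k) (grid_pos N k))\<^sup>2) \<le> 4 * A\<^sup>2 * l * t + 1"
        using order_less_imp_le[OF elim(1)] nn by (simp only: ennreal_le_iff)
      then show "exp (6 * (\<Sum>k<grid_size N. (drift_bound (grid_time N k) (grid_pos N k))\<^sup>2 * measure lborel (grid_cell N k))) \<le> CZ"
        unfolding CZ_def by (simp add: mult.commute)
    qed
    finally show ?case .
  qed
qed

lemma Z_second:
  assumes N: "0 < N" and Z4: "nnE M (\<lambda>w. Z N w ^ 4) \<le> ennreal CZ"
  shows "nnE M (\<lambda>w. (Z N w)\<^sup>2) \<le> ennreal CZ"
proof -
  note [measurable] = Z_measurable[OF N]
  have Z4': "nnE M (\<lambda>w. ((Z N w)\<^sup>2)\<^sup>2) \<le> ennreal CZ" using Z4 by (simp add: power_mult[symmetric])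
  have "(\<integral>\<^sup>+w. ennreal \<bar>1 * (Z N w)\<^sup>2\<bar> \<partial>M) \<le> ennreal (1 * 1 / 2 + CZ / (2 * 1))"
    by (rule product_small[OF _ _ _ Z4']) (use CZ in \<open>auto simp: emeasure_space_1\<close>)
  also have "... \<le> ennreal CZ" using CZ by (intro ennreal_leI) auto
  finally show ?thesis by simp
qed

definition tilted :: "nat \<Rightarrow> real \<Rightarrow> real \<Rightarrow> ennreal" where
  "tilted N s y = nnE M (\<lambda>w. \<bar>u s y w\<bar> * Z N w)"

text \<open>The loss c0/2 consists of c0/4 for small values of \<open>\<sigma>\<close> (smoothed
  sign) and c0/4 for large ones (truncation at \<open>K\<close>, which is why \<open>K\<close>
  dominates the moments). The subtraction in \<open>ennreal\<close> is cut off at 0.\<close>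

lemma tilted_lower_sigma:
  assumes s: "0 \<le> s" "s \<le> t" and N: "0 < N" and Z4: "nnE M (\<lambda>w. Z N w ^ 4) \<le> ennreal CZ"
    and K: "c0 / 4 \<le> K" "((L\<^sup>2 * (4 * exp (growth_rate 2 * t)))\<^sup>2 + CZ) / (c0 / 4) \<le> K"
  shows "ennreal c0 * (tilted N s y - ennreal (1 / 2)) \<le> nnE M (\<lambda>w. clip K (\<sigma> (u s y w)) * clip 1 (\<sigma> (u s y w) / (c0 / 4)) * Z N w)"
proof -
  note [measurable] = Z_measurable[OF N] u_measurable[OF s(1), of y]
  define d where "d = c0 / 4"
  have d: "0 < d" using c0 by (simp add: d_def)
  have K0: "0 < K" "d \<le> K" using K(1) d by (auto simp: d_def)
  define F where "F z = clip K z * clip 1 (z / d)" for z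
  have [measurable]: "F \<in> borel_measurable borel" unfolding F_def[abs_def] by measurable
  have F0: "0 \<le> F z" for z unfolding F_def by (rule clip_product_ge[OF d K0(2)])
  define M4 where "M4 = (L\<^sup>2 * (4 * exp (growth_rate 2 * t)))\<^sup>2"
  have s4: "nnE M (\<lambda>w. ((\<sigma> (u s y w))\<^sup>2)\<^sup>2) \<le> ennreal M4"
  proof -
    have "nnE M (\<lambda>w. \<sigma> (u s y w) ^ (2 * 2)) \<le> ennreal ((L\<^sup>2 * (4 * exp (growth_rate 2 * t))) ^ 2)"
    proof (rule \<sigma>_moment_le)
      have "growth_rate 2 * s \<le> growth_rate 2 * t" using s growth_rate_pos[of 2] by (intro mult_left_mono) auto
      then have "(4 * exp (growth_rate 2 * s))\<^sup>2 \<le> (4 * exp (growth_rate 2 * t))\<^sup>2" by (intro power_mono) auto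
      then show "nnE M (\<lambda>w. u s y w ^ (2 * 2)) \<le> ennreal ((4 * exp (growth_rate 2 * t))\<^sup>2)"
        by (intro order_trans[OF u_moment_le[of 2 s y]] ennreal_leI) (use s in auto)
    qed auto
    then show ?thesis by (simp add: M4_def power_mult[symmetric])
  qed
  have sz: "nnE M (\<lambda>w. (\<sigma> (u s y w))\<^sup>2 * Z N w) \<le> ennreal (M4 + CZ)"
  proof -
    have "(\<integral>\<^sup>+w. ennreal \<bar>(\<sigma> (u s y w))\<^sup>2 * Z N w\<bar> \<partial>M) \<le> ennreal (1 * M4 / 2 + CZ / (2 * 1))"
      by (rule product_small[OF _ _ s4 Z_second[OF N Z4]]) (use CZ in \<open>auto simp: M4_def\<close>)
    also have "... \<le> ennreal (M4 + CZ)" using CZ zero_le_power2[of "L\<^sup>2 * (4 * exp (growth_rate 2 * t))"] unfolding M4_def by (intro ennreal_leI) linarith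
    finally show ?thesis using Z_pos[OF N] by (simp add: abs_mult less_imp_le)
  qed
  have "ennreal c0 * tilted N s y = nnE M (\<lambda>w. c0 * \<bar>u s y w\<bar> * Z N w)"
    unfolding tilted_def using c0 by (subst nn_integral_cmult[symmetric]) (auto simp: ennreal_mult'[symmetric] mult.assoc)
  also have "... \<le> (\<integral>\<^sup>+w. ennreal (F (\<sigma> (u s y w)) * Z N w) + (ennreal (1 / K) * ennreal ((\<sigma> (u s y w))\<^sup>2 * Z N w) + ennreal d * ennreal (Z N w)) \<partial>M)"
  proof (rule nn_integral_mono)
    fix w
    have z: "0 \<le> Z N w" using Z_pos[OF N] by (simp add: less_imp_le)
    have "c0 * \<bar>u s y w\<bar> \<le> F (\<sigma> (u s y w)) + (1 / K * (\<sigma> (u s y w))\<^sup>2 + d)"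
      using c0(2)[of "u s y w"] clip_product_ge(2)[OF d K0(2), of "\<sigma> (u s y w)"] unfolding F_def by linarith
    then have "c0 * \<bar>u s y w\<bar> * Z N w \<le> (F (\<sigma> (u s y w)) + (1 / K * (\<sigma> (u s y w))\<^sup>2 + d)) * Z N w" using z by (rule mult_right_mono)
    also have "... = F (\<sigma> (u s y w)) * Z N w + (1 / K * ((\<sigma> (u s y w))\<^sup>2 * Z N w) + d * Z N w)" by (simp add: algebra_simps)
    finally have "ennreal (c0 * \<bar>u s y w\<bar> * Z N w) \<le> ennreal (F (\<sigma> (u s y w)) * Z N w + (1 / K * ((\<sigma> (u s y w))\<^sup>2 * Z N w) + d * Z N w))" by (rule ennreal_leI)
    also have "... = ennreal (F (\<sigma> (u s y w)) * Z N w) + (ennreal (1 / K * ((\<sigma> (u s y w))\<^sup>2 * Z N w)) + ennreal (d * Z N w))"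
      using F0 z K0 d by (subst ennreal_plus; simp)+
    also have "ennreal (1 / K * ((\<sigma> (u s y w))\<^sup>2 * Z N w)) = ennreal (1 / K) * ennreal ((\<sigma> (u s y w))\<^sup>2 * Z N w)" using K0 by (intro ennreal_mult') simp
    also have "ennreal (d * Z N w) = ennreal d * ennreal (Z N w)" using d by (intro ennreal_mult') simp
    finally show "ennreal (c0 * \<bar>u s y w\<bar> * Z N w) \<le> ennreal (F (\<sigma> (u s y w)) * Z N w) + (ennreal (1 / K) * ennreal ((\<sigma> (u s y w))\<^sup>2 * Z N w) + ennreal d * ennreal (Z N w))" .
  qed
  also have "... = nnE M (\<lambda>w. F (\<sigma> (u s y w)) * Z N w) + (ennreal (1 / K) * nnE M (\<lambda>w. (\<sigma> (u s y w))\<^sup>2 * Z N w) + ennreal d * 1)"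
    by (simp add: nn_integral_add nn_integral_cmult Z_integrable[OF N])
  also have "... \<le> nnE M (\<lambda>w. F (\<sigma> (u s y w)) * Z N w) + (ennreal (1 / K) * ennreal (M4 + CZ) + ennreal d * 1)"
    by (intro add_mono mult_left_mono sz order_refl) auto
  also have "ennreal (1 / K) * ennreal (M4 + CZ) + ennreal d * 1 \<le> ennreal (c0 / 2)"
  proof -
    have "M4 + CZ \<le> K * d" using K(2) d by (simp add: M4_def d_def[symmetric] divide_le_eq)
    then have "1 / K * (M4 + CZ) \<le> d" using K0 by (simp add: divide_le_eq mult.commute)
    then have "1 / K * (M4 + CZ) + d \<le> c0 / 2" unfolding d_def by linarith
    moreover have "ennreal (1 / K) * ennreal (M4 + CZ) + ennreal d * 1 = ennreal (1 / K * (M4 + CZ) + d)"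
    proof -
      have "0 \<le> M4 + CZ" using CZ zero_le_power2[of "L\<^sup>2 * (4 * exp (growth_rate 2 * t))"] unfolding M4_def by linarith
      then show ?thesis using K0 d by (subst ennreal_plus) (auto simp: ennreal_mult'[symmetric])
    qed
    ultimately show ?thesis by (simp add: ennreal_leI)
  qed
  finally have le: "ennreal c0 * tilted N s y \<le> nnE M (\<lambda>w. F (\<sigma> (u s y w)) * Z N w) + ennreal (c0 / 2)" by (simp add: add_left_mono)
  have "ennreal c0 * (tilted N s y - ennreal (1 / 2)) = ennreal c0 * tilted N s y - ennreal c0 * ennreal (1 / 2)"
    by (rule ennreal_right_diff_distrib) simp
  also have "ennreal c0 * ennreal (1 / 2) = ennreal (c0 / 2)" using c0 by (subst ennreal_mult'[symmetric]) auto
  also have "ennreal c0 * tilted N s y - ennreal (c0 / 2) \<le> nnE M (\<lambda>w. F (\<sigma> (u s y w)) * Z N w)"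
    using le by (subst ennreal_minus_le_iff) (auto simp: add.commute)
  finally show ?thesis by (simp add: F_def d_def)
qed

text \<open>The deterministic weight, within the truncation box, with which the drift enters the
  mild equation.\<close>

definition kernel_mass :: "real \<Rightarrow> nat \<Rightarrow> real \<Rightarrow> real \<times> real \<Rightarrow> real" where
  "kernel_mass \<tau> K x z = indicator {0<..} (fst z) * (if in_box (\<tau> - 1 / real K) (real K) (fst z) (snd z) then heat_kernel (\<tau> - fst z) (snd z - x) * bump A l x0 (snd z) else 0)"

abbreviation gain :: "real \<Rightarrow> nat \<Rightarrow> real \<Rightarrow> nat \<Rightarrow> ennreal" where
  "gain \<tau> K x N \<equiv> \<integral>\<^sup>+z. ennreal (kernel_mass \<tau> K x z) * (ennreal c0 * (tilted N (fst z) (snd z) - ennreal (1 / 2))) \<partial>lborel"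

lemma heat_bump_continuous: "0 < K \<Longrightarrow> 0 < \<tau> \<Longrightarrow> continuous_on ({0..\<tau> - 1 / real K} \<times> UNIV) (\<lambda>(s, y). heat_kernel (\<tau> - s) (y - x) * bump A l x0 y)"
proof -
  assume K: "0 < K" and \<tau>: "0 < \<tau>"
  have "continuous_on ({0..\<tau> - 1 / real K} \<times> UNIV) (\<lambda>p. (\<lambda>(s, y). heat_kernel (\<tau> - s) (y - x)) p * bump A l x0 (snd p))"
    by (intro continuous_on_mult kernel_box[OF kernel_heat[OF \<tau>] K] continuous_on_compose2[OF bump_continuous[OF l, of UNIV A x0]] continuous_on_snd continuous_on_id) auto
  then show ?thesis by (simp add: case_prod_beta)
qed

lemma kernel_mass_nonneg: "0 < K \<Longrightarrow> 0 \<le> kernel_mass \<tau> K x z"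
  unfolding kernel_mass_def using A bump_bounds(1)[of A l x0 "snd z"]
  by (auto simp: in_box_def indicator_def intro!: mult_nonneg_nonneg heat_kernel_nonneg dest: time_cutoff_less)

lemma kernel_mass_measurable[measurable]: "0 < K \<Longrightarrow> 0 < \<tau> \<Longrightarrow> kernel_mass \<tau> K x \<in> borel_measurable borel"
  unfolding kernel_mass_def[abs_def] using box_measurable[OF heat_bump_continuous[of K \<tau> x]] by measurable

lemma tilted_measurable:
  assumes "0 < N"
  shows "(\<lambda>z. indicator {0<..} (fst z) * tilted N (fst z) (snd z)) \<in> borel_measurable (borel :: (real \<times> real) measure)"
proof -
  note [measurable] = u_joint_measurable Z_measurable[OF assms]
  have "(\<lambda>z. \<integral>\<^sup>+w. ennreal (\<bar>indicator {0<..} (fst z) * u (fst z) (snd z) w\<bar> * Z N w) \<partial>M) \<in> borel_measurable (borel :: (real \<times> real) measure)"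
    by (intro borel_measurable_nn_integral) measurable
  then show ?thesis by (rule measurable_cong[THEN iffD1, rotated]) (auto simp: tilted_def indicator_def)
qed

text \<open>Tilted means are taken in the mild equation. Its stochastic integral is replaced by a
  grid sum, which by \<open>tilt_msum\<close> acquires the mean of its drift; that mean is bounded
  below by the gain. The absolute value in \<open>tilted\<close> only helps, as it bounds the tilted
  mean of the solution.\<close>

theorem tilted_recursion:
  assumes \<tau>: "0 < \<tau>" "\<tau> \<le> t" and e: "0 < e"
  obtains K1 where "\<And>K. K1 \<le> K \<Longrightarrow> 0 < K \<and> eventually (\<lambda>N. 1 + gain \<tau> K x N
     \<le> tilted N \<tau> x + ennreal e) sequentially"
proof -
  define ker where "ker s y = heat_kernel (\<tau> - s) (y - x)" for s y
  have ker: "kernel \<tau> ker" unfolding ker_def by (rule kernel_heat[OF \<tau>(1)])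
  obtain J where hw: "has_walsh_integral M \<xi> (\<lambda>s y w. indicator {0<..<\<tau>} s * heat_kernel (\<tau> - s) (y - x) * \<sigma> (u s y w)) J"
    and uJ: "AE w in M. u \<tau> x w = 1 + J w" by (rule u_mild[OF \<tau>(1)])
  have [measurable]: "J \<in> borel_measurable M" using hw by (simp add: has_walsh_integral_def)
  have app: "approximable \<tau> ker J" by (rule walsh_approximable[OF ker]) (use hw in \<open>simp add: ker_def\<close>)
  \<comment> \<open>Young's parameter: it balances the L2 error of the grid sum against the second
    moment of the density, so that each contributes e/4.\<close>
  define rr where "rr = 2 * CZ / e"
  have rr: "0 < rr" using CZ e by (simp add: rr_def)
  obtain K2 where K2: "\<And>K. K2 \<le> K \<Longrightarrow> 0 < K \<and> eventually (\<lambda>N. approx_error \<tau> ker J K N \<le> ennreal (e / (2 * rr))) sequentially"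
    by (rule approximableD[OF app, of "e / (2 * rr)"]) (use e rr in auto)
  define M4 where "M4 = (L\<^sup>2 * (4 * exp (growth_rate 2 * t)))\<^sup>2"
  define K1 where "K1 = max K2 (nat \<lceil>max K0 (max (c0 / 4) ((M4 + CZ) / (c0 / 4)))\<rceil>)"
  show thesis
  proof (rule that[of K1])
    fix K assume KK: "K1 \<le> K"
    then have K: "0 < K" and KK0: "K0 \<le> real K" "c0 / 4 \<le> real K" "(M4 + CZ) / (c0 / 4) \<le> real K"
      using K2[of K] by (auto simp: K1_def)
    have evS: "eventually (\<lambda>N. approx_error \<tau> ker J K N \<le> ennreal (e / (2 * rr))) sequentially"
      using K2[of K] KK by (simp add: K1_def)
    define T where "T = \<tau> - 1 / real K"
    have Tt: "T < t" unfolding T_def by (rule less_le_trans[OF time_cutoff_less[OF order_refl K] \<tau>(2)])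
    define F where "F z = clip K (\<sigma> z) * clip 1 (\<sigma> z / (c0 / 4))" for z
    have Fc: "continuous_on UNIV F" unfolding F_def by (intro continuous_intros continuous_on_mult \<sigma>_continuous) (use c0 in auto)
    have Fb: "\<bar>F z\<bar> \<le> K" for z
      unfolding F_def using clip_bounds(1)[of "real K" "\<sigma> z"] clip_bounds(1)[of 1 "\<sigma> z / (c0 / 4)"] by (auto intro: abs_mult_le_left)
    have F0: "0 \<le> F z" for z unfolding F_def by (rule clip_product_ge) (use c0 KK0 in auto)
    have gc: "continuous_on ({0..T} \<times> UNIV) (\<lambda>(s, y). ker s y * bump A l x0 y)" unfolding ker_def T_def by (rule heat_bump_continuous[OF K \<tau>(1)])
    define f where "f s y w = (if in_box T (real K) s y then ker s y * bump A l x0 y * F (u s y w) else 0)" for s y w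
    note fc = field_conv[OF gc Fc Fb, where K = "real K", folded f_def]
    \<comment> \<open>The two factors are cut off to different boxes. At a point of the field's box
      outside the drift's box the bump vanishes already.\<close>
    have prodf: "approx_field \<tau> K ker s y w * drift s y w = f s y w" for s y w
    proof (cases "in_box T K s y")
      case True
      show ?thesis
      proof (cases "in_box t K0 s y")
        case t: True
        with True show ?thesis by (simp add: approx_field_def drift_def f_def F_def T_def)
      next
        case False
        then have "\<not> (- K0 < y \<and> y \<le> K0)" using True Tt by (auto simp: in_box_def)
        then have "2 * l \<le> \<bar>y - x0\<bar>" using K0 by linarith
        then show ?thesis using False True by (simp add: f_def drift_def bump_outside[OF l])
      qed
    qed (simp add: approx_field_def f_def T_def)
    have f0: "0 \<le> f s y w" for s y w
      using F0[of "u s y w"] bump_bounds(1)[of A l x0 y] A heat_kernel_nonneg[of "\<tau> - s" "y - x"] K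
      by (auto simp: f_def ker_def T_def in_box_def intro!: mult_nonneg_nonneg dest: time_cutoff_less)
    define W where "W = ({0<..T + 1} \<times> {-(real K + 1)..real K + 1} :: (real \<times> real) set)"
    have Wm[measurable]: "W \<in> sets borel" by (simp add: W_def)
    define wd where "wd = enn2real (emeasure lborel W)"
    have wd: "0 \<le> wd" "emeasure lborel W = ennreal wd" using emeasure_window by (auto simp: wd_def W_def)
    \<comment> \<open>The same balance over space-time, where \<open>W\<close>, of measure
      \<open>wd\<close>, carries both the field and its step approximation; the added 1 keeps \<mu>
      positive.\<close>
    define \<mu> where "\<mu> = 2 * (wd * CZ + 1) / e"
    have \<mu>: "0 < \<mu>" using CZ e wd by (simp add: \<mu>_def add_nonneg_pos)
    have "eventually (\<lambda>N. (\<integral>\<^sup>+w. (nnE lborel (\<lambda>z. (grid_step N (\<lambda>s y. f s y w) z - indicator {0<..} (fst z) * f (fst z) (snd z) w)\<^sup>2)) \<partial>M) < ennreal (e / (2 * \<mu>))) sequentially"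
      using fc(1) by (rule order_tendstoD(2)) (use e \<mu> in auto)
    then have "eventually (\<lambda>N. 1 + gain \<tau> K x N
     \<le> tilted N \<tau> x + ennreal e) sequentially"
      using evS Z_fourth eventually_gt_at_top[of "0::nat"]
    proof eventually_elim
      case (elim N)
      note N = elim(4) and Z4 = elim(3)
      note Zm[measurable] = Z_measurable[OF N]
      interpret C: noise_cells M \<xi> "grid_cell N" "grid_region N" by (rule grid_cells[OF N])
      define X h where "X k = approx_field \<tau> K ker (grid_time N k) (grid_pos N k)" and "h k = drift (grid_time N k) (grid_pos N k)" for k
      obtain c where c: "0 \<le> c" "\<And>s y w. \<bar>approx_field \<tau> K ker s y w\<bar> \<le> c" by (rule approx_field_bounded[OF ker K]) blast
      define S where "S = grid_sum N (approx_field \<tau> K ker)"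
      have [measurable]: "S \<in> borel_measurable M" unfolding S_def by (rule grid_sum_measurable[OF approx_field_adapted])
      define Tn where "Tn w = (\<Sum>k<grid_size N. measure lborel (grid_cell N k) * f (grid_time N k) (grid_pos N k) w)" for w
      have ts: "integrable M (\<lambda>w. S w * Z N w) \<and> integrable M (\<lambda>w. Tn w * Z N w) \<and> expectation (\<lambda>w. S w * Z N w) = expectation (\<lambda>w. Tn w * Z N w)"
      proof -
        have "integrable M (\<lambda>w. C.msum X (grid_size N) w * C.tilt h (grid_size N) w) \<and>
          integrable M (\<lambda>w. (\<Sum>k<grid_size N. measure lborel (grid_cell N k) * X k w * h k w) * C.tilt h (grid_size N) w) \<and>
          expectation (\<lambda>w. C.msum X (grid_size N) w * C.tilt h (grid_size N) w) = expectation (\<lambda>w. (\<Sum>k<grid_size N. measure lborel (grid_cell N k) * X k w * h k w) * C.tilt h (grid_size N) w)"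
        proof (rule C.tilt_msum)
          show "h k \<in> borel_measurable (NS (grid_region N k))" for k unfolding h_def by (rule grid_adapted[OF N drift_adapted])
          show "X k \<in> borel_measurable (NS (grid_region N k))" for k unfolding X_def by (rule grid_adapted[OF N approx_field_adapted])
          show "\<bar>h k w\<bar> \<le> drift_bound (grid_time N k) (grid_pos N k)" for k w unfolding h_def by (rule drift_le)
          show "\<bar>X k w\<bar> \<le> c" for k w unfolding X_def by (rule c)
        qed
        moreover have "C.msum X (grid_size N) = S" unfolding S_def grid_sum_msum[OF N] X_def ..
        moreover have "C.tilt h (grid_size N) = Z N" unfolding Z_def h_def ..
        moreover have "(\<Sum>k<grid_size N. measure lborel (grid_cell N k) * X k w * h k w) = Tn w" for w
          unfolding Tn_def X_def h_def by (simp add: mult.assoc prodf)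
        ultimately show ?thesis by simp
      qed
      have Tn0: "0 \<le> Tn w" for w unfolding Tn_def using f0 by (intro sum_nonneg mult_nonneg_nonneg) auto
      have Zp: "0 \<le> Z N w" for w using Z_pos[OF N] by (simp add: less_imp_le)
      have um[measurable]: "u \<tau> x \<in> borel_measurable M" using \<tau> by (intro u_measurable) simp
      have [measurable]: "S \<in> borel_measurable M" unfolding S_def by (rule grid_sum_measurable[OF approx_field_adapted])
      note [measurable] = Z_measurable[OF N]
      have err1: "(\<integral>\<^sup>+w. ennreal \<bar>(J w - S w) * Z N w\<bar> \<partial>M) \<le> ennreal (e / 2)"
      proof -
        have "(\<integral>\<^sup>+w. ennreal \<bar>(J w - S w) * Z N w\<bar> \<partial>M) \<le> ennreal (rr * (e / (2 * rr)) / 2 + CZ / (2 * rr))"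
          by (rule product_small[OF _ _ _ Z_second[OF N Z4]]) (use elim(2) e rr CZ in \<open>simp_all add: S_def[symmetric]\<close>)
        also have "rr * (e / (2 * rr)) / 2 + CZ / (2 * rr) = e / 2" using rr CZ e by (simp add: rr_def field_simps)
        finally show ?thesis .
      qed
      \<comment> \<open>The density has mean 1, so the left side is the tilted mean of 1 + S, and 1
        + S is close to the solution 1 + J.\<close>
      have step1: "1 + nnE M (\<lambda>w. Tn w * Z N w) \<le> tilted N \<tau> x + ennreal (e / 2)"
      proof -
        have "1 + nnE M (\<lambda>w. Tn w * Z N w) = ennreal (1 + expectation (\<lambda>w. Tn w * Z N w))"
          using ts Tn0 Zp by (subst nn_integral_eq_integral) (auto simp: ennreal_plus integral_nonneg_AE)
        also have "1 + expectation (\<lambda>w. Tn w * Z N w) = expectation (\<lambda>w. Z N w + S w * Z N w)"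
          using ts Z_integrable[OF N] by simp
        also have "ennreal (expectation (\<lambda>w. Z N w + S w * Z N w)) \<le> (\<integral>\<^sup>+w. ennreal \<bar>Z N w + S w * Z N w\<bar> \<partial>M)"
        proof -
          have i: "integrable M (\<lambda>w. Z N w + S w * Z N w)" using ts Z_integrable[OF N] by simp
          have "expectation (\<lambda>w. Z N w + S w * Z N w) \<le> expectation (\<lambda>w. \<bar>Z N w + S w * Z N w\<bar>)"
            using i by (intro integral_mono) auto
          then show ?thesis using i by (subst nn_integral_eq_integral) (auto intro: ennreal_leI)
        qed
        also have "... \<le> (\<integral>\<^sup>+w. ennreal (\<bar>u \<tau> x w\<bar> * Z N w) + ennreal \<bar>(J w - S w) * Z N w\<bar> \<partial>M)"
        proof (rule nn_integral_mono_AE)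
          show "AE w in M. ennreal \<bar>Z N w + S w * Z N w\<bar> \<le> ennreal (\<bar>u \<tau> x w\<bar> * Z N w) + ennreal \<bar>(J w - S w) * Z N w\<bar>"
            using uJ
          proof eventually_elim
            case (elim w)
            have "Z N w + S w * Z N w = u \<tau> x w * Z N w - (J w - S w) * Z N w" unfolding elim by (simp add: algebra_simps)
            then have "\<bar>Z N w + S w * Z N w\<bar> \<le> \<bar>u \<tau> x w * Z N w\<bar> + \<bar>(J w - S w) * Z N w\<bar>" by linarith
            also have "\<bar>u \<tau> x w * Z N w\<bar> = \<bar>u \<tau> x w\<bar> * Z N w" using Zp[of w] by (simp add: abs_mult)
            finally show ?case using Zp[of w] by (simp add: ennreal_plus[symmetric] ennreal_leI del: ennreal_plus)
          qed
        qed
        also have "... = tilted N \<tau> x + (\<integral>\<^sup>+w. ennreal \<bar>(J w - S w) * Z N w\<bar> \<partial>M)"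
          unfolding tilted_def by (rule nn_integral_add) measurable
        also have "... \<le> tilted N \<tau> x + ennreal (e / 2)" by (intro add_left_mono err1)
        finally show ?thesis .
      qed
      define gs where "gs z w = grid_step N (\<lambda>s y. f s y w) z" for z w
      define fi where "fi z w = indicator {0<..} (fst z) * f (fst z) (snd z) w" for z w
      have gsm[measurable]: "(\<lambda>(z, w). gs z w) \<in> borel_measurable (borel \<Otimes>\<^sub>M M)" unfolding gs_def by (rule fc(2))
      have fim[measurable]: "(\<lambda>(z, w). fi z w) \<in> borel_measurable (borel \<Otimes>\<^sub>M M)" unfolding fi_def by (rule fc(3))
      have fi0: "0 \<le> fi z w" for z w using f0 by (simp add: fi_def)
      have gs0: "0 \<le> gs z w" for z w unfolding gs_def grid_step_def using f0 by (intro sum_nonneg mult_nonneg_nonneg) auto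
      have Tgs: "ennreal (Tn w * Z N w) = nnE lborel (\<lambda>z. gs z w * Z N w)" for w
      proof -
        have "nnE lborel (\<lambda>z. gs z w * Z N w) = (\<integral>\<^sup>+z. ennreal (gs z w) * ennreal (Z N w) \<partial>lborel)"
          by (intro nn_integral_cong ennreal_mult gs0 Zp)
        also have "... = nnE lborel (\<lambda>z. gs z w) * ennreal (Z N w)"
          unfolding gs_def by (rule nn_integral_multc) measurable
        also have "nnE lborel (\<lambda>z. gs z w) = ennreal (Tn w)"
          unfolding gs_def Tn_def by (rule nn_integral_grid_step) (rule f0)
        finally show ?thesis using Tn0 Zp by (simp add: ennreal_mult)
      qed
      obtain Bk where Bk: "0 \<le> Bk" "\<And>s y. in_box T K s y \<Longrightarrow> \<bar>ker s y * bump A l x0 y\<bar> \<le> Bk" by (rule box_bounded[OF gc, where K = "real K"]) blast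
      have fW: "\<bar>f s y w\<bar> \<le> Bk * K" for s y w
        using Bk Fb[of "u s y w"] by (auto simp: f_def abs_mult[of "ker s y * bump A l x0 y"] intro!: mult_mono)
      have supp: "gs z w = 0 \<and> fi z w = 0" if "z \<notin> W" for z w
      proof -
        have "\<bar>gs z w\<bar> \<le> Bk * K * indicator ({0<..T + 1} \<times> {-(real K + 1)..real K + 1}) z"
          unfolding gs_def by (rule grid_step_bound) (use fW in \<open>auto simp: f_def in_box_def\<close>)
        then show ?thesis using that by (cases z) (auto simp: W_def fi_def f_def in_box_def indicator_def)
      qed
      have err2: "(\<integral>\<^sup>+w. (nnE lborel (\<lambda>z. \<bar>gs z w - fi z w\<bar> * Z N w)) \<partial>M) \<le> ennreal (e / 2)"
      proof -
        have "(\<integral>\<^sup>+w. (nnE lborel (\<lambda>z. \<bar>gs z w - fi z w\<bar> * Z N w)) \<partial>M)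
          \<le> (\<integral>\<^sup>+w. ennreal (\<mu> / 2) * nnE lborel (\<lambda>z. (gs z w - fi z w)\<^sup>2) + ennreal (wd / (2 * \<mu>)) * ennreal ((Z N w)\<^sup>2) \<partial>M)"
        proof (rule nn_integral_mono)
          fix w assume w: "w \<in> space M"
          have [measurable]: "(\<lambda>z. gs z w) \<in> borel_measurable borel" "(\<lambda>z. fi z w) \<in> borel_measurable borel"
            using w by measurable
          have "nnE lborel (\<lambda>z. \<bar>gs z w - fi z w\<bar> * Z N w) \<le> (\<integral>\<^sup>+z. ennreal (\<mu> / 2) * ennreal ((gs z w - fi z w)\<^sup>2) + ennreal ((Z N w)\<^sup>2 / (2 * \<mu>)) * indicator W z \<partial>lborel)"
          proof (rule nn_integral_mono)
            fix z
            show "ennreal (\<bar>gs z w - fi z w\<bar> * Z N w) \<le> ennreal (\<mu> / 2) * ennreal ((gs z w - fi z w)\<^sup>2) + ennreal ((Z N w)\<^sup>2 / (2 * \<mu>)) * indicator W z"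
            proof (cases "z \<in> W")
              case True
              define d where "d = gs z w - fi z w"
              have "0 \<le> (\<mu> * \<bar>d\<bar> - Z N w)\<^sup>2" by simp
              then have "2 * \<mu> * (\<bar>d\<bar> * Z N w) \<le> \<mu>\<^sup>2 * d\<^sup>2 + (Z N w)\<^sup>2" by (simp add: power2_diff power_mult_distrib mult_ac)
              then have "\<bar>d\<bar> * Z N w \<le> \<mu> / 2 * d\<^sup>2 + (Z N w)\<^sup>2 / (2 * \<mu>)" using \<mu> by (simp add: field_simps power2_eq_square)
              then show ?thesis using \<mu> True by (simp add: d_def[symmetric] ennreal_mult'[symmetric] ennreal_plus[symmetric] ennreal_leI del: ennreal_plus)
            qed (simp add: supp)
          qed
          also have "... = ennreal (\<mu> / 2) * nnE lborel (\<lambda>z. (gs z w - fi z w)\<^sup>2) + ennreal ((Z N w)\<^sup>2 / (2 * \<mu>)) * ennreal wd"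
            by (simp add: nn_integral_add nn_integral_cmult nn_integral_cmult_indicator wd)
          also have "ennreal ((Z N w)\<^sup>2 / (2 * \<mu>)) * ennreal wd = ennreal (wd / (2 * \<mu>)) * ennreal ((Z N w)\<^sup>2)"
            using wd \<mu> by (simp add: ennreal_mult[symmetric] mult_ac)
          finally show "nnE lborel (\<lambda>z. \<bar>gs z w - fi z w\<bar> * Z N w) \<le> ennreal (\<mu> / 2) * nnE lborel (\<lambda>z. (gs z w - fi z w)\<^sup>2) + ennreal (wd / (2 * \<mu>)) * ennreal ((Z N w)\<^sup>2)" .
        qed
        also have "... = ennreal (\<mu> / 2) * (\<integral>\<^sup>+w. (nnE lborel (\<lambda>z. (gs z w - fi z w)\<^sup>2)) \<partial>M) + ennreal (wd / (2 * \<mu>)) * nnE M (\<lambda>w. (Z N w)\<^sup>2)"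
        proof -
          have [measurable]: "(\<lambda>w. \<integral>\<^sup>+z. ennreal ((gs z w - fi z w)\<^sup>2) \<partial>lborel) \<in> borel_measurable M"
            by (intro lborel.borel_measurable_nn_integral; subst measurable_cong_sets[OF sets_pair_measure_cong[OF refl sets_lborel] refl], measurable)
          show ?thesis by (simp add: nn_integral_add nn_integral_cmult)
        qed
        also have "... \<le> ennreal (\<mu> / 2) * ennreal (e / (2 * \<mu>)) + ennreal (wd / (2 * \<mu>)) * ennreal CZ"
          using elim(1) Z_second[OF N Z4] unfolding gs_def fi_def by (intro add_mono mult_left_mono) (auto intro: less_imp_le)
        also have "... = ennreal (\<mu> / 2 * (e / (2 * \<mu>)) + wd / (2 * \<mu>) * CZ)"
          using \<mu> e wd CZ by (subst ennreal_plus) (auto simp: ennreal_mult'[symmetric])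
        also have "... \<le> ennreal (e / 2)"
        proof (rule ennreal_leI)
          have "wd * CZ / \<mu> \<le> e / 2"
          proof -
            have "wd * CZ \<le> e / 2 * \<mu>" using e by (simp add: \<mu>_def)
            then show ?thesis using \<mu> by (simp add: divide_le_eq)
          qed
          moreover have "X \<le> e / 2 \<Longrightarrow> e / 4 + X / 2 \<le> e / 2" for X :: real by linarith
          ultimately have a: "e / 4 + (wd * CZ / \<mu>) / 2 \<le> e / 2" by blast
          have b: "\<mu> / 2 * (e / (2 * \<mu>)) = e / 4" "wd / (2 * \<mu>) * CZ = (wd * CZ / \<mu>) / 2" using \<mu> by simp_all
          show "\<mu> / 2 * (e / (2 * \<mu>)) + wd / (2 * \<mu>) * CZ \<le> e / 2" unfolding b by (rule a)
        qed
        finally show ?thesis .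
      qed
      have step2: "(\<integral>\<^sup>+w. (nnE lborel (\<lambda>z. fi z w * Z N w)) \<partial>M) \<le> nnE M (\<lambda>w. Tn w * Z N w) + ennreal (e / 2)"
      proof -
        have "(\<integral>\<^sup>+w. (nnE lborel (\<lambda>z. fi z w * Z N w)) \<partial>M) \<le> (\<integral>\<^sup>+w. (nnE lborel (\<lambda>z. gs z w * Z N w)) + nnE lborel (\<lambda>z. \<bar>gs z w - fi z w\<bar> * Z N w) \<partial>M)"
        proof (rule nn_integral_mono)
          fix w assume w: "w \<in> space M"
          have [measurable]: "(\<lambda>z. gs z w) \<in> borel_measurable borel" "(\<lambda>z. fi z w) \<in> borel_measurable borel"
            using w by measurable
          have "nnE lborel (\<lambda>z. fi z w * Z N w) \<le> (\<integral>\<^sup>+z. ennreal (gs z w * Z N w) + ennreal (\<bar>gs z w - fi z w\<bar> * Z N w) \<partial>lborel)"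
          proof (rule nn_integral_mono)
            fix z
            have "fi z w * Z N w \<le> (gs z w + \<bar>gs z w - fi z w\<bar>) * Z N w" by (intro mult_right_mono Zp) linarith
            then show "ennreal (fi z w * Z N w) \<le> ennreal (gs z w * Z N w) + ennreal (\<bar>gs z w - fi z w\<bar> * Z N w)"
              using gs0[of z w] Zp[of w] by (simp add: distrib_right ennreal_plus[symmetric] ennreal_leI del: ennreal_plus)
          qed
          also have "... = nnE lborel (\<lambda>z. gs z w * Z N w) + nnE lborel (\<lambda>z. \<bar>gs z w - fi z w\<bar> * Z N w)"
            by (rule nn_integral_add) measurable
          finally show "nnE lborel (\<lambda>z. fi z w * Z N w) \<le> ..." .
        qed
        also have "... = (\<integral>\<^sup>+w. (nnE lborel (\<lambda>z. gs z w * Z N w)) \<partial>M) + (\<integral>\<^sup>+w. (nnE lborel (\<lambda>z. \<bar>gs z w - fi z w\<bar> * Z N w)) \<partial>M)"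
          by (rule nn_integral_add; intro lborel.borel_measurable_nn_integral; subst measurable_cong_sets[OF sets_pair_measure_cong[OF refl sets_lborel] refl], measurable)
        also have "... \<le> nnE M (\<lambda>w. Tn w * Z N w) + ennreal (e / 2)"
          unfolding Tgs by (intro add_left_mono err2)
        finally show ?thesis .
      qed
      have step3: "gain \<tau> K x N \<le> (\<integral>\<^sup>+w. (nnE lborel (\<lambda>z. fi z w * Z N w)) \<partial>M)"
      proof -
        have "gain \<tau> K x N \<le> (\<integral>\<^sup>+z. (nnE M (\<lambda>w. fi z w * Z N w)) \<partial>lborel)"
        proof (rule nn_integral_mono)
          fix z :: "real \<times> real"
          show "ennreal (kernel_mass \<tau> K x z) * (ennreal c0 * (tilted N (fst z) (snd z) - ennreal (1 / 2))) \<le> nnE M (\<lambda>w. fi z w * Z N w)"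
          proof (cases "0 < fst z \<and> in_box T K (fst z) (snd z)")
            case True
            then have s: "0 \<le> fst z" "fst z \<le> t" using Tt by (auto simp: in_box_def)
            note [measurable] = u_measurable[OF s(1), of "snd z"]
            have [measurable]: "F \<in> borel_measurable borel" by (intro borel_measurable_continuous_onI Fc)
            have km: "kernel_mass \<tau> K x z = ker (fst z) (snd z) * bump A l x0 (snd z)" using True by (simp add: kernel_mass_def ker_def T_def)
            have km0: "0 \<le> kernel_mass \<tau> K x z" by (rule kernel_mass_nonneg[OF K])
            have "ennreal (kernel_mass \<tau> K x z) * (ennreal c0 * (tilted N (fst z) (snd z) - ennreal (1 / 2))) \<le> ennreal (kernel_mass \<tau> K x z) * nnE M (\<lambda>w. F (u (fst z) (snd z) w) * Z N w)"
              unfolding F_def by (intro mult_left_mono tilted_lower_sigma[OF s N Z4 KK0(2)]) (use KK0(3) in \<open>auto simp: M4_def\<close>)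
            also have "... = (\<integral>\<^sup>+w. ennreal (kernel_mass \<tau> K x z) * ennreal (F (u (fst z) (snd z) w) * Z N w) \<partial>M)"
              by (rule nn_integral_cmult[symmetric]) measurable
            also have "... = nnE M (\<lambda>w. fi z w * Z N w)"
              using True km0 by (intro nn_integral_cong) (simp add: ennreal_mult'[symmetric] fi_def f_def km mult.assoc)
            finally show ?thesis .
          next
            case False
            then have "kernel_mass \<tau> K x z = 0" by (auto simp: kernel_mass_def T_def)
            then show ?thesis by simp
          qed
        qed
        also have "... = (\<integral>\<^sup>+w. (nnE lborel (\<lambda>z. fi z w * Z N w)) \<partial>M)"
          by (subst nn_swap(1), measurable, subst nn_swap(2), measurable)
        finally show ?thesis .
      qed
      have "1 + gain \<tau> K x N \<le> 1 + ((nnE M (\<lambda>w. Tn w * Z N w)) + ennreal (e / 2))"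
        by (intro add_left_mono order_trans[OF step3 step2])
      also have "... = (1 + nnE M (\<lambda>w. Tn w * Z N w)) + ennreal (e / 2)" by (simp add: add.assoc)
      also have "... \<le> (tilted N \<tau> x + ennreal (e / 2)) + ennreal (e / 2)" by (intro add_right_mono step1)
      also have "... = tilted N \<tau> x + ennreal e" using e ennreal_plus[of "e / 2" "e / 2"] by (simp add: add.assoc)
      finally show ?case .
    qed
    then show "0 < K \<and> eventually (\<lambda>N. 1 + gain \<tau> K x N
     \<le> tilted N \<tau> x + ennreal e) sequentially" using K by simp
  qed
qed

end

context she_tilt
begin

text \<open>Over a time \<open>l\<^sup>2\<close> the heat kernel keeps a fixed fraction of its mass within distance \<open>l\<close> of
  \<open>x0\<close>, so the drift produced by the tilt doubles the expectation.\<close>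

lemma tilted_step:
  assumes \<tau>: "l\<^sup>2 \<le> \<tau>" "\<tau> \<le> t" and x: "\<bar>x - x0\<bar> \<le> l" and g: "3 / 4 \<le> g"
    and rate: "c0 * A * l\<^sup>2 * (exp (- 4) / sqrt (2 * pi)) = 4"
    and ev: "\<And>s y. \<tau> - l\<^sup>2 < s \<Longrightarrow> s < \<tau> \<Longrightarrow> \<bar>y - x0\<bar> \<le> l \<Longrightarrow> eventually (\<lambda>N. ennreal g \<le> tilted N s y) sequentially"
  shows "eventually (\<lambda>N. ennreal (2 * g) \<le> tilted N \<tau> x) sequentially"
proof -
  have l2: "0 < l\<^sup>2" and \<tau>0: "0 < \<tau>" using l \<tau> by (auto intro: less_le_trans[of 0 "l\<^sup>2"])
  obtain K1 where K1: "\<And>K. K1 \<le> K \<Longrightarrow> 0 < K \<and> eventually (\<lambda>N. 1 + gain \<tau> K x N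
     \<le> tilted N \<tau> x + ennreal (1 / 8)) sequentially"
    by (rule tilted_recursion[OF \<tau>0 \<tau>(2), of "1 / 8"]) auto
  obtain K :: nat where K: "max (real K1) (max (2 / l\<^sup>2) (\<bar>x0\<bar> + l + 1)) \<le> real K" using real_arch_simple by blast
  then have K1K: "K1 \<le> K" and Kl: "2 / l\<^sup>2 \<le> K" and Kx: "\<bar>x0\<bar> + l + 1 \<le> K" by auto
  have Kpos: "0 < K" using K1[OF K1K] by simp
  define f where "f N z = ennreal (kernel_mass \<tau> K x z) * (ennreal c0 * (tilted N (fst z) (snd z) - ennreal (1 / 2)))" for N z
  have fm: "f (Suc N) \<in> borel_measurable lborel" for N
  proof -
    have "f (Suc N) = (\<lambda>z. ennreal (kernel_mass \<tau> K x z) * (ennreal c0 * (indicator {0<..} (fst z) * tilted (Suc N) (fst z) (snd z) - ennreal (1 / 2))))"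
      by (auto simp: f_def fun_eq_iff indicator_def kernel_mass_def)
    then show ?thesis using tilted_measurable[of "Suc N"] kernel_mass_measurable[OF Kpos \<tau>0, of x] by simp
  qed
  \<comment> \<open>In this window the remaining time is at least l^2/2 and the distance to
    \<open>x\<close> at most 2 l, so the heat kernel's exponent is at most 4 in size; this is the
    origin of \<open>exp (- 4)\<close> in \<open>rate\<close>.\<close>
  define R where "R = {\<tau> - l\<^sup>2<..<\<tau> - l\<^sup>2 / 2} \<times> {x0 - l..x0 + l}"
  have [measurable]: "R \<in> sets borel" unfolding R_def by (simp add: borel_prod[symmetric])
  define c1 where "c1 = A * (exp (- 4) / (l * sqrt (2 * pi)))"
  have c1: "0 \<le> c1" using A l by (simp add: c1_def)
  have mass: "c1 \<le> kernel_mass \<tau> K x z" if z: "z \<in> R" for z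
  proof -
    obtain s y where zs: "z = (s, y)" by (cases z)
    have s: "\<tau> - l\<^sup>2 < s" "s < \<tau> - l\<^sup>2 / 2" and y: "\<bar>y - x0\<bar> \<le> l" using z by (auto simp: R_def zs)
    have r: "l\<^sup>2 / 2 \<le> \<tau> - s" "\<tau> - s \<le> l\<^sup>2" "0 < \<tau> - s" using s l2 by auto
    have "1 / real K \<le> l\<^sup>2 / 2" using Kl Kpos l2 by (simp add: field_simps)
    then have ib: "0 < s" "in_box (\<tau> - 1 / real K) (real K) s y" using s \<tau> y Kx l2 by (auto simp: in_box_def)
    have "\<bar>y - x\<bar> \<le> 2 * l" using x y by linarith
    then have "(y - x)\<^sup>2 \<le> (2 * l)\<^sup>2" using power_mono[of "\<bar>y - x\<bar>" "2 * l" 2] by simp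
    also have "... \<le> 4 * (2 * (\<tau> - s))" using r by (simp add: power_mult_distrib)
    finally have "(y - x)\<^sup>2 / (2 * (\<tau> - s)) \<le> 4" using r by (simp add: divide_le_eq)
    then have e: "exp (- 4) \<le> exp (- ((y - x)\<^sup>2 / (2 * (\<tau> - s))))" by simp
    have "sqrt (2 * pi * (\<tau> - s)) \<le> sqrt (2 * pi * l\<^sup>2)" using r by (intro real_sqrt_le_mono mult_left_mono) auto
    also have "... = l * sqrt (2 * pi)" using l by (simp add: real_sqrt_mult)
    finally have "exp (- 4) / (l * sqrt (2 * pi)) \<le> heat_kernel (\<tau> - s) (y - x)"
      unfolding heat_kernel_def using e r l by (intro frac_le) auto
    then have "A * (exp (- 4) / (l * sqrt (2 * pi))) \<le> A * heat_kernel (\<tau> - s) (y - x)" using A by (intro mult_left_mono) auto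
    then show ?thesis unfolding c1_def kernel_mass_def zs using ib bump_inside[OF l y, of A] by (simp add: mult.commute)
  qed
  define c2 where "c2 = c1 * (c0 * (g - 1 / 2))"
  have c2: "0 \<le> c2" using c1 c0 g by (simp add: c2_def)
  \<comment> \<open>By \<open>rate\<close> the window yields 4 (g - 1/2). Adding 1 and subtracting
    two errors of 1/8 leaves 4 g - 5/4, which is at least 2 g for g at least 3/4.\<close>
  define I where "I = c2 * (l\<^sup>2 / 2 * (2 * l))"
  have I: "I = 4 * (g - 1 / 2)"
  proof -
    have "I = (g - 1 / 2) * (c0 * A * l\<^sup>2 * (exp (- 4) / sqrt (2 * pi)))" using l by (simp add: I_def c2_def c1_def)
    then show ?thesis unfolding rate by simp
  qed
  \<comment> \<open>The lower bound on \<open>tilted\<close> holds from some \<open>N\<close> on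
    that depends on the point, so Fatou's lemma takes the place of uniform convergence. The shift to
    \<open>Suc N\<close> avoids the empty grid.\<close>
  have low: "ennreal c2 * indicator R z \<le> liminf (\<lambda>N. f (Suc N) z)" for z
  proof (cases "z \<in> R")
    case True
    obtain s y where zs: "z = (s, y)" by (cases z)
    have "eventually (\<lambda>N. ennreal g \<le> tilted N s y) sequentially"
      by (rule ev) (use True l2 in \<open>auto simp: R_def zs\<close>)
    then have "eventually (\<lambda>N. ennreal g \<le> tilted (Suc N) s y) sequentially" by (rule eventually_sequentially_Suc[THEN iffD2])
    then have "eventually (\<lambda>N. ennreal c2 \<le> f (Suc N) z) sequentially"
    proof eventually_elim
      case (elim N)
      have "ennreal g - ennreal (1 / 2) = ennreal (g - 1 / 2)" by (rule ennreal_minus) simp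
      then have "ennreal c2 = ennreal c1 * (ennreal c0 * (ennreal g - ennreal (1 / 2)))"
        using c1 c0 g by (simp add: c2_def ennreal_mult)
      also have "... \<le> f (Suc N) z"
        unfolding f_def zs using elim mass[OF True] by (intro mult_mono ennreal_minus_mono ennreal_leI) (auto simp: zs)
      finally show ?case .
    qed
    then show ?thesis using True by (simp add: Liminf_bounded)
  qed simp
  have "ennreal I = (\<integral>\<^sup>+z. ennreal c2 * indicator R z \<partial>lborel)"
  proof -
    have "emeasure lborel R = emeasure lborel {\<tau> - l\<^sup>2<..<\<tau> - l\<^sup>2 / 2} * emeasure lborel {x0 - l..x0 + l}"
      unfolding R_def lborel_prod[symmetric] by (rule lborel.emeasure_pair_measure_Times) auto
    also have "... = ennreal (l\<^sup>2 / 2 * (2 * l))" using l2 l by (simp add: ennreal_mult'[symmetric])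
    finally show ?thesis using c2 by (simp add: nn_integral_cmult_indicator I_def ennreal_mult'[symmetric])
  qed
  also have "... \<le> (\<integral>\<^sup>+z. liminf (\<lambda>N. f (Suc N) z) \<partial>lborel)" by (intro nn_integral_mono low)
  also have "... \<le> liminf (\<lambda>N. \<integral>\<^sup>+z. f (Suc N) z \<partial>lborel)" by (rule nn_integral_liminf[OF fm])
  finally have lim: "ennreal I \<le> liminf (\<lambda>N. \<integral>\<^sup>+z. f (Suc N) z \<partial>lborel)" .
  have "ennreal (I - 1 / 8) < ennreal I" using I g by (simp add: ennreal_less_iff)
  then have "eventually (\<lambda>N. ennreal (I - 1 / 8) < (\<integral>\<^sup>+z. f (Suc N) z \<partial>lborel)) sequentially"
    using lim by (intro less_LiminfD) (rule less_le_trans)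
  then have "eventually (\<lambda>N. ennreal (I - 1 / 8) < (\<integral>\<^sup>+z. f N z \<partial>lborel)) sequentially"
    by (rule eventually_sequentially_Suc[where P = "\<lambda>N. ennreal (I - 1 / 8) < (\<integral>\<^sup>+z. f N z \<partial>lborel)", THEN iffD1])
  with conjunct2[OF K1[OF K1K], folded f_def] show ?thesis
  proof eventually_elim
    case (elim N)
    have "ennreal (2 * g) + ennreal (1 / 8) \<le> ennreal (1 + (I - 1 / 8))"
      using g by (simp add: I ennreal_plus[symmetric] ennreal_leI del: ennreal_plus)
    also have "... = 1 + ennreal (I - 1 / 8)" using I g by (subst ennreal_plus) auto
    also have "... \<le> 1 + (\<integral>\<^sup>+z. f N z \<partial>lborel)" using elim(2) by (intro add_left_mono) simp
    also have "... \<le> tilted N \<tau> x + ennreal (1 / 8)" by (rule elim(1))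
    finally have "ennreal (1 / 8) + ennreal (2 * g) \<le> ennreal (1 / 8) + tilted N \<tau> x" by (simp add: add.commute)
    then show ?case by (simp add: ennreal_add_left_cancel_le)
  qed
qed

text \<open>One doubling per time l^2. The initial 3/4 is 1 minus the error 1/4 of the recursion; it
  exceeds the loss 1/2 enough for \<open>tilted_step\<close> to double it.\<close>

lemma tilted_growth:
  assumes rate: "c0 * A * l\<^sup>2 * (exp (- 4) / sqrt (2 * pi)) = 4"
    and "0 < s" "real k * l\<^sup>2 \<le> s" "s \<le> t" "\<bar>y - x0\<bar> \<le> l"
  shows "eventually (\<lambda>N. ennreal (3 / 4 * 2 ^ k) \<le> tilted N s y) sequentially"
  using assms(2-)
proof (induction k arbitrary: s y)
  case 0
  obtain K1 where K1: "\<And>K. K1 \<le> K \<Longrightarrow> 0 < K \<and> eventually (\<lambda>N. 1 + gain s K y N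
     \<le> tilted N s y + ennreal (1 / 4)) sequentially"
    by (rule tilted_recursion[of s "1 / 4" y]) (use 0 in auto)
  from conjunct2[OF K1[OF order_refl]] show ?case
  proof eventually_elim
    case (elim N)
    have "ennreal (1 / 4) + ennreal (3 / 4) = 1" by (subst ennreal_plus[symmetric]) auto
    also have "1 \<le> 1 + gain s K1 y N" by simp
    also note elim
    finally have "ennreal (1 / 4) + ennreal (3 / 4) \<le> ennreal (1 / 4) + tilted N s y" by (simp add: add.commute)
    then show ?case by (simp add: ennreal_add_left_cancel_le)
  qed
next
  case (Suc k)
  have k: "real k * l\<^sup>2 + l\<^sup>2 \<le> s" using Suc.prems by (simp add: algebra_simps)
  have k0: "0 \<le> real k * l\<^sup>2" by simp
  have "eventually (\<lambda>N. ennreal (2 * (3 / 4 * 2 ^ k)) \<le> tilted N s y) sequentially"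
  proof (rule tilted_step[OF _ Suc.prems(3,4) _ rate])
    show "l\<^sup>2 \<le> s" using k k0 by linarith
    show "(3 / 4 :: real) \<le> 3 / 4 * 2 ^ k" by simp
    show "s - l\<^sup>2 < r \<Longrightarrow> r < s \<Longrightarrow> \<bar>z - x0\<bar> \<le> l \<Longrightarrow> eventually (\<lambda>N. ennreal (3 / 4 * 2 ^ k) \<le> tilted N r z) sequentially" for r z
    proof (rule Suc.IH)
      assume r: "s - l\<^sup>2 < r" "r < s" "\<bar>z - x0\<bar> \<le> l"
      show "0 < r" "real k * l\<^sup>2 \<le> r" "r \<le> t" "\<bar>z - x0\<bar> \<le> l" using r k k0 Suc.prems(3) by linarith+
    qed
  qed
  then show ?case by (simp add: mult_ac)
qed

text \<open>Paley-Zygmund under the tilted measure: a tilted mean of at least \<Lambda>, together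
  with a bounded second moment of the product of solution and density, forces values above
  \<Lambda>/2 with a definite probability under the original measure. That second moment is bounded
  through the fourth moments of both factors.\<close>

lemma tail_ge:
  assumes rate: "c0 * A * l\<^sup>2 * (exp (- 4) / sqrt (2 * pi)) = 4" and k: "real k * l\<^sup>2 \<le> t"
  shows "1 / 8 / ((4 * exp (growth_rate 2 * t))\<^sup>2 * CZ) \<le> prob {w \<in> space M. 3 / 8 * 2 ^ k \<le> \<bar>u t x0 w\<bar>}"
proof -
  define \<Lambda> :: real where "\<Lambda> = 3 / 4 * 2 ^ k"
  have \<Lambda>: "3 / 4 \<le> \<Lambda>" by (simp add: \<Lambda>_def)
  have "eventually (\<lambda>N. ennreal \<Lambda> \<le> tilted N t x0) sequentially"
    unfolding \<Lambda>_def by (rule tilted_growth[OF rate t k]) (use l in auto)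
  with Z_fourth eventually_gt_at_top[of "0::nat"] have "eventually (\<lambda>N. 0 < N \<and> ennreal \<Lambda> \<le> tilted N t x0 \<and> nnE M (\<lambda>w. Z N w ^ 4) \<le> ennreal CZ) sequentially"
    by eventually_elim simp
  then obtain N where N: "0 < N" and low: "ennreal \<Lambda> \<le> tilted N t x0" and Z4: "nnE M (\<lambda>w. Z N w ^ 4) \<le> ennreal CZ"
    using eventually_happens'[OF sequentially_bot] by blast
  have [measurable]: "u t x0 \<in> borel_measurable M" "Z N \<in> borel_measurable M" using u_measurable[of t x0] t Z_measurable[OF N] by auto
  define U4 where "U4 = (4 * exp (growth_rate 2 * t))\<^sup>2"
  have U4: "1 \<le> U4"
  proof -
    have "1 \<le> 4 * exp (growth_rate 2 * t)" using growth_rate_pos[of 2] t by (intro mult_ge1_I[of 4]) auto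
    then show ?thesis unfolding U4_def by (rule one_le_power)
  qed
  have u4: "nnE M (\<lambda>w. ((u t x0 w)\<^sup>2)\<^sup>2) \<le> ennreal U4"
    using u_moment_le[of 2 t x0] t by (simp add: U4_def power_mult[symmetric])
  have z4: "nnE M (\<lambda>w. ((Z N w)\<^sup>2)\<^sup>2) \<le> ennreal CZ" using Z4 by (simp add: power_mult[symmetric])
  define S where "S = U4 * CZ"
  have S: "1 \<le> S" unfolding S_def using U4 CZ by (simp add: mult_ge1_I)
  have "(\<integral>\<^sup>+w. ennreal \<bar>(u t x0 w)\<^sup>2 * (Z N w)\<^sup>2\<bar> \<partial>M) \<le> ennreal (1 * U4 / 2 + CZ / (2 * 1))"
    by (rule product_small[OF _ _ u4 z4]) (use U4 CZ in auto)
  also have "... \<le> ennreal S"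
  proof (rule ennreal_leI)
    have "U4 * 1 \<le> U4 * CZ" "1 * CZ \<le> U4 * CZ" using U4 CZ by (intro mult_left_mono mult_right_mono; simp)+
    then show "1 * U4 / 2 + CZ / (2 * 1) \<le> S" unfolding S_def by linarith
  qed
  finally have uz: "nnE M (\<lambda>w. (u t x0 w * Z N w)\<^sup>2) \<le> ennreal S" by (simp add: power_mult_distrib)
  define G where "G = {w \<in> space M. \<Lambda> / 2 \<le> \<bar>u t x0 w\<bar>}"
  have [measurable]: "G \<in> sets M" unfolding G_def by measurable
  define P where "P = prob G"
  have gi: "nnE M (\<lambda>w. (indicator G w)\<^sup>2) \<le> ennreal P"
  proof -
    have "nnE M (\<lambda>w. (indicator G w)\<^sup>2) = (\<integral>\<^sup>+w. indicator G w \<partial>M)" by (intro nn_integral_cong) (auto simp: indicator_def)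
    then show ?thesis by (simp add: P_def emeasure_eq_measure)
  qed
  have "ennreal \<Lambda> \<le> (\<integral>\<^sup>+w. ennreal (\<Lambda> / 2) * ennreal (Z N w) + ennreal \<bar>u t x0 w * Z N w * indicator G w\<bar> \<partial>M)"
  proof (rule order_trans[OF low], unfold tilted_def, rule nn_integral_mono)
    fix w assume wd: "w \<in> space M"
    have z: "0 \<le> Z N w" using Z_pos[OF N, of w] by simp
    have "\<bar>u t x0 w\<bar> * Z N w \<le> \<Lambda> / 2 * Z N w + \<bar>u t x0 w * Z N w * indicator G w\<bar>"
    proof (cases "w \<in> G")
      case True
      have "0 \<le> \<Lambda> / 2 * Z N w" using z \<Lambda> by simp
      then show ?thesis using True z by (simp add: abs_mult)
    next
      case False
      then have "\<bar>u t x0 w\<bar> * Z N w \<le> \<Lambda> / 2 * Z N w" using wd z by (intro mult_right_mono) (auto simp: G_def)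
      then show ?thesis using False by simp
    qed
    then show "ennreal (\<bar>u t x0 w\<bar> * Z N w) \<le> ennreal (\<Lambda> / 2) * ennreal (Z N w) + ennreal \<bar>u t x0 w * Z N w * indicator G w\<bar>"
      using z \<Lambda> by (simp add: ennreal_mult'[symmetric] ennreal_plus[symmetric] ennreal_leI del: ennreal_plus)
  qed
  also have "... = ennreal (\<Lambda> / 2) + (\<integral>\<^sup>+w. ennreal \<bar>u t x0 w * Z N w * indicator G w\<bar> \<partial>M)"
    by (simp add: nn_integral_add nn_integral_cmult Z_integrable[OF N])
  \<comment> \<open>Young's parameter \<Lambda>/(2 S) makes the first term \<Lambda>/4, so the term
    with the probability \<open>P\<close> has to supply the remaining \<Lambda>/4.\<close>
  also have "... \<le> ennreal (\<Lambda> / 2) + ennreal (\<Lambda> / (2 * S) * S / 2 + P / (2 * (\<Lambda> / (2 * S))))"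
    by (intro add_left_mono product_small[OF _ _ uz gi]) (use S \<Lambda> in \<open>auto simp: P_def\<close>)
  also have "... = ennreal (\<Lambda> / 2 + (\<Lambda> / 4 + P * S / \<Lambda>))"
    using S \<Lambda> by (subst ennreal_plus[symmetric]) (auto simp: P_def field_simps)
  finally have "\<Lambda> \<le> \<Lambda> / 2 + (\<Lambda> / 4 + P * S / \<Lambda>)"
    using S \<Lambda> by (subst (asm) ennreal_le_iff) (auto simp: P_def)
  then have "\<Lambda> / 4 \<le> P * S / \<Lambda>" by linarith
  then have "\<Lambda> / 4 * \<Lambda> \<le> P * S" using \<Lambda> by (subst (asm) le_divide_eq) auto
  moreover have "1 / 8 \<le> \<Lambda> / 4 * \<Lambda>" using mult_mono[OF \<Lambda> \<Lambda>] \<Lambda> by simp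
  ultimately have "1 / 8 \<le> P * S" by linarith
  then have "1 / 8 / S \<le> P" using S by (simp add: field_simps)
  then show ?thesis unfolding S_def U4_def P_def G_def \<Lambda>_def by simp
qed

end

section \<open>Tail of the solution: choice of the drift\<close>

context she
begin

text \<open>A strength \<open>A\<close> proportional to \<open>r\<close>, on the width given by A
  l^2 = B, allows about 10 r doublings before time \<open>t\<close>. The exponent A^2 l t of the
  cost is then of order r^(3/2).\<close>

lemma tail_lower_bound:
  assumes t: "0 < t"
  obtains C where "0 < C" "\<And>r x. 1 \<le> r \<Longrightarrow> exp (- C * r powr (3/2)) \<le> prob {w \<in> space M. exp r \<le> \<bar>u t x w\<bar>}"
proof -
  \<comment> \<open>The value of \<open>A * l\<^sup>2\<close> that the growth condition
    \<open>rate\<close> prescribes.\<close>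
  define B where "B = 4 / (c0 * (exp (- 4) / sqrt (2 * pi)))"
  have B: "0 < B" using c0 by (simp add: B_def)
  \<comment> \<open>Chosen so that 10 r steps of duration l^2 fill the time \<open>t\<close>
    exactly.\<close>
  define a where "a = 10 * B / t"
  have a: "0 < a" using B t by (simp add: a_def)
  \<comment> \<open>Collects the 8 and the moment of the solution from \<open>tail_ge\<close>, and
    the 6 that the slack in \<open>CZ\<close> contributes to the exponent.\<close>
  define b where "b = ln (8 * (4 * exp (growth_rate 2 * t))\<^sup>2) + 6"
  define C where "C = \<bar>b\<bar> + 24 * t * sqrt B * a powr (3/2)"
  have "0 < 24 * t * sqrt B * a powr (3/2)" using t B a by simp
  then have C: "0 < C" unfolding C_def by linarith
  show thesis
  proof (rule that[OF C])
    fix r x :: real assume r: "1 \<le> r"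
    define A where "A = a * r"
    have A: "0 < A" using a r by (simp add: A_def)
    define l where "l = sqrt (B / A)"
    have l: "0 < l" and l2: "l\<^sup>2 = B / A" using B A by (simp_all add: l_def)
    interpret T: she_tilt M \<xi> \<sigma> u L c0 t A l x "\<bar>x\<bar> + 2 * l" by unfold_locales (use t A l in auto)
    define k where "k = nat \<lfloor>10 * r\<rfloor>"
    have k: "real k \<le> 10 * r" "10 * r - 1 < real k" using r unfolding k_def by linarith+
    have "1 / 8 / ((4 * exp (growth_rate 2 * t))\<^sup>2 * T.CZ) \<le> prob {w \<in> space M. 3 / 8 * 2 ^ k \<le> \<bar>u t x w\<bar>}"
    proof (rule T.tail_ge)
      show "c0 * A * l\<^sup>2 * (exp (- 4) / sqrt (2 * pi)) = 4" using A c0 unfolding l2 B_def by simp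
      have "real k * l\<^sup>2 \<le> 10 * r * l\<^sup>2" using k by (intro mult_right_mono) auto
      also have "... = t" unfolding l2 A_def a_def using r B t by (simp add: field_simps)
      finally show "real k * l\<^sup>2 \<le> t" .
    qed
    moreover have "exp (- C * r powr (3/2)) \<le> 1 / 8 / ((4 * exp (growth_rate 2 * t))\<^sup>2 * T.CZ)"
    proof -
      have "A\<^sup>2 * l = sqrt B * A powr (3/2)"
      proof -
        have "A\<^sup>2 = A powr 2" using A by simp
        moreover have "l = sqrt B * A powr (- (1/2))"
          unfolding l_def real_sqrt_divide powr_minus powr_half_sqrt[OF less_imp_le[OF A]] by (rule divide_inverse)
        ultimately have "A\<^sup>2 * l = sqrt B * (A powr 2 * A powr (- (1/2)))" by simp
        also have "A powr 2 * A powr (- (1/2)) = A powr (3/2)" by (subst powr_add[symmetric]) simp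
        finally show ?thesis .
      qed
      also have "A powr (3/2) = a powr (3/2) * r powr (3/2)" unfolding A_def using a r by (simp add: powr_mult)
      finally have Al: "A\<^sup>2 * l = sqrt B * (a powr (3/2) * r powr (3/2))" .
      have r1: "1 \<le> r powr (3/2)" using r by (simp add: ge_one_powr_ge_zero)
      have "b \<le> \<bar>b\<bar> * r powr (3/2)" using mult_left_mono[OF r1, of "\<bar>b\<bar>"] by simp
      moreover have "C * r powr (3/2) = \<bar>b\<bar> * r powr (3/2) + 24 * t * (A\<^sup>2 * l)" unfolding C_def Al by (simp add: algebra_simps)
      ultimately have e: "- C * r powr (3/2) \<le> - (b + 24 * t * (A\<^sup>2 * l))" by simp
      have "exp (b + 24 * t * (A\<^sup>2 * l)) = exp (ln (8 * (4 * exp (growth_rate 2 * t))\<^sup>2)) * exp (6 + 24 * t * (A\<^sup>2 * l))"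
        unfolding b_def exp_add[symmetric] by (simp only: add.assoc)
      also have "exp (ln (8 * (4 * exp (growth_rate 2 * t))\<^sup>2)) = 8 * (4 * exp (growth_rate 2 * t))\<^sup>2" by (rule exp_ln) simp
      also have "exp (6 + 24 * t * (A\<^sup>2 * l)) = T.CZ" unfolding T.CZ_def by (simp add: algebra_simps)
      finally have "exp (- (b + 24 * t * (A\<^sup>2 * l))) = inverse (8 * (4 * exp (growth_rate 2 * t))\<^sup>2 * T.CZ)"
        unfolding exp_minus by (rule arg_cong)
      also have "... = 1 / 8 / ((4 * exp (growth_rate 2 * t))\<^sup>2 * T.CZ)" by (simp only: divide_divide_eq_left mult.assoc inverse_eq_divide)
      finally have "exp (- (b + 24 * t * (A\<^sup>2 * l))) = 1 / 8 / ((4 * exp (growth_rate 2 * t))\<^sup>2 * T.CZ)" .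
      moreover have "exp (- C * r powr (3/2)) \<le> exp (- (b + 24 * t * (A\<^sup>2 * l)))" using e by (simp only: exp_le_cancel_iff)
      ultimately show ?thesis by (simp only:)
    qed
    moreover have "prob {w \<in> space M. 3 / 8 * 2 ^ k \<le> \<bar>u t x w\<bar>} \<le> prob {w \<in> space M. exp r \<le> \<bar>u t x w\<bar>}"
    proof (rule finite_measure_mono)
      \<comment> \<open>Ten doublings per unit of \<open>r\<close> are ample: 2^k is at least
        exp(k/2), which exceeds exp(r + 3), and the additional 3 covers the factor 3/8.\<close>
      have "exp (1/2 :: real) \<le> 2" using exp_bound_half[of "1/2::real"] by simp
      then have "exp (1/2) ^ k \<le> (2::real) ^ k" by (intro power_mono) auto
      then have "exp (real k / 2) \<le> 2 ^ k" by (simp add: exp_of_nat_mult[symmetric])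
      moreover have "exp (r + 3) \<le> exp (real k / 2)" using k r by simp
      moreover have "8 / 3 * exp r \<le> exp (r + 3)" using exp_ge_add_one_self[of 3] by (simp add: exp_add mult.commute)
      ultimately have "exp r \<le> 3 / 8 * 2 ^ k" by linarith
      then show "{w \<in> space M. 3 / 8 * 2 ^ k \<le> \<bar>u t x w\<bar>} \<subseteq> {w \<in> space M. exp r \<le> \<bar>u t x w\<bar>}" by auto
      show "{w \<in> space M. exp r \<le> \<bar>u t x w\<bar>} \<in> events" using u_measurable[OF less_imp_le[OF t], of x] by measurable
    qed
    ultimately show "exp (- C * r powr (3/2)) \<le> prob {w \<in> space M. exp r \<le> \<bar>u t x w\<bar>}" by linarith
  qed
qed

end

section \<open>Localization\<close>

context she
begin

lemma sum_square_le:
  assumes [measurable]: "X \<in> borel_measurable M" "Y \<in> borel_measurable M"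
    and X: "nnE M (\<lambda>w. (X w)\<^sup>2) \<le> ennreal a" and Y: "nnE M (\<lambda>w. (Y w)\<^sup>2) \<le> ennreal b" and "0 \<le> a" "0 \<le> b"
  shows "nnE M (\<lambda>w. (X w + Y w)\<^sup>2) \<le> ennreal (2 * a + 2 * b)"
proof -
  have "nnE M (\<lambda>w. (X w + Y w)\<^sup>2) \<le> (\<integral>\<^sup>+w. ennreal 2 * ennreal ((X w)\<^sup>2) + ennreal 2 * ennreal ((Y w)\<^sup>2) \<partial>M)"
  proof (rule nn_integral_mono)
    fix w
    have "(X w + Y w)\<^sup>2 \<le> 2 * (X w)\<^sup>2 + 2 * (Y w)\<^sup>2"
      using zero_le_power2[of "X w - Y w"] by (simp add: power2_eq_square algebra_simps)
    then have "ennreal ((X w + Y w)\<^sup>2) \<le> ennreal (2 * (X w)\<^sup>2 + 2 * (Y w)\<^sup>2)" by (rule ennreal_leI)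
    then show "ennreal ((X w + Y w)\<^sup>2) \<le> ennreal 2 * ennreal ((X w)\<^sup>2) + ennreal 2 * ennreal ((Y w)\<^sup>2)"
      by (simp add: ennreal_mult')
  qed
  also have "... = ennreal 2 * nnE M (\<lambda>w. (X w)\<^sup>2) + ennreal 2 * nnE M (\<lambda>w. (Y w)\<^sup>2)"
    by (subst nn_integral_add) (auto simp: nn_integral_cmult)
  also have "... \<le> ennreal 2 * ennreal a + ennreal 2 * ennreal b" by (intro add_mono mult_left_mono X Y) auto
  also have "... = ennreal (2 * a + 2 * b)" using assms by (simp add: ennreal_mult')
  finally show ?thesis .
qed

text \<open>Picard iteration with the noise outside the slab switched off. The error at level \<open>n\<close> is a
  boundary term, which decays exponentially away from the boundary of the slab, plus the geometric
  error of the iteration.\<close>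

lemma localization_step:
  fixes x0 R \<beta> T :: real and n :: nat and V :: "real \<Rightarrow> real \<Rightarrow> 'a \<Rightarrow> real"
  defines "A \<equiv> {x0 - R..x0 + R}"
  defines "D \<equiv> \<lambda>n s y. exp (\<beta> * s) * (4 * exp 1 * exp (\<bar>y - x0\<bar> - R) + 4 * (1 / 2) ^ n)"
  assumes \<beta>: "growth_rate 1 \<le> \<beta>" "48 * L\<^sup>2 * exp (T / 2) \<le> sqrt \<beta>" and t: "0 < t" "t \<le> T"
    and Vm: "\<And>s y. 0 \<le> s \<Longrightarrow> s \<le> T \<Longrightarrow> V s y \<in> borel_measurable (NS ({0<..s} \<times> A))"
    and V: "\<And>s y. 0 \<le> s \<Longrightarrow> s \<le> T \<Longrightarrow> nnE M (\<lambda>w. (u s y w - V s y w)\<^sup>2) \<le> ennreal (D n s y)"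
  shows "\<exists>W. W \<in> borel_measurable (NS ({0<..t} \<times> A)) \<and> nnE M (\<lambda>w. (u t x w - W w)\<^sup>2) \<le> ennreal (D (Suc n) t x)"
proof -
  have \<beta>0: "0 < \<beta>" using \<beta>(1) growth_rate_pos[of 1] by simp
  define ker where "ker s y = heat_kernel (t - s) (y - x)" for s y
  have ker: "kernel t ker" unfolding ker_def by (rule kernel_heat[OF t(1)])
  obtain J where hw: "has_walsh_integral M \<xi> (\<lambda>s y w. indicator {0<..<t} s * heat_kernel (t - s) (y - x) * \<sigma> (u s y w)) J"
    and uJ: "AE w in M. u t x w = 1 + J w" by (rule u_mild[OF t(1)])
  have Jm[measurable]: "J \<in> borel_measurable M" using hw by (simp add: has_walsh_integral_def)
  have app: "approximable t ker J" unfolding ker_def by (rule walsh_approximable[OF kernel_heat[OF t(1)] hw])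
  have D0: "0 \<le> D n s y" for s y by (simp add: D_def)
  \<comment> \<open>Tuned so that twice \<open>(1 + L\<^sup>2) * \<delta>\<close> is a quarter of
    the geometric part of \<open>D n t x\<close>.\<close>
  define \<delta> where "\<delta> = 4 * exp (\<beta> * t) * (1 / 2) ^ n / (8 * (1 + L\<^sup>2))"
  have L2: "0 < 1 + L\<^sup>2" by (simp add: add_pos_nonneg)
  then have \<delta>: "0 < \<delta>" by (simp add: \<delta>_def)
  obtain K1 where K1: "\<And>K. K1 \<le> K \<Longrightarrow> 0 < K \<and> eventually (\<lambda>N. approx_error t ker J K N \<le> ennreal \<delta>) sequentially"
    by (rule approximableD[OF app \<delta>]) blast
  define K where "K = K1"
  have K: "0 < K" and ev1: "eventually (\<lambda>N. approx_error t ker J K N \<le> ennreal \<delta>) sequentially"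
    using K1[of K] by (simp_all add: K_def)
  \<comment> \<open>The condition on \<beta> makes one application of the squared kernel shrink the
    error by 8 L^2; after the Lipschitz factor and the triangle inequality for squares a quarter of
    \<open>D n t x\<close> survives.\<close>
  define I where "I = D n t x / (8 * L\<^sup>2)"
  have I0: "0 \<le> I" unfolding I_def using D0 by simp
  have ev2: "eventually (\<lambda>N. box_sum (t - 1 / real K) (real K) N (\<lambda>s y. (ker s y)\<^sup>2 * D n s y) \<le> I + \<delta>) sequentially"
  proof (rule box_sum_eventually_le[OF ker K _ D0 _ I0 \<delta>])
    show "continuous_on ({0..t} \<times> UNIV) (\<lambda>(s, y). D n s y)" unfolding D_def case_prod_beta by (intro continuous_intros)
    define W where "W y = 4 * exp 1 * exp (\<bar>y - x0\<bar> - R) + 4 * (1 / 2) ^ n" for y :: real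
    define c where "c = 2 * exp (T / 2) * W x"
    have W0: "0 \<le> W y" for y by (simp add: W_def)
    have [measurable]: "W \<in> borel_measurable borel" unfolding W_def[abs_def] by measurable
    have Wc: "nnE lborel (\<lambda>y. heat_kernel r (y - x) * W y) \<le> ennreal c" if r: "0 < r" "r < t" for r
    proof -
      have "nnE lborel (\<lambda>y. heat_kernel r (y - x) * W y) \<le> (\<integral>\<^sup>+y. ennreal (W x) * ennreal (heat_kernel r (y - x) * exp \<bar>y - x\<bar>) \<partial>lborel)"
      proof (rule nn_integral_mono)
        fix y
        \<comment> \<open>A displacement changes the boundary weight by at most a factor exp |y -
          x|, whose heat average is at most 2 exp(T/2).\<close>
        have "exp (\<bar>y - x0\<bar> - R) \<le> exp (\<bar>x - x0\<bar> - R) * exp \<bar>y - x\<bar>" unfolding exp_add[symmetric] by simp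
        then have "4 * exp 1 * exp (\<bar>y - x0\<bar> - R) \<le> 4 * exp 1 * (exp (\<bar>x - x0\<bar> - R) * exp \<bar>y - x\<bar>)" by (intro mult_left_mono) auto
        moreover have "4 * (1 / 2) ^ n \<le> 4 * (1 / 2) ^ n * exp \<bar>y - x\<bar>" by simp
        ultimately have "W y \<le> W x * exp \<bar>y - x\<bar>" unfolding W_def distrib_right mult.assoc by (rule add_mono)
        then have "heat_kernel r (y - x) * W y \<le> heat_kernel r (y - x) * (W x * exp \<bar>y - x\<bar>)"
          using heat_kernel_nonneg[OF r(1)] by (rule mult_left_mono)
        then show "ennreal (heat_kernel r (y - x) * W y) \<le> ennreal (W x) * ennreal (heat_kernel r (y - x) * exp \<bar>y - x\<bar>)"
          using W0 by (simp add: ennreal_mult'[symmetric] ennreal_leI mult_ac)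
      qed
      also have "... = ennreal (W x) * nnE lborel (\<lambda>y. heat_kernel r (y - x) * exp \<bar>y - x\<bar>)" by (intro nn_integral_cmult) measurable
      also have "... \<le> ennreal (W x) * ennreal (2 * exp (r / 2))" by (intro mult_left_mono nn_integral_heat_kernel_exp r) auto
      also have "... \<le> ennreal c" unfolding c_def using r t W0[of x]
        by (subst ennreal_mult'[symmetric]) (auto intro!: ennreal_leI mult_mono simp: mult.commute)
      finally show ?thesis .
    qed
    have "nnE lborel (\<lambda>z. indicator {0<..<t} (fst z) * ((ker (fst z) (snd z))\<^sup>2 * D n (fst z) (snd z))) \<le> ennreal (c * (3 * exp (\<beta> * t) / sqrt \<beta>))"
      unfolding ker_def D_def W_def[symmetric] by (rule heat_kernel_weight[OF t(1) \<beta>0 _ W0 _ Wc]) (use W0 in \<open>auto simp: c_def\<close>)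
    also have "... \<le> ennreal I"
    proof (rule ennreal_leI)
      have L: "0 < L\<^sup>2" using L by simp
      have "48 * L\<^sup>2 * exp (T / 2) * (W x * exp (\<beta> * t)) \<le> sqrt \<beta> * (W x * exp (\<beta> * t))" using W0 by (intro mult_right_mono \<beta>) auto
      then have "c * (3 * exp (\<beta> * t)) * (8 * L\<^sup>2) \<le> (W x * exp (\<beta> * t)) * sqrt \<beta>" unfolding c_def by (simp add: mult_ac)
      then have "c * (3 * exp (\<beta> * t)) / sqrt \<beta> \<le> W x * exp (\<beta> * t) / (8 * L\<^sup>2)"
        using \<beta>0 L by (subst frac_le_eq) (auto simp: divide_le_0_iff not_less)
      then show "c * (3 * exp (\<beta> * t) / sqrt \<beta>) \<le> I" unfolding I_def D_def W_def[symmetric] by (simp add: mult.commute)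
    qed
    finally show "nnE lborel (\<lambda>z. indicator {0<..<t} (fst z) * ((ker (fst z) (snd z))\<^sup>2 * D n (fst z) (snd z))) \<le> ennreal I" .
  qed
  \<comment> \<open>\<open>K \<le> N\<close> keeps the cells in use before time \<open>t\<close>:
    they start by \<open>t - 1 / K\<close> and last for 1/N.\<close>
  obtain N where N: "max 1 K \<le> N" and N1: "approx_error t ker J K N \<le> ennreal \<delta>"
    and N2: "box_sum (t - 1 / real K) (real K) N (\<lambda>s y. (ker s y)\<^sup>2 * D n s y) \<le> I + \<delta>"
    using eventually_happens'[OF sequentially_bot eventually_conj[OF eventually_ge_at_top[of "max 1 K"] eventually_conj[OF ev1 ev2]]] by blast
  have N0: "0 < N" and KN: "K \<le> N" using N by auto
  interpret C: noise_cells M \<xi> "grid_cell N" "grid_region N" by (rule grid_cells[OF N0])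
  \<comment> \<open>Only whole cells are kept, so that their noise belongs to the slab.\<close>
  define inside where "inside y \<longleftrightarrow> x0 - R \<le> y \<and> y + 1 / real N \<le> x0 + R" for y
  define Y where "Y s y w = (if in_box (t - 1 / real K) (real K) s y \<and> inside y then ker s y * clip K (\<sigma> (V s y w)) else 0)" for s y w
  define S where "S = grid_sum N (approx_field t K ker)"
  define S' where "S' = grid_sum N Y"
  have Tle: "t - 1 / real K \<le> T" using t by (simp add: le_diff_eq diff_le_eq add_increasing2)
  have Yad: "Y s y \<in> borel_measurable (NS ({0<..s} \<times> A))" if "0 \<le> s" for s y
  proof (cases "s \<le> T")
    case True
    note [measurable] = Vm[OF that True, of y]
    show ?thesis unfolding Y_def[abs_def] by measurable
  next
    case False
    then have "Y s y = (\<lambda>_. 0)" using Tle by (auto simp: Y_def in_box_def fun_eq_iff)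
    then show ?thesis by simp
  qed
  have Yad': "Y s y \<in> borel_measurable (NS ({0<..s} \<times> UNIV))" if "0 \<le> s" for s y
    by (rule noise_sigma_measurable_mono[OF Yad[OF that]]) auto
  have S'm: "S' \<in> borel_measurable (NS ({0<..t} \<times> A))"
    unfolding S'_def grid_sum_def[abs_def]
  proof (intro borel_measurable_sum)
    fix k
    let ?s = "grid_time N k" and ?y = "grid_pos N k"
    show "(\<lambda>w. Y ?s ?y w * \<xi> (grid_cell N k) w) \<in> borel_measurable (NS ({0<..t} \<times> A))"
    proof (cases "in_box (t - 1 / real K) (real K) ?s ?y \<and> inside ?y")
      case True
      have "1 / real N \<le> 1 / real K" using K KN by (simp add: frac_le)
      then have s: "?s + 1 / real N \<le> t" using True by (auto simp: in_box_def)
      then have "?s \<le> t" using N0 by (auto intro: order_trans[rotated])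
      then have "{0<..?s} \<times> A \<subseteq> {0<..t} \<times> A" by auto
      moreover have "grid_cell N k \<subseteq> {0<..t} \<times> A"
        using True s grid_time_nonneg[of N k] by (auto simp: grid_cell_def A_def inside_def)
      ultimately show ?thesis
        by (intro borel_measurable_times noise_sigma_measurable_mono[OF Yad[OF grid_time_nonneg]] noise_measurable_sigma grid_cell_noise)
    next
      case False
      then show ?thesis by (auto simp: Y_def)
    qed
  qed
  define X where "X k w = approx_field t K ker (grid_time N k) (grid_pos N k) w - Y (grid_time N k) (grid_pos N k) w" for k w
  define b where "b k = (if in_box (t - 1 / real K) (real K) (grid_time N k) (grid_pos N k) then L\<^sup>2 * ((ker (grid_time N k) (grid_pos N k))\<^sup>2 * D n (grid_time N k) (grid_pos N k)) else 0)" for k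
  have b0: "0 \<le> b k" for k unfolding b_def using D0 by simp
  have "nnE M (\<lambda>w. C.msum X (grid_size N) w ^ (2 * 1)) \<le> ennreal (((2 * real 1 - 1) * (\<Sum>k<grid_size N. measure lborel (grid_cell N k) * b k)) ^ 1)"
  proof (rule C.msum_moment_le[OF _ b0 order_refl])
    fix k
    let ?s = "grid_time N k" and ?y = "grid_pos N k"
    show "X k \<in> borel_measurable (NS (grid_region N k))"
      unfolding X_def[abs_def] by (intro borel_measurable_diff grid_adapted[OF N0 approx_field_adapted] grid_adapted[OF N0 Yad'])
    show "nnE M (\<lambda>w. X k w ^ (2 * 1)) \<le> ennreal (b k ^ 1)"
    proof (cases "in_box (t - 1 / real K) (real K) ?s ?y")
      case False
      then show ?thesis by (simp add: X_def Y_def approx_field_def b_def)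
    next
      case ib: True
      then have s: "0 \<le> ?s" "?s \<le> T" using Tle by (auto simp: in_box_def)
      define c where "c = L\<^sup>2 * (ker ?s ?y)\<^sup>2"
      \<comment> \<open>Outside the slab the solution is replaced by 0; as
        \<open>\<sigma> 0 = 0\<close>, this amounts to omitting the cell.\<close>
      define v where "v = (if inside ?y then V ?s ?y else (\<lambda>_. 0))"
      have [measurable]: "u ?s ?y \<in> borel_measurable M" "v \<in> borel_measurable M"
        using u_measurable[OF s(1)] noise_sigma_measurable_M[OF Vm[OF s]] by (auto simp: v_def)
      have uv: "nnE M (\<lambda>w. (u ?s ?y w - v w)\<^sup>2) \<le> ennreal (D n ?s ?y)"
      proof (cases "inside ?y")
        case True
        then show ?thesis using V[OF s, of ?y] by (simp add: v_def)
      next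
        case False
        have "nnE M (\<lambda>w. (u ?s ?y w)\<^sup>2) \<le> ennreal (4 * exp (growth_rate 1 * ?s))"
          using u_moment_le[OF order_refl s(1), of ?y] by simp
        also have "... \<le> ennreal (D n ?s ?y)"
        proof (rule ennreal_leI)
          \<comment> \<open>A discarded cell has its corner at distance at least R - 1 from the
            centre, where the boundary term of \<open>D\<close> already exceeds the second moment of
            the solution. This explains the factor \<open>exp 1\<close> in \<open>D\<close>.\<close>
          have "1 / real N \<le> 1" using N0 by simp
          then have "R - 1 \<le> \<bar>?y - x0\<bar>" using False unfolding inside_def by linarith
          then have "1 \<le> exp (1 + (\<bar>?y - x0\<bar> - R))" by simp
          then have "4 * 1 \<le> 4 * exp 1 * exp (\<bar>?y - x0\<bar> - R) + 4 * (1 / 2) ^ n" unfolding exp_add by (intro add_increasing2) auto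
          moreover have "exp (growth_rate 1 * ?s) \<le> exp (\<beta> * ?s)" using \<beta>(1) s by (simp add: mult_right_mono)
          ultimately have "exp (growth_rate 1 * ?s) * (4 * 1) \<le> D n ?s ?y" unfolding D_def by (intro mult_mono) auto
          then show "4 * exp (growth_rate 1 * ?s) \<le> D n ?s ?y" by simp
        qed
        finally show ?thesis using False by (simp add: v_def)
      qed
      have "nnE M (\<lambda>w. X k w ^ (2 * 1)) \<le> (\<integral>\<^sup>+w. ennreal c * ennreal ((u ?s ?y w - v w)\<^sup>2) \<partial>M)"
      proof (rule nn_integral_mono)
        fix w
        have "X k w = ker ?s ?y * (clip K (\<sigma> (u ?s ?y w)) - clip K (\<sigma> (v w)))"
          using ib \<sigma>0 by (auto simp: X_def approx_field_def Y_def v_def right_diff_distrib clip_def)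
        moreover have "\<bar>clip K (\<sigma> (u ?s ?y w)) - clip K (\<sigma> (v w))\<bar> \<le> L * \<bar>u ?s ?y w - v w\<bar>"
          by (rule order_trans[OF clip_lipschitz]) (rule lip)
        ultimately have "\<bar>X k w\<bar> \<le> \<bar>ker ?s ?y\<bar> * (L * \<bar>u ?s ?y w - v w\<bar>)" by (simp add: abs_mult mult_left_mono)
        then have "\<bar>X k w\<bar>\<^sup>2 \<le> (\<bar>ker ?s ?y\<bar> * (L * \<bar>u ?s ?y w - v w\<bar>))\<^sup>2" by (rule power_mono) simp
        then have "(X k w)\<^sup>2 \<le> c * (u ?s ?y w - v w)\<^sup>2" by (simp add: c_def power_mult_distrib mult_ac)
        moreover have "0 \<le> c" by (simp add: c_def)
        ultimately show "ennreal (X k w ^ (2 * 1)) \<le> ennreal c * ennreal ((u ?s ?y w - v w)\<^sup>2)" by (simp add: ennreal_mult'[symmetric] ennreal_leI)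
      qed
      also have "... = ennreal c * nnE M (\<lambda>w. (u ?s ?y w - v w)\<^sup>2)" by (intro nn_integral_cmult) measurable
      also have "... \<le> ennreal c * ennreal (D n ?s ?y)" by (intro mult_left_mono uv) auto
      also have "... = ennreal (b k ^ 1)" using ib D0 by (simp add: ennreal_mult'[symmetric] b_def c_def mult.assoc)
      finally show ?thesis .
    qed
  qed
  moreover have "C.msum X (grid_size N) w = S w - S' w" for w
    by (simp add: C.msum_def S_def S'_def grid_sum_def X_def sum_subtractf left_diff_distrib)
  moreover have "(\<Sum>k<grid_size N. measure lborel (grid_cell N k) * b k) = L\<^sup>2 * box_sum (t - 1 / real K) (real K) N (\<lambda>s y. (ker s y)\<^sup>2 * D n s y)"
    unfolding box_sum_def sum_distrib_left b_def by (intro sum.cong) auto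
  ultimately have "nnE M (\<lambda>w. (S w - S' w)\<^sup>2) \<le> ennreal (L\<^sup>2 * box_sum (t - 1 / real K) (real K) N (\<lambda>s y. (ker s y)\<^sup>2 * D n s y))" by simp
  also have "... \<le> ennreal (L\<^sup>2 * (I + \<delta>))" by (intro ennreal_leI mult_left_mono N2) simp
  finally have SS: "nnE M (\<lambda>w. (S w - S' w)\<^sup>2) \<le> ennreal (L\<^sup>2 * (I + \<delta>))" .
  have [measurable]: "S \<in> borel_measurable M" "S' \<in> borel_measurable M"
    unfolding S_def S'_def by (rule grid_sum_measurable[OF approx_field_adapted], assumption) (rule grid_sum_measurable[OF Yad'])
  show ?thesis
  proof (intro exI conjI)
    show "(\<lambda>w. 1 + S' w) \<in> borel_measurable (NS ({0<..t} \<times> A))" using S'm by measurable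
    have "nnE M (\<lambda>w. (u t x w - (1 + S' w))\<^sup>2) = nnE M (\<lambda>w. ((J w - S w) + (S w - S' w))\<^sup>2)"
      by (rule nn_integral_cong_AE, use uJ in eventually_elim) simp
    also have "... \<le> ennreal (2 * \<delta> + 2 * (L\<^sup>2 * (I + \<delta>)))"
      by (rule sum_square_le) (use N1[folded S_def] SS I0 \<delta> in simp_all)
    also have "... \<le> ennreal (D (Suc n) t x)"
    proof (rule ennreal_leI)
      have "L\<^sup>2 * I = D n t x / 8" using L by (simp add: I_def)
      moreover have "\<delta> * (1 + L\<^sup>2) = exp (\<beta> * t) * (1 / 2) ^ n / 2"
      proof -
        have "4 * a / (8 * b) * b = a / 2" if "0 < b" for a b :: real using that by simp
        from this[OF L2, of "exp (\<beta> * t) * (1 / 2) ^ n"] show ?thesis by (simp only: \<delta>_def mult.assoc)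
      qed
      moreover have "2 * \<delta> + 2 * (L\<^sup>2 * (I + \<delta>)) = 2 * (L\<^sup>2 * I) + 2 * (\<delta> * (1 + L\<^sup>2))" by algebra
      ultimately have "2 * \<delta> + 2 * (L\<^sup>2 * (I + \<delta>)) = D n t x / 4 + exp (\<beta> * t) * (1 / 2) ^ n" by simp
      also have "... = exp (\<beta> * t) * (exp 1 * exp (\<bar>x - x0\<bar> - R) + 2 * (1 / 2) ^ n)" unfolding D_def by (simp add: field_simps)
      also have "... \<le> D (Suc n) t x" unfolding D_def by (intro mult_left_mono) (auto simp: mult_right_mono)
      finally show "2 * \<delta> + 2 * (L\<^sup>2 * (I + \<delta>)) \<le> D (Suc n) t x" .
    qed
    finally show "nnE M (\<lambda>w. (u t x w - (1 + S' w))\<^sup>2) \<le> ennreal (D (Suc n) t x)" .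
  qed
qed

text \<open>The iteration starts from the approximation 0, which the second moment covers, and is
  run until 2^(-n) is below exp(-R). At the centre of the slab the boundary term is of order exp(-R)
  as well.\<close>

theorem localization:
  assumes T: "0 < T"
  obtains C where "0 < C" "\<And>x R. \<exists>V. V \<in> borel_measurable (NS ({0<..T} \<times> {x - R..x + R})) \<and> nnE M (\<lambda>w. (u T x w - V w)\<^sup>2) \<le> ennreal (C * exp (- R))"
proof -
  define \<beta> where "\<beta> = max (growth_rate 1) ((48 * L\<^sup>2 * exp (T / 2))\<^sup>2)"
  have \<beta>: "growth_rate 1 \<le> \<beta>" "48 * L\<^sup>2 * exp (T / 2) \<le> sqrt \<beta>" by (auto simp: \<beta>_def intro!: real_le_rsqrt)
  define D where "D = (\<lambda>x0 R (n :: nat) s y. exp (\<beta> * s) * (4 * exp 1 * exp (\<bar>y - x0\<bar> - R) + 4 * (1 / 2) ^ n))"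
  have main: "\<exists>V. V \<in> borel_measurable (NS ({0<..s} \<times> {x0 - R..x0 + R})) \<and> nnE M (\<lambda>w. (u s y w - V w)\<^sup>2) \<le> ennreal (D x0 R n s y)"
    if "0 \<le> s" "s \<le> T" for x0 R n s y
    using that
  proof (induction n arbitrary: s y)
    case 0
    have "nnE M (\<lambda>w. (u s y w - 0)\<^sup>2) \<le> ennreal (4 * exp (growth_rate 1 * s))"
      using u_moment_le[OF order_refl 0(1), of y] by simp
    also have "... \<le> ennreal (D x0 R 0 s y)"
    proof (rule ennreal_leI)
      have "exp (growth_rate 1 * s) * 4 \<le> D x0 R 0 s y" unfolding D_def using \<beta>(1) 0 by (intro mult_mono) (auto simp: mult_right_mono)
      then show "4 * exp (growth_rate 1 * s) \<le> D x0 R 0 s y" by simp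
    qed
    finally show ?case by (intro exI[of _ "\<lambda>_. 0"]) auto
  next
    case (Suc n)
    show ?case
    proof (cases "s = 0")
      case True
      have "nnE M (\<lambda>w. (u s y w - 1)\<^sup>2) = (\<integral>\<^sup>+w. 0 \<partial>M)" by (rule nn_integral_cong) (simp add: True u_0)
      then show ?thesis by (intro exI[of _ "\<lambda>_. 1"]) auto
    next
      case False
      \<comment> \<open>The approximations are chosen point by point, with measurability in the
        sample point alone; the next level evaluates them at finitely many grid points.\<close>
      have "\<exists>V. \<forall>r z. 0 \<le> r \<longrightarrow> r \<le> T \<longrightarrow> V r z \<in> borel_measurable (NS ({0<..r} \<times> {x0 - R..x0 + R})) \<and> nnE M (\<lambda>w. (u r z w - V r z w)\<^sup>2) \<le> ennreal (D x0 R n r z)"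
        by (intro choice allI) (use Suc.IH in blast)
      then obtain V where V: "\<And>r z. 0 \<le> r \<Longrightarrow> r \<le> T \<Longrightarrow> V r z \<in> borel_measurable (NS ({0<..r} \<times> {x0 - R..x0 + R}))"
        "\<And>r z. 0 \<le> r \<Longrightarrow> r \<le> T \<Longrightarrow> nnE M (\<lambda>w. (u r z w - V r z w)\<^sup>2) \<le> ennreal (D x0 R n r z)" by blast
      show ?thesis unfolding D_def
        by (rule localization_step[OF \<beta> _ Suc.prems(2) V(1) V(2)[unfolded D_def]]) (use False Suc.prems in auto)
    qed
  qed
  show thesis
  proof (rule that[of "exp (\<beta> * T) * (4 * exp 1 + 4)"])
    show "0 < exp (\<beta> * T) * (4 * exp 1 + 4)" by (simp add: add_pos_pos)
    fix x R :: real
    obtain n :: nat where n: "(1 / 2) ^ n < exp (- R)" using real_arch_pow_inv[of "exp (- R)" "1 / 2"] by auto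
    have "D x R n T x \<le> exp (\<beta> * T) * (4 * exp 1 + 4) * exp (- R)"
      unfolding D_def mult.assoc using n by (intro mult_left_mono) (auto simp: distrib_right)
    then have "ennreal (D x R n T x) \<le> ennreal (exp (\<beta> * T) * (4 * exp 1 + 4) * exp (- R))" by (rule ennreal_leI)
    then show "\<exists>V. V \<in> borel_measurable (NS ({0<..T} \<times> {x - R..x + R})) \<and> nnE M (\<lambda>w. (u T x w - V w)\<^sup>2) \<le> ennreal (exp (\<beta> * T) * (4 * exp 1 + 4) * exp (- R))"
      using main[OF less_imp_le[OF T] order_refl] by (meson order_trans)
  qed
qed

end

section \<open>Lower bound for the dimension\<close>

lemma card_nat_interval_le:
  assumes "b - a \<le> d" "0 \<le> d" shows "real (card {k :: nat. a < real k \<and> real k < b}) \<le> d + 1"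
proof -
  have "card {k :: nat. a < real k \<and> real k < b} = card (int ` {k :: nat. a < real k \<and> real k < b})" by (simp add: card_image)
  also have "... \<le> card {\<lfloor>a\<rfloor> + 1..\<lceil>b\<rceil> - 1}" by (rule card_mono) (auto, linarith+)
  finally have "real (card {k :: nat. a < real k \<and> real k < b}) \<le> real (nat (\<lceil>b\<rceil> - 1 - \<lfloor>a\<rfloor>))" by simp
  also have "... \<le> d + 1" using assms by linarith
  finally show ?thesis .
qed

lemma card_UN_list_le:
  assumes "\<And>q. q \<in> set Q \<Longrightarrow> finite (F q)"
  shows "real (card (\<Union>q\<in>set Q. F q)) \<le> (\<Sum>q\<leftarrow>Q. real (card (F q)))"
  using assms
proof (induction Q)
  case (Cons q Q)
  have "card (F q \<union> (\<Union>q\<in>set Q. F q)) \<le> card (F q) + card (\<Union>q\<in>set Q. F q)" by (rule card_Un_le)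
  then show ?case using Cons by simp
qed simp

text \<open>One point per interval of length \<open>l\<close> yields at least P/2 points, where P =
  exp((1 - \<theta>) n). A box of side r < N holds at most r/l + 2 of them, which is at most 3 e P
  (r/N)^\<rho>; for the 2 this uses r at least 1 and \<rho> at most 1 - \<theta>. Summing over the
  cover gives 1/(6 e).\<close>

lemma macro_content_ge:
  fixes E :: "real set" and n :: nat and \<theta> \<rho> :: real
  defines "l \<equiv> exp (\<theta> * real n)"
  assumes \<theta>: "0 < \<theta>" "\<theta> < 1" and \<rho>: "0 < \<rho>" "\<rho> \<le> 1 - \<theta>"
    and E: "\<And>k. real (Suc k) * l \<le> exp (real (Suc n)) - exp (real n) \<Longrightarrow> \<exists>x\<in>E. exp (real n) + real k * l \<le> x \<and> x < exp (real n) + real (Suc k) * l"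
  shows "ennreal (1 / (6 * exp 1)) \<le> macro_content (Suc n) \<rho> E"
  unfolding macro_content_def
proof (rule Inf_greatest, clarify)
  fix Q :: "(real \<times> real) list"
  assume side: "\<forall>(x, r)\<in>set Q. 1 \<le> r" and cov: "E \<inter> shell (Suc n) \<subseteq> (\<Union>(x, r)\<in>set Q. upright_box x r)"
  define N where "N = exp (real (Suc n))"
  define P where "P = exp ((1 - \<theta>) * real n)"
  have N: "0 < N" and l: "0 < l" and P: "1 \<le> P" using \<theta> by (simp_all add: N_def l_def P_def)
  have Nl: "N = exp 1 * P * l" by (simp add: N_def P_def l_def exp_add[symmetric] algebra_simps)
  have "1 / (6 * exp 1) \<le> (\<Sum>(x, r)\<leftarrow>Q. (r / N) powr \<rho>)"
  proof (cases "\<exists>(x, r)\<in>set Q. N \<le> r")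
    \<comment> \<open>A single box of side at least \<open>N\<close> already contributes 1.\<close>
    case True
    then obtain x r where xr: "(x, r) \<in> set Q" "N \<le> r" by auto
    have "1 \<le> (r / N) powr \<rho>" using xr N \<rho> by (intro ge_one_powr_ge_zero) auto
    also have "... \<le> (\<Sum>(x, r)\<leftarrow>Q. (r / N) powr \<rho>)"
      by (rule member_le_sum_list) (use xr in force, auto)
    finally have "1 \<le> (\<Sum>(x, r)\<leftarrow>Q. (r / N) powr \<rho>)" .
    moreover have "1 / (6 * exp 1) \<le> (1 :: real)" using exp_ge_add_one_self[of 1] by (simp add: divide_le_eq)
    ultimately show ?thesis by linarith
  next
    case False
    define K where "K = nat \<lfloor>(N - exp (real n)) / l\<rfloor>"
    have "N - exp (real n) = (exp 1 - 1) * P * l" by (simp add: N_def P_def l_def exp_add[symmetric] algebra_simps)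
    then have Kq: "(N - exp (real n)) / l = (exp 1 - 1) * P" using l by simp
    \<comment> \<open>With 5/2 below e the quotient is at least 3 P/2, and its floor at least P/2
      since P is at least 1.\<close>
    have e: "5 / 2 \<le> exp (1 :: real)" using exp_lower_Taylor_quadratic[of 1] by simp
    have "3 / 2 * P \<le> (exp 1 - 1) * P" using e P by (intro mult_right_mono) auto
    then have KP: "P / 2 \<le> real K" using P unfolding K_def Kq by linarith
    have "\<exists>x. \<forall>k<K. x k \<in> E \<and> exp (real n) + real k * l \<le> x k \<and> x k < exp (real n) + real (Suc k) * l"
    proof (rule choice_iff'[THEN iffD1], intro allI impI)
      fix k assume "k < K"
      then have "real (Suc k) \<le> (N - exp (real n)) / l" unfolding K_def Kq by linarith
      then have "real (Suc k) * l \<le> exp (real (Suc n)) - exp (real n)" using l by (simp add: N_def le_divide_eq)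
      then show "\<exists>x. x \<in> E \<and> exp (real n) + real k * l \<le> x \<and> x < exp (real n) + real (Suc k) * l" using E by blast
    qed
    then obtain x where xE: "\<And>k. k < K \<Longrightarrow> x k \<in> E" and x1: "\<And>k. k < K \<Longrightarrow> exp (real n) + real k * l \<le> x k"
      and x2: "\<And>k. k < K \<Longrightarrow> x k < exp (real n) + real (Suc k) * l" by blast
    define F where "F q = {k. k < K \<and> x k \<in> upright_box (fst q) (snd q)}" for q
    have "{..<K} \<subseteq> (\<Union>q\<in>set Q. F q)"
    proof
      fix k assume "k \<in> {..<K}"
      then have k: "k < K" by simp
      have "real (Suc k) \<le> (N - exp (real n)) / l" using k unfolding K_def Kq by linarith
      then have "real (Suc k) * l \<le> N - exp (real n)" using l by (simp add: le_divide_eq)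
      moreover have "0 \<le> real k * l" using l by simp
      ultimately have "exp (real n) \<le> x k" "x k < N" using x1[OF k] x2[OF k] by linarith+
      then have "x k \<in> shell (Suc n)" unfolding shell_real N_def using exp_gt_zero[of "real (Suc n)"] exp_gt_zero[of "real n"] by linarith
      then have "x k \<in> (\<Union>(x, r)\<in>set Q. upright_box x r)" using cov xE[OF k] by blast
      then show "k \<in> (\<Union>q\<in>set Q. F q)" using k by (fastforce simp: F_def)
    qed
    then have "card {..<K} \<le> card (\<Union>q\<in>set Q. F q)" by (intro card_mono) (auto simp: F_def)
    then have "real K \<le> real (card (\<Union>q\<in>set Q. F q))" by simp
    also have "... \<le> (\<Sum>q\<leftarrow>Q. real (card (F q)))" by (rule card_UN_list_le) (simp add: F_def)
    also have "... \<le> (\<Sum>q\<leftarrow>Q. 3 * exp 1 * P * (snd q / N) powr \<rho>)"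
    proof (rule sum_list_mono)
      fix q assume q: "q \<in> set Q"
      obtain y r where yr: "q = (y, r)" by (cases q)
      have r: "1 \<le> r" "r < N" using side False q by (auto simp: yr not_le)
      define a where "a = r / N"
      have a: "0 < a" "a \<le> 1" using r N by (auto simp: a_def)
      \<comment> \<open>A box can contain the point of interval \<open>k\<close> only if
        \<open>k\<close> lies in an open real interval of length r/l + 1, which holds at most r/l +
        2 integers.\<close>
      have "F q \<subseteq> {k. (y - exp (real n)) / l - 1 < real k \<and> real k < (y + r - exp (real n)) / l}"
        using x1 x2 l by (fastforce simp: F_def yr upright_box_real field_simps)
      moreover have "finite {k. (y - exp (real n)) / l - 1 < real k \<and> real k < (y + r - exp (real n)) / l}"
        by (rule finite_subset[of _ "{..nat \<lceil>(y + r - exp (real n)) / l\<rceil>}"]) (auto, linarith)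
      ultimately have "real (card (F q)) \<le> real (card {k. (y - exp (real n)) / l - 1 < real k \<and> real k < (y + r - exp (real n)) / l})"
        by (simp add: card_mono)
      also have "... \<le> (r / l + 1) + 1" by (rule card_nat_interval_le) (use l r in \<open>auto simp: field_simps\<close>)
      also have "... \<le> 3 * exp 1 * P * a powr \<rho>"
      proof -
        have "r / l = a * (exp 1 * P)" using l P by (simp add: a_def Nl)
        also have "a \<le> a powr \<rho>" using powr_mono'[of \<rho> 1 a] a \<rho> \<theta> by simp
        finally have 1: "r / l \<le> a powr \<rho> * (exp 1 * P)" using P by (simp add: mult_right_mono)
        have "1 \<le> r powr \<rho>" using r \<rho> by (simp add: ge_one_powr_ge_zero)
        also have "r powr \<rho> = a powr \<rho> * N powr \<rho>" using N r by (simp add: a_def powr_divide)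
        also have "N powr \<rho> \<le> exp 1 * P"
        proof -
          have "N powr \<rho> \<le> N powr (1 - \<theta>)" using \<rho> by (intro powr_mono) (simp_all add: N_def)
          also have "... = exp ((1 - \<theta>) * real (Suc n))" by (simp add: N_def powr_def)
          also have "... \<le> exp (1 + (1 - \<theta>) * real n)" using \<theta> by (simp add: algebra_simps)
          finally show ?thesis by (simp add: P_def exp_add)
        qed
        finally have 2: "1 \<le> a powr \<rho> * (exp 1 * P)" by (simp add: mult_left_mono)
        show ?thesis using 1 2 by (simp add: mult_ac)
      qed
      finally show "real (card (F q)) \<le> 3 * exp 1 * P * (snd q / N) powr \<rho>" by (simp add: a_def yr)
    qed
    also have "... = 3 * exp 1 * P * (\<Sum>(x, r)\<leftarrow>Q. (r / N) powr \<rho>)" by (simp add: sum_list_const_mult case_prod_unfold)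
    finally have "P / 2 \<le> 3 * exp 1 * P * (\<Sum>(x, r)\<leftarrow>Q. (r / N) powr \<rho>)" using KP by linarith
    then have "P * 1 \<le> P * (6 * exp 1 * (\<Sum>(x, r)\<leftarrow>Q. (r / N) powr \<rho>))" by (simp add: mult_ac)
    then have "1 \<le> 6 * exp 1 * (\<Sum>(x, r)\<leftarrow>Q. (r / N) powr \<rho>)" using P by (simp only: mult_le_cancel_left_pos[of P])
    then show ?thesis by (simp add: divide_le_eq mult.commute)
  qed
  then have "ennreal (1 / (6 * exp 1)) \<le> ennreal (\<Sum>(x, r)\<leftarrow>Q. (r / N) powr \<rho>)" by (rule ennreal_leI)
  also have "... = (\<Sum>(x, r)\<leftarrow>Q. ennreal ((r / exp (real (Suc n))) powr \<rho>))"
    unfolding N_def case_prod_unfold by (rule sum_list_ennreal[symmetric]) auto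
  finally show "ennreal (1 / (6 * exp 1)) \<le> (\<Sum>(x, r)\<leftarrow>Q. ennreal ((r / exp (real (Suc n))) powr \<rho>))" .
qed

text \<open>For an exponent below 1 - \<theta> the contents of all late shells stay above one
  positive constant, so their series diverges.\<close>

lemma macro_dim_ge:
  fixes E :: "real set" and \<theta> :: real
  assumes \<theta>: "0 < \<theta>" "\<theta> < 1"
    and E: "\<And>n k. n0 \<le> n \<Longrightarrow> real (Suc k) * exp (\<theta> * real n) \<le> exp (real (Suc n)) - exp (real n) \<Longrightarrow>
      \<exists>x\<in>E. exp (real n) + real k * exp (\<theta> * real n) \<le> x \<and> x < exp (real n) + real (Suc k) * exp (\<theta> * real n)"
  shows "ereal (1 - \<theta>) \<le> macro_dim E"
  unfolding macro_dim_def
proof (rule Inf_greatest, clarify)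
  fix \<rho> :: real assume \<rho>: "0 < \<rho>" and fin: "(\<Sum>n. macro_content (Suc n) \<rho> E) < \<infinity>"
  show "ereal (1 - \<theta>) \<le> ereal \<rho>"
  proof (rule ccontr)
    assume "\<not> ereal (1 - \<theta>) \<le> ereal \<rho>"
    then have \<rho>': "\<rho> \<le> 1 - \<theta>" by simp
    define c :: real where "c = 1 / (6 * exp 1)"
    have c: "0 < c" by (simp add: c_def)
    have ge: "ennreal c \<le> macro_content (Suc n) \<rho> E" if "n0 \<le> n" for n
      unfolding c_def by (rule macro_content_ge[OF \<theta> \<rho> \<rho>' E[OF that]])
    obtain s where s: "(\<Sum>n. macro_content (Suc n) \<rho> E) = ennreal s" "0 \<le> s" using fin by (cases "\<Sum>n. macro_content (Suc n) \<rho> E") auto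
    obtain m :: nat where m: "s < real m * c" using reals_Archimedean3[OF c] by blast
    have "ennreal (real m * c) = (\<Sum>n\<in>{n0..<n0 + m}. ennreal c)" using c by (simp add: ennreal_mult ennreal_of_nat_eq_real_of_nat)
    also have "... \<le> (\<Sum>n\<in>{n0..<n0 + m}. macro_content (Suc n) \<rho> E)" by (intro sum_mono ge) simp
    also have "... \<le> ennreal s" unfolding s(1)[symmetric] by (intro sum_le_suminf) auto
    finally show False using m s(2) c by (simp add: ennreal_le_iff)
  qed
qed

section \<open>Peaks in all long intervals of late shells\<close>

context she
begin

text \<open>The induction carries measurability over the union of the regions along, which is what
  \<open>noise_indep\<close> requires against the next region.\<close>

lemma prob_no_event_le:
  fixes p :: real
  assumes G: "\<And>j. j < m \<Longrightarrow> G j \<in> sets (NS (U j))" and U: "\<And>i j. i < j \<Longrightarrow> j < m \<Longrightarrow> U i \<inter> U j = {}"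
    and p: "\<And>j. j < m \<Longrightarrow> prob (G j) \<le> 1 - p"
  shows "{w \<in> space M. \<forall>j<m. w \<in> G j} \<in> sets (NS (\<Union>j<m. U j)) \<and> prob {w \<in> space M. \<forall>j<m. w \<in> G j} \<le> exp (- p * real m)"
  using assms
proof (induction m)
  case 0
  have "{w \<in> space M. \<forall>j<0. w \<in> G j} = space M" by auto
  moreover have "space M \<in> sets (NS (\<Union>j<0. U j))" using sets.top[of "NS (\<Union>j<0. U j)"] unfolding space_noise_sigma .
  moreover have "prob (space M) \<le> exp (- p * real 0)" using prob_space by simp
  ultimately show ?case by (simp only:)
next
  case (Suc m)
  define H where "H = {w \<in> space M. \<forall>j<m. w \<in> G j}"
  have H: "H \<in> sets (NS (\<Union>j<m. U j))" "prob H \<le> exp (- p * real m)"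
  proof -
    have "H \<in> sets (NS (\<Union>j<m. U j)) \<and> prob H \<le> exp (- p * real m)"
      unfolding H_def by (rule Suc.IH; rule Suc.prems) simp_all
    then show "H \<in> sets (NS (\<Union>j<m. U j))" "prob H \<le> exp (- p * real m)" by auto
  qed
  have Gm: "G m \<in> sets (NS (U m))" using Suc.prems by simp
  have e: "{w \<in> space M. \<forall>j<Suc m. w \<in> G j} = H \<inter> G m" by (auto simp: H_def less_Suc_eq)
  have "(\<Union>j<m. U j) \<inter> U m = {}" using Suc.prems(2)[of _ m] by auto
  then have "prob (H \<inter> G m) = prob H * prob (G m)" using noise_indep H(1) Gm by (intro indep_setD) auto
  also have "... \<le> exp (- p * real m) * exp (- p)"
    using H(2) Suc.prems(3)[of m] exp_ge_add_one_self[of "- p"] by (intro mult_mono) auto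
  also have "... = exp (- p * real (Suc m))" by (simp add: exp_add[symmetric] algebra_simps)
  finally have "prob (H \<inter> G m) \<le> exp (- p * real (Suc m))" .
  moreover have "H \<inter> G m \<in> sets (NS (\<Union>j<Suc m. U j))"
  proof (rule sets.Int)
    show "H \<in> sets (NS (\<Union>j<Suc m. U j))" by (rule subsetD[OF sets_noise_sigma_mono H(1)]) fastforce
    show "G m \<in> sets (NS (\<Union>j<Suc m. U j))" by (rule subsetD[OF sets_noise_sigma_mono Gm]) auto
  qed
  ultimately show ?case unfolding e by blast
qed

text \<open>The values of the solution are replaced by local variables \<open>V\<close> over
  disjoint windows, which are exactly independent. A replacement error below 1 is affordable twice
  because exp r + 2 is at most exp(r + 2); the events \<open>far\<close> where it is larger are
  handled by Chebyshev's inequality and a union bound.\<close>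

lemma prob_no_peak_le:
  fixes c :: "nat \<Rightarrow> real"
  assumes t: "0 < t" and C: "0 < C"
    and loc: "\<And>x. \<exists>V. V \<in> borel_measurable (NS ({0<..t} \<times> {x - R..x + R})) \<and> nnE M (\<lambda>w. (u t x w - V w)\<^sup>2) \<le> ennreal C"
    and sep: "\<And>i j. i < j \<Longrightarrow> j < m \<Longrightarrow> c i + 2 * R < c j"
    and q: "\<And>x. q \<le> prob {w \<in> space M. exp (r + 2) \<le> \<bar>u t x w\<bar>}" and r: "0 \<le> r"
  shows "prob {w \<in> space M. \<forall>j<m. \<bar>u t (c j) w\<bar> < exp r} \<le> exp (- (q - C) * real m) + real m * C"
proof -
  obtain V where Vm: "\<And>x. V x \<in> borel_measurable (NS ({0<..t} \<times> {x - R..x + R}))"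
    and V: "\<And>x. (nnE M (\<lambda>w. (u t x w - V x w)\<^sup>2)) \<le> ennreal C" using loc by metis
  note [measurable] = Vm[THEN noise_sigma_measurable_M] u_measurable[OF less_imp_le[OF t]]
  define far where "far x = {w \<in> space M. 1 \<le> \<bar>u t x w - V x w\<bar>}" for x
  define G where "G x = {w \<in> space M. \<bar>V x w\<bar> < exp r + 1}" for x
  have [measurable]: "far x \<in> events" "G x \<in> events" for x unfolding far_def G_def by measurable
  have far: "prob (far x) \<le> C" for x
    unfolding far_def using markov_even_power[of "\<lambda>w. u t x w - V x w" 1 C 1] V[of x] C by simp
  have G: "G x \<in> sets (NS ({0<..t} \<times> {x - R..x + R}))" for x
  proof -
    note [measurable] = Vm[of x]
    have "{w \<in> space (NS ({0<..t} \<times> {x - R..x + R})). \<bar>V x w\<bar> < exp r + 1} \<in> sets (NS ({0<..t} \<times> {x - R..x + R}))" by measurable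
    then show ?thesis by (simp add: G_def)
  qed
  have "1 * 2 \<le> exp r * (exp 2 - 1)" using r exp_ge_add_one_self[of "2 :: real"] by (intro mult_mono) auto
  then have e2: "exp r + 2 \<le> exp (r + 2)" by (simp add: exp_add algebra_simps)
  have pG: "prob (G x) \<le> 1 - (q - C)" for x
  proof -
    have "{w \<in> space M. exp (r + 2) \<le> \<bar>u t x w\<bar>} \<subseteq> (space M - G x) \<union> far x"
      using e2 by (auto simp: G_def far_def)
    then have "prob {w \<in> space M. exp (r + 2) \<le> \<bar>u t x w\<bar>} \<le> prob ((space M - G x) \<union> far x)" by (intro finite_measure_mono) auto
    also have "... \<le> prob (space M - G x) + prob (far x)" by (intro measure_Un_le) auto
    also have "prob (space M - G x) = 1 - prob (G x)" by (rule prob_compl) measurable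
    finally show ?thesis using q[of x] far[of x] by linarith
  qed
  have "prob {w \<in> space M. \<forall>j<m. w \<in> G (c j)} \<le> exp (- (q - C) * real m)"
    by (rule prob_no_event_le[THEN conjunct2, OF G _ pG]) (use sep in \<open>fastforce\<close>)
  moreover have "prob (\<Union>j<m. far (c j)) \<le> real m * C"
  proof -
    have "prob (\<Union>j<m. far (c j)) \<le> (\<Sum>j<m. prob (far (c j)))" by (rule finite_measure_subadditive_finite) auto
    also have "... \<le> (\<Sum>j<m. C)" by (intro sum_mono far)
    finally show ?thesis by simp
  qed
  moreover have "prob {w \<in> space M. \<forall>j<m. \<bar>u t (c j) w\<bar> < exp r} \<le> prob ({w \<in> space M. \<forall>j<m. w \<in> G (c j)} \<union> (\<Union>j<m. far (c j)))"
  proof (rule finite_measure_mono)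
    show "{w \<in> space M. \<forall>j<m. \<bar>u t (c j) w\<bar> < exp r} \<subseteq> {w \<in> space M. \<forall>j<m. w \<in> G (c j)} \<union> (\<Union>j<m. far (c j))"
    proof
      fix w assume wd: "w \<in> {w \<in> space M. \<forall>j<m. \<bar>u t (c j) w\<bar> < exp r}"
      have "w \<in> G (c j) \<or> w \<in> far (c j)" if "j < m" for j
      proof -
        have "w \<in> space M" "\<bar>u t (c j) w\<bar> < exp r" using wd that by auto
        then show ?thesis by (auto simp: far_def G_def)
      qed
      then show "w \<in> {w \<in> space M. \<forall>j<m. w \<in> G (c j)} \<union> (\<Union>j<m. far (c j))" using wd by blast
    qed
  qed measurable
  moreover have "... \<le> prob {w \<in> space M. \<forall>j<m. w \<in> G (c j)} + prob (\<Union>j<m. far (c j))" by (intro measure_Un_le) auto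
  ultimately show ?thesis by linarith
qed

text \<open>An interval of length exp(\<theta> n) holds of order exp(\<theta> n)/n separated points,
  while for small \<gamma> a peak at one of them has probability at least exp(-\<theta> (n + 1)/4).
  Up to the localization error the absence of a peak is superexponentially unlikely, and
  Borel-Cantelli covers all intervals of all late shells.\<close>

theorem macro_dim_peaks_ge:
  assumes t: "0 < t" and \<theta>: "0 < \<theta>" "\<theta> < 1"
  obtains \<gamma>0 where "0 < \<gamma>0" "\<And>\<gamma>. 0 < \<gamma> \<Longrightarrow> \<gamma> \<le> \<gamma>0 \<Longrightarrow> AE w in M. ereal (1 - \<theta>) \<le> macro_dim (tall_peaks t (\<lambda>x. ln (u t x w)) \<gamma>)"
proof -
  obtain C1 where C1: "0 < C1" "\<And>r x. 1 \<le> r \<Longrightarrow> exp (- C1 * r powr (3/2)) \<le> prob {w \<in> space M. exp r \<le> \<bar>u t x w\<bar>}"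
    by (rule tail_lower_bound[OF t]) blast
  obtain C2 where C2: "0 < C2" "\<And>x R. \<exists>V. V \<in> borel_measurable (NS ({0<..t} \<times> {x - R..x + R})) \<and> nnE M (\<lambda>w. (u t x w - V w)\<^sup>2) \<le> ennreal (C2 * exp (- R))"
    by (rule localization[OF t]) blast
  \<comment> \<open>Makes C1 (r + 2)^(3/2) at most \<theta> (n + 1)/4: once r is at least 2 the
    shift by 2 at most doubles r, and 2^(3/2) is at most 4.\<close>
  define g0 where "g0 = (\<theta> / (16 * C1)) powr (2/3)"
  have g0: "0 < g0" using \<theta> C1 by (simp add: g0_def)
  show thesis
  proof (rule that[of "g0 / t powr (1/3)"])
    show "0 < g0 / t powr (1/3)" using g0 t by simp
    fix \<gamma> assume \<gamma>: "0 < \<gamma>" "\<gamma> \<le> g0 / t powr (1/3)"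
    define g where "g = \<gamma> * t powr (1/3)"
    have g: "0 < g" "g \<le> g0" using \<gamma> t by (simp_all add: g_def pos_le_divide_eq)
    define r where "r n = g * real (Suc n) powr (2/3)" for n
    \<comment> \<open>The localization error, a multiple of exp(-4 (n + 1)), outweighs the at most
      exp(n + 1) intervals with at most exp(n + 1) points each.\<close>
    define R where "R n = 4 * real (Suc n)" for n
    define l where "l n = exp (\<theta> * real n)" for n
    define m where "m n = nat \<lfloor>l n / (3 * R n)\<rfloor>" for n
    define \<delta> where "\<delta> n = C2 * exp (- R n)" for n
    define q where "q n = exp (- (\<theta> / 4) * real (Suc n))" for n
    \<comment> \<open>Spacing 3 R keeps windows of radius R disjoint, and by the choice of
      \<open>m\<close> the points stay within interval \<open>k\<close>.\<close>
    define c where "c n k j = exp (real n) + real k * l n + 3 * R n * real j" for n k j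
    define K where "K n = nat \<lfloor>exp (real (Suc n))\<rfloor>" for n
    define bad where "bad n = (\<Union>k<K n. {w \<in> space M. \<forall>j<m n. \<bar>u t (c n k j) w\<bar> < exp (r n)})" for n
    have R: "0 < R n" for n by (simp add: R_def)
    have mR: "real (m n) * (3 * R n) \<le> l n" "l n / (3 * R n) - 1 \<le> real (m n)" for n
    proof -
      have "0 \<le> l n / (3 * R n)" using R[of n] by (simp add: l_def)
      then have "real (m n) \<le> l n / (3 * R n)" "l n / (3 * R n) - 1 \<le> real (m n)" unfolding m_def by linarith+
      then show "real (m n) * (3 * R n) \<le> l n" "l n / (3 * R n) - 1 \<le> real (m n)" using R[of n] by (simp_all add: le_divide_eq)
    qed
    note [measurable] = u_measurable[OF less_imp_le[OF t]]
    have bad[measurable]: "bad n \<in> events" for n unfolding bad_def by measurable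
    have e1: "eventually (\<lambda>n. 2 \<le> r n) sequentially" unfolding r_def using g(1) by real_asymp
    have e2: "eventually (\<lambda>n. \<delta> n \<le> q n / 2) sequentially"
    proof -
      have "0 < 4 - \<theta> / 4" using \<theta> by simp
      then have "eventually (\<lambda>n. C2 * exp (- (4 - \<theta> / 4) * real (Suc n)) \<le> 1 / 2) sequentially" by real_asymp
      then show ?thesis
      proof eventually_elim
        case (elim n)
        have "\<delta> n = q n * (C2 * exp (- (4 - \<theta> / 4) * real (Suc n)))"
          unfolding \<delta>_def q_def R_def by (simp add: exp_add[symmetric] algebra_simps)
        also have "... \<le> q n * (1 / 2)" by (intro mult_left_mono elim) (simp add: q_def)
        finally show ?case by simp
      qed
    qed
    \<comment> \<open>Half the expected number of peaks among the points grows like exp(3 \<theta>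
      n/4)/n and so exceeds the linear exponent that the union bound over intervals asks
      for.\<close>
    have e3: "eventually (\<lambda>n. 2 * real (Suc n) \<le> q n / 2 * (l n / (3 * R n) - 1)) sequentially"
      unfolding q_def l_def R_def using \<theta>(1) by real_asymp
    have pb: "eventually (\<lambda>n. prob (bad n) \<le> (1 + C2) * exp (- 1) ^ n) sequentially"
      using e1 e2 e3
    proof eventually_elim
      case (elim n)
      have q: "q n \<le> prob {w \<in> space M. exp (r n + 2) \<le> \<bar>u t x w\<bar>}" for x
      proof -
        have "(r n + 2) powr (3/2) \<le> (2 * r n) powr (3/2)" using elim(1) by (intro powr_mono2) auto
        also have "... = 2 powr (3/2) * (g powr (3/2) * real (Suc n))"
          using g by (simp add: r_def powr_mult powr_powr)
        also have "... \<le> 4 * (g0 powr (3/2) * real (Suc n))"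
        proof (intro mult_mono powr_mono2)
          show "2 powr (3/2) \<le> (4::real)" using powr_mono[of "3/2" 2 "2::real"] by simp
        qed (use g in auto)
        also have "g0 powr (3/2) = \<theta> / (16 * C1)" using \<theta> C1 by (simp add: g0_def powr_powr)
        finally have "C1 * (r n + 2) powr (3/2) \<le> C1 * (4 * (\<theta> / (16 * C1) * real (Suc n)))" using C1 by (intro mult_left_mono) auto
        also have "... = \<theta> / 4 * real (Suc n)" using C1 by simp
        finally have "q n \<le> exp (- C1 * (r n + 2) powr (3/2))" by (simp add: q_def)
        also have "... \<le> prob {w \<in> space M. exp (r n + 2) \<le> \<bar>u t x w\<bar>}" by (rule C1) (use elim(1) in simp)
        finally show ?thesis .
      qed
      have \<delta>0: "0 < \<delta> n" using C2 by (simp add: \<delta>_def)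
      have "prob (bad n) \<le> (\<Sum>k<K n. prob {w \<in> space M. \<forall>j<m n. \<bar>u t (c n k j) w\<bar> < exp (r n)})"
        unfolding bad_def by (rule finite_measure_subadditive_finite) auto
      also have "... \<le> (\<Sum>k<K n. exp (- 2 * real (Suc n)) + C2 * exp (- 3 * real (Suc n)))"
      proof (rule sum_mono)
        fix k
        have "prob {w \<in> space M. \<forall>j<m n. \<bar>u t (c n k j) w\<bar> < exp (r n)} \<le> exp (- (q n - \<delta> n) * real (m n)) + real (m n) * \<delta> n"
        proof (rule prob_no_peak_le[OF t \<delta>0 _ _ q])
          show "\<exists>V. V \<in> borel_measurable (NS ({0<..t} \<times> {x - R n..x + R n})) \<and> nnE M (\<lambda>w. (u t x w - V w)\<^sup>2) \<le> ennreal (\<delta> n)" for x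
            unfolding \<delta>_def by (rule C2(2))
          show "c n k i + 2 * R n < c n k j" if "i < j" for i j
          proof -
            have "3 * R n * (real i + 1) \<le> 3 * R n * real j" using R[of n] that by (intro mult_left_mono) auto
            then show ?thesis using R[of n] by (simp add: c_def algebra_simps)
          qed
        qed (use elim(1) in auto)
        moreover have "exp (- (q n - \<delta> n) * real (m n)) \<le> exp (- 2 * real (Suc n))"
        proof -
          have q0: "0 \<le> q n" by (simp add: q_def)
          have "2 * real (Suc n) \<le> q n / 2 * real (m n)" using elim(3) mult_left_mono[OF mR(2)[of n], of "q n / 2"] q0 by linarith
          also have "... \<le> (q n - \<delta> n) * real (m n)" using elim(2) by (intro mult_right_mono) auto
          finally show ?thesis by (simp only: exp_le_cancel_iff mult_minus_left neg_le_iff_le)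
        qed
        moreover have "real (m n) * \<delta> n \<le> C2 * exp (- 3 * real (Suc n))"
        proof -
          have "real (m n) * 1 \<le> real (m n) * (3 * R n)" by (intro mult_left_mono) (auto simp: R_def)
          also have "... \<le> exp (real (Suc n))"
          proof (rule order_trans[OF mR(1)])
            have "\<theta> * real n \<le> 1 * real n" using \<theta> by (intro mult_right_mono) auto
            then show "l n \<le> exp (real (Suc n))" by (simp add: l_def)
          qed
          finally have "real (m n) * \<delta> n \<le> exp (real (Suc n)) * \<delta> n" using \<delta>0 by (intro mult_right_mono) auto
          also have "... = C2 * exp (- 3 * real (Suc n))" by (simp add: \<delta>_def R_def mult.left_commute exp_add[symmetric])
          finally show ?thesis .
        qed
        ultimately show "prob {w \<in> space M. \<forall>j<m n. \<bar>u t (c n k j) w\<bar> < exp (r n)} \<le> exp (- 2 * real (Suc n)) + C2 * exp (- 3 * real (Suc n))" by linarith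
      qed
      also have "... = real (K n) * (exp (- 2 * real (Suc n)) + C2 * exp (- 3 * real (Suc n)))" by simp
      also have "... \<le> exp (real (Suc n)) * (exp (- 2 * real (Suc n)) + C2 * exp (- 2 * real (Suc n)))"
      proof (intro mult_mono add_left_mono mult_left_mono)
        show "real (K n) \<le> exp (real (Suc n))" unfolding K_def using exp_ge_zero[of "real (Suc n)"] by linarith
      qed (use C2 in auto)
      also have "... = (1 + C2) * exp (- real (Suc n))" by (simp add: algebra_simps exp_add[symmetric] del: of_nat_Suc)
      also have "... \<le> (1 + C2) * exp (- 1) ^ n" using C2 by (intro mult_left_mono) (auto simp: exp_of_nat_mult[symmetric])
      finally show ?case .
    qed
    have "summable (\<lambda>n. prob (bad n))"
    proof (rule summable_comparison_test_ev)
      show "eventually (\<lambda>n. norm (prob (bad n)) \<le> (1 + C2) * exp (- 1) ^ n) sequentially" using pb by simp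
      show "summable (\<lambda>n. (1 + C2) * exp (- 1 :: real) ^ n)" by (intro summable_mult summable_geometric) simp
    qed
    then have "AE w in M. eventually (\<lambda>n. w \<in> space M - bad n) sequentially"
      by (intro borel_cantelli_AE1) (auto simp: emeasure_eq_measure)
    then show "AE w in M. ereal (1 - \<theta>) \<le> macro_dim (tall_peaks t (\<lambda>x. ln (u t x w)) \<gamma>)"
    proof eventually_elim
      case (elim w)
      then obtain n0 where n0: "\<And>n. n0 \<le> n \<Longrightarrow> w \<in> space M - bad n" unfolding eventually_sequentially by blast
      show ?case
      \<comment> \<open>From shell 3 on all points exceed \<open>exp (exp 1)\<close>, the left end
        of \<open>tall_peaks\<close>, as e is at most 3.\<close>
      proof (rule macro_dim_ge[OF \<theta>, where ?n0.0 = "max 3 n0"])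
        fix n k assume n: "max 3 n0 \<le> n" and k: "real (Suc k) * exp (\<theta> * real n) \<le> exp (real (Suc n)) - exp (real n)"
        have l1: "1 \<le> l n" using \<theta> by (simp add: l_def)
        have "real (Suc k) = real (Suc k) * 1" by simp
        also have "... \<le> real (Suc k) * l n" using l1 by (intro mult_left_mono) auto
        also have "... \<le> exp (real (Suc n)) - exp (real n)" using k unfolding l_def .
        also have "... \<le> exp (real (Suc n))" by simp
        finally have "real (Suc k) \<le> exp (real (Suc n))" .
        then have "k < K n" unfolding K_def by linarith
        then obtain j where j: "j < m n" and big: "exp (r n) \<le> \<bar>u t (c n k j) w\<bar>"
          using n0[of n] n by (auto simp: bad_def not_less)
        define x where "x = c n k j"
        have "3 * R n * real j < 3 * R n * real (m n)" using R[of n] j by (intro mult_strict_left_mono) auto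
        also have "... \<le> l n" using mR(1)[of n] by (simp only: mult.commute)
        finally have "3 * R n * real j < l n" .
        moreover have "0 \<le> 3 * R n * real j" using R[of n] by simp
        moreover have "real (Suc k) * l n = real k * l n + l n" by (simp add: distrib_right)
        ultimately have xl: "exp (real n) + real k * l n \<le> x" "x < exp (real n) + real (Suc k) * l n" unfolding x_def c_def by linarith+
        have "0 \<le> real k * l n" using l1 by simp
        then have x: "exp (real n) \<le> x" using xl(1) by linarith
        have "exp (real n) + real (Suc k) * l n \<le> exp (real (Suc n))" using k unfolding l_def by (simp only: le_diff_eq add.commute)
        with xl(2) have x': "x < exp (real (Suc n))" by (rule less_le_trans)
        have x0: "0 < x" using x exp_gt_zero[of "real n"] by linarith
        have "exp 1 \<le> real n" using n exp_le by (simp add: order_trans[of "exp 1" 3 "real n"])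
        then have "exp (exp 1) \<le> x" using x by (meson exp_le_cancel_iff order_trans)
        moreover have "\<gamma> * t powr (1/3) * ln x powr (2/3) \<le> ln (u t x w)"
        proof -
          have "0 \<le> real n" "real n \<le> ln x" using x x0 by (simp_all add: ln_ge_iff)
          moreover have "ln x < ln (exp (real (Suc n)))" using x' x0 by (subst ln_less_cancel_iff) auto
          ultimately have "0 \<le> ln x" "ln x \<le> real (Suc n)" unfolding ln_exp by linarith+
          then have "ln x powr (2/3) \<le> real (Suc n) powr (2/3)" by (intro powr_mono2) auto
          then have "g * ln x powr (2/3) \<le> r n" unfolding r_def using g by (intro mult_left_mono) auto
          also have "r n \<le> ln (u t x w)"
          proof -
            have "u t x w \<noteq> 0" using big exp_gt_zero[of "r n"] by (auto simp: x_def)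
            then have "exp (r n) \<le> exp (ln (u t x w))" using big by (simp add: x_def exp_ln_abs)
            then show ?thesis by simp
          qed
          finally show ?thesis by (simp add: g_def)
        qed
        ultimately have "x \<in> tall_peaks t (\<lambda>x. ln (u t x w)) \<gamma>" by (simp add: tall_peaks_def)
        then show "\<exists>x\<in>tall_peaks t (\<lambda>x. ln (u t x w)) \<gamma>. exp (real n) + real k * exp (\<theta> * real n) \<le> x \<and> x < exp (real n) + real (Suc k) * exp (\<theta> * real n)"
          using xl unfolding l_def by blast
      qed
    qed
  qed
qed

end

text \<open>The dimension at \<gamma> stays below 1 by some fixed \<open>f\<close>, whereas small
  heights reach dimension 1 - \<theta> for a \<theta> chosen below \<open>f\<close>.\<close>

lemma (in she) peaks_dimension_increases:
  assumes t: "0 < t" and \<gamma>: "0 < \<gamma>"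
  shows "\<exists>\<gamma>'. 0 < \<gamma>' \<and> \<gamma>' < \<gamma> \<and> (AE w in M. macro_dim (tall_peaks t (\<lambda>x. ln (u t x w)) \<gamma>) < macro_dim (tall_peaks t (\<lambda>x. ln (u t x w)) \<gamma>'))"
proof -
  obtain f where f: "0 < f" "AE w in M. macro_dim (tall_peaks t (\<lambda>x. ln (u t x w)) \<gamma>) \<le> ereal (1 - f)"
    by (rule macro_dim_peaks_le[OF t \<gamma>]) blast
  define \<theta> where "\<theta> = min (f / 2) (1 / 2)"
  have \<theta>: "0 < \<theta>" "\<theta> < 1" "\<theta> < f" using f(1) by (auto simp: \<theta>_def)
  obtain \<gamma>0 where \<gamma>0: "0 < \<gamma>0" "\<And>\<gamma>. 0 < \<gamma> \<Longrightarrow> \<gamma> \<le> \<gamma>0 \<Longrightarrow> AE w in M. ereal (1 - \<theta>) \<le> macro_dim (tall_peaks t (\<lambda>x. ln (u t x w)) \<gamma>)"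
    by (rule macro_dim_peaks_ge[OF t \<theta>(1,2)]) blast
  have "AE w in M. ereal (1 - \<theta>) \<le> macro_dim (tall_peaks t (\<lambda>x. ln (u t x w)) (min \<gamma>0 (\<gamma> / 2)))"
    by (rule \<gamma>0) (use \<gamma>0 \<gamma> in auto)
  with f(2) have "AE w in M. macro_dim (tall_peaks t (\<lambda>x. ln (u t x w)) \<gamma>) < macro_dim (tall_peaks t (\<lambda>x. ln (u t x w)) (min \<gamma>0 (\<gamma> / 2)))"
  proof eventually_elim
    case (elim w)
    have "ereal (1 - f) < ereal (1 - \<theta>)" using \<theta> by simp
    with elim show ?case by (meson le_less_trans less_le_trans)
  qed
  then show ?thesis using \<gamma>0 \<gamma> by (intro exI[of _ "min \<gamma>0 (\<gamma> / 2)"]) auto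
qed

theorem corollary7p3:
  fixes M :: "'a measure"
    and \<xi> :: "(real \<times> real) set \<Rightarrow> 'a \<Rightarrow> real"
    and \<sigma> :: "real \<Rightarrow> real"
    and u :: "real \<Rightarrow> real \<Rightarrow> 'a \<Rightarrow> real"
  assumes "white_noise M \<xi>"
    and "\<exists>L. L-lipschitz_on UNIV \<sigma>"
    and "\<sigma> 0 = 0"
    and "0 < (INF z\<in>-{0}. ereal \<bar>\<sigma> z / z\<bar>)"
    and "(INF z\<in>-{0}. ereal \<bar>\<sigma> z / z\<bar>) \<le> (SUP z\<in>-{0}. ereal \<bar>\<sigma> z / z\<bar>)"
    and "(SUP z\<in>-{0}. ereal \<bar>\<sigma> z / z\<bar>) < \<infinity>"
    and "mild_solution M \<xi> \<sigma> u"
  shows "\<forall>t>0. \<exists>\<gamma> :: nat \<Rightarrow> real.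
           (\<forall>i. \<gamma> i > \<gamma> (Suc i) \<and> \<gamma> (Suc i) > 0) \<and>
           (AE \<omega> in M. \<forall>i.
              macro_dim (tall_peaks t (\<lambda>x. ln (u t x \<omega>)) (\<gamma> i))
                < macro_dim (tall_peaks t (\<lambda>x. ln (u t x \<omega>)) (\<gamma> (Suc i))))"
proof (intro allI impI)
  fix t :: real assume t: "0 < t"
  obtain L where L: "L-lipschitz_on UNIV \<sigma>" using assms(2) by blast
  obtain c where c: "0 < ereal c" "ereal c < (INF z\<in>-{0}. ereal \<bar>\<sigma> z / z\<bar>)" using ereal_dense2[OF assms(4)] by blast
  interpret noise M \<xi> using assms(1) by unfold_locales
  interpret she M \<xi> \<sigma> u "max L 1" c
  proof
    show "\<bar>\<sigma> a - \<sigma> b\<bar> \<le> max L 1 * \<bar>a - b\<bar>" for a b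
      using lipschitz_onD[OF L, of a b] mult_right_mono[OF max.cobounded1[of L 1], of "\<bar>a - b\<bar>"] by (simp add: dist_real_def)
    show "c * \<bar>z\<bar> \<le> \<bar>\<sigma> z\<bar>" for z
    proof (cases "z = 0")
      case False
      have "ereal c < ereal \<bar>\<sigma> z / z\<bar>" using c(2) False by (elim less_le_trans) (auto intro: INF_lower)
      then show ?thesis using False by (simp add: pos_less_divide_eq less_imp_le)
    qed simp
  qed (use assms c in auto)
  let ?D = "\<lambda>\<omega> \<gamma>. macro_dim (tall_peaks t (\<lambda>x. ln (u t x \<omega>)) \<gamma>)"
  \<comment> \<open>The levels are deterministic and chosen successively, each with its own almost
    sure inequality; the countably many null sets are united at the end.\<close>
  have "\<exists>\<gamma> :: nat \<Rightarrow> real. \<forall>i. 0 < \<gamma> i \<and> (\<gamma> (Suc i) < \<gamma> i \<and> (AE \<omega> in M. ?D \<omega> (\<gamma> i) < ?D \<omega> (\<gamma> (Suc i))))"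
    by (rule dependent_nat_choice) (use peaks_dimension_increases[OF t] zero_less_one in blast)+
  then obtain \<gamma> :: "nat \<Rightarrow> real" where \<gamma>: "\<And>i. 0 < \<gamma> i" "\<And>i. \<gamma> (Suc i) < \<gamma> i" "\<And>i. AE \<omega> in M. ?D \<omega> (\<gamma> i) < ?D \<omega> (\<gamma> (Suc i))" by blast
  show "\<exists>\<gamma>. (\<forall>i. \<gamma> i > \<gamma> (Suc i) \<and> \<gamma> (Suc i) > 0) \<and> (AE \<omega> in M. \<forall>i. ?D \<omega> (\<gamma> i) < ?D \<omega> (\<gamma> (Suc i)))"
    using \<gamma> by (intro exI[of _ \<gamma>]) (simp add: AE_all_countable)
qed

end
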